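(* Let $F=\dfrac{\beta^2}{\beta-\alpha}$ be a $G$-invariant infinite series $(\alpha,\beta)$-metric on the reductive homogeneous Finsler space $G/H$ (of dimension $n$) with a decomposition of the Lie algebra $\mathfrak g=\mathfrak h+\mathfrak m$. Let $v\in\mathfrak m$ correspond to the 1-form $\beta$, where $\mathfrak m$ is identified with the tangent space $T_H(G/H)$ of $G/H$ at the origin $H$. Let $\{v_1,\dots,v_n\}$ be an orthonormal basis of $\mathfrak m$ with $v=|v|\,v_n$, and write $y=y^iv_i$, $y_i=y^i$. Put $\alpha=\alpha(y)$, $s=\beta(y)/\alpha(y)$, $b=\|\beta\|_\alpha$ and $$A=\frac{-(n+1)s^5+(7n+1)s^4-12ns^3+2(2-n)b^2s^2+4(2n-1)b^2s}{2\,(s^3-3s^2+2b^2)^2}.$$ Then the mean Berwald curvature of the homogeneous Finsler space with infinite series metric is given by $$\begin{aligned}E_{ij}(H,y)=\frac12\Big[&\Big(\frac1\alpha\frac{\partial^2A}{\partial y^i\partial y^j}-\frac{y_i}{\alpha^3}\frac{\partial A}{\partial y^j}-\frac{y_j}{\alpha^3}\frac{\partial A}{\partial y^i}-\frac{A}{\alpha^3}\delta^j_i+\frac{3Ay_iy_j}{\alpha^5}\Big)\langle[v,y]_{\mathfrak m},y\rangle\\ &+\Big(\frac1\alpha\frac{\partial A}{\partial y^j}-\frac{Ay_j}{\alpha^3}\Big)\big(\langle[v,v_i]_{\mathfrak m},y\rangle+\langle[v,y]_{\mathfrak m},v_i\rangle\big)\\ &+\Big(\frac1\alpha\frac{\partial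 A}{\partial y^i}-\frac{Ay_i}{\alpha^3}\Big)\big(\langle[v,v_j]_{\mathfrak m},y\rangle+\langle[v,y]_{\mathfrak m},v_j\rangle\big)\\ &+\frac A\alpha\big(\langle[v,v_j]_{\mathfrak m},v_i\rangle+\langle[v,v_i]_{\mathfrak m},v_j\rangle\big)\\ &+\Big\{\Big(1-\frac2s\Big)\frac{\partial^2A}{\partial y^i\partial y^j}+\frac{2s_{y^i}}{s^2}\frac{\partial A}{\partial y^j}+\frac{2s_{y^j}}{s^2}\frac{\partial A}{\partial y^i}-\frac{4As_{y^i}s_{y^j}}{s^3}+\frac{2A}{s^2}s_{y^iy^j}\Big\}\langle[v,y]_{\mathfrak m},v\rangle\\ &+\Big\{\Big(1-\frac2s\Big)\frac{\partial A}{\partial y^j}+\frac{2As_{y^j}}{s^2}\Big\}\langle[v,v_i]_{\mathfrak m},v\rangle+\Big\{\Big(1-\frac2s\Big)\frac{\partial A}{\partial y^i}+\frac{2As_{y^i}}{s^2}\Big\}\langle[v,v_j]_{\mathfrak m},v\rangle\Big],\end{aligned}$$ where $s_{y^i}=\partial s/\partial y^i$ and $s_{y^iy^j}=\partial^2s/\partial y^i\partial y^j$.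
   Context: A Finsler metric on a connected smooth $n$-manifold $M$ is a function $F:TM\to[0,\infty)$, smooth on $TM\setminus\{0\}$, whose restriction to each $T_xM$ is a Minkowski norm, i.e. $F$ is positively homogeneous of degree one in $y$ and the Hessian $g_{ij}=\frac12(F^2)_{y^iy^j}$ is positive definite for $y\neq0$. The infinite series $(\alpha,\beta)$-metric is the metric $F=\beta^2/(\beta-\alpha)=\alpha\phi(s)$, $s=\beta/\alpha$, $\phi(s)=s^2/(s-1)$, where $\alpha(x,y)=\sqrt{a_{ij}(x)y^iy^j}$ is (the norm of) a Riemannian metric and $\beta=b_i(x)y^i$ is a 1-form; $\|\beta\|_\alpha$ is the length of $\beta$ with respect to $\alpha$. $G$ is a Lie group and $H$ a compact (isotropy) subgroup, with Lie algebras $\mathfrak g,\mathfrak h$ and $G/H$ connected; reductive means $\mathfrak g=\mathfrak h\oplus\mathfrak m$ as vector spaces with $\mathrm{Ad}(h)\mathfrak m\subset\mathfrak m$ for all $h\in H$. $[\cdot,\cdot]_{\mathfrak m}$ denotes the $\mathfrak m$-component of the Lie bracket. $\mathfrak m$ is identified with $T_H(G/H)$ by $w\mapsto\frac{d}{dt}(\exp(tw)H)|_{t=0}$. $F$ is $G$-invariant if it is preserved by the natural action of $G$. $\langle\cdot,\cdot\rangle$ is the inner product on $\mathfrak m$ given by the Riemannian metric $\alpha$ at the origin; $v\in\mathfrak m$ corresponds to $\beta$ via $\langle v,y\rangle=\beta(y)$ for all $y\in\mathfrak m$ (so $b=|v|$). Orthonormality is with respect to $\langle\cdot,\cdot\rangle$.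 $S$-curvature: for a basis $\{e_i\}$ of $T_xM$ let $\sigma_F(x)=\mathrm{Vol}(B^n)/\mathrm{Vol}\{(y^i)\in\mathbb R^n: F(x,y^ie_i)<1\}$ ($B^n$ the Euclidean unit ball), and let $\tau(x,y)=\ln\big(\sqrt{\det(g_{ij}(x,y))}/\sigma_F(x)\big)$ be the distortion. Then $S(x,y)=\frac{d}{dt}\big[\tau(\gamma(t),\dot\gamma(t))\big]_{t=0}$, where $\gamma$ is the geodesic of $F$ with $\gamma(0)=x$, $\dot\gamma(0)=y\ne0$. The mean Berwald curvature is $E_{ij}(x,y)=\frac12\frac{\partial^2S(x,y)}{\partial y^i\partial y^j}$; at the origin $H$ the coordinates $y^i$ are those with respect to the basis $\{v_i\}$ of $\mathfrak m$. *)

theory Defs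
  imports "HOL-Analysis.Analysis" "HOL-Algebra.Left_Coset" "HOL-Library.Function_Algebras"
begin

section \<open>Pointwise real vector space structure on functions\<close>

instantiation "fun" :: (type, real_vector) real_vector
begin

definition scaleR_fun :: "real \<Rightarrow> ('a \<Rightarrow> 'b) \<Rightarrow> 'a \<Rightarrow> 'b"
  where "scaleR_fun r f = (\<lambda>x. r *\<^sub>R f x)"

instance
  by standard (auto simp: scaleR_fun_def fun_eq_iff plus_fun_def scaleR_add_right scaleR_add_left)

end


section \<open>Derivatives and smooth maps in vector spaces\<close>

text \<open>Partial derivative of \<open>f\<close> at \<open>x\<close> in the direction \<open>u\<close>. For coordinates \<open>x = \<Sum>i. x\<^sup>i e\<^sub>i\<close>
  with respect to a basis \<open>e\<close>, this is \<open>\<partial>f/\<partial>x\<^sup>i\<close> if \<open>u = e\<^sub>i\<close>.\<close>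

definition pd :: "('v::real_vector \<Rightarrow> real) \<Rightarrow> 'v \<Rightarrow> 'v \<Rightarrow> real"
  where "pd f u x = deriv (\<lambda>t. f (x + t *\<^sub>R u)) 0"

text \<open>Only meaningful for open \<open>S\<close>.\<close>

primrec Ck_on :: "nat \<Rightarrow> 'a::real_normed_vector set \<Rightarrow> ('a \<Rightarrow> 'b::real_normed_vector) \<Rightarrow> bool"
  where
    "Ck_on 0 S f \<longleftrightarrow> continuous_on S f"
  | "Ck_on (Suc k) S f \<longleftrightarrow>
       (\<forall>x\<in>S. f differentiable (at x)) \<and> (\<forall>u. Ck_on k S (\<lambda>x. frechet_derivative f (at x) u))"

definition smooth_on :: "'a::real_normed_vector set \<Rightarrow> ('a \<Rightarrow> 'b::real_normed_vector) \<Rightarrow> bool"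
  where "smooth_on S f \<longleftrightarrow> (\<forall>k. Ck_on k S f)"


section \<open>Smooth manifolds\<close>

text \<open>A chart is a pair of its domain and its coordinate map; the values of the coordinate map
  outside the domain are irrelevant. Atlases need not be maximal.\<close>

type_synonym ('p, 'e) chart = "'p set \<times> ('p \<Rightarrow> 'e)"

abbreviation chart_inv :: "('p, 'e) chart \<Rightarrow> 'e \<Rightarrow> 'p"
  where "chart_inv c \<equiv> inv_into (fst c) (snd c)"

definition transition :: "('p, 'e) chart \<Rightarrow> ('p, 'e) chart \<Rightarrow> 'e \<Rightarrow> 'e"
  where "transition c c' = snd c' \<circ> chart_inv c"

definition smooth_manifold :: "'p topology \<Rightarrow> ('p, 'e::euclidean_space) chart set \<Rightarrow> bool"
  where "smooth_manifold X A \<longleftrightarrow>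
    Hausdorff_space X \<and> second_countable X \<and> (\<Union>c\<in>A. fst c) = topspace X \<and>
    (\<forall>c\<in>A. openin X (fst c) \<and> open (snd c ` fst c) \<and>
       homeomorphic_map (subtopology X (fst c)) (top_of_set (snd c ` fst c)) (snd c)) \<and>
    (\<forall>c\<in>A. \<forall>c'\<in>A. smooth_on (snd c ` (fst c \<inter> fst c')) (transition c c'))"

definition prod_atlas :: "('p, 'e) chart set \<Rightarrow> ('q, 'f) chart set \<Rightarrow> ('p \<times> 'q, 'e \<times> 'f) chart set"
  where "prod_atlas A B = {(fst c \<times> fst d, map_prod (snd c) (snd d)) | c d. c \<in> A \<and> d \<in> B}"

text \<open>The openness condition expresses continuity.\<close>

definition smooth_map ::
    "('p, 'e::euclidean_space) chart set \<Rightarrow> ('q, 'f::euclidean_space) chart set \<Rightarrow> ('p \<Rightarrow> 'q) \<Rightarrow> bool"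
  where "smooth_map A B f \<longleftrightarrow>
    f ` (\<Union>c\<in>A. fst c) \<subseteq> (\<Union>d\<in>B. fst d) \<and>
    (\<forall>c\<in>A. \<forall>d\<in>B. let W = snd c ` {p \<in> fst c. f p \<in> fst d} in
       open W \<and> smooth_on W (snd d \<circ> f \<circ> chart_inv c))"

definition smooth_curve :: "('p, 'e::euclidean_space) chart set \<Rightarrow> real set \<Rightarrow> (real \<Rightarrow> 'p) \<Rightarrow> bool"
  where "smooth_curve A I \<gamma> \<longleftrightarrow>
    \<gamma> ` I \<subseteq> (\<Union>c\<in>A. fst c) \<and>
    (\<forall>c\<in>A. let J = {t \<in> I. \<gamma> t \<in> fst c} in open J \<and> smooth_on J (snd c \<circ> \<gamma>))"

text \<open>A tangent vector at \<open>p\<close> is the family of its coordinate representations in all charts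
  around \<open>p\<close>, which transform into each other by the derivatives of the coordinate changes. At
  charts not belonging to the atlas or not containing \<open>p\<close> the family is \<open>0\<close>, so that the tangent
  space is a linear subspace of a function space.\<close>

type_synonym ('p, 'e) tangent = "('p, 'e) chart \<Rightarrow> 'e"

definition tangent_space :: "('p, 'e::euclidean_space) chart set \<Rightarrow> 'p \<Rightarrow> ('p, 'e) tangent set"
  where "tangent_space A p = {\<xi>.
    (\<forall>c\<in>A. \<forall>c'\<in>A. p \<in> fst c \<and> p \<in> fst c' \<longrightarrow>
       \<xi> c' = frechet_derivative (transition c c') (at (snd c p)) (\<xi> c)) \<and>
    (\<forall>c. \<not> (c \<in> A \<and> p \<in> fst c) \<longrightarrow> \<xi> c = 0)}"

text \<open>The tangent vector \<open>\<Sum>i. y\<^sup>i \<partial>/\<partial>x\<^sup>i\<close> at \<open>p\<close> in the chart \<open>c\<close>.\<close>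

definition coord_tangent ::
    "('p, 'e::euclidean_space) chart set \<Rightarrow> ('p, 'e) chart \<Rightarrow> 'p \<Rightarrow> 'e \<Rightarrow> ('p, 'e) tangent"
  where "coord_tangent A c p y = (\<lambda>c'. if c' \<in> A \<and> p \<in> fst c'
    then frechet_derivative (transition c c') (at (snd c p)) y else 0)"

definition velocity :: "('p, 'e::euclidean_space) chart set \<Rightarrow> (real \<Rightarrow> 'p) \<Rightarrow> real \<Rightarrow> ('p, 'e) tangent"
  where "velocity A \<gamma> t = (\<lambda>c. if c \<in> A \<and> \<gamma> t \<in> fst c
    then vector_derivative (snd c \<circ> \<gamma>) (at t) else 0)"

text \<open>The differential of \<open>f\<close> at \<open>p\<close>; it does not depend on the chart chosen around \<open>p\<close>.\<close>

definition differential ::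
    "('p, 'e::euclidean_space) chart set \<Rightarrow> ('q, 'f::euclidean_space) chart set \<Rightarrow> ('p \<Rightarrow> 'q) \<Rightarrow>
     'p \<Rightarrow> ('p, 'e) tangent \<Rightarrow> ('q, 'f) tangent"
  where "differential A B f p \<xi> = (\<lambda>d. if d \<in> B \<and> f p \<in> fst d
    then (let c = (SOME c. c \<in> A \<and> p \<in> fst c)
          in frechet_derivative (snd d \<circ> f \<circ> chart_inv c) (at (snd c p)) (\<xi> c))
    else 0)"

text \<open>Lie bracket of vector fields, \<open>[V, W]\<^sup>i = V\<^sup>j \<partial>W\<^sup>i/\<partial>x\<^sup>j - W\<^sup>j \<partial>V\<^sup>i/\<partial>x\<^sup>j\<close>.\<close>

definition vf_bracket ::
    "('p, 'e::euclidean_space) chart set \<Rightarrow> ('p \<Rightarrow> ('p, 'e) tangent) \<Rightarrow> ('p \<Rightarrow> ('p, 'e) tangent) \<Rightarrow>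
     'p \<Rightarrow> ('p, 'e) tangent"
  where "vf_bracket A V W p = (\<lambda>c. if c \<in> A \<and> p \<in> fst c
    then frechet_derivative (\<lambda>x. W (chart_inv c x) c) (at (snd c p)) (V p c)
       - frechet_derivative (\<lambda>x. V (chart_inv c x) c) (at (snd c p)) (W p c)
    else 0)"


section \<open>Lie groups and homogeneous spaces\<close>

definition lie_group :: "('g, 'r) monoid_scheme \<Rightarrow> 'g topology \<Rightarrow> ('g, 'e::euclidean_space) chart set \<Rightarrow> bool"
  where "lie_group G X A \<longleftrightarrow>
    group G \<and> smooth_manifold X A \<and> topspace X = carrier G \<and>
    smooth_map (prod_atlas A A) A (\<lambda>(g, h). g \<otimes>\<^bsub>G\<^esub> h) \<and>
    smooth_map A A (\<lambda>g. inv\<^bsub>G\<^esub> g)"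

text \<open>The Lie algebra is the tangent space at the identity, with the bracket of left invariant
  vector fields.\<close>

definition lie_algebra ::
    "('g, 'r) monoid_scheme \<Rightarrow> ('g, 'e::euclidean_space) chart set \<Rightarrow> ('g, 'e) tangent set"
  where "lie_algebra G A = tangent_space A \<one>\<^bsub>G\<^esub>"

definition left_invariant_field ::
    "('g, 'r) monoid_scheme \<Rightarrow> ('g, 'e::euclidean_space) chart set \<Rightarrow> ('g, 'e) tangent \<Rightarrow>
     'g \<Rightarrow> ('g, 'e) tangent"
  where "left_invariant_field G A X g = differential A A (\<lambda>h. g \<otimes>\<^bsub>G\<^esub> h) \<one>\<^bsub>G\<^esub> X"

definition lie_bracket ::
    "('g, 'r) monoid_scheme \<Rightarrow> ('g, 'e::euclidean_space) chart set \<Rightarrow> ('g, 'e) tangent \<Rightarrow>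
     ('g, 'e) tangent \<Rightarrow> ('g, 'e) tangent"
  where "lie_bracket G A X Y =
    vf_bracket A (left_invariant_field G A X) (left_invariant_field G A Y) \<one>\<^bsub>G\<^esub>"

definition one_parameter_subgroup ::
    "('g, 'r) monoid_scheme \<Rightarrow> ('g, 'e::euclidean_space) chart set \<Rightarrow> ('g, 'e) tangent \<Rightarrow>
     (real \<Rightarrow> 'g) \<Rightarrow> bool"
  where "one_parameter_subgroup G A X \<gamma> \<longleftrightarrow>
    smooth_curve A UNIV \<gamma> \<and> (\<forall>s t. \<gamma> (s + t) = \<gamma> s \<otimes>\<^bsub>G\<^esub> \<gamma> t) \<and> velocity A \<gamma> 0 = X"

definition lie_exp ::
    "('g, 'r) monoid_scheme \<Rightarrow> ('g, 'e::euclidean_space) chart set \<Rightarrow> ('g, 'e) tangent \<Rightarrow> 'g"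
  where "lie_exp G A X = (THE \<gamma>. one_parameter_subgroup G A X \<gamma>) 1"

definition Ad ::
    "('g, 'r) monoid_scheme \<Rightarrow> ('g, 'e::euclidean_space) chart set \<Rightarrow> 'g \<Rightarrow> ('g, 'e) tangent \<Rightarrow>
     ('g, 'e) tangent"
  where "Ad G A g = differential A A (\<lambda>h. g \<otimes>\<^bsub>G\<^esub> h \<otimes>\<^bsub>G\<^esub> inv\<^bsub>G\<^esub> g) \<one>\<^bsub>G\<^esub>"

text \<open>The Lie algebra of a closed subgroup, as a subalgebra of the Lie algebra of the group.\<close>

definition subgroup_algebra ::
    "('g, 'r) monoid_scheme \<Rightarrow> ('g, 'e::euclidean_space) chart set \<Rightarrow> 'g set \<Rightarrow> ('g, 'e) tangent set"
  where "subgroup_algebra G A H = {X \<in> lie_algebra G A. \<forall>t. lie_exp G A (t *\<^sub>R X) \<in> H}"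

text \<open>\<open>(Y, B)\<close> is the space of left cosets with its quotient manifold structure, i.e. the unique one
  for which the projection is a smooth submersion.\<close>

definition homogeneous_space ::
    "('g, 'r) monoid_scheme \<Rightarrow> 'g topology \<Rightarrow> ('g, 'e::euclidean_space) chart set \<Rightarrow> 'g set \<Rightarrow>
     'g set topology \<Rightarrow> ('g set, 'f::euclidean_space) chart set \<Rightarrow> bool"
  where "homogeneous_space G X A H Y B \<longleftrightarrow>
    lie_group G X A \<and> subgroup H G \<and> compactin X H \<and>
    smooth_manifold Y B \<and> topspace Y = lcosets\<^bsub>G\<^esub> H \<and> connected_space Y \<and>
    smooth_map A B (\<lambda>g. g <#\<^bsub>G\<^esub> H) \<and>
    (\<forall>g\<in>carrier G. differential A B (\<lambda>g. g <#\<^bsub>G\<^esub> H) g ` tangent_space A g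
                     = tangent_space B (g <#\<^bsub>G\<^esub> H))"

definition reductive_decomposition ::
    "('g, 'r) monoid_scheme \<Rightarrow> ('g, 'e::euclidean_space) chart set \<Rightarrow> 'g set \<Rightarrow> ('g, 'e) tangent set \<Rightarrow> bool"
  where "reductive_decomposition G A H \<mm> \<longleftrightarrow>
    subspace \<mm> \<and> \<mm> \<subseteq> lie_algebra G A \<and> subgroup_algebra G A H \<inter> \<mm> = {0} \<and>
    (\<forall>X\<in>lie_algebra G A. \<exists>Z\<in>subgroup_algebra G A H. \<exists>w\<in>\<mm>. X = Z + w) \<and>
    (\<forall>h\<in>H. Ad G A h ` \<mm> \<subseteq> \<mm>)"

definition m_component ::
    "('g, 'r) monoid_scheme \<Rightarrow> ('g, 'e::euclidean_space) chart set \<Rightarrow> 'g set \<Rightarrow> ('g, 'e) tangent set \<Rightarrow>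
     ('g, 'e) tangent \<Rightarrow> ('g, 'e) tangent"
  where "m_component G A H \<mm> X = (THE w. w \<in> \<mm> \<and> X - w \<in> subgroup_algebra G A H)"

text \<open>The identification of \<open>\<mm>\<close> with the tangent space of \<open>G/H\<close> at the origin \<open>H\<close>.\<close>

definition origin_tangent ::
    "('g, 'r) monoid_scheme \<Rightarrow> ('g, 'e::euclidean_space) chart set \<Rightarrow> 'g set \<Rightarrow>
     ('g set, 'f::euclidean_space) chart set \<Rightarrow> ('g, 'e) tangent \<Rightarrow> ('g set, 'f) tangent"
  where "origin_tangent G A H B w = velocity B (\<lambda>t. lie_exp G A (t *\<^sub>R w) <#\<^bsub>G\<^esub> H) 0"


section \<open>Riemannian metrics and 1-forms\<close>

definition riemannian_metric ::
    "('p, 'e::euclidean_space) chart set \<Rightarrow> ('p \<Rightarrow> ('p, 'e) tangent \<Rightarrow> ('p, 'e) tangent \<Rightarrow> real) \<Rightarrow> bool"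
  where "riemannian_metric A a \<longleftrightarrow>
    (\<forall>p \<in> (\<Union>c\<in>A. fst c). \<forall>\<xi>\<in>tangent_space A p.
       (\<forall>\<eta>\<in>tangent_space A p. a p \<xi> \<eta> = a p \<eta> \<xi> \<and>
          (\<forall>\<zeta>\<in>tangent_space A p. \<forall>r. a p (r *\<^sub>R \<xi> + \<eta>) \<zeta> = r * a p \<xi> \<zeta> + a p \<eta> \<zeta>)) \<and>
       (\<xi> \<noteq> 0 \<longrightarrow> a p \<xi> \<xi> > 0)) \<and>
    (\<forall>c\<in>A. \<forall>u w. smooth_on (snd c ` fst c)
       (\<lambda>x. a (chart_inv c x) (coord_tangent A c (chart_inv c x) u)
                              (coord_tangent A c (chart_inv c x) w)))"

definition one_form ::
    "('p, 'e::euclidean_space) chart set \<Rightarrow> ('p \<Rightarrow> ('p, 'e) tangent \<Rightarrow> real) \<Rightarrow> bool"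
  where "one_form A \<beta> \<longleftrightarrow>
    (\<forall>p \<in> (\<Union>c\<in>A. fst c). \<forall>\<xi>\<in>tangent_space A p. \<forall>\<eta>\<in>tangent_space A p. \<forall>r.
       \<beta> p (r *\<^sub>R \<xi> + \<eta>) = r * \<beta> p \<xi> + \<beta> p \<eta>) \<and>
    (\<forall>c\<in>A. \<forall>u. smooth_on (snd c ` fst c)
       (\<lambda>x. \<beta> (chart_inv c x) (coord_tangent A c (chart_inv c x) u)))"

definition one_form_length ::
    "('p, 'e::euclidean_space) chart set \<Rightarrow> ('p \<Rightarrow> ('p, 'e) tangent \<Rightarrow> ('p, 'e) tangent \<Rightarrow> real) \<Rightarrow>
     ('p \<Rightarrow> ('p, 'e) tangent \<Rightarrow> real) \<Rightarrow> 'p \<Rightarrow> real"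
  where "one_form_length A a \<beta> p = (SUP \<xi> \<in> tangent_space A p - {0}. \<beta> p \<xi> / sqrt (a p \<xi> \<xi>))"


section \<open>Finsler metrics\<close>

text \<open>Fundamental tensor \<open>g\<^sub>i\<^sub>j(p,\<xi>) = \<onehalf> (F\<^sup>2)\<^bsub>y\<^sup>i y\<^sup>j\<^esub>\<close>, evaluated on \<open>u\<close> and \<open>w\<close>.\<close>

definition fundamental_tensor ::
    "('p \<Rightarrow> ('p, 'e) tangent \<Rightarrow> real) \<Rightarrow> 'p \<Rightarrow> ('p, 'e::euclidean_space) tangent \<Rightarrow>
     ('p, 'e) tangent \<Rightarrow> ('p, 'e) tangent \<Rightarrow> real"
  where "fundamental_tensor F p \<xi> u w = 1/2 * pd (pd (\<lambda>\<eta>. (F p \<eta>)\<^sup>2) w) u \<xi>"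

definition local_expr ::
    "('p, 'e::euclidean_space) chart set \<Rightarrow> ('p \<Rightarrow> ('p, 'e) tangent \<Rightarrow> real) \<Rightarrow> ('p, 'e) chart \<Rightarrow>
     'e \<Rightarrow> 'e \<Rightarrow> real"
  where "local_expr A F c x y = F (chart_inv c x) (coord_tangent A c (chart_inv c x) y)"

text \<open>A Finsler metric whose domain is a conic open subset \<open>D\<close> of the slit tangent bundle (\<open>D p\<close> is
  the part of the domain over \<open>p\<close>); \<open>D p = tangent_space A p - {0}\<close> gives Finsler metrics on the
  whole tangent bundle. The generality is needed for \<open>\<beta>\<^sup>2/(\<beta> - \<alpha>)\<close>, which is nonpositive whenever
  \<open>\<beta> \<le> 0\<close> and therefore is never defined and positive on a whole slit tangent bundle, but
  which is a Finsler metric on the cone \<open>\<beta> > \<alpha>\<close> (nonempty if the length of \<open>\<beta>\<close> exceeds 1).\<close>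

definition finsler_metric ::
    "('p, 'e::euclidean_space) chart set \<Rightarrow> ('p \<Rightarrow> ('p, 'e) tangent set) \<Rightarrow>
     ('p \<Rightarrow> ('p, 'e) tangent \<Rightarrow> real) \<Rightarrow> bool"
  where "finsler_metric A D F \<longleftrightarrow>
    (\<forall>p \<in> (\<Union>c\<in>A. fst c).
       D p \<noteq> {} \<and> D p \<subseteq> tangent_space A p - {0} \<and>
       (\<forall>\<xi>\<in>D p. F p \<xi> \<ge> 0 \<and>
          (\<forall>r>0. r *\<^sub>R \<xi> \<in> D p \<and> F p (r *\<^sub>R \<xi>) = r * F p \<xi>) \<and>
          (\<forall>u \<in> tangent_space A p - {0}. fundamental_tensor F p \<xi> u u > 0))) \<and>
    (\<forall>c\<in>A. let W = {(x, y). x \<in> snd c ` fst c \<and>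
                            coord_tangent A c (chart_inv c x) y \<in> D (chart_inv c x)}
       in open W \<and> smooth_on W (\<lambda>(x, y). local_expr A F c x y))"

definition tangent_basis ::
    "('p, 'e::euclidean_space) chart set \<Rightarrow> 'p \<Rightarrow> ('i::finite \<Rightarrow> ('p, 'e) tangent) \<Rightarrow> bool"
  where "tangent_basis A p e \<longleftrightarrow>
    inj e \<and> independent (range e) \<and> span (range e) = tangent_space A p"

definition bh_density ::
    "('p \<Rightarrow> ('p, real^'n) tangent set) \<Rightarrow> ('p \<Rightarrow> ('p, real^'n) tangent \<Rightarrow> real) \<Rightarrow> 'p \<Rightarrow>
     ('n \<Rightarrow> ('p, real^'n) tangent) \<Rightarrow> real"
  where "bh_density D F p e =
    measure lborel (ball (0::real^'n) 1) /
    measure lborel {y::real^'n. (\<Sum>i\<in>UNIV. y $ i *\<^sub>R e i) \<in> D p \<and> F p (\<Sum>i\<in>UNIV. y $ i *\<^sub>R e i) < 1}"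

text \<open>The value does not depend on the choice of the basis.\<close>

definition distortion ::
    "('p, real^'n) chart set \<Rightarrow> ('p \<Rightarrow> ('p, real^'n) tangent set) \<Rightarrow>
     ('p \<Rightarrow> ('p, real^'n) tangent \<Rightarrow> real) \<Rightarrow> 'p \<Rightarrow> ('p, real^'n) tangent \<Rightarrow> real"
  where "distortion A D F p \<xi> =
    (let e = (SOME e :: 'n \<Rightarrow> ('p, real^'n) tangent. tangent_basis A p e)
     in ln (sqrt (det (\<chi> i j. fundamental_tensor F p \<xi> (e i) (e j))) / bh_density D F p e))"

text \<open>Geodesic (spray) coefficients in local coordinates,
  \<open>G\<^sup>i = \<onequarter> g\<^sup>i\<^sup>l ([F\<^sup>2]\<^bsub>x\<^sup>k y\<^sup>l\<^esub> y\<^sup>k - [F\<^sup>2]\<^bsub>x\<^sup>l\<^esub>)\<close>, for \<open>L = F\<^sup>2\<close> as a function of \<open>x\<close> and \<open>y\<close>.\<close>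

definition spray_coeff ::
    "(real^'n \<Rightarrow> real^'n \<Rightarrow> real) \<Rightarrow> real^'n \<Rightarrow> real^'n \<Rightarrow> real^'n"
  where "spray_coeff L x y =
    (let g = (\<chi> i j. 1/2 * pd (pd (L x) (axis j 1)) (axis i 1) y) :: real^'n^'n
     in \<chi> i. 1/4 * (\<Sum>l\<in>UNIV. matrix_inv g $ i $ l *
          ((\<Sum>k\<in>UNIV. pd (\<lambda>x'. pd (L x') (axis l 1) y) (axis k 1) x * y $ k)
           - pd (\<lambda>x'. L x' y) (axis l 1) x)))"

definition geodesic ::
    "('p, real^'n) chart set \<Rightarrow> ('p \<Rightarrow> ('p, real^'n) tangent set) \<Rightarrow>
     ('p \<Rightarrow> ('p, real^'n) tangent \<Rightarrow> real) \<Rightarrow> real set \<Rightarrow> (real \<Rightarrow> 'p) \<Rightarrow> bool"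
  where "geodesic A D F I \<gamma> \<longleftrightarrow>
    smooth_curve A I \<gamma> \<and> (\<forall>t\<in>I. velocity A \<gamma> t \<in> D (\<gamma> t)) \<and>
    (\<forall>t\<in>I. \<forall>c\<in>A. \<gamma> t \<in> fst c \<longrightarrow>
       (let x = snd c \<circ> \<gamma>; x' = (\<lambda>r. vector_derivative x (at r))
        in vector_derivative x' (at t)
           + 2 *\<^sub>R spray_coeff (\<lambda>u w. (local_expr A F c u w)\<^sup>2) (x t) (x' t) = 0))"

definition S_curvature ::
    "('p, real^'n) chart set \<Rightarrow> ('p \<Rightarrow> ('p, real^'n) tangent set) \<Rightarrow>
     ('p \<Rightarrow> ('p, real^'n) tangent \<Rightarrow> real) \<Rightarrow> 'p \<Rightarrow> ('p, real^'n) tangent \<Rightarrow> real"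
  where "S_curvature A D F p \<xi> = (THE r. \<exists>\<gamma> \<epsilon>. \<epsilon> > 0 \<and>
    geodesic A D F {-\<epsilon><..<\<epsilon>} \<gamma> \<and> \<gamma> 0 = p \<and> velocity A \<gamma> 0 = \<xi> \<and>
    ((\<lambda>t. distortion A D F (\<gamma> t) (velocity A \<gamma> t)) has_real_derivative r) (at 0))"

text \<open>\<open>mean_berwald A D F p \<xi> (e i) (e j)\<close> is \<open>E\<^sub>i\<^sub>j(p,\<xi>)\<close> with respect to a basis \<open>e\<close>.\<close>

definition mean_berwald ::
    "('p, real^'n) chart set \<Rightarrow> ('p \<Rightarrow> ('p, real^'n) tangent set) \<Rightarrow>
     ('p \<Rightarrow> ('p, real^'n) tangent \<Rightarrow> real) \<Rightarrow> 'p \<Rightarrow> ('p, real^'n) tangent \<Rightarrow>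
     ('p, real^'n) tangent \<Rightarrow> ('p, real^'n) tangent \<Rightarrow> real"
  where "mean_berwald A D F p \<xi> u w = 1/2 * pd (pd (S_curvature A D F p) w) u \<xi>"

text \<open>Invariance of \<open>F\<close>, together with its domain, under the action \<open>g \<cdot> (xH) = (gx)H\<close>.\<close>

definition invariant_finsler ::
    "('g, 'r) monoid_scheme \<Rightarrow> ('g set, 'f::euclidean_space) chart set \<Rightarrow>
     ('g set \<Rightarrow> ('g set, 'f) tangent set) \<Rightarrow> ('g set \<Rightarrow> ('g set, 'f) tangent \<Rightarrow> real) \<Rightarrow> bool"
  where "invariant_finsler G B D F \<longleftrightarrow>
    (\<forall>g\<in>carrier G. \<forall>P \<in> (\<Union>c\<in>B. fst c). \<forall>\<xi>\<in>D P.
       differential B B (\<lambda>Q. g <#\<^bsub>G\<^esub> Q) P \<xi> \<in> D (g <#\<^bsub>G\<^esub> P) \<and>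
       F (g <#\<^bsub>G\<^esub> P) (differential B B (\<lambda>Q. g <#\<^bsub>G\<^esub> Q) P \<xi>) = F P \<xi>)"

definition infinite_series_metric ::
    "('p, 'e::euclidean_space) chart set \<Rightarrow> ('p \<Rightarrow> ('p, 'e) tangent set) \<Rightarrow>
     ('p \<Rightarrow> ('p, 'e) tangent \<Rightarrow> ('p, 'e) tangent \<Rightarrow> real) \<Rightarrow> ('p \<Rightarrow> ('p, 'e) tangent \<Rightarrow> real) \<Rightarrow>
     ('p \<Rightarrow> ('p, 'e) tangent \<Rightarrow> real) \<Rightarrow> bool"
  where "infinite_series_metric A D a \<beta> F \<longleftrightarrow>
    riemannian_metric A a \<and> one_form A \<beta> \<and> finsler_metric A D F \<and>
    (\<forall>p \<in> (\<Union>c\<in>A. fst c). \<forall>\<xi>\<in>D p. F p \<xi> = (\<beta> p \<xi>)\<^sup>2 / (\<beta> p \<xi> - sqrt (a p \<xi> \<xi>)))"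

end

(* Since F is invariant, it is given by one fixed Minkowski norm in any frame transported by
   left translations. Hence the Euler-Lagrange equation for F^2 at the origin determines the acceleration of a geodesic relative to such a frame through
   the Lie bracket alone. In dimension at least two, invariance of F forces alpha and beta to be
   invariant, hence the distortion is T(s) plus a constant with an explicit function T, and S is
   T'(s) times the derivative of s along the relative acceleration:
     S(y) = A/alpha <[v,y],y> + A (1 - 2/s) <[v,y],v>.
   In dimension one s is constant and all brackets vanish. Differentiating S twice in y gives E. *)
theory Submission
  imports Defs
begin

section \<open>Calculus of smooth maps\<close>

text \<open>No geodesic is ever lifted to the group. Invariance is differentiated only along curves
  that are straight in one chart of G: constancy of F^2 and of its momenta there gives two
  identities at the origin whose correction terms depend on the charts; subtracting them from the
  Euler-Lagrange equation leaves the antisymmetric part of these terms, which is the bracket. Along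
  the geodesic itself the distortion is read as a function of s = \<beta>/\<alpha>; for this
  \<alpha> and \<beta> must be known to be invariant, whereas only F is assumed to be. Their
  invariance is recovered from F on an open cone: squaring away the roots yields a polynomial
  identity, which spreads to the whole tangent space. In dimension one F is a multiple of the
  coordinate on a ray and does not determine \<alpha> and \<beta>, so that case is separate. The
  S-curvature is a definite description, so geodesics must be shown to exist; so must one-parameter
  subgroups, on which the identification of \<mm> rests. That the action on cosets is differentiable
  follows from local right inverses of the projection.\<close>

lemma frechet_derivative_eq: "(f has_derivative f') (at x) \<Longrightarrow> frechet_derivative f (at x) = f'"
  by (metis frechet_derivative_at)

text \<open>Both functions have the same derivatives at x, possibly none, so the choice operator
  behind \<open>frechet_derivative\<close> picks the same value even where neither is
  differentiable.\<close>

lemma frechet_derivative_cong_open: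
  assumes "open S" "x \<in> S" "\<And>z. z \<in> S \<Longrightarrow> f z = g z"
  shows "frechet_derivative f (at x) = frechet_derivative g (at x)"
    and "f differentiable (at x) \<longleftrightarrow> g differentiable (at x)"
proof -
  have *: "(f has_derivative f') (at x) \<longleftrightarrow> (g has_derivative f') (at x)" for f'
    using assms by (metis has_derivative_transform_within_open)
  show "frechet_derivative f (at x) = frechet_derivative g (at x)"
    unfolding frechet_derivative_def * ..
  show "f differentiable (at x) \<longleftrightarrow> g differentiable (at x)"
    unfolding differentiable_def * ..
qed

lemma frechet_derivative_works_at:
  "f differentiable (at x) \<Longrightarrow> (f has_derivative frechet_derivative f (at x)) (at x)"
  by (simp add: frechet_derivative_works)

section \<open>Closure properties of \<open>Ck_on\<close>\<close>

lemma Ck_on_cong: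
  assumes "open S" "\<And>x. x \<in> S \<Longrightarrow> f x = g x"
  shows "Ck_on k S f \<longleftrightarrow> Ck_on k S g"
  using assms(2)
proof (induction k arbitrary: f g)
  case 0
  then show ?case by (simp cong: continuous_on_cong)
next
  case (Suc k)
  have "Ck_on k S (\<lambda>x. frechet_derivative f (at x) u) = Ck_on k S (\<lambda>x. frechet_derivative g (at x) u)" for u
    by (rule Suc.IH) (metis frechet_derivative_cong_open(1)[OF assms(1)] Suc.prems)
  moreover have "f differentiable (at x) \<longleftrightarrow> g differentiable (at x)" if "x \<in> S" for x
    using frechet_derivative_cong_open(2)[OF assms(1) that] Suc.prems by blast
  ultimately show ?case by simp
qed

lemma Ck_on_subset: "Ck_on k S f \<Longrightarrow> T \<subseteq> S \<Longrightarrow> Ck_on k T f"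
  by (induction k arbitrary: f) (auto intro: continuous_on_subset)

lemma Ck_on_SucD: "Ck_on (Suc k) S f \<Longrightarrow> Ck_on k S f"
proof (induction k arbitrary: f)
  case 0
  then show ?case
    by (auto intro!: continuous_at_imp_continuous_on differentiable_imp_continuous_within)
next
  case (Suc k)
  have "f differentiable (at x)" if "x \<in> S" for x
    using Suc.prems that unfolding Ck_on.simps by blast
  moreover have "Ck_on k S (\<lambda>x. frechet_derivative f (at x) u)" for u
    by (rule Suc.IH) (use Suc.prems in simp)
  ultimately show ?case by simp
qed

lemma Ck_on_local:
  assumes "\<And>x. x \<in> S \<Longrightarrow> \<exists>T. open T \<and> x \<in> T \<and> Ck_on k T f"
  shows "Ck_on k S f"
  using assms
proof (induction k arbitrary: f)
  case 0
  then show ?case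
    by (metis Ck_on.simps(1) at_within_open continuous_at_imp_continuous_on continuous_on_eq_continuous_within)
next
  case (Suc k)
  show ?case
    by (simp, intro conjI ballI allI Suc.IH) (use Suc.prems in \<open>(fastforce simp del: Ck_on.simps(1))+\<close>)
qed

lemma Ck_on_const: "Ck_on k S (\<lambda>x. c)"
proof (induction k arbitrary: c)
  case (Suc k)
  then show ?case by (simp add: frechet_derivative_eq[OF has_derivative_const])
qed simp

lemma Ck_on_bounded_linear: "bounded_linear f \<Longrightarrow> Ck_on k S f"
proof (induction k arbitrary: f)
  case 0
  then show ?case by (simp add: linear_continuous_on)
next
  case (Suc k)
  then show ?case
    by (auto simp: frechet_derivative_eq[OF bounded_linear_imp_has_derivative] Ck_on_const
        intro: bounded_linear_imp_differentiable)
qed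

lemma Ck_on_add: "open S \<Longrightarrow> Ck_on k S f \<Longrightarrow> Ck_on k S g \<Longrightarrow> Ck_on k S (\<lambda>x. f x + g x)"
proof (induction k arbitrary: f g)
  case 0
  then show ?case by (auto intro: continuous_intros)
next
  case (Suc k)
  have eq: "frechet_derivative (\<lambda>x. f x + g x) (at x) u
        = frechet_derivative f (at x) u + frechet_derivative g (at x) u" if "x \<in> S" for x u
      using Suc.prems that by (subst frechet_derivative_eq[OF has_derivative_add])
        (auto intro: frechet_derivative_works_at)
  have "Ck_on k S (\<lambda>x. frechet_derivative (\<lambda>x. f x + g x) (at x) u)" for u
  proof -
    have "Ck_on k S (\<lambda>x. frechet_derivative f (at x) u + frechet_derivative g (at x) u)"
      using Suc by auto
    then show ?thesis
      by (rule Ck_on_cong[OF Suc.prems(1), THEN iffD2, rotated]) (simp add: eq)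
  qed
  then show ?case using Suc.prems by (auto intro: differentiable_add)
qed

lemma Ck_on_linear_compose:
  assumes "bounded_linear L"
  shows "open S \<Longrightarrow> Ck_on k S f \<Longrightarrow> Ck_on k S (\<lambda>x. L (f x))"
proof (induction k arbitrary: f)
  case 0
  then show ?case using assms by (simp add: bounded_linear.continuous_on)
next
  case (Suc k)
  have eq: "((\<lambda>x. L (f x)) has_derivative (\<lambda>u. L (frechet_derivative f (at x) u))) (at x)" if "x \<in> S" for x
    using Suc.prems that bounded_linear.has_derivative[OF assms frechet_derivative_works_at] by auto
  have "Ck_on k S (\<lambda>x. frechet_derivative (\<lambda>x. L (f x)) (at x) u)" for u
    using Ck_on_cong[OF Suc.prems(1), of "\<lambda>x. frechet_derivative (\<lambda>x. L (f x)) (at x) u"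
        "\<lambda>x. L (frechet_derivative f (at x) u)" k] Suc frechet_derivative_eq[OF eq] by auto
  then show ?case unfolding Ck_on.simps differentiable_def using eq by blast
qed

text \<open>Each term of the product rule keeps one factor undifferentiated, so the induction
  hypothesis is applied to a derivative and to a factor lowered by
  \<open>Ck_on_SucD\<close>.\<close>

lemma Ck_on_bilinear:
  assumes "bounded_bilinear bop"
  shows "open S \<Longrightarrow> Ck_on k S f \<Longrightarrow> Ck_on k S g \<Longrightarrow> Ck_on k S (\<lambda>x. bop (f x) (g x))"
proof (induction k arbitrary: f g)
  case 0
  then show ?case using assms by (simp add: bounded_bilinear.continuous_on)
next
  case (Suc k)
  have eq: "((\<lambda>x. bop (f x) (g x)) has_derivative
      (\<lambda>u. bop (f x) (frechet_derivative g (at x) u) + bop (frechet_derivative f (at x) u) (g x))) (at x)"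
    if "x \<in> S" for x
    using Suc.prems that by (intro bounded_bilinear.FDERIV[OF assms] frechet_derivative_works_at) auto
  have "Ck_on k S (\<lambda>x. frechet_derivative (\<lambda>x. bop (f x) (g x)) (at x) u)" for u
  proof -
    have "Ck_on k S (\<lambda>x. bop (f x) (frechet_derivative g (at x) u) + bop (frechet_derivative f (at x) u) (g x))"
      using Suc.prems(2,3)
      by (intro Ck_on_add[OF Suc.prems(1)] Suc.IH[OF Suc.prems(1) Ck_on_SucD[OF Suc.prems(2)]]
          Suc.IH[OF Suc.prems(1) _ Ck_on_SucD[OF Suc.prems(3)]]) simp_all
    then show ?thesis
      by (rule Ck_on_cong[OF Suc.prems(1), THEN iffD2, rotated]) (simp add: frechet_derivative_eq[OF eq])
  qed
  then show ?case unfolding Ck_on.simps differentiable_def using eq by blast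
qed

lemma Ck_on_sum:
  "open S \<Longrightarrow> (\<And>i. i \<in> I \<Longrightarrow> Ck_on k S (f i)) \<Longrightarrow> Ck_on k S (\<lambda>x. \<Sum>i\<in>I. f i x)"
  by (induction I rule: infinite_finite_induct) (auto simp: Ck_on_const Ck_on_add)

text \<open>In the chain rule the direction \<open>frechet_derivative g (at x) u\<close> varies with
  x, while \<open>Ck_on\<close> only controls derivatives in fixed directions. Expanding that
  direction in \<open>Basis\<close> reduces to scalar functions times derivatives along basis
  vectors; hence the intermediate space is Euclidean.\<close>

lemma Ck_on_compose:
  fixes g :: "'a::real_normed_vector \<Rightarrow> 'b::euclidean_space" and f :: "'b \<Rightarrow> 'c::real_normed_vector"
  shows "open S \<Longrightarrow> Ck_on k T f \<Longrightarrow> Ck_on k S g \<Longrightarrow> g ` S \<subseteq> T \<Longrightarrow> Ck_on k S (\<lambda>x. f (g x))"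
proof (induction k arbitrary: f)
  case 0
  then show ?case by (auto intro: continuous_on_compose2)
next
  case (Suc k)
  have "g differentiable (at x)" "f differentiable (at (g x))" if "x \<in> S" for x
    using Suc.prems that by auto
  note gf = frechet_derivative_works_at[OF this(1)] frechet_derivative_works_at[OF this(2)]
  have exp: "frechet_derivative f (at (g x)) w = (\<Sum>b\<in>Basis. (w \<bullet> b) *\<^sub>R frechet_derivative f (at (g x)) b)"
    if "x \<in> S" for x w
  proof -
    have "linear (frechet_derivative f (at (g x)))"
      using gf(2)[OF that] by (rule has_derivative_linear)
    then have "frechet_derivative f (at (g x)) (\<Sum>b\<in>Basis. (w \<bullet> b) *\<^sub>R b)
      = (\<Sum>b\<in>Basis. (w \<bullet> b) *\<^sub>R frechet_derivative f (at (g x)) b)"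
      by (simp add: linear_sum linear_scale)
    then show ?thesis by (simp add: euclidean_representation)
  qed
  have eq: "((\<lambda>x. f (g x)) has_derivative (\<lambda>u. frechet_derivative f (at (g x)) (frechet_derivative g (at x) u))) (at x)"
    if "x \<in> S" for x
    by (rule has_derivative_compose[OF gf[OF that]])
  have "Ck_on k S (\<lambda>x. frechet_derivative (\<lambda>x. f (g x)) (at x) u)" for u
  proof -
    have "Ck_on k S (\<lambda>x. \<Sum>b\<in>Basis. (frechet_derivative g (at x) u \<bullet> b) *\<^sub>R frechet_derivative f (at (g x)) b)"
    proof (intro Ck_on_sum Ck_on_bilinear[OF bounded_bilinear_scaleR] Suc.prems)
      fix b
      show "Ck_on k S (\<lambda>x. frechet_derivative g (at x) u \<bullet> b)"
        by (intro Ck_on_linear_compose[OF bounded_linear_inner_left Suc.prems(1)]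
            Suc.prems(3)[unfolded Ck_on.simps, THEN conjunct2, rule_format])
      show "Ck_on k S (\<lambda>x. frechet_derivative f (at (g x)) b)"
        by (rule Suc.IH[of "\<lambda>z. frechet_derivative f (at z) b", OF Suc.prems(1) _ Ck_on_SucD[OF Suc.prems(3)] Suc.prems(4)])
          (rule Suc.prems(2)[unfolded Ck_on.simps, THEN conjunct2, rule_format])
    qed
    then show ?thesis
      by (rule Ck_on_cong[OF Suc.prems(1), THEN iffD2, rotated]) (simp add: frechet_derivative_eq[OF eq] exp[symmetric])
  qed
  then show ?case unfolding Ck_on.simps differentiable_def using eq by blast
qed

lemma Ck_on_inverse: "Ck_on k (- {0::real}) inverse"
proof (induction k)
  case 0
  then show ?case by (auto intro: continuous_intros)
next
  case (Suc k)
  have op: "open (- {0::real})" by auto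
  have d: "(inverse has_derivative (\<lambda>u. - (inverse x * u * inverse x))) (at x)" if "x \<in> - {0::real}" for x
    using that by (auto intro: has_derivative_inverse')
  have "Ck_on k (- {0}) (\<lambda>x::real. frechet_derivative inverse (at x) u)" for u
  proof -
    have "Ck_on k (- {0}) (\<lambda>x::real. (- u) *\<^sub>R (inverse x * inverse x))"
      by (intro Ck_on_linear_compose[OF bounded_linear_scaleR_right] op Ck_on_bilinear[OF bounded_bilinear_mult] Suc.IH)
    then show ?thesis
      using Ck_on_cong[OF op, of "\<lambda>x::real. frechet_derivative inverse (at x) u" "\<lambda>x. (- u) *\<^sub>R (inverse x * inverse x)"]
        frechet_derivative_eq[OF d] by (auto simp: mult_ac)
  qed
  then show ?case unfolding Ck_on.simps differentiable_def using d by blast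
qed

section \<open>Calculus of smooth functions\<close>

lemma smooth_on_cong:
  assumes "open S" "\<And>x. x \<in> S \<Longrightarrow> f x = g x"
  shows "smooth_on S f \<longleftrightarrow> smooth_on S g"
proof -
  have "Ck_on k S f = Ck_on k S g" for k by (rule Ck_on_cong[OF assms])
  then show ?thesis by (simp add: smooth_on_def)
qed

lemma smooth_on_subset: "smooth_on S f \<Longrightarrow> T \<subseteq> S \<Longrightarrow> smooth_on T f"
  by (auto simp: smooth_on_def intro: Ck_on_subset)

lemma smooth_on_local:
  "(\<And>x. x \<in> S \<Longrightarrow> \<exists>T. open T \<and> x \<in> T \<and> smooth_on T f) \<Longrightarrow> smooth_on S f"
  unfolding smooth_on_def by (meson Ck_on_local)

lemma smooth_on_const [simp]: "smooth_on S (\<lambda>x. c)"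
  by (simp add: smooth_on_def Ck_on_const)

lemma smooth_on_bounded_linear: "bounded_linear f \<Longrightarrow> smooth_on S f"
  by (simp add: smooth_on_def Ck_on_bounded_linear)

lemma smooth_on_id [simp]: "smooth_on S (\<lambda>x. x)"
  by (simp add: smooth_on_bounded_linear bounded_linear_ident)

lemma smooth_on_add: "open S \<Longrightarrow> smooth_on S f \<Longrightarrow> smooth_on S g \<Longrightarrow> smooth_on S (\<lambda>x. f x + g x)"
  by (simp add: smooth_on_def Ck_on_add)

lemma smooth_on_linear_compose:
  "bounded_linear L \<Longrightarrow> open S \<Longrightarrow> smooth_on S f \<Longrightarrow> smooth_on S (\<lambda>x. L (f x))"
  by (simp add: smooth_on_def Ck_on_linear_compose)

lemma smooth_on_bilinear:
  "bounded_bilinear bop \<Longrightarrow> open S \<Longrightarrow> smooth_on S f \<Longrightarrow> smooth_on S g \<Longrightarrow> smooth_on S (\<lambda>x. bop (f x) (g x))"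
  by (simp add: smooth_on_def Ck_on_bilinear)

lemmas smooth_on_scaleR = smooth_on_bilinear[OF bounded_bilinear_scaleR]
lemmas smooth_on_mult = smooth_on_bilinear[OF bounded_bilinear_mult]

lemma smooth_on_minus: "open S \<Longrightarrow> smooth_on S f \<Longrightarrow> smooth_on S (\<lambda>x. - f x)"
  using smooth_on_linear_compose[OF bounded_linear_minus[OF bounded_linear_ident]] by blast

lemma smooth_on_diff: "open S \<Longrightarrow> smooth_on S f \<Longrightarrow> smooth_on S g \<Longrightarrow> smooth_on S (\<lambda>x. f x - g x)"
  using smooth_on_add[of S f "\<lambda>x. - g x"] by (simp add: smooth_on_minus)

lemma smooth_on_sum:
  "open S \<Longrightarrow> (\<And>i. i \<in> I \<Longrightarrow> smooth_on S (f i)) \<Longrightarrow> smooth_on S (\<lambda>x. \<Sum>i\<in>I. f i x)"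
  by (simp add: smooth_on_def Ck_on_sum)

lemma smooth_on_prod:
  fixes f :: "'i \<Rightarrow> 'a::real_normed_vector \<Rightarrow> real"
  shows "open S \<Longrightarrow> (\<And>i. i \<in> I \<Longrightarrow> smooth_on S (f i)) \<Longrightarrow> smooth_on S (\<lambda>x. \<Prod>i\<in>I. f i x)"
  by (induction I rule: infinite_finite_induct) (auto simp: smooth_on_mult)

lemma smooth_on_compose:
  fixes g :: "'a::real_normed_vector \<Rightarrow> 'b::euclidean_space"
  shows "open S \<Longrightarrow> smooth_on T f \<Longrightarrow> smooth_on S g \<Longrightarrow> g ` S \<subseteq> T \<Longrightarrow> smooth_on S (\<lambda>x. f (g x))"
  unfolding smooth_on_def by (blast intro: Ck_on_compose)

lemma smooth_on_inverse:
  fixes f :: "'a::real_normed_vector \<Rightarrow> real"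
  assumes "open S" "smooth_on S f" "\<And>x. x \<in> S \<Longrightarrow> f x \<noteq> 0"
  shows "smooth_on S (\<lambda>x. inverse (f x))"
  by (rule smooth_on_compose[OF assms(1) _ assms(2)]) (use assms(3) Ck_on_inverse in \<open>auto simp: smooth_on_def\<close>)

lemma smooth_on_divide:
  fixes f :: "'a::real_normed_vector \<Rightarrow> real"
  assumes "open S" "smooth_on S f" "smooth_on S g" "\<And>x. x \<in> S \<Longrightarrow> g x \<noteq> 0"
  shows "smooth_on S (\<lambda>x. f x / g x)"
  using smooth_on_mult[OF assms(1,2) smooth_on_inverse[OF assms(1,3,4)]] by (simp add: divide_inverse)

lemma smooth_on_Pair:
  assumes "open S" "smooth_on S f" "smooth_on S g"
  shows "smooth_on S (\<lambda>x. (f x, g x))"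
proof -
  have "smooth_on S (\<lambda>x. (f x, 0) + (0, g x))"
    by (intro smooth_on_add assms smooth_on_linear_compose[of "\<lambda>x. (x, 0)"] smooth_on_linear_compose[of "\<lambda>x. (0, x)"])
      (auto intro!: bounded_linear_Pair bounded_linear_ident bounded_linear_zero)
  then show ?thesis by simp
qed

lemma smooth_on_snd: "smooth_on S snd"
  by (simp add: smooth_on_bounded_linear bounded_linear_snd)

lemma smooth_on_imp_differentiable: "smooth_on S f \<Longrightarrow> x \<in> S \<Longrightarrow> f differentiable (at x)"
  unfolding smooth_on_def by (metis Ck_on.simps(2))

lemma smooth_on_has_derivative:
  "smooth_on S f \<Longrightarrow> x \<in> S \<Longrightarrow> (f has_derivative frechet_derivative f (at x)) (at x)"
  by (simp add: frechet_derivative_works_at smooth_on_imp_differentiable)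

lemma smooth_on_imp_continuous_on: "smooth_on S f \<Longrightarrow> continuous_on S f"
  unfolding smooth_on_def by (metis Ck_on.simps(1))

lemma smooth_on_frechet: "smooth_on S f \<Longrightarrow> smooth_on S (\<lambda>x. frechet_derivative f (at x) u)"
  unfolding smooth_on_def by (metis Ck_on.simps(2))

lemma frechet_derivative_expand:
  fixes f :: "'a::euclidean_space \<Rightarrow> 'b::real_normed_vector"
  assumes "f differentiable (at x)"
  shows "frechet_derivative f (at x) w = (\<Sum>b\<in>Basis. (w \<bullet> b) *\<^sub>R frechet_derivative f (at x) b)"
proof -
  have "frechet_derivative f (at x) (\<Sum>b\<in>Basis. (w \<bullet> b) *\<^sub>R b)
      = (\<Sum>b\<in>Basis. (w \<bullet> b) *\<^sub>R frechet_derivative f (at x) b)"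
    using linear_frechet_derivative[OF assms] by (simp add: linear_sum linear_scale)
  then show ?thesis by (simp add: euclidean_representation)
qed

text \<open>Both the base point and the direction may vary. In this form left invariant fields and
  the force term of the geodesic equation are seen to be smooth.\<close>

lemma smooth_on_frechet_compose:
  fixes f :: "'a::euclidean_space \<Rightarrow> 'b::real_normed_vector" and g :: "'c::real_normed_vector \<Rightarrow> 'a"
  assumes "open S" "smooth_on T f" "smooth_on S g" "g ` S \<subseteq> T" "smooth_on S h"
  shows "smooth_on S (\<lambda>x. frechet_derivative f (at (g x)) (h x))"
proof -
  have "smooth_on S (\<lambda>x. \<Sum>b\<in>Basis. (h x \<bullet> b) *\<^sub>R frechet_derivative f (at (g x)) b)"
    by (intro smooth_on_sum smooth_on_scaleR assms(1) smooth_on_compose[OF assms(1) smooth_on_frechet[OF assms(2)] assms(3,4)]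
        smooth_on_linear_compose[OF bounded_linear_inner_left assms(1,5)])
  then show ?thesis
  proof (rule smooth_on_cong[OF assms(1), THEN iffD2, rotated])
    fix x assume "x \<in> S"
    then have "f differentiable (at (g x))"
      using assms(2,4) by (auto intro: smooth_on_imp_differentiable)
    then show "frechet_derivative f (at (g x)) (h x)
        = (\<Sum>b\<in>Basis. (h x \<bullet> b) *\<^sub>R frechet_derivative f (at (g x)) b)"
      by (rule frechet_derivative_expand)
  qed
qed

lemma smooth_on_vec:
  fixes f :: "'a::real_normed_vector \<Rightarrow> real ^ 'n"
  assumes "open S" "\<And>i. smooth_on S (\<lambda>x. f x $ i)"
  shows "smooth_on S f"
proof -
  have "smooth_on S (\<lambda>x. \<Sum>i\<in>UNIV. f x $ i *\<^sub>R (axis i 1 :: real ^ 'n))"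
    by (intro smooth_on_sum smooth_on_scaleR assms smooth_on_const)
  moreover have "(\<Sum>i\<in>UNIV. f x $ i *\<^sub>R (axis i 1 :: real ^ 'n)) = f x" for x
    using basis_expansion[of "f x"] by (simp add: scalar_mult_eq_scaleR)
  ultimately show ?thesis by simp
qed

lemma smooth_on_det:
  fixes A :: "'a::real_normed_vector \<Rightarrow> real ^ 'n ^ 'n"
  assumes "open S" "\<And>i j. smooth_on S (\<lambda>x. A x $ i $ j)"
  shows "smooth_on S (\<lambda>x. det (A x))"
  unfolding det_def by (intro smooth_on_sum smooth_on_mult smooth_on_prod assms smooth_on_const)

lemma line_has_derivative:
  assumes "f differentiable (at (x + t *\<^sub>R u))"
  shows "((\<lambda>t. f (x + t *\<^sub>R u)) has_vector_derivative frechet_derivative f (at (x + t *\<^sub>R u)) u) (at t)"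
proof -
  have d: "(f has_derivative frechet_derivative f (at (x + t *\<^sub>R u))) (at (x + t *\<^sub>R u))"
    using assms by (rule frechet_derivative_works_at)
  have "((\<lambda>t. x + t *\<^sub>R u) has_derivative (\<lambda>h. h *\<^sub>R u)) (at t)"
    by (auto intro!: derivative_eq_intros)
  from has_derivative_compose[OF this d] show ?thesis
    by (simp add: has_vector_derivative_def linear_scale[OF has_derivative_linear[OF d]])
qed

lemma pd_eq_frechet:
  assumes "f differentiable (at x)"
  shows "pd f u x = frechet_derivative f (at x) u"
  using line_has_derivative[of f x 0 u] assms
  by (auto simp: pd_def has_real_derivative_iff_has_vector_derivative[symmetric] intro!: DERIV_imp_deriv)

section \<open>Symmetry of second derivatives\<close>

text \<open>Mean value theorem twice: along u for the increment of f between x and x + h w, then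
  along w for the derivative in direction u. The second difference is symmetric in u and w but the
  right side is not, and this forces the symmetry of second derivatives.\<close>

lemma second_difference:
  fixes f :: "'a::euclidean_space \<Rightarrow> real"
  assumes f: "smooth_on S f" and S: "ball x r \<subseteq> S" and h: "h > 0" "h * (norm u + norm w) < r"
  shows "\<exists>p. dist p x \<le> h * (norm u + norm w) \<and>
    f (x + h *\<^sub>R u + h *\<^sub>R w) - f (x + h *\<^sub>R u) - f (x + h *\<^sub>R w) + f x
      = h * (h * frechet_derivative (\<lambda>z. frechet_derivative f (at z) u) (at p) w)"
proof -
  define f1 where "f1 z = frechet_derivative f (at z) u" for z
  have bnd: "norm (a *\<^sub>R u + b *\<^sub>R w) \<le> h * (norm u + norm w)" if "\<bar>a\<bar> \<le> h" "\<bar>b\<bar> \<le> h" for a b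
  proof -
    have "norm (a *\<^sub>R u + b *\<^sub>R w) \<le> \<bar>a\<bar> * norm u + \<bar>b\<bar> * norm w"
      by (metis norm_scaleR norm_triangle_ineq)
    also have "\<dots> \<le> h * norm u + h * norm w"
      using that by (intro add_mono mult_right_mono) auto
    finally show ?thesis by (simp add: algebra_simps)
  qed
  have inS: "x + a *\<^sub>R u + b *\<^sub>R w \<in> S" if "\<bar>a\<bar> \<le> h" "\<bar>b\<bar> \<le> h" for a b
  proof -
    have "norm (x - (x + a *\<^sub>R u + b *\<^sub>R w)) < r"
      using bnd[OF that] h(2) norm_minus_cancel[of "a *\<^sub>R u + b *\<^sub>R w"] by (simp add: algebra_simps)
    then show ?thesis using S by (auto simp: dist_norm)
  qed
  have d1: "((\<lambda>t. f (z + t *\<^sub>R u)) has_real_derivative f1 (z + t *\<^sub>R u)) (at t)"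
    if "z + t *\<^sub>R u \<in> S" for z t
    using line_has_derivative[OF smooth_on_imp_differentiable[OF f that]]
    by (simp add: has_real_derivative_iff_has_vector_derivative f1_def)
  define g where "g t = f ((x + h *\<^sub>R w) + t *\<^sub>R u) - f (x + t *\<^sub>R u)" for t
  have "\<exists>t>0. t < h \<and> g h - g 0 = (h - 0) * (f1 ((x + h *\<^sub>R w) + t *\<^sub>R u) - f1 (x + t *\<^sub>R u))"
  proof (rule MVT2[OF h(1)])
    fix t assume "0 \<le> t" "t \<le> h"
    then show "(g has_real_derivative f1 ((x + h *\<^sub>R w) + t *\<^sub>R u) - f1 (x + t *\<^sub>R u)) (at t)"
      unfolding g_def using inS[of t h] inS[of t 0] h(1)
      by (intro DERIV_diff d1) (auto simp: add_ac)
  qed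
  then obtain t where t: "0 < t" "t < h" and
    gt: "g h - g 0 = h * (f1 ((x + h *\<^sub>R w) + t *\<^sub>R u) - f1 (x + t *\<^sub>R u))"
    by auto
  have f1: "smooth_on S f1" unfolding f1_def by (rule smooth_on_frechet[OF f])
  have "\<exists>q>0. q < h \<and> f1 ((x + t *\<^sub>R u) + h *\<^sub>R w) - f1 ((x + t *\<^sub>R u) + 0 *\<^sub>R w)
      = (h - 0) * frechet_derivative f1 (at ((x + t *\<^sub>R u) + q *\<^sub>R w)) w"
  proof (rule MVT2[OF h(1)])
    fix q assume "0 \<le> q" "q \<le> h"
    then show "((\<lambda>q. f1 ((x + t *\<^sub>R u) + q *\<^sub>R w)) has_real_derivative
        frechet_derivative f1 (at ((x + t *\<^sub>R u) + q *\<^sub>R w)) w) (at q)"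
      using line_has_derivative[OF smooth_on_imp_differentiable[OF f1 inS[of t q]]] t
      by (simp add: has_real_derivative_iff_has_vector_derivative)
  qed
  then obtain q where q: "0 < q" "q < h" and
    fq: "f1 ((x + t *\<^sub>R u) + h *\<^sub>R w) - f1 (x + t *\<^sub>R u) = h * frechet_derivative f1 (at (x + t *\<^sub>R u + q *\<^sub>R w)) w"
    by auto
  have "g h - g 0 = h * (h * frechet_derivative f1 (at (x + t *\<^sub>R u + q *\<^sub>R w)) w)"
    using gt fq by (simp add: add_ac)
  then have "f (x + h *\<^sub>R u + h *\<^sub>R w) - f (x + h *\<^sub>R u) - f (x + h *\<^sub>R w) + f x
      = h * (h * frechet_derivative f1 (at (x + t *\<^sub>R u + q *\<^sub>R w)) w)"
    by (simp add: g_def add_ac)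
  moreover have "dist (x + t *\<^sub>R u + q *\<^sub>R w) x \<le> h * (norm u + norm w)"
    using bnd[of t q] t q by (simp add: dist_norm add.assoc)
  ultimately show ?thesis unfolding f1_def by blast
qed

lemma second_derivative_symmetric_real:
  fixes f :: "'a::euclidean_space \<Rightarrow> real"
  assumes S: "open S" "x \<in> S" and f: "smooth_on S f"
  shows "frechet_derivative (\<lambda>z. frechet_derivative f (at z) u) (at x) w
       = frechet_derivative (\<lambda>z. frechet_derivative f (at z) w) (at x) u"
proof -
  define A where "A z = frechet_derivative (\<lambda>z. frechet_derivative f (at z) u) (at z) w" for z
  define B where "B z = frechet_derivative (\<lambda>z. frechet_derivative f (at z) w) (at z) u" for z
  have "continuous_on S A" "continuous_on S B"
    unfolding A_def B_def by (intro smooth_on_imp_continuous_on smooth_on_frechet f)+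
  then have cont: "isCont A x" "isCont B x"
    using S by (auto simp: continuous_on_eq_continuous_at)
  obtain r where r: "r > 0" "ball x r \<subseteq> S" using S open_contains_ball by blast
  have "\<bar>A x - B x\<bar> \<le> e" if e: "e > 0" for e
  proof -
    obtain d1 where d1: "d1 > 0" "\<And>z. dist z x < d1 \<Longrightarrow> dist (A z) (A x) < e/2"
      using cont(1)[unfolded continuous_at_eps_delta, rule_format, OF half_gt_zero[OF e]] by blast
    obtain d2 where d2: "d2 > 0" "\<And>z. dist z x < d2 \<Longrightarrow> dist (B z) (B x) < e/2"
      using cont(2)[unfolded continuous_at_eps_delta, rule_format, OF half_gt_zero[OF e]] by blast
    define m where "m = min r (min d1 d2)"
    \<comment> \<open>The summand 1 covers u = w = 0 and makes \<open>h * (norm u + norm w)\<close>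
      strictly less than m, so both intermediate points lie where the continuity estimates
      hold.\<close>
    define h where "h = m / (norm u + norm w + 1)"
    have m: "m > 0" using r d1 d2 by (simp add: m_def)
    have n: "norm u + norm w + 1 > 0" by (smt (verit) norm_ge_zero)
    have h: "h > 0" using m n by (simp add: h_def)
    have "h * (norm u + norm w) < h * (norm u + norm w + 1)" using h by simp
    also have "\<dots> = m" using n by (simp add: h_def)
    finally have hm: "h * (norm u + norm w) < m" .
    have hm': "h * (norm w + norm u) < r" "h * (norm u + norm w) < r" using hm by (auto simp: m_def add_ac)
    obtain p where p: "dist p x \<le> h * (norm u + norm w)"
      "f (x + h *\<^sub>R u + h *\<^sub>R w) - f (x + h *\<^sub>R u) - f (x + h *\<^sub>R w) + f x = h * (h * A p)"
      using second_difference[OF f r(2) h hm'(2)] unfolding A_def by blast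
    obtain q where q: "dist q x \<le> h * (norm w + norm u)"
      "f (x + h *\<^sub>R w + h *\<^sub>R u) - f (x + h *\<^sub>R w) - f (x + h *\<^sub>R u) + f x = h * (h * B q)"
      using second_difference[OF f r(2) h hm'(1)] unfolding B_def by blast
    have comm: "x + h *\<^sub>R w + h *\<^sub>R u = x + h *\<^sub>R u + h *\<^sub>R w" by (simp add: add_ac)
    have "h * (h * A p) = h * (h * B q)" using p(2) q(2)[unfolded comm] by linarith
    then have "A p = B q" using h by simp
    moreover have "dist (A p) (A x) < e/2" using p(1) hm by (intro d1) (auto simp: m_def)
    moreover have "dist (B q) (B x) < e/2" using q(1) hm by (intro d2) (auto simp: m_def add_ac)
    ultimately show ?thesis unfolding dist_real_def by linarith
  qed
  then have "\<bar>A x - B x\<bar> \<le> 0" by (rule field_le_epsilon) auto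
  then show ?thesis by (simp add: A_def B_def)
qed

lemma second_derivative_symmetric:
  fixes f :: "'a::euclidean_space \<Rightarrow> 'b::euclidean_space"
  assumes S: "open S" "x \<in> S" and f: "smooth_on S f"
  shows "frechet_derivative (\<lambda>z. frechet_derivative f (at z) u) (at x) w
       = frechet_derivative (\<lambda>z. frechet_derivative f (at z) w) (at x) u"
proof (rule euclidean_eqI)
  fix b :: 'b assume "b \<in> Basis"
  have lin: "frechet_derivative (\<lambda>z. g z \<bullet> b) (at z) w = frechet_derivative g (at z) w \<bullet> b"
    if "smooth_on S g" "z \<in> S" for g :: "'a \<Rightarrow> 'b" and z w
    using has_derivative_inner_left[OF smooth_on_has_derivative[OF that], of b]
    by (simp add: frechet_derivative_eq)
  have *: "frechet_derivative (\<lambda>z. frechet_derivative f (at z) u) (at x) w \<bullet> b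
      = frechet_derivative (\<lambda>z. frechet_derivative (\<lambda>z. f z \<bullet> b) (at z) u) (at x) w" for u w
    using frechet_derivative_cong_open(1)[OF S, of "\<lambda>z. frechet_derivative (\<lambda>z. f z \<bullet> b) (at z) u"
        "\<lambda>z. frechet_derivative f (at z) u \<bullet> b"] lin[OF f]
      lin[OF smooth_on_frechet[OF f] S(2)] by simp
  show "frechet_derivative (\<lambda>z. frechet_derivative f (at z) u) (at x) w \<bullet> b
       = frechet_derivative (\<lambda>z. frechet_derivative f (at z) w) (at x) u \<bullet> b"
    unfolding * by (rule second_derivative_symmetric_real[OF S
        smooth_on_linear_compose[OF bounded_linear_inner_left S(1) f]])
qed

section \<open>Ordinary differential equations\<close>

text \<open>The operator norm of the derivative is dominated by the sum of the norms of the partial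
  derivatives, which is continuous and so bounded on the compact ball; convexity of the ball then
  gives the Lipschitz bound.\<close>

lemma smooth_on_lipschitz_cball:
  fixes f :: "'a::euclidean_space \<Rightarrow> 'b::euclidean_space"
  assumes "smooth_on U f" "cball x r \<subseteq> U"
  obtains K where "K > 0" "K-lipschitz_on (cball x r) f"
proof -
  have "continuous_on (cball x r) (\<lambda>z. \<Sum>b\<in>Basis. norm (frechet_derivative f (at z) b))"
    using smooth_on_imp_continuous_on[OF smooth_on_frechet[OF smooth_on_subset[OF assms]]]
    by (intro continuous_intros) auto
  then have "bounded ((\<lambda>z. \<Sum>b\<in>Basis. norm (frechet_derivative f (at z) b)) ` cball x r)"
    by (intro compact_imp_bounded compact_continuous_image) auto
  then obtain K where K: "K > 0" "\<And>z. z \<in> cball x r \<Longrightarrow> norm (\<Sum>b\<in>Basis. norm (frechet_derivative f (at z) b)) \<le> K"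
    unfolding bounded_pos by auto
  have bnd: "norm (frechet_derivative f (at z) w) \<le> K * norm w" if "z \<in> cball x r" for z w
  proof -
    have "f differentiable (at z)" using that assms smooth_on_imp_differentiable by blast
    then have "norm (frechet_derivative f (at z) w) \<le> (\<Sum>b\<in>Basis. norm ((w \<bullet> b) *\<^sub>R frechet_derivative f (at z) b))"
      by (subst frechet_derivative_expand) (auto intro: norm_sum simp del: norm_scaleR)
    also have "\<dots> \<le> (\<Sum>b\<in>Basis. norm w * norm (frechet_derivative f (at z) b))"
      by (intro sum_mono) (auto intro!: mult_right_mono Basis_le_norm)
    also have "\<dots> \<le> norm w * K"
      unfolding sum_distrib_left[symmetric] using K(2)[OF that]
      by (intro mult_left_mono) auto
    finally show ?thesis by (simp add: mult_ac)
  qed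
  have "K-lipschitz_on (cball x r) f"
  proof (rule bounded_derivative_imp_lipschitz)
    fix z assume z: "z \<in> cball x r"
    show "(f has_derivative frechet_derivative f (at z)) (at z within cball x r)"
      by (rule has_derivative_at_withinI, rule smooth_on_has_derivative[OF assms(1)]) (use z assms(2) in blast)
    show "onorm (frechet_derivative f (at z)) \<le> K"
      by (rule onorm_le) (rule bnd[OF z])
  qed (use K(1) in \<open>simp_all add: convex_cball\<close>)
  with K show ?thesis using that by blast
qed

text \<open>Bootstrap: if x is C^k then so is its derivative f(x), hence x is C^(k+1).\<close>

lemma ode_smooth:
  fixes x :: "real \<Rightarrow> 'a::euclidean_space"
  assumes I: "open I" and f: "smooth_on U f"
    and x: "\<And>t. t \<in> I \<Longrightarrow> x t \<in> U" "\<And>t. t \<in> I \<Longrightarrow> (x has_vector_derivative f (x t)) (at t)"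
  shows "smooth_on I x"
proof -
  have fr: "frechet_derivative x (at t) u = u *\<^sub>R f (x t)" if "t \<in> I" for t u
    using x(2)[OF that] by (simp add: has_vector_derivative_def frechet_derivative_eq)
  have diff: "x differentiable (at t)" if "t \<in> I" for t
    using x(2)[OF that] by (auto simp: has_vector_derivative_def differentiable_def)
  have "Ck_on k I x" for k
  proof (induction k)
    case 0
    then show ?case
      using diff by (auto intro!: continuous_at_imp_continuous_on differentiable_imp_continuous_within)
  next
    case (Suc k)
    have "Ck_on k I (\<lambda>t. f (x t))"
      using Ck_on_compose[OF I _ Suc, of U f] f x(1) by (auto simp: smooth_on_def)
    then have "Ck_on k I (\<lambda>t. u *\<^sub>R f (x t))" for u
      by (rule Ck_on_linear_compose[OF bounded_linear_scaleR_right I])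
    then have "Ck_on k I (\<lambda>t. frechet_derivative x (at t) u)" for u
      by (rule Ck_on_cong[OF I, THEN iffD2, rotated]) (rule fr)
    then show ?case using diff by simp
  qed
  then show ?thesis by (simp add: smooth_on_def)
qed

text \<open>Gronwall in differential form: the Lipschitz bound makes the squared distance times
  exp(-2Kt) nonincreasing, and it starts at 0.\<close>

lemma ode_unique_forward:
  fixes x y :: "real \<Rightarrow> 'a::real_inner"
  assumes f: "K-lipschitz_on B f"
    and x: "\<And>t. 0 \<le> t \<Longrightarrow> t < d \<Longrightarrow> x t \<in> B \<and> (x has_vector_derivative f (x t)) (at t)"
    and y: "\<And>t. 0 \<le> t \<Longrightarrow> t < d \<Longrightarrow> y t \<in> B \<and> (y has_vector_derivative f (y t)) (at t)"
    and eq: "x 0 = y 0" and t: "0 \<le> t" "t < d"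
  shows "x t = y t"
proof -
  define h where "h r = (x r - y r) \<bullet> (x r - y r) * exp (- 2 * K * r)" for r
  have "h t \<le> h 0"
  proof (rule DERIV_nonpos_imp_nonincreasing[OF t(1)])
    fix r assume r: "0 \<le> r" "r \<le> t"
    then have r': "0 \<le> r" "r < d" using t by auto
    define z where "z = x r - y r"
    have dz: "((\<lambda>r. x r - y r) has_vector_derivative f (x r) - f (y r)) (at r)"
      using x[OF r'] y[OF r'] by (intro has_vector_derivative_diff) auto
    have "((\<lambda>r. (x r - y r) \<bullet> (x r - y r)) has_derivative
        (\<lambda>k. z \<bullet> (k *\<^sub>R (f (x r) - f (y r))) + (k *\<^sub>R (f (x r) - f (y r))) \<bullet> z)) (at r)"
      unfolding z_def by (rule has_derivative_inner) (use dz in \<open>auto simp: has_vector_derivative_def\<close>)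
    then have "((\<lambda>r. (x r - y r) \<bullet> (x r - y r)) has_real_derivative 2 * (z \<bullet> (f (x r) - f (y r)))) (at r)"
      unfolding has_field_derivative_def
      by (rule has_derivative_eq_rhs) (auto simp: inner_commute algebra_simps)
    then have D: "(h has_real_derivative (2 * (z \<bullet> (f (x r) - f (y r)))) * exp (- 2 * K * r)
        + (z \<bullet> z) * (exp (- 2 * K * r) * (- 2 * K))) (at r)"
      unfolding h_def z_def by (auto intro!: derivative_eq_intros)
    have "z \<bullet> (f (x r) - f (y r)) \<le> norm z * norm (f (x r) - f (y r))"
      by (rule norm_cauchy_schwarz)
    also have "\<dots> \<le> norm z * (K * norm z)"
      using x[OF r'] y[OF r'] lipschitz_on_normD[OF f, of "x r" "y r"]
      by (intro mult_left_mono) (auto simp: z_def)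
    also have "\<dots> = K * (z \<bullet> z)" by (simp add: dot_square_norm power2_eq_square)
    finally have "(2 * (z \<bullet> (f (x r) - f (y r))) - 2 * K * (z \<bullet> z)) * exp (- 2 * K * r) \<le> 0"
      by (intro mult_nonpos_nonneg) auto
    then show "\<exists>y. (h has_real_derivative y) (at r) \<and> y \<le> 0"
      by (intro exI[of _ "(2 * (z \<bullet> (f (x r) - f (y r)))) * exp (- 2 * K * r)
        + (z \<bullet> z) * (exp (- 2 * K * r) * (- 2 * K))"] conjI D) (simp add: algebra_simps)
  qed
  also have "h 0 = 0" by (simp add: h_def eq)
  finally have "(x t - y t) \<bullet> (x t - y t) \<le> 0"
    by (simp add: h_def mult_le_0_iff)
  then have "(x t - y t) \<bullet> (x t - y t) = 0" by (intro antisym) auto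
  then show ?thesis by simp
qed

lemma ode_unique:
  fixes x y :: "real \<Rightarrow> 'a::real_inner"
  assumes f: "K-lipschitz_on B f"
    and x: "\<And>t. \<bar>t\<bar> < d \<Longrightarrow> x t \<in> B \<and> (x has_vector_derivative f (x t)) (at t)"
    and y: "\<And>t. \<bar>t\<bar> < d \<Longrightarrow> y t \<in> B \<and> (y has_vector_derivative f (y t)) (at t)"
    and eq: "x 0 = y 0" and t: "\<bar>t\<bar> < d"
  shows "x t = y t"
proof (cases "t \<ge> 0")
  case True
  then show ?thesis using ode_unique_forward[OF f, of d x y t] x y eq t by auto
next
  case False
  have rev: "((\<lambda>t. z (- t)) has_vector_derivative - f (z (- t))) (at t)"
    if "(z has_vector_derivative f (z (- t))) (at (- t))" for z :: "real \<Rightarrow> 'a" and t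
  proof -
    have "(uminus has_vector_derivative (- 1 :: real)) (at t)"
      by (auto intro!: derivative_eq_intros)
    from vector_diff_chain_at[OF this that] show ?thesis by (simp add: o_def)
  qed
  have "x (- (- t)) = y (- (- t))"
    using False x y eq t by (intro ode_unique_forward[of K B "\<lambda>z. - f z" d "\<lambda>t. x (- t)" "\<lambda>t. y (- t)" "- t"])
      (auto intro!: rev lipschitz_on_minus f)
  then show ?thesis by simp
qed

text \<open>Picard iteration as a contraction of the bounded continuous functions on the whole line.
  To stay in that complete space the field is precomposed with the retraction \<open>cp\<close> onto
  a ball, which makes it bounded and globally Lipschitz, and time is clamped by \<open>cl\<close>.
  The fixed point stays in the ball at all times and satisfies the original equation at small
  ones.\<close>

lemma ode_exists:
  fixes f :: "'a::euclidean_space \<Rightarrow> 'a"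
  assumes U: "open U" "x0 \<in> U" and f: "smooth_on U f"
  obtains \<epsilon> x where "\<epsilon> > 0" "x 0 = x0" "smooth_on {-\<epsilon><..<\<epsilon>} x"
    "\<And>t. \<bar>t\<bar> < \<epsilon> \<Longrightarrow> x t \<in> U \<and> (x has_vector_derivative f (x t)) (at t)"
proof -
  obtain r where r: "r > 0" "cball x0 r \<subseteq> U" using U open_contains_cball by blast
  obtain K where K: "K > 0" "K-lipschitz_on (cball x0 r) f"
    using smooth_on_lipschitz_cball[OF f r(2)] by blast
  define cp where "cp = closest_point (cball x0 r)"
  have cp: "cp z \<in> cball x0 r" "dist (cp z) (cp z') \<le> dist z z'" for z z'
    using r by (auto simp: cp_def simp del: mem_cball
        intro!: closest_point_in_set closest_point_lipschitz)
  define g where "g z = f (cp z)" for z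
  have g_lip: "norm (g z - g z') \<le> K * norm (z - z')" for z z'
  proof -
    have "dist (g z) (g z') \<le> K * dist (cp z) (cp z')"
      unfolding g_def by (rule lipschitz_onD[OF K(2) cp(1) cp(1)])
    also have "\<dots> \<le> K * dist z z'" using cp(2) K(1) by (intro mult_left_mono) auto
    finally show ?thesis by (simp add: dist_norm)
  qed
  then have g_cont: "continuous_on UNIV g"
    using K(1) by (intro lipschitz_on_continuous_on[of K] lipschitz_onI) (auto simp: dist_norm)
  have "bounded (f ` cball x0 r)"
    using smooth_on_imp_continuous_on[OF smooth_on_subset[OF f r(2)]]
    by (intro compact_imp_bounded compact_continuous_image) auto
  then obtain M where M: "M > 0" "\<And>z. z \<in> cball x0 r \<Longrightarrow> norm (f z) \<le> M"
    unfolding bounded_pos by auto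
  have gM: "norm (g z) \<le> M" for z using M(2)[OF cp(1)] by (simp add: g_def)
  \<comment> \<open>The factor 3 is the bound 2\<epsilon> + \<epsilon> on the lengths of the two
    integrals in \<open>J\<close>. The first entry makes the contraction factor 1/2, the second
    keeps all iterates in the ball.\<close>
  define \<epsilon> where "\<epsilon> = min (1 / (6 * K)) (r / (3 * M))"
  have \<epsilon>: "\<epsilon> > 0" "3 * \<epsilon> * K \<le> 1/2" "3 * \<epsilon> * M \<le> r"
    using K(1) M(1) r(1) by (auto simp: \<epsilon>_def min_def field_simps)
  define cl where "cl t = max (- \<epsilon>) (min \<epsilon> t)" for t :: real
  have cl: "- \<epsilon> \<le> cl t" "cl t \<le> \<epsilon>" "\<bar>t\<bar> \<le> \<epsilon> \<Longrightarrow> cl t = t" for t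
    using \<epsilon>(1) by (auto simp: cl_def)
  \<comment> \<open>The integral from 0 to \<open>cl t\<close>, for either sign, is written with
    base point -\<epsilon> because intervals carry no orientation.\<close>
  define J where "J \<phi> t = x0 + (integral {-\<epsilon>..cl t} (\<lambda>s. g (apply_bcontfun \<phi> s))
      - integral {-\<epsilon>..0} (\<lambda>s. g (apply_bcontfun \<phi> s)))" for \<phi> :: "real \<Rightarrow>\<^sub>C 'a" and t
  have gphi_cont: "continuous_on T (\<lambda>s. g (apply_bcontfun \<phi> s))" for \<phi> :: "real \<Rightarrow>\<^sub>C 'a" and T
    by (rule continuous_on_compose2[OF g_cont]) auto
  have intb: "norm (integral {-\<epsilon>..cl t} h - integral {-\<epsilon>..0} h) \<le> 3 * \<epsilon> * B"
    if "continuous_on UNIV h" "\<And>s. norm (h s) \<le> B" "B \<ge> 0" for h :: "real \<Rightarrow> 'a" and t B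
  proof -
    have "norm (integral {-\<epsilon>..cl t} h) \<le> B * (cl t - (- \<epsilon>))" "norm (integral {-\<epsilon>..0} h) \<le> B * (0 - (- \<epsilon>))"
      using cl[of t] \<epsilon>(1) that by (intro integral_bound; auto intro: continuous_on_subset)+
    moreover have "B * (cl t - (- \<epsilon>)) \<le> B * (2 * \<epsilon>)"
      using cl(2)[of t] that(3) by (intro mult_left_mono) auto
    ultimately show ?thesis
      using norm_triangle_ineq4[of "integral {-\<epsilon>..cl t} h" "integral {-\<epsilon>..0} h"] by (simp add: algebra_simps)
  qed
  have J_near: "norm (J \<phi> t - x0) \<le> 3 * \<epsilon> * M" for \<phi> t
    unfolding J_def using intb[of "\<lambda>s. g (apply_bcontfun \<phi> s)" M t] gphi_cont gM M(1) by auto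
  have "J \<phi> \<in> bcontfun" for \<phi>
  proof -
    have "continuous_on {-\<epsilon>..\<epsilon>} (\<lambda>t. integral {-\<epsilon>..t} (\<lambda>s. g (apply_bcontfun \<phi> s)))"
      by (intro indefinite_integral_continuous_1 integrable_continuous_real gphi_cont)
    then have "continuous_on UNIV (\<lambda>t. integral {-\<epsilon>..cl t} (\<lambda>s. g (apply_bcontfun \<phi> s)))"
      by (rule continuous_on_compose2) (use cl in \<open>auto simp: cl_def intro!: continuous_intros\<close>)
    then have "continuous_on UNIV (J \<phi>)" unfolding J_def by (intro continuous_intros) auto
    moreover have "norm (J \<phi> t) \<le> norm x0 + 3 * \<epsilon> * M" for t
      using J_near[of \<phi> t] norm_triangle_sub[of "J \<phi> t" x0] by linarith
    then have "bounded (range (J \<phi>))" unfolding bounded_iff by blast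
    ultimately show ?thesis by (simp add: bcontfun_def)
  qed
  then have J_app: "apply_bcontfun (Bcontfun (J \<phi>)) = J \<phi>" for \<phi>
    by (rule Bcontfun_inverse)
  have "\<exists>!\<phi>. Bcontfun (J \<phi>) = \<phi>"
  proof (rule banach_fix_type[of "1/2"]; (intro allI)?)
    fix \<phi> \<psi> :: "real \<Rightarrow>\<^sub>C 'a"
    show "dist (Bcontfun (J \<phi>)) (Bcontfun (J \<psi>)) \<le> 1/2 * dist \<phi> \<psi>"
    proof (rule dist_bound)
      fix t
      let ?h = "\<lambda>s. g (apply_bcontfun \<phi> s) - g (apply_bcontfun \<psi> s)"
      have "J \<phi> t - J \<psi> t = integral {-\<epsilon>..cl t} ?h - integral {-\<epsilon>..0} ?h"
        unfolding J_def by (subst (1 2) integral_diff) (auto intro!: integrable_continuous_real gphi_cont)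
      moreover have "norm (?h s) \<le> K * dist \<phi> \<psi>" for s
      proof -
        have "norm (?h s) \<le> K * dist (apply_bcontfun \<phi> s) (apply_bcontfun \<psi> s)"
          using g_lip by (simp add: dist_norm)
        also have "\<dots> \<le> K * dist \<phi> \<psi>" using K(1) by (intro mult_left_mono dist_bounded) auto
        finally show ?thesis .
      qed
      moreover have "continuous_on UNIV ?h" by (intro continuous_on_diff gphi_cont)
      ultimately have "norm (J \<phi> t - J \<psi> t) \<le> 3 * \<epsilon> * (K * dist \<phi> \<psi>)"
        using intb[of ?h "K * dist \<phi> \<psi>" t] K(1) by simp
      also have "\<dots> \<le> 1/2 * dist \<phi> \<psi>"
        using \<epsilon>(2) mult_right_mono[OF \<epsilon>(2), of "dist \<phi> \<psi>"] by (simp add: mult_ac)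
      finally show "dist (apply_bcontfun (Bcontfun (J \<phi>)) t) (apply_bcontfun (Bcontfun (J \<psi>)) t) \<le> 1/2 * dist \<phi> \<psi>"
        by (simp add: J_app dist_norm)
    qed
  qed auto
  then obtain \<phi> where "Bcontfun (J \<phi>) = \<phi>" by blast
  then have phi: "apply_bcontfun \<phi> t = J \<phi> t" for t by (metis J_app)
  define x where "x = apply_bcontfun \<phi>"
  have x_in: "x t \<in> cball x0 r" for t
    using J_near[of \<phi> t] \<epsilon>(3) phi by (simp add: x_def dist_norm norm_minus_commute)
  have gx: "g (x t) = f (x t)" for t
    using x_in[of t] by (simp add: g_def cp_def closest_point_self)
  have x_der: "(x has_vector_derivative f (x t)) (at t)" if "\<bar>t\<bar> < \<epsilon>" for t
  proof -
    have "((\<lambda>t. integral {-\<epsilon>..t} (\<lambda>s. g (x s))) has_vector_derivative g (x t)) (at t within {-\<epsilon>..\<epsilon>})"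
      unfolding x_def using that by (intro integral_has_vector_derivative gphi_cont) auto
    then have "((\<lambda>t. x0 + (integral {-\<epsilon>..t} (\<lambda>s. g (x s)) - integral {-\<epsilon>..0} (\<lambda>s. g (x s))))
        has_vector_derivative g (x t)) (at t within {-\<epsilon><..<\<epsilon>})"
      by (auto intro!: derivative_eq_intros elim: has_vector_derivative_within_subset)
    then have "((\<lambda>t. x0 + (integral {-\<epsilon>..t} (\<lambda>s. g (x s)) - integral {-\<epsilon>..0} (\<lambda>s. g (x s))))
        has_vector_derivative g (x t)) (at t)"
      using that by (subst (asm) at_within_open) auto
    then show ?thesis
    proof (subst gx[symmetric], rule has_vector_derivative_transform_within_open)
      show "open {-\<epsilon><..<\<epsilon>}" "t \<in> {-\<epsilon><..<\<epsilon>}" using that by auto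
      fix s assume "s \<in> {-\<epsilon><..<\<epsilon>}"
      then show "x0 + (integral {-\<epsilon>..s} (\<lambda>s. g (x s)) - integral {-\<epsilon>..0} (\<lambda>s. g (x s))) = x s"
        using phi[of s] cl(3)[of s] by (simp add: x_def J_def abs_le_iff)
    qed
  qed
  have "x 0 = x0" using phi[of 0] cl(3)[of 0] \<epsilon>(1) by (simp add: x_def J_def)
  moreover have xU: "x t \<in> U" for t using x_in r(2) by blast
  moreover have "smooth_on {-\<epsilon><..<\<epsilon>} x"
    by (rule ode_smooth[OF _ f xU]) (auto intro!: x_der)
  ultimately show ?thesis using that[OF \<epsilon>(1)] x_der by blast
qed

section \<open>Derivatives at moving points in moving directions\<close>

lemma has_derivative_transform_eventually_at:
  "(f has_derivative f') (at x) \<Longrightarrow> \<forall>\<^sub>F z in nhds x. f z = g z \<Longrightarrow> (g has_derivative f') (at x)"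
  unfolding eventually_nhds using has_derivative_transform_within_open by blast

lemma eventually_nhds_compose_continuous:
  assumes "\<forall>\<^sub>F z in nhds (f x). P z" "isCont f x"
  shows "\<forall>\<^sub>F y in nhds x. P (f y)"
  using eventually_compose_filterlim[OF assms(1)] assms(2)
  by (simp add: isCont_def tendsto_at_iff_tendsto_nhds)

text \<open>Product rule for Df(k)(h). The second derivative of f is never formed as a bilinear map:
  it enters as the derivative of Df(.)(h x) with the direction frozen, which is also the form in
  which its symmetry is available.\<close>

lemma frechet_derivative_along:
  fixes f :: "'a::euclidean_space \<Rightarrow> 'b::euclidean_space" and k h :: "'c::real_normed_vector \<Rightarrow> 'a"
  assumes S: "open S" "k x \<in> S" and f: "smooth_on S f"
    and k: "(k has_derivative k') (at x)" and h: "(h has_derivative h') (at x)"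
  shows "((\<lambda>z. frechet_derivative f (at (k z)) (h z)) has_derivative
     (\<lambda>w. frechet_derivative f (at (k x)) (h' w)
        + frechet_derivative (\<lambda>z. frechet_derivative f (at z) (h x)) (at (k x)) (k' w))) (at x)"
proof -
  let ?d = "\<lambda>z. frechet_derivative f (at z)"
  have expand: "?d z v = (\<Sum>b\<in>Basis. (v \<bullet> b) *\<^sub>R ?d z b)" if "z \<in> S" for z v
    by (rule frechet_derivative_expand[OF smooth_on_imp_differentiable[OF f that]])
  have db: "((\<lambda>z. ?d z b) has_derivative frechet_derivative (\<lambda>z. ?d z b) (at (k x))) (at (k x))" for b
    by (rule smooth_on_has_derivative[OF smooth_on_frechet[OF f] S(2)])
  have dbk: "((\<lambda>z. ?d (k z) b) has_derivative (\<lambda>w. frechet_derivative (\<lambda>z. ?d z b) (at (k x)) (k' w))) (at x)" for b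
    by (rule has_derivative_compose[OF k db])
  have c: "frechet_derivative (\<lambda>z. ?d z (h x)) (at (k x)) w
      = (\<Sum>b\<in>Basis. (h x \<bullet> b) *\<^sub>R frechet_derivative (\<lambda>z. ?d z b) (at (k x)) w)" for w
  proof -
    have "((\<lambda>z. \<Sum>b\<in>Basis. (h x \<bullet> b) *\<^sub>R ?d z b) has_derivative
      (\<lambda>w. \<Sum>b\<in>Basis. (h x \<bullet> b) *\<^sub>R frechet_derivative (\<lambda>z. ?d z b) (at (k x)) w)) (at (k x))"
      by (intro has_derivative_sum has_derivative_scaleR_right db)
    then have "((\<lambda>z. ?d z (h x)) has_derivative
      (\<lambda>w. \<Sum>b\<in>Basis. (h x \<bullet> b) *\<^sub>R frechet_derivative (\<lambda>z. ?d z b) (at (k x)) w)) (at (k x))"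
      by (rule has_derivative_transform_within_open[OF _ S]) (rule expand[symmetric])
    then show ?thesis by (simp add: frechet_derivative_eq)
  qed
  have D: "((\<lambda>z. \<Sum>b\<in>Basis. (h z \<bullet> b) *\<^sub>R ?d (k z) b) has_derivative (\<lambda>w. \<Sum>b\<in>Basis.
      (h x \<bullet> b) *\<^sub>R frechet_derivative (\<lambda>z. ?d z b) (at (k x)) (k' w) + (h' w \<bullet> b) *\<^sub>R ?d (k x) b)) (at x)"
    by (intro has_derivative_sum has_derivative_scaleR has_derivative_inner_left h dbk)
  have ev: "\<forall>\<^sub>F z in nhds x. k z \<in> S"
    by (rule eventually_nhds_compose_continuous[OF eventually_nhds_in_open[OF S] has_derivative_continuous[OF k]])
  have "((\<lambda>z. ?d (k z) (h z)) has_derivative (\<lambda>w. \<Sum>b\<in>Basis.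
      (h x \<bullet> b) *\<^sub>R frechet_derivative (\<lambda>z. ?d z b) (at (k x)) (k' w) + (h' w \<bullet> b) *\<^sub>R ?d (k x) b)) (at x)"
  proof (rule has_derivative_transform_eventually_at[OF D])
    show "\<forall>\<^sub>F z in nhds x. (\<Sum>b\<in>Basis. (h z \<bullet> b) *\<^sub>R ?d (k z) b) = ?d (k z) (h z)"
      using ev by eventually_elim (rule expand[symmetric])
  qed
  then show ?thesis
    by (rule has_derivative_eq_rhs) (simp add: fun_eq_iff c sum.distrib expand[OF S(2), symmetric] add_ac)
qed

lemma frechet_derivative_apply_has_derivative:
  fixes f :: "'a::euclidean_space \<Rightarrow> 'b::euclidean_space"
  assumes S: "open S" "x \<in> S" and f: "smooth_on S f" and h: "(h has_derivative h') (at x)"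
  shows "((\<lambda>z. frechet_derivative f (at z) (h z)) has_derivative
     (\<lambda>w. frechet_derivative f (at x) (h' w)
        + frechet_derivative (\<lambda>z. frechet_derivative f (at z) (h x)) (at x) w)) (at x)"
  by (rule frechet_derivative_along[where k="\<lambda>z. z", OF S f has_derivative_ident h])

section \<open>Charts and tangent spaces\<close>

abbreviation points :: "('p, 'e) chart set \<Rightarrow> 'p set"
  where "points A \<equiv> (\<Union>c\<in>A. fst c)"

abbreviation dtrans :: "('p, 'e::euclidean_space) chart \<Rightarrow> ('p, 'e) chart \<Rightarrow> 'p \<Rightarrow> 'e \<Rightarrow> 'e"
  where "dtrans c c' p \<equiv> frechet_derivative (transition c c') (at (snd c p))"

locale mfd =
  fixes X :: "'p topology" and A :: "('p, 'e::euclidean_space) chart set"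
  assumes mfd: "smooth_manifold X A"
begin

lemma topspace_eq: "topspace X = points A"
  using mfd by (simp add: smooth_manifold_def)

lemma chart_homeo:
  "c \<in> A \<Longrightarrow> homeomorphic_map (subtopology X (fst c)) (top_of_set (snd c ` fst c)) (snd c)"
  using mfd by (auto simp: smooth_manifold_def)

lemma chart_openin: "c \<in> A \<Longrightarrow> openin X (fst c)"
  using mfd by (auto simp: smooth_manifold_def)

lemma chart_open: "c \<in> A \<Longrightarrow> open (snd c ` fst c)"
  using mfd by (auto simp: smooth_manifold_def)

lemma chart_inj: "c \<in> A \<Longrightarrow> inj_on (snd c) (fst c)"
  using homeomorphic_imp_injective_map[OF chart_homeo] openin_subset[OF chart_openin]
  by (auto simp: inf.absorb2)

lemma chart_inv_left [simp]: "c \<in> A \<Longrightarrow> p \<in> fst c \<Longrightarrow> chart_inv c (snd c p) = p"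
  by (simp add: chart_inj)

lemma chart_inv_in: "x \<in> snd c ` fst c \<Longrightarrow> chart_inv c x \<in> fst c"
  by (rule inv_into_into)

lemma chart_inv_right: "x \<in> snd c ` fst c \<Longrightarrow> snd c (chart_inv c x) = x"
  by (rule f_inv_into_f)

lemma open_chart_image:
  assumes "c \<in> A" "openin X V"
  shows "open (snd c ` (fst c \<inter> V))"
proof -
  have "openin (subtopology X (fst c)) (fst c \<inter> V)"
    using assms(2) by (auto simp: openin_subtopology)
  then have "openin (top_of_set (snd c ` fst c)) (snd c ` (fst c \<inter> V))"
    using homeomorphic_imp_open_map[OF chart_homeo[OF assms(1)]] by (simp add: open_map_def)
  then show ?thesis
    using chart_open[OF assms(1)] openin_open_eq by blast
qed

lemma open_overlap: "c \<in> A \<Longrightarrow> c' \<in> A \<Longrightarrow> open (snd c ` (fst c \<inter> fst c'))"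
  by (rule open_chart_image[OF _ chart_openin])

lemma in_overlap: "c \<in> A \<Longrightarrow> q \<in> fst c \<Longrightarrow> snd c q \<in> snd c ` (fst c \<inter> V) \<longleftrightarrow> q \<in> V"
  using chart_inj[of c] by (auto simp: inj_on_def)

lemma transition_smooth: "c \<in> A \<Longrightarrow> c' \<in> A \<Longrightarrow> smooth_on (snd c ` (fst c \<inter> fst c')) (transition c c')"
  using mfd by (auto simp: smooth_manifold_def)

lemma transition_apply: "c \<in> A \<Longrightarrow> p \<in> fst c \<Longrightarrow> transition c c' (snd c p) = snd c' p"
  by (simp add: transition_def)

lemma dtrans_has_derivative:
  assumes "c \<in> A" "c' \<in> A" "p \<in> fst c" "p \<in> fst c'"
  shows "(transition c c' has_derivative dtrans c c' p) (at (snd c p))"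
  by (rule smooth_on_has_derivative[OF transition_smooth[OF assms(1,2)]]) (use assms in auto)

lemma dtrans_linear:
  "c \<in> A \<Longrightarrow> c' \<in> A \<Longrightarrow> p \<in> fst c \<Longrightarrow> p \<in> fst c' \<Longrightarrow> linear (dtrans c c' p)"
  using dtrans_has_derivative has_derivative_linear by blast

lemma dtrans_id: 
  assumes "c \<in> A" "p \<in> fst c"
  shows "dtrans c c p w = w"
proof -
  have "(transition c c has_derivative (\<lambda>w. w)) (at (snd c p))"
    by (rule has_derivative_transform_within_open[OF has_derivative_ident chart_open[OF assms(1)]])
      (use assms in \<open>auto simp: transition_apply\<close>)
  then show ?thesis by (simp add: frechet_derivative_eq)
qed

lemma dtrans_comp:
  assumes c: "c \<in> A" "c' \<in> A" "c'' \<in> A" and p: "p \<in> fst c" "p \<in> fst c'" "p \<in> fst c''"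
  shows "dtrans c' c'' p (dtrans c c' p w) = dtrans c c'' p w"
proof -
  let ?S = "snd c ` (fst c \<inter> (fst c' \<inter> fst c''))"
  have "((\<lambda>x. transition c' c'' (transition c c' x)) has_derivative (\<lambda>w. dtrans c' c'' p (dtrans c c' p w))) (at (snd c p))"
    by (rule has_derivative_compose[OF dtrans_has_derivative[OF c(1,2) p(1,2)]])
      (use dtrans_has_derivative[OF c(2,3) p(2,3)] c p in \<open>simp add: transition_apply\<close>)
  then have "(transition c c'' has_derivative (\<lambda>w. dtrans c' c'' p (dtrans c c' p w))) (at (snd c p))"
    by (rule has_derivative_transform_within_open[where s="?S"])
      (use c p in \<open>auto simp: transition_apply intro!: open_chart_image openin_Int chart_openin\<close>)
  then show ?thesis by (simp add: frechet_derivative_eq)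
qed

lemma tangentD:
  "\<xi> \<in> tangent_space A p \<Longrightarrow> c \<in> A \<Longrightarrow> c' \<in> A \<Longrightarrow> p \<in> fst c \<Longrightarrow> p \<in> fst c' \<Longrightarrow> \<xi> c' = dtrans c c' p (\<xi> c)"
  unfolding tangent_space_def by blast

lemma tangentI:
  assumes "\<And>c c'. c \<in> A \<Longrightarrow> c' \<in> A \<Longrightarrow> p \<in> fst c \<Longrightarrow> p \<in> fst c' \<Longrightarrow> \<xi> c' = dtrans c c' p (\<xi> c)"
    and "\<And>c. \<not> (c \<in> A \<and> p \<in> fst c) \<Longrightarrow> \<xi> c = 0"
  shows "\<xi> \<in> tangent_space A p"
  unfolding tangent_space_def using assms by blast

lemma tangent_outside: "\<xi> \<in> tangent_space A p \<Longrightarrow> \<not> (c \<in> A \<and> p \<in> fst c) \<Longrightarrow> \<xi> c = 0"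
  unfolding tangent_space_def by blast

lemma coord_tangent_in:
  "c \<in> A \<Longrightarrow> p \<in> fst c \<Longrightarrow> coord_tangent A c p w \<in> tangent_space A p"
  by (rule tangentI) (auto simp: coord_tangent_def dtrans_comp)

lemma coord_tangent_apply [simp]:
  "c \<in> A \<Longrightarrow> p \<in> fst c \<Longrightarrow> coord_tangent A c p w c = w"
  by (simp add: coord_tangent_def dtrans_id)

lemma coord_tangent_eq:
  "\<xi> \<in> tangent_space A p \<Longrightarrow> c \<in> A \<Longrightarrow> p \<in> fst c \<Longrightarrow> coord_tangent A c p (\<xi> c) = \<xi>"
  unfolding coord_tangent_def by (rule ext) (metis tangentD tangent_outside)

lemma tangent_eqI:
  "\<xi> \<in> tangent_space A p \<Longrightarrow> \<eta> \<in> tangent_space A p \<Longrightarrow> c \<in> A \<Longrightarrow> p \<in> fst c \<Longrightarrow> \<xi> c = \<eta> c \<Longrightarrow> \<xi> = \<eta>"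
  by (metis coord_tangent_eq)

lemma coord_tangent_linear:
  assumes "c \<in> A" "p \<in> fst c"
  shows "linear (coord_tangent A c p)"
proof (rule linearI)
  show "coord_tangent A c p (u + w) = coord_tangent A c p u + coord_tangent A c p w" for u w
    using linear_add[OF dtrans_linear[OF assms(1) _ assms(2)]]
    by (auto simp: coord_tangent_def fun_eq_iff)
  show "coord_tangent A c p (r *\<^sub>R u) = r *\<^sub>R coord_tangent A c p u" for r u
    using linear_scale[OF dtrans_linear[OF assms(1) _ assms(2)]]
    by (auto simp: coord_tangent_def fun_eq_iff scaleR_fun_def)
qed

lemma tangent_space_range:
  "c \<in> A \<Longrightarrow> p \<in> fst c \<Longrightarrow> tangent_space A p = range (coord_tangent A c p)"
  by (metis (no_types, lifting) coord_tangent_eq coord_tangent_in image_subset_iff rangeI subsetI subset_antisym)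

lemma subspace_tangent_space: "p \<in> points A \<Longrightarrow> subspace (tangent_space A p)"
  using tangent_space_range linear_subspace_image[OF coord_tangent_linear subspace_UNIV] by (metis UN_E)

end

section \<open>Differentiable curves and maps\<close>

text \<open>The eventual condition replaces continuity in the topology of the manifold. One chart is
  demanded; \<open>curve_diffD\<close> passes to any other.\<close>

definition curve_diff :: "('p, 'e::euclidean_space) chart set \<Rightarrow> (real \<Rightarrow> 'p) \<Rightarrow> real \<Rightarrow> bool"
  where "curve_diff A \<gamma> t \<longleftrightarrow> (\<exists>c\<in>A. \<gamma> t \<in> fst c \<and> (\<forall>\<^sub>F s in nhds t. \<gamma> s \<in> fst c) \<and>
    (snd c \<circ> \<gamma>) differentiable (at t))"

abbreviation rep :: "('p \<Rightarrow> 'q) \<Rightarrow> ('p, 'e) chart \<Rightarrow> ('q, 'f) chart \<Rightarrow> 'e \<Rightarrow> 'f"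
  where "rep f c d \<equiv> snd d \<circ> f \<circ> chart_inv c"

text \<open>Differentiability at a single point, weaker than \<open>smooth_map\<close>: for the
  action of a group element on the cosets this is all that will be proved, and it suffices for
  differentials and the chain rule.\<close>

definition map_diff :: "('p, 'e::euclidean_space) chart set \<Rightarrow> ('q, 'f::euclidean_space) chart set \<Rightarrow>
    ('p \<Rightarrow> 'q) \<Rightarrow> 'p \<Rightarrow> bool"
  where "map_diff A B f p \<longleftrightarrow> (\<exists>c\<in>A. \<exists>d\<in>B. p \<in> fst c \<and> f p \<in> fst d \<and>
    (\<forall>\<^sub>F x in nhds (snd c p). f (chart_inv c x) \<in> fst d) \<and> rep f c d differentiable (at (snd c p)))"

context mfd
begin

section \<open>Curves and vector fields under change of chart\<close>

lemma eventually_nhds_chart: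
  assumes "c \<in> A" "p \<in> fst c" "openin X V" "p \<in> V"
  shows "\<forall>\<^sub>F x in nhds (snd c p). x \<in> snd c ` (fst c \<inter> V)"
  by (rule eventually_nhds_in_open[OF open_chart_image[OF assms(1,3)]]) (use assms in auto)

lemma curve_chart_change:
  assumes c: "c \<in> A" "\<gamma> t \<in> fst c" "\<forall>\<^sub>F s in nhds t. \<gamma> s \<in> fst c"
    and D: "((snd c \<circ> \<gamma>) has_vector_derivative w) (at t)"
    and c': "c' \<in> A" "\<gamma> t \<in> fst c'"
  shows "\<forall>\<^sub>F s in nhds t. \<gamma> s \<in> fst c'"
    and "((snd c' \<circ> \<gamma>) has_vector_derivative dtrans c c' (\<gamma> t) w) (at t)"
proof -
  have "isCont (snd c \<circ> \<gamma>) t"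
    using D by (rule has_vector_derivative_continuous)
  then have "\<forall>\<^sub>F s in nhds t. (snd c \<circ> \<gamma>) s \<in> snd c ` (fst c \<inter> fst c')"
    by (rule eventually_nhds_compose_continuous[rotated])
      (use eventually_nhds_chart[OF c(1,2) chart_openin[OF c'(1)] c'(2)] in simp)
  then show ev: "\<forall>\<^sub>F s in nhds t. \<gamma> s \<in> fst c'"
    using c(3) by eventually_elim (simp add: in_overlap[OF c(1)])
  have "((\<lambda>s. transition c c' ((snd c \<circ> \<gamma>) s)) has_derivative (\<lambda>h. dtrans c c' (\<gamma> t) (h *\<^sub>R w))) (at t)"
    by (rule has_derivative_compose[OF D[unfolded has_vector_derivative_def]])
      (use dtrans_has_derivative[OF c(1) c'(1) c(2) c'(2)] in simp)
  moreover have "\<forall>\<^sub>F s in nhds t. transition c c' ((snd c \<circ> \<gamma>) s) = (snd c' \<circ> \<gamma>) s"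
    using c(3) by eventually_elim (simp add: transition_apply[OF c(1)])
  ultimately have "((snd c' \<circ> \<gamma>) has_derivative (\<lambda>h. dtrans c c' (\<gamma> t) (h *\<^sub>R w))) (at t)"
    by (rule has_derivative_transform_eventually_at)
  then show "((snd c' \<circ> \<gamma>) has_vector_derivative dtrans c c' (\<gamma> t) w) (at t)"
    by (simp add: has_vector_derivative_def linear_scale[OF dtrans_linear[OF c(1) c'(1) c(2) c'(2)]])
qed

lemma curve_diffD:
  assumes "curve_diff A \<gamma> t" "c \<in> A" "\<gamma> t \<in> fst c"
  shows "\<forall>\<^sub>F s in nhds t. \<gamma> s \<in> fst c"
    and "((snd c \<circ> \<gamma>) has_vector_derivative velocity A \<gamma> t c) (at t)"
proof -
  obtain k where k: "k \<in> A" "\<gamma> t \<in> fst k" "\<forall>\<^sub>F s in nhds t. \<gamma> s \<in> fst k"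
      "(snd k \<circ> \<gamma>) differentiable (at t)"
    using assms(1) by (auto simp: curve_diff_def)
  note ch = curve_chart_change[OF k(1-3) k(4)[unfolded vector_derivative_works] assms(2,3)]
  show "\<forall>\<^sub>F s in nhds t. \<gamma> s \<in> fst c" by (rule ch(1))
  show "((snd c \<circ> \<gamma>) has_vector_derivative velocity A \<gamma> t c) (at t)"
    using ch(2) vector_derivative_at[OF ch(2)] assms(2,3) by (simp add: velocity_def)
qed

lemma velocity_coord:
  assumes c: "c \<in> A" "\<gamma> t \<in> fst c" "\<forall>\<^sub>F s in nhds t. \<gamma> s \<in> fst c"
    and D: "((snd c \<circ> \<gamma>) has_vector_derivative w) (at t)"
  shows "curve_diff A \<gamma> t" and "velocity A \<gamma> t = coord_tangent A c (\<gamma> t) w"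
proof -
  show "curve_diff A \<gamma> t"
    unfolding curve_diff_def using c D by (auto intro: differentiableI_vector)
  show "velocity A \<gamma> t = coord_tangent A c (\<gamma> t) w"
  proof
    fix c'
    show "velocity A \<gamma> t c' = coord_tangent A c (\<gamma> t) w c'"
      using vector_derivative_at[OF curve_chart_change(2)[OF c D, of c']]
      by (auto simp: velocity_def coord_tangent_def)
  qed
qed

lemma velocity_in:
  assumes "curve_diff A \<gamma> t"
  shows "velocity A \<gamma> t \<in> tangent_space A (\<gamma> t)"
proof -
  obtain c where c: "c \<in> A" "\<gamma> t \<in> fst c" using assms by (auto simp: curve_diff_def)
  show ?thesis
    by (subst velocity_coord(2)[OF c curve_diffD[OF assms c]]) (rule coord_tangent_in[OF c])
qed

lemma curve_diff_const:
  assumes "p \<in> points A"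
  shows "curve_diff A (\<lambda>t. p) t" "velocity A (\<lambda>t. p) t = 0"
proof -
  obtain c where c: "c \<in> A" "p \<in> fst c" using assms by auto
  have D: "((snd c \<circ> (\<lambda>t. p)) has_vector_derivative 0) (at t)" by (simp add: o_def)
  show "curve_diff A (\<lambda>t. p) t"
    by (rule velocity_coord(1)[OF c _ D]) (simp add: c)
  have "velocity A (\<lambda>t. p) t = coord_tangent A c p 0"
    by (rule velocity_coord(2)[OF c _ D]) (simp add: c)
  then show "velocity A (\<lambda>t. p) t = 0" by (simp add: linear_0[OF coord_tangent_linear[OF c]])
qed

lemma smooth_curve_diff:
  assumes "smooth_curve A I \<gamma>" "t \<in> I"
  shows "curve_diff A \<gamma> t"
proof -
  obtain c where c: "c \<in> A" "\<gamma> t \<in> fst c" using assms by (auto simp: smooth_curve_def)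
  have J: "open {t \<in> I. \<gamma> t \<in> fst c}" "smooth_on {t \<in> I. \<gamma> t \<in> fst c} (snd c \<circ> \<gamma>)"
    using assms(1) c(1) by (auto simp: smooth_curve_def Let_def)
  have "\<forall>\<^sub>F s in nhds t. s \<in> {t \<in> I. \<gamma> t \<in> fst c}"
    by (rule eventually_nhds_in_open[OF J(1)]) (use assms c in auto)
  then have "\<forall>\<^sub>F s in nhds t. \<gamma> s \<in> fst c" by eventually_elim auto
  then show ?thesis
    unfolding curve_diff_def using c smooth_on_imp_differentiable[OF J(2)] assms(2) by blast
qed

text \<open>Transitions being smooth, one chart near each time decides about all charts, as
  \<open>smooth_curve\<close> demands.\<close>

lemma smooth_curveI:
  assumes I: "open I" and loc: "\<And>t. t \<in> I \<Longrightarrow> \<exists>J c. open J \<and> t \<in> J \<and> c \<in> A \<and> \<gamma> ` J \<subseteq> fst c \<and> smooth_on J (snd c \<circ> \<gamma>)"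
  shows "smooth_curve A I \<gamma>"
  unfolding smooth_curve_def Let_def
proof (intro conjI ballI)
  show "\<gamma> ` I \<subseteq> points A" using loc by blast
  fix c' assume c': "c' \<in> A"
  have key: "\<exists>T. open T \<and> t \<in> T \<and> T \<subseteq> {t \<in> I. \<gamma> t \<in> fst c'} \<and> smooth_on T (snd c' \<circ> \<gamma>)"
    if t: "t \<in> I" "\<gamma> t \<in> fst c'" for t
  proof -
    obtain J c where J: "open J" "t \<in> J" "c \<in> A" "\<gamma> ` J \<subseteq> fst c" "smooth_on J (snd c \<circ> \<gamma>)"
      using loc[OF t(1)] by blast
    define T where "T = I \<inter> (J \<inter> (snd c \<circ> \<gamma>) -` (snd c ` (fst c \<inter> fst c')))"
    have opT: "open T"
      unfolding T_def by (intro open_Int I continuous_open_preimage smooth_on_imp_continuous_on J open_overlap c')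
    have in': "\<gamma> s \<in> fst c" "\<gamma> s \<in> fst c'" "(snd c \<circ> \<gamma>) s \<in> snd c ` (fst c \<inter> fst c')" "s \<in> I" if "s \<in> T" for s
      using that J(4) in_overlap[OF J(3), of "\<gamma> s"] by (auto simp: T_def)
    have "smooth_on T (\<lambda>s. transition c c' ((snd c \<circ> \<gamma>) s))"
      by (rule smooth_on_compose[OF opT transition_smooth[OF J(3) c']])
        (use in'(3) smooth_on_subset[OF J(5), of T] in \<open>auto simp: T_def o_def\<close>)
    then have "smooth_on T (snd c' \<circ> \<gamma>)"
      by (rule smooth_on_cong[OF opT, THEN iffD2, rotated]) (simp add: transition_apply[OF J(3) in'(1)])
    moreover have "t \<in> T" using t J in_overlap[OF J(3), of "\<gamma> t"] by (auto simp: T_def)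
    ultimately show ?thesis using opT in' by blast
  qed
  show "open {t \<in> I. \<gamma> t \<in> fst c'}"
    by (subst open_subopen) (use key in blast)
  show "smooth_on {t \<in> I. \<gamma> t \<in> fst c'} (snd c' \<circ> \<gamma>)"
    by (rule smooth_on_local) (use key in blast)
qed

text \<open>The terms with second derivatives of the coordinate change cancel by symmetry.\<close>

lemma vf_bracket_in:
  assumes p: "p \<in> points A"
    and V: "\<And>q. q \<in> points A \<Longrightarrow> V q \<in> tangent_space A q"
    and W: "\<And>q. q \<in> points A \<Longrightarrow> W q \<in> tangent_space A q"
    and dV: "\<And>c. c \<in> A \<Longrightarrow> p \<in> fst c \<Longrightarrow> (\<lambda>x. V (chart_inv c x) c) differentiable (at (snd c p))"
    and dW: "\<And>c. c \<in> A \<Longrightarrow> p \<in> fst c \<Longrightarrow> (\<lambda>x. W (chart_inv c x) c) differentiable (at (snd c p))"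
  shows "vf_bracket A V W p \<in> tangent_space A p"
proof -
  have key: "vf_bracket A V W p c' = dtrans c c' p (vf_bracket A V W p c)"
    if c: "c \<in> A" "c' \<in> A" "p \<in> fst c" "p \<in> fst c'" for c c'
  proof -
    let ?S = "snd c ` (fst c \<inter> fst c')" and ?x = "snd c p" and ?\<tau> = "transition c c'"
    have S: "open ?S" "?x \<in> ?S" using c open_overlap by auto
    note sm = transition_smooth[OF c(1,2)]
    \<comment> \<open>The transformation law of the components of U is differentiated: besides the
      tensorial term there appears the Hessian of the transition map on U p and w.\<close>
    have tr: "frechet_derivative (\<lambda>x. U (chart_inv c' x) c') (at (snd c' p)) (dtrans c c' p w)
      = dtrans c c' p (frechet_derivative (\<lambda>x. U (chart_inv c x) c) (at ?x) w)
        + frechet_derivative (\<lambda>z. frechet_derivative ?\<tau> (at z) (U p c)) (at ?x) w"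
      if U: "\<And>q. q \<in> points A \<Longrightarrow> U q \<in> tangent_space A q"
        and dU: "\<And>c. c \<in> A \<Longrightarrow> p \<in> fst c \<Longrightarrow> (\<lambda>x. U (chart_inv c x) c) differentiable (at (snd c p))"
      for U w
    proof -
      let ?Uc = "\<lambda>x. U (chart_inv c x) c" and ?Uc' = "\<lambda>x. U (chart_inv c' x) c'"
      have "((\<lambda>z. frechet_derivative ?\<tau> (at z) (?Uc z)) has_derivative
         (\<lambda>w. dtrans c c' p (frechet_derivative ?Uc (at ?x) w)
          + frechet_derivative (\<lambda>z. frechet_derivative ?\<tau> (at z) (?Uc ?x)) (at ?x) w)) (at ?x)"
        by (rule frechet_derivative_apply_has_derivative[OF S sm frechet_derivative_works_at[OF dU[OF c(1,3)]]])
      moreover have "((\<lambda>z. ?Uc' (?\<tau> z)) has_derivative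
          (\<lambda>w. frechet_derivative ?Uc' (at (snd c' p)) (dtrans c c' p w))) (at ?x)"
        by (rule has_derivative_compose[OF dtrans_has_derivative[OF c]])
          (use frechet_derivative_works_at[OF dU[OF c(2,4)]] c in \<open>simp add: transition_apply\<close>)
      then have "((\<lambda>z. frechet_derivative ?\<tau> (at z) (?Uc z)) has_derivative
          (\<lambda>w. frechet_derivative ?Uc' (at (snd c' p)) (dtrans c c' p w))) (at ?x)"
      proof (rule has_derivative_transform_within_open[OF _ S])
        fix z assume "z \<in> ?S"
        then obtain q where q: "q \<in> fst c" "q \<in> fst c'" "z = snd c q" by auto
        have "U q \<in> tangent_space A q" using U q c by blast
        from tangentD[OF this c(1,2) q(1,2)]
        show "?Uc' (?\<tau> z) = frechet_derivative ?\<tau> (at z) (?Uc z)"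
          using q c by (simp add: transition_apply)
      qed
      ultimately have "(\<lambda>w. frechet_derivative ?Uc' (at (snd c' p)) (dtrans c c' p w))
        = (\<lambda>w. dtrans c c' p (frechet_derivative ?Uc (at ?x) w)
          + frechet_derivative (\<lambda>z. frechet_derivative ?\<tau> (at z) (?Uc ?x)) (at ?x) w)"
        by (rule has_derivative_unique[rotated])
      then show ?thesis using c by (simp add: fun_eq_iff)
    qed
    have eq: "V p c' = dtrans c c' p (V p c)" "W p c' = dtrans c c' p (W p c)"
      using tangentD[OF V[OF p] c] tangentD[OF W[OF p] c] by auto
    have trV: "frechet_derivative (\<lambda>x. V (chart_inv c' x) c') (at (snd c' p)) (dtrans c c' p (W p c))
      = dtrans c c' p (frechet_derivative (\<lambda>x. V (chart_inv c x) c) (at ?x) (W p c))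
        + frechet_derivative (\<lambda>z. frechet_derivative ?\<tau> (at z) (V p c)) (at ?x) (W p c)"
      by (rule tr) (use V dV in auto)
    have trW: "frechet_derivative (\<lambda>x. W (chart_inv c' x) c') (at (snd c' p)) (dtrans c c' p (V p c))
      = dtrans c c' p (frechet_derivative (\<lambda>x. W (chart_inv c x) c) (at ?x) (V p c))
        + frechet_derivative (\<lambda>z. frechet_derivative ?\<tau> (at z) (W p c)) (at ?x) (V p c)"
      by (rule tr) (use W dW in auto)
    show ?thesis
      using c second_derivative_symmetric[OF S sm, of "V p c" "W p c"]
      by (simp add: vf_bracket_def eq trV trW linear_diff[OF dtrans_linear[OF c]])
  qed
  show ?thesis by (rule tangentI, rule key) (simp_all only: vf_bracket_def if_False)
qed

end

section \<open>Differentials of maps and the chain rule\<close>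

locale mfd_map = M: mfd X A + N: mfd Y B
  for X :: "'p topology" and A :: "('p, 'e::euclidean_space) chart set"
    and Y :: "'q topology" and B :: "('q, 'f::euclidean_space) chart set"
begin

lemma map_chart_change:
  assumes c: "c \<in> A" "p \<in> fst c" and d: "d \<in> B" "f p \<in> fst d"
    and ev: "\<forall>\<^sub>F x in nhds (snd c p). f (chart_inv c x) \<in> fst d"
    and D: "(rep f c d has_derivative D) (at (snd c p))"
    and c': "c' \<in> A" "p \<in> fst c'" and d': "d' \<in> B" "f p \<in> fst d'"
  shows "\<forall>\<^sub>F x in nhds (snd c' p). f (chart_inv c' x) \<in> fst d'"
    and "(rep f c' d' has_derivative (\<lambda>w. dtrans d d' (f p) (D (dtrans c' c p w)))) (at (snd c' p))"
proof -
  have D': "(rep f c d has_derivative D) (at (transition c' c (snd c' p)))"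
    using D c' by (simp add: M.transition_apply)
  have D1: "((\<lambda>x. rep f c d (transition c' c x)) has_derivative (\<lambda>w. D (dtrans c' c p w))) (at (snd c' p))"
    by (rule has_derivative_compose[OF M.dtrans_has_derivative[OF c'(1) c(1) c'(2) c(2)] D'])
  have fp: "rep f c d (transition c' c (snd c' p)) = snd d (f p)"
    using c c' by (simp add: M.transition_apply)
  have e1: "\<forall>\<^sub>F x in nhds (snd c' p). chart_inv c (transition c' c x) = chart_inv c' x"
    using M.eventually_nhds_chart[OF c' M.chart_openin[OF c(1)] c(2)]
    by eventually_elim (use c c' in \<open>auto simp: M.transition_apply\<close>)
  have "\<forall>\<^sub>F x in nhds (snd c' p). f (chart_inv c (transition c' c x)) \<in> fst d"
    by (rule eventually_nhds_compose_continuous[OF _ has_derivative_continuous[OF M.dtrans_has_derivative[OF c'(1) c(1) c'(2) c(2)]]])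
      (use ev c' in \<open>simp add: M.transition_apply\<close>)
  then have e2: "\<forall>\<^sub>F x in nhds (snd c' p). f (chart_inv c' x) \<in> fst d"
    using e1 by eventually_elim simp
  have "\<forall>\<^sub>F y in nhds (rep f c d (transition c' c (snd c' p))). y \<in> snd d ` (fst d \<inter> fst d')"
    unfolding fp by (rule N.eventually_nhds_chart[OF d N.chart_openin[OF d'(1)] d'(2)])
  then have "\<forall>\<^sub>F x in nhds (snd c' p). rep f c d (transition c' c x) \<in> snd d ` (fst d \<inter> fst d')"
    by (rule eventually_nhds_compose_continuous[OF _ has_derivative_continuous[OF D1]])
  then show "\<forall>\<^sub>F x in nhds (snd c' p). f (chart_inv c' x) \<in> fst d'"
    using e1 e2 by eventually_elim (simp add: N.in_overlap[OF d(1)])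
  have "((\<lambda>x. transition d d' (rep f c d (transition c' c x))) has_derivative
      (\<lambda>w. dtrans d d' (f p) (D (dtrans c' c p w)))) (at (snd c' p))"
    by (rule has_derivative_compose[OF D1])
      (simp only: fp N.dtrans_has_derivative[OF d(1) d'(1) d(2) d'(2)])
  moreover have "\<forall>\<^sub>F x in nhds (snd c' p). transition d d' (rep f c d (transition c' c x)) = rep f c' d' x"
    using e1 e2 by eventually_elim (simp add: N.transition_apply[OF d(1)])
  ultimately show "(rep f c' d' has_derivative (\<lambda>w. dtrans d d' (f p) (D (dtrans c' c p w)))) (at (snd c' p))"
    by (rule has_derivative_transform_eventually_at)
qed

lemma map_diffD:
  assumes "map_diff A B f p" "c \<in> A" "p \<in> fst c" "d \<in> B" "f p \<in> fst d"
  shows "\<forall>\<^sub>F x in nhds (snd c p). f (chart_inv c x) \<in> fst d"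
    and "rep f c d differentiable (at (snd c p))"
    and "(rep f c d has_derivative frechet_derivative (rep f c d) (at (snd c p))) (at (snd c p))"
proof -
  obtain c0 d0 where c0: "c0 \<in> A" "p \<in> fst c0" and d0: "d0 \<in> B" "f p \<in> fst d0"
    and ev: "\<forall>\<^sub>F x in nhds (snd c0 p). f (chart_inv c0 x) \<in> fst d0"
    and D: "rep f c0 d0 differentiable (at (snd c0 p))"
    using assms(1) by (auto simp: map_diff_def)
  note ch = map_chart_change[OF c0 d0 ev frechet_derivative_works_at[OF D] assms(2-5)]
  show "\<forall>\<^sub>F x in nhds (snd c p). f (chart_inv c x) \<in> fst d" by (rule ch(1))
  show "rep f c d differentiable (at (snd c p))" using ch(2) differentiable_def by blast
  then show "(rep f c d has_derivative frechet_derivative (rep f c d) (at (snd c p))) (at (snd c p))"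
    by (rule frechet_derivative_works_at)
qed

text \<open>\<open>differential\<close> reads its argument in a chart picked by SOME; the chain rule
  with the transitions shows that every chart gives the same vector.\<close>

lemma differential_apply:
  assumes f: "map_diff A B f p" and \<xi>: "\<xi> \<in> tangent_space A p"
    and c: "c \<in> A" "p \<in> fst c" and d: "d \<in> B" "f p \<in> fst d"
  shows "differential A B f p \<xi> d = frechet_derivative (rep f c d) (at (snd c p)) (\<xi> c)"
proof -
  define k where "k = (SOME c. c \<in> A \<and> p \<in> fst c)"
  have k: "k \<in> A" "p \<in> fst k" unfolding k_def using c by (metis (mono_tags, lifting) someI_ex)+
  note ch = map_chart_change(2)[OF c d map_diffD(1)[OF f c d] map_diffD(3)[OF f c d] k d]
  have "frechet_derivative (rep f k d) (at (snd k p)) (\<xi> k)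
      = dtrans d d (f p) (frechet_derivative (rep f c d) (at (snd c p)) (dtrans k c p (\<xi> k)))"
    by (simp add: frechet_derivative_eq[OF ch])
  also have "\<dots> = frechet_derivative (rep f c d) (at (snd c p)) (\<xi> c)"
    using M.tangentD[OF \<xi> k(1) c(1) k(2) c(2)] by (simp add: N.dtrans_id[OF d])
  finally show ?thesis using d by (simp add: differential_def k_def Let_def)
qed

lemma differential_in:
  assumes f: "map_diff A B f p" and \<xi>: "\<xi> \<in> tangent_space A p"
  shows "differential A B f p \<xi> \<in> tangent_space B (f p)"
proof -
  obtain c where c: "c \<in> A" "p \<in> fst c" using f by (auto simp: map_diff_def)
  have key: "differential A B f p \<xi> d' = dtrans d d' (f p) (differential A B f p \<xi> d)"
    if d: "d \<in> B" "f p \<in> fst d" and d': "d' \<in> B" "f p \<in> fst d'" for d d'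
    using map_chart_change(2)[OF c d map_diffD(1)[OF f c d] map_diffD(3)[OF f c d] c d']
    by (simp add: differential_apply[OF f \<xi> c d] differential_apply[OF f \<xi> c d']
        frechet_derivative_eq M.dtrans_id[OF c])
  show ?thesis by (rule N.tangentI, rule key) (simp_all only: differential_def if_False)
qed

lemma differential_linear:
  assumes f: "map_diff A B f p" and \<xi>: "\<xi> \<in> tangent_space A p" and \<eta>: "\<eta> \<in> tangent_space A p"
  shows "differential A B f p (r *\<^sub>R \<xi> + \<eta>) = r *\<^sub>R differential A B f p \<xi> + differential A B f p \<eta>"
proof -
  obtain c d where c: "c \<in> A" "p \<in> fst c" and d: "d \<in> B" "f p \<in> fst d"
    using f by (auto simp: map_diff_def)
  have pA: "p \<in> points A" "f p \<in> points B" using c d by auto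
  have s: "r *\<^sub>R \<xi> + \<eta> \<in> tangent_space A p"
    using M.subspace_tangent_space[OF pA(1)] \<xi> \<eta> by (simp add: subspace_add subspace_scale)
  have l: "linear (frechet_derivative (rep f c d) (at (snd c p)))"
    by (rule linear_frechet_derivative[OF map_diffD(2)[OF f c d]])
  show ?thesis
  proof (rule N.tangent_eqI[OF _ _ d])
    show "differential A B f p (r *\<^sub>R \<xi> + \<eta>) \<in> tangent_space B (f p)"
      by (rule differential_in[OF f s])
    show "r *\<^sub>R differential A B f p \<xi> + differential A B f p \<eta> \<in> tangent_space B (f p)"
      using N.subspace_tangent_space[OF pA(2)] differential_in[OF f] \<xi> \<eta>
      by (simp add: subspace_add subspace_scale)
    show "differential A B f p (r *\<^sub>R \<xi> + \<eta>) d = (r *\<^sub>R differential A B f p \<xi> + differential A B f p \<eta>) d"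
      using differential_apply[OF f _ c d] \<xi> \<eta> s
      by (simp add: scaleR_fun_def linear_add[OF l] linear_scale[OF l])
  qed
qed

lemma velocity_compose:
  assumes \<gamma>: "curve_diff A \<gamma> t" and f: "map_diff A B f (\<gamma> t)"
  shows "curve_diff B (\<lambda>t. f (\<gamma> t)) t"
    and "velocity B (\<lambda>t. f (\<gamma> t)) t = differential A B f (\<gamma> t) (velocity A \<gamma> t)"
proof -
  obtain c d where c: "c \<in> A" "\<gamma> t \<in> fst c" and d: "d \<in> B" "f (\<gamma> t) \<in> fst d"
    using f by (auto simp: map_diff_def)
  note g = M.curve_diffD[OF \<gamma> c]
  note m = map_diffD[OF f c d]
  have cont: "isCont (snd c \<circ> \<gamma>) t" using g(2) by (rule has_vector_derivative_continuous)
  have "\<forall>\<^sub>F s in nhds t. f (chart_inv c ((snd c \<circ> \<gamma>) s)) \<in> fst d"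
    by (rule eventually_nhds_compose_continuous[OF _ cont]) (use m(1) in simp)
  then have ev: "\<forall>\<^sub>F s in nhds t. f (\<gamma> s) \<in> fst d"
    using g(1) by eventually_elim (simp add: c)
  let ?D = "frechet_derivative (rep f c d) (at (snd c (\<gamma> t)))"
  have "((\<lambda>s. rep f c d ((snd c \<circ> \<gamma>) s)) has_derivative (\<lambda>h. ?D (h *\<^sub>R velocity A \<gamma> t c))) (at t)"
    by (rule has_derivative_compose[OF g(2)[unfolded has_vector_derivative_def]]) (use m(3) c in \<open>simp add: o_def\<close>)
  moreover have "\<forall>\<^sub>F s in nhds t. rep f c d ((snd c \<circ> \<gamma>) s) = (snd d \<circ> (\<lambda>t. f (\<gamma> t))) s"
    using g(1) by eventually_elim (simp add: c)
  ultimately have "((snd d \<circ> (\<lambda>t. f (\<gamma> t))) has_derivative (\<lambda>h. ?D (h *\<^sub>R velocity A \<gamma> t c))) (at t)"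
    by (rule has_derivative_transform_eventually_at)
  then have D: "((snd d \<circ> (\<lambda>t. f (\<gamma> t))) has_vector_derivative ?D (velocity A \<gamma> t c)) (at t)"
    by (simp add: has_vector_derivative_def linear_scale[OF linear_frechet_derivative[OF m(2)]])
  show "curve_diff B (\<lambda>t. f (\<gamma> t)) t"
    by (rule N.velocity_coord(1)[OF d ev D])
  show "velocity B (\<lambda>t. f (\<gamma> t)) t = differential A B f (\<gamma> t) (velocity A \<gamma> t)"
    unfolding N.velocity_coord(2)[OF d ev D] differential_apply[OF f M.velocity_in[OF \<gamma>] c d, symmetric]
    by (rule N.coord_tangent_eq[OF differential_in[OF f M.velocity_in[OF \<gamma>]] d])
qed

lemma rep_cong:
  assumes "\<And>q. q \<in> points A \<Longrightarrow> f q = g q" "c \<in> A" "p \<in> fst c"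
  shows "\<forall>\<^sub>F x in nhds (snd c p). f (chart_inv c x) = g (chart_inv c x)"
    and "(rep f c d has_derivative D) (at (snd c p)) \<longleftrightarrow> (rep g c d has_derivative D) (at (snd c p))"
proof -
  have "\<forall>\<^sub>F x in nhds (snd c p). x \<in> snd c ` fst c"
    by (rule eventually_nhds_in_open[OF M.chart_open[OF assms(2)]]) (use assms(3) in auto)
  then show ev: "\<forall>\<^sub>F x in nhds (snd c p). f (chart_inv c x) = g (chart_inv c x)"
  proof eventually_elim
    case (elim x)
    have "chart_inv c x \<in> points A" using M.chart_inv_in[OF elim] assms(2) by (rule UN_I[rotated])
    then show ?case by (rule assms(1))
  qed
  have "\<forall>\<^sub>F x in nhds (snd c p). rep f c d x = rep g c d x" "\<forall>\<^sub>F x in nhds (snd c p). rep g c d x = rep f c d x"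
    using ev by (eventually_elim, simp)+
  then show "(rep f c d has_derivative D) (at (snd c p)) \<longleftrightarrow> (rep g c d has_derivative D) (at (snd c p))"
    using has_derivative_transform_eventually_at by blast
qed

lemma map_diff_cong:
  assumes eq: "\<And>q. q \<in> points A \<Longrightarrow> f q = g q" and f: "map_diff A B f p"
  shows "map_diff A B g p"
proof -
  obtain c d where c: "c \<in> A" "p \<in> fst c" and d: "d \<in> B" "f p \<in> fst d"
    using f by (auto simp: map_diff_def)
  note mf = map_diffD[OF f c d]
  have ev: "\<forall>\<^sub>F x in nhds (snd c p). f (chart_inv c x) = g (chart_inv c x)"
    by (rule rep_cong(1)[OF _ c]) (rule eq)
  have "\<forall>\<^sub>F x in nhds (snd c p). g (chart_inv c x) \<in> fst d"
    using mf(1) ev by eventually_elim simp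
  moreover have "(rep g c d has_derivative frechet_derivative (rep f c d) (at (snd c p))) (at (snd c p))"
    by (rule rep_cong(2)[OF _ c, THEN iffD1]) (rule eq, assumption, rule mf(3))
  then have "rep g c d differentiable (at (snd c p))"
    unfolding differentiable_def by blast
  moreover have "g p \<in> fst d" using d eq[of p] UN_I[of c A p fst] c by simp
  ultimately show ?thesis unfolding map_diff_def using c d(1) by blast
qed

lemma differential_cong:
  assumes eq: "\<And>q. q \<in> points A \<Longrightarrow> f q = g q" and p: "p \<in> points A"
  shows "differential A B f p \<xi> = differential A B g p \<xi>"
proof -
  define k where "k = (SOME c. c \<in> A \<and> p \<in> fst c)"
  have "\<exists>c. c \<in> A \<and> p \<in> fst c" using p by auto
  then have k: "k \<in> A" "p \<in> fst k" unfolding k_def by (metis (mono_tags, lifting) someI_ex)+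
  have fr: "frechet_derivative (rep f k d) (at (snd k p)) = frechet_derivative (rep g k d) (at (snd k p))" for d
  proof -
    have "(rep f k d has_derivative D) (at (snd k p)) \<longleftrightarrow> (rep g k d has_derivative D) (at (snd k p))" for D
      by (rule rep_cong(2)[OF _ k]) (rule eq)
    then show ?thesis unfolding frechet_derivative_def by presburger
  qed
  show ?thesis
    unfolding differential_def k_def[symmetric] Let_def eq[OF p] fr ..
qed

lemma smooth_map_diff:
  assumes f: "smooth_map A B f" and p: "p \<in> points A"
  shows "map_diff A B f p"
proof -
  obtain c d where c: "c \<in> A" "p \<in> fst c" and d: "d \<in> B" "f p \<in> fst d"
    using f p unfolding smooth_map_def by blast
  define W where "W = snd c ` {p \<in> fst c. f p \<in> fst d}"
  have W: "open W" "smooth_on W (rep f c d)" "snd c p \<in> W"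
    using f c d by (auto simp: smooth_map_def Let_def W_def)
  have "\<forall>\<^sub>F x in nhds (snd c p). x \<in> W" by (rule eventually_nhds_in_open[OF W(1,3)])
  then have "\<forall>\<^sub>F x in nhds (snd c p). f (chart_inv c x) \<in> fst d"
    by eventually_elim (auto simp: W_def c)
  then show ?thesis
    unfolding map_diff_def using c d smooth_on_imp_differentiable[OF W(2,3)] by blast
qed

end

locale mfd_map2 = F: mfd_map X A Y B + G: mfd_map Y B Z C
  for X :: "'p topology" and A :: "('p, 'e::euclidean_space) chart set"
    and Y :: "'q topology" and B :: "('q, 'f::euclidean_space) chart set"
    and Z :: "'r topology" and C :: "('r, 'h::euclidean_space) chart set"
begin

sublocale GF: mfd_map X A Z C ..

lemma differential_compose:
  assumes f: "map_diff A B f p" and g: "map_diff B C g (f p)"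
  shows "map_diff A C (\<lambda>q. g (f q)) p"
    and "\<xi> \<in> tangent_space A p \<Longrightarrow>
      differential B C g (f p) (differential A B f p \<xi>) = differential A C (\<lambda>q. g (f q)) p \<xi>"
proof -
  obtain c d where c: "c \<in> A" "p \<in> fst c" and d: "d \<in> B" "f p \<in> fst d"
    using f by (auto simp: map_diff_def)
  obtain k where k: "k \<in> C" "g (f p) \<in> fst k" using g by (auto simp: map_diff_def)
  note mf = F.map_diffD[OF f c d] and mg = G.map_diffD[OF g d k]
  have fp: "rep f c d (snd c p) = snd d (f p)" using c by simp
  have cont: "isCont (rep f c d) (snd c p)" by (rule has_derivative_continuous[OF mf(3)])
  have "\<forall>\<^sub>F x in nhds (snd c p). g (chart_inv d (rep f c d x)) \<in> fst k"
    by (rule eventually_nhds_compose_continuous[OF _ cont]) (use mg(1) fp in simp)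
  then have ev: "\<forall>\<^sub>F x in nhds (snd c p). g (f (chart_inv c x)) \<in> fst k"
    using mf(1) by eventually_elim (simp add: d)
  have "((\<lambda>x. rep g d k (rep f c d x)) has_derivative
      (\<lambda>w. frechet_derivative (rep g d k) (at (snd d (f p))) (frechet_derivative (rep f c d) (at (snd c p)) w)))
      (at (snd c p))"
    by (rule has_derivative_compose[OF mf(3)]) (use mg(3) c in \<open>simp add: o_def\<close>)
  moreover have "\<forall>\<^sub>F x in nhds (snd c p). rep g d k (rep f c d x) = rep (\<lambda>q. g (f q)) c k x"
    using mf(1) by eventually_elim (simp add: d)
  ultimately have D: "(rep (\<lambda>q. g (f q)) c k has_derivative
      (\<lambda>w. frechet_derivative (rep g d k) (at (snd d (f p))) (frechet_derivative (rep f c d) (at (snd c p)) w)))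
      (at (snd c p))"
    by (rule has_derivative_transform_eventually_at)
  show gf: "map_diff A C (\<lambda>q. g (f q)) p"
    unfolding map_diff_def using c k ev D differentiable_def by blast
  assume \<xi>: "\<xi> \<in> tangent_space A p"
  show "differential B C g (f p) (differential A B f p \<xi>) = differential A C (\<lambda>q. g (f q)) p \<xi>"
  proof (rule G.N.tangent_eqI[OF _ _ k])
    show "differential B C g (f p) (differential A B f p \<xi>) \<in> tangent_space C (g (f p))"
      by (intro G.differential_in g F.differential_in f \<xi>)
    show "differential A C (\<lambda>q. g (f q)) p \<xi> \<in> tangent_space C (g (f p))"
      by (rule GF.differential_in[OF gf \<xi>])
    show "differential B C g (f p) (differential A B f p \<xi>) k = differential A C (\<lambda>q. g (f q)) p \<xi> k"
      unfolding G.differential_apply[OF g F.differential_in[OF f \<xi>] d k]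
        F.differential_apply[OF f \<xi> c d] GF.differential_apply[OF gf \<xi> c k]
      by (simp add: frechet_derivative_eq[OF D])
  qed
qed

end

section \<open>Lie groups\<close>

lemma scaleR_fun_apply: "(r *\<^sub>R f) x = r *\<^sub>R f x"
  by (simp add: scaleR_fun_def)

lemma (in mfd) differential_id:
  assumes "\<xi> \<in> tangent_space A p" "p \<in> points A"
  shows "map_diff A A (\<lambda>q. q) p" and "differential A A (\<lambda>q. q) p \<xi> = \<xi>"
proof -
  interpret I: mfd_map X A X A ..
  obtain c where c: "c \<in> A" "p \<in> fst c" using assms(2) by auto
  have D: "(rep (\<lambda>q. q) c c has_derivative (\<lambda>w. w)) (at (snd c p))"
    by (rule has_derivative_transform_within_open[OF has_derivative_ident chart_open[OF c(1)]])
      (use c in \<open>auto simp: chart_inv_right\<close>)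
  have "\<forall>\<^sub>F x in nhds (snd c p). x \<in> snd c ` fst c"
    by (rule eventually_nhds_in_open[OF chart_open[OF c(1)]]) (use c in auto)
  then have ev: "\<forall>\<^sub>F x in nhds (snd c p). chart_inv c x \<in> fst c"
    by eventually_elim (rule chart_inv_in)
  have "rep (\<lambda>q. q) c c differentiable (at (snd c p))"
    unfolding differentiable_def using D by blast
  then show md: "map_diff A A (\<lambda>q. q) p"
    unfolding map_diff_def using c ev by blast
  show "differential A A (\<lambda>q. q) p \<xi> = \<xi>"
    by (rule tangent_eqI[OF I.differential_in[OF md assms(1)] assms(1) c])
      (subst I.differential_apply[OF md assms(1) c c], subst frechet_derivative_eq[OF D], rule refl)
qed

locale lie = group G + mfd X A
  for G :: "('g, 'r) monoid_scheme" (structure) and X :: "'g topology"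
    and A :: "('g, 'e::euclidean_space) chart set" +
  assumes lie_group: "lie_group G X A"
begin

sublocale GG: mfd_map X A X A ..
sublocale GGG: mfd_map2 X A X A X A ..

lemma points_eq: "points A = carrier G"
  using lie_group topspace_eq by (simp add: lie_group_def)

lemma chart_at: "g \<in> carrier G \<Longrightarrow> \<exists>c\<in>A. g \<in> fst c"
  using points_eq by blast

lemma chart_carrier: "c \<in> A \<Longrightarrow> g \<in> fst c \<Longrightarrow> g \<in> carrier G"
  using points_eq by blast

section \<open>Left translations and left invariant fields\<close>

definition mrep :: "('g, 'e) chart \<Rightarrow> ('g, 'e) chart \<Rightarrow> ('g, 'e) chart \<Rightarrow> 'e \<times> 'e \<Rightarrow> 'e"
  where "mrep c k d = (\<lambda>z. snd d (chart_inv c (fst z) \<otimes> chart_inv k (snd z)))"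

text \<open>The set on which \<open>mrep\<close> really is multiplication in coordinates; elsewhere
  chart values and \<open>chart_inv\<close> are arbitrary.\<close>

definition mdom :: "('g, 'e) chart \<Rightarrow> ('g, 'e) chart \<Rightarrow> ('g, 'e) chart \<Rightarrow> ('e \<times> 'e) set"
  where "mdom c k d = {(snd c g, snd k h) | g h. g \<in> fst c \<and> h \<in> fst k \<and> g \<otimes> h \<in> fst d}"

lemma mdomI: "g \<in> fst c \<Longrightarrow> h \<in> fst k \<Longrightarrow> g \<otimes> h \<in> fst d \<Longrightarrow> (snd c g, snd k h) \<in> mdom c k d"
  unfolding mdom_def by blast

lemma mult_smooth:
  assumes "c \<in> A" "k \<in> A" "d \<in> A"
  shows "open (mdom c k d)" "smooth_on (mdom c k d) (mrep c k d)"
proof -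
  let ?C = "(fst c \<times> fst k, map_prod (snd c) (snd k))"
  let ?m = "\<lambda>(g, h). g \<otimes> h"
  let ?W = "snd ?C ` {p \<in> fst ?C. ?m p \<in> fst d}"
  have C: "?C \<in> prod_atlas A A" unfolding prod_atlas_def using assms by blast
  have "smooth_map (prod_atlas A A) A ?m" using lie_group by (simp add: lie_group_def)
  then have W: "open ?W" "smooth_on ?W (snd d \<circ> ?m \<circ> chart_inv ?C)"
    unfolding smooth_map_def Let_def using C assms(3) by blast+
  have eq: "?W = mdom c k d" by (force simp: mdom_def)
  show op: "open (mdom c k d)" using W(1) eq by simp
  have inj: "inj_on (map_prod (snd c) (snd k)) (fst c \<times> fst k)"
    using chart_inj[OF assms(1)] chart_inj[OF assms(2)] by (rule map_prod_inj_on)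
  show "smooth_on (mdom c k d) (mrep c k d)"
  proof (rule smooth_on_cong[OF op, THEN iffD1])
    show "smooth_on (mdom c k d) (snd d \<circ> ?m \<circ> chart_inv ?C)" using W(2) eq by simp
    fix z assume "z \<in> mdom c k d"
    then obtain g h where z: "z = (snd c g, snd k h)" "g \<in> fst c" "h \<in> fst k" by (auto simp: mdom_def)
    have "chart_inv ?C (map_prod (snd c) (snd k) (g, h)) = (g, h)"
      unfolding fst_conv snd_conv by (rule inv_into_f_f[OF inj]) (use z in simp)
    then show "(snd d \<circ> ?m \<circ> chart_inv ?C) z = mrep c k d z"
      using z assms by (simp add: mrep_def)
  qed
qed

text \<open>Writing the derivative of a left translation as a partial derivative of the product map
  shows how it depends on g; smoothness of left invariant fields comes from this.\<close>

lemma mrep_right_derivative: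
  assumes "c \<in> A" "k \<in> A" "d \<in> A" and g: "g \<in> fst c" "h \<in> fst k" "g \<otimes> h \<in> fst d"
  shows "(rep (\<lambda>h. g \<otimes> h) k d has_derivative
    (\<lambda>w. frechet_derivative (mrep c k d) (at (snd c g, snd k h)) (0, w))) (at (snd k h))"
    and "\<forall>\<^sub>F y in nhds (snd k h). g \<otimes> chart_inv k y \<in> fst d"
proof -
  have in': "(snd c g, snd k h) \<in> mdom c k d" by (rule mdomI[OF g])
  have i: "((\<lambda>y. (snd c g, y)) has_derivative (\<lambda>w. (0, w))) (at (snd k h))"
    by (auto intro!: derivative_eq_intros)
  have "((\<lambda>y. mrep c k d (snd c g, y)) has_derivative
      (\<lambda>w. frechet_derivative (mrep c k d) (at (snd c g, snd k h)) (0, w))) (at (snd k h))"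
    by (rule has_derivative_compose[OF i smooth_on_has_derivative[OF mult_smooth(2)[OF assms(1-3)] in']])
  then show "(rep (\<lambda>h. g \<otimes> h) k d has_derivative
    (\<lambda>w. frechet_derivative (mrep c k d) (at (snd c g, snd k h)) (0, w))) (at (snd k h))"
    by (simp add: mrep_def o_def assms(1) g(1))
  have "\<forall>\<^sub>F z in nhds (snd c g, snd k h). z \<in> mdom c k d"
    by (rule eventually_nhds_in_open[OF mult_smooth(1)[OF assms(1-3)] in'])
  then have "\<forall>\<^sub>F y in nhds (snd k h). (snd c g, y) \<in> mdom c k d"
    by (rule eventually_nhds_compose_continuous[OF _ has_derivative_continuous[OF i]])
  then show "\<forall>\<^sub>F y in nhds (snd k h). g \<otimes> chart_inv k y \<in> fst d"
  proof eventually_elim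
    case (elim y)
    then obtain g' h' where gh: "snd c g = snd c g'" "y = snd k h'" "g' \<in> fst c" "h' \<in> fst k" "g' \<otimes> h' \<in> fst d"
      by (auto simp: mdom_def)
    then have "g = g'" using chart_inj[OF assms(1)] g(1) by (auto dest: inj_onD)
    then show ?case using gh assms(2) by simp
  qed
qed

lemma left_mult_diff:
  assumes "g \<in> carrier G" "h \<in> carrier G"
  shows "map_diff A A (\<lambda>h. g \<otimes> h) h"
proof -
  obtain c where c: "c \<in> A" "g \<in> fst c" using chart_at[OF assms(1)] by blast
  obtain k where k: "k \<in> A" "h \<in> fst k" using chart_at[OF assms(2)] by blast
  obtain d where d: "d \<in> A" "g \<otimes> h \<in> fst d" using chart_at[OF m_closed[OF assms]] by blast
  note D = mrep_right_derivative[OF c(1) k(1) d(1) c(2) k(2) d(2)]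
  have "rep (\<lambda>h. g \<otimes> h) k d differentiable (at (snd k h))"
    unfolding differentiable_def using D(1) by blast
  then show ?thesis unfolding map_diff_def using k d D(2) by blast
qed

abbreviation lif :: "('g, 'e) tangent \<Rightarrow> 'g \<Rightarrow> ('g, 'e) tangent"
  where "lif \<equiv> left_invariant_field G A"

abbreviation "\<gg> \<equiv> lie_algebra G A"

lemma subspace_lie_algebra: "subspace \<gg>"
  unfolding lie_algebra_def by (rule subspace_tangent_space) (simp add: points_eq)

lemma lif_in: "u \<in> \<gg> \<Longrightarrow> g \<in> carrier G \<Longrightarrow> lif u g \<in> tangent_space A g"
  unfolding left_invariant_field_def lie_algebra_def
  using GG.differential_in[OF left_mult_diff[of g \<one>], of u] by simp

lemma lif_linear:
  "u \<in> \<gg> \<Longrightarrow> w \<in> \<gg> \<Longrightarrow> g \<in> carrier G \<Longrightarrow> lif (r *\<^sub>R u + w) g = r *\<^sub>R lif u g + lif w g"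
  unfolding left_invariant_field_def lie_algebra_def
  by (rule GG.differential_linear[OF left_mult_diff]) auto

lemma lif_one: 
  assumes "u \<in> \<gg>"
  shows "lif u \<one> = u"
proof -
  have p: "\<one> \<in> points A" by (simp add: points_eq)
  have "differential A A (\<lambda>h. \<one> \<otimes> h) \<one> u = differential A A (\<lambda>h. h) \<one> u"
    by (rule GG.differential_cong[OF _ p]) (simp add: points_eq)
  then show ?thesis
    using differential_id(2)[OF assms[unfolded lie_algebra_def] p] by (simp add: left_invariant_field_def)
qed

lemma lif_invariant:
  assumes u: "u \<in> \<gg>" and g: "g \<in> carrier G" "h \<in> carrier G"
  shows "differential A A (\<lambda>q. g \<otimes> q) h (lif u h) = lif u (g \<otimes> h)"
proof -
  have u': "u \<in> tangent_space A \<one>" using u by (simp add: lie_algebra_def)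
  have m2: "map_diff A A (\<lambda>q. g \<otimes> q) (h \<otimes> \<one>)" by (rule left_mult_diff) (use g in auto)
  have "differential A A (\<lambda>q. g \<otimes> q) (h \<otimes> \<one>) (differential A A (\<lambda>q. h \<otimes> q) \<one> u)
      = differential A A (\<lambda>q. g \<otimes> (h \<otimes> q)) \<one> u"
    by (rule GGG.differential_compose(2)[OF left_mult_diff[OF g(2) one_closed] m2 u'])
  also have "\<dots> = differential A A (\<lambda>q. g \<otimes> h \<otimes> q) \<one> u"
    by (rule GG.differential_cong) (use g in \<open>simp_all add: points_eq m_assoc\<close>)
  finally show ?thesis using g by (simp add: left_invariant_field_def)
qed

definition lifc :: "('g, 'e) chart \<Rightarrow> ('g, 'e) tangent \<Rightarrow> 'e \<Rightarrow> 'e"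
  where "lifc c u = (\<lambda>x. lif u (chart_inv c x) c)"

lemma lifc_smooth:
  assumes u: "u \<in> \<gg>" and c: "c \<in> A"
  shows "smooth_on (snd c ` fst c) (lifc c u)"
proof -
  obtain k where k: "k \<in> A" "\<one> \<in> fst k" using chart_at[OF one_closed] by blast
  have op: "open (snd c ` fst c)" by (rule chart_open[OF c])
  have inW: "(x, snd k \<one>) \<in> mdom c k c" if "x \<in> snd c ` fst c" for x
    using that k chart_carrier[OF c] by (auto intro!: mdomI)
  have "smooth_on (snd c ` fst c) (\<lambda>x. frechet_derivative (mrep c k c) (at (x, snd k \<one>)) (0, u k))"
    by (rule smooth_on_frechet_compose[OF op mult_smooth(2)[OF c k(1) c]])
      (use inW in \<open>auto intro!: smooth_on_Pair op\<close>)
  then show ?thesis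
  proof (rule smooth_on_cong[OF op, THEN iffD1, rotated])
    fix x assume x: "x \<in> snd c ` fst c"
    have g: "chart_inv c x \<in> fst c" "chart_inv c x \<in> carrier G" "snd c (chart_inv c x) = x"
      using chart_inv_in[OF x] chart_carrier[OF c] chart_inv_right[OF x] by auto
    have g1: "chart_inv c x \<otimes> \<one> \<in> fst c" using g by simp
    have u': "u \<in> tangent_space A \<one>" using u by (simp add: lie_algebra_def)
    have "lif u (chart_inv c x) c = frechet_derivative (rep (\<lambda>h. chart_inv c x \<otimes> h) k c) (at (snd k \<one>)) (u k)"
      unfolding left_invariant_field_def
      by (rule GG.differential_apply[OF left_mult_diff[OF g(2) one_closed] u' k c g1])
    also have "\<dots> = frechet_derivative (mrep c k c) (at (x, snd k \<one>)) (0, u k)"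
      by (subst frechet_derivative_eq[OF mrep_right_derivative(1)[OF c k(1) c g(1) k(2) g1]]) (simp add: g(3))
    finally show "frechet_derivative (mrep c k c) (at (x, snd k \<one>)) (0, u k) = lifc c u x"
      by (simp add: lifc_def)
  qed
qed

lemma lifc_differentiable:
  "u \<in> \<gg> \<Longrightarrow> c \<in> A \<Longrightarrow> g \<in> fst c \<Longrightarrow> lifc c u differentiable (at (snd c g))"
  by (rule smooth_on_imp_differentiable[OF lifc_smooth]) auto

section \<open>The Lie bracket\<close>

abbreviation "lbr \<equiv> lie_bracket G A"

lemma lie_bracket_in:
  assumes "u \<in> \<gg>" "w \<in> \<gg>"
  shows "lbr u w \<in> \<gg>"
  unfolding lie_bracket_def lie_algebra_def
  by (rule vf_bracket_in)
    (use lif_in[OF assms(1)] lif_in[OF assms(2)] lifc_differentiable[OF assms(1)] lifc_differentiable[OF assms(2)]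
      in \<open>simp_all add: points_eq lifc_def\<close>)

lemma lie_bracket_coord:
  assumes "u \<in> \<gg>" "w \<in> \<gg>" "c \<in> A" "\<one> \<in> fst c"
  shows "lbr u w c = frechet_derivative (lifc c w) (at (snd c \<one>)) (u c)
    - frechet_derivative (lifc c u) (at (snd c \<one>)) (w c)"
  using assms by (simp add: lie_bracket_def vf_bracket_def lif_one lifc_def)

lemma lie_bracket_anti:
  assumes "u \<in> \<gg>" "w \<in> \<gg>"
  shows "lbr u w = - lbr w u"
proof -
  obtain c where c: "c \<in> A" "\<one> \<in> fst c" using chart_at[OF one_closed] by blast
  have l: "lbr u w \<in> tangent_space A \<one>" "- lbr w u \<in> tangent_space A \<one>"
    using lie_bracket_in assms subspace_neg[OF subspace_lie_algebra] by (auto simp: lie_algebra_def)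
  show ?thesis
    by (rule tangent_eqI[OF l c]) (simp add: lie_bracket_coord assms c)
qed

lemma lie_bracket_linear:
  assumes "u \<in> \<gg>" "w \<in> \<gg>" "z \<in> \<gg>"
  shows "lbr u (r *\<^sub>R w + z) = r *\<^sub>R lbr u w + lbr u z"
proof -
  obtain c where c: "c \<in> A" "\<one> \<in> fst c" using chart_at[OF one_closed] by blast
  have s: "r *\<^sub>R w + z \<in> \<gg>"
    using subspace_lie_algebra assms by (simp add: subspace_add subspace_scale)
  have l: "lbr u (r *\<^sub>R w + z) \<in> tangent_space A \<one>" "r *\<^sub>R lbr u w + lbr u z \<in> tangent_space A \<one>"
    using lie_bracket_in assms s subspace_lie_algebra 
    by (auto simp: lie_algebra_def intro!: subspace_add subspace_scale)
  let ?x = "snd c \<one>"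
  have x: "?x \<in> snd c ` fst c" using c by auto
  have "(lifc c (r *\<^sub>R w + z) has_derivative
      (\<lambda>h. r *\<^sub>R frechet_derivative (lifc c w) (at ?x) h + frechet_derivative (lifc c z) (at ?x) h)) (at ?x)"
  proof (rule has_derivative_transform_within_open[OF _ chart_open[OF c(1)] x])
    show "((\<lambda>x. r *\<^sub>R lifc c w x + lifc c z x) has_derivative
      (\<lambda>h. r *\<^sub>R frechet_derivative (lifc c w) (at ?x) h + frechet_derivative (lifc c z) (at ?x) h)) (at ?x)"
      by (intro has_derivative_add has_derivative_scaleR_right frechet_derivative_works_at lifc_differentiable assms c)
    fix x assume "x \<in> snd c ` fst c"
    then have "chart_inv c x \<in> carrier G" by (rule chart_carrier[OF c(1) chart_inv_in])
    then show "r *\<^sub>R lifc c w x + lifc c z x = lifc c (r *\<^sub>R w + z) x"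
      unfolding lifc_def by (subst lif_linear[OF assms(2,3)]) (simp_all only: scaleR_fun_apply plus_fun_apply)
  qed
  then have fr: "frechet_derivative (lifc c (r *\<^sub>R w + z)) (at ?x)
     = (\<lambda>h. r *\<^sub>R frechet_derivative (lifc c w) (at ?x) h + frechet_derivative (lifc c z) (at ?x) h)"
    by (rule frechet_derivative_eq)
  have lin: "linear (frechet_derivative (lifc c u) (at ?x))"
    by (rule linear_frechet_derivative[OF lifc_differentiable[OF assms(1) c]])
  show ?thesis
  proof (rule tangent_eqI[OF l c])
    show "lbr u (r *\<^sub>R w + z) c = (r *\<^sub>R lbr u w + lbr u z) c"
      unfolding plus_fun_apply scaleR_fun_apply lie_bracket_coord[OF assms(1) s c]
        lie_bracket_coord[OF assms(1,2) c] lie_bracket_coord[OF assms(1,3) c] fr linear_add[OF lin] linear_scale[OF lin]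
      by (simp add: algebra_simps)
  qed
qed

subsection \<open>One-parameter subgroups\<close>

lemma one_parameter_in: "one_parameter_subgroup G A u \<gamma> \<Longrightarrow> \<gamma> t \<in> carrier G"
  unfolding one_parameter_subgroup_def smooth_curve_def points_eq by blast

lemma one_parameter_zero:
  assumes "one_parameter_subgroup G A u \<gamma>"
  shows "\<gamma> 0 = \<one>"
proof -
  have "\<gamma> (0 + 0) = \<gamma> 0 \<otimes> \<gamma> 0" using assms unfolding one_parameter_subgroup_def by blast
  then show ?thesis using one_parameter_in[OF assms, of 0] by (simp add: l_cancel_one')
qed

lemma one_parameter_diff: "one_parameter_subgroup G A u \<gamma> \<Longrightarrow> curve_diff A \<gamma> t"
  unfolding one_parameter_subgroup_def using smooth_curve_diff by blast

lemma velocity_shift: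
  assumes "curve_diff A \<gamma> (t + r)"
  shows "curve_diff A (\<lambda>s. \<gamma> (t + s)) r" "velocity A (\<lambda>s. \<gamma> (t + s)) r = velocity A \<gamma> (t + r)"
proof -
  obtain c where c: "c \<in> A" "\<gamma> (t + r) \<in> fst c" using assms by (auto simp: curve_diff_def)
  note g = curve_diffD[OF assms c]
  have cont: "isCont (\<lambda>s. t + s) r" by (intro continuous_intros)
  have ev: "\<forall>\<^sub>F s in nhds r. \<gamma> (t + s) \<in> fst c"
    by (rule eventually_nhds_compose_continuous[OF g(1) cont])
  have "((\<lambda>s. t + s) has_vector_derivative 1) (at r)"
    by (auto intro!: derivative_eq_intros)
  from vector_diff_chain_at[OF this g(2)]
  have D: "((snd c \<circ> (\<lambda>s. \<gamma> (t + s))) has_vector_derivative velocity A \<gamma> (t + r) c) (at r)"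
    by (simp add: o_def)
  show "curve_diff A (\<lambda>s. \<gamma> (t + s)) r" by (rule velocity_coord(1)[OF c ev D])
  show "velocity A (\<lambda>s. \<gamma> (t + s)) r = velocity A \<gamma> (t + r)"
    by (subst velocity_coord(2)[OF c ev D]) (rule coord_tangent_eq[OF velocity_in[OF assms] c])
qed

text \<open>Differentiate \<gamma>(t + s) = \<gamma>(t)\<gamma>(s) at s = 0: a one-parameter
  subgroup is an integral curve of its left invariant field.\<close>

lemma one_parameter_velocity:
  assumes "one_parameter_subgroup G A u \<gamma>"
  shows "velocity A \<gamma> t = lif u (\<gamma> t)"
proof -
  have hom: "\<gamma> (t + s) = \<gamma> t \<otimes> \<gamma> s" for s using assms unfolding one_parameter_subgroup_def by blast
  have v0: "velocity A \<gamma> 0 = u" using assms unfolding one_parameter_subgroup_def by blast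
  note z = one_parameter_zero[OF assms]
  have "velocity A \<gamma> t = velocity A (\<lambda>s. \<gamma> (t + s)) 0"
    using velocity_shift(2)[of \<gamma> t 0] one_parameter_diff[OF assms] by simp
  also have "\<dots> = velocity A (\<lambda>s. \<gamma> t \<otimes> \<gamma> s) 0" by (simp add: hom)
  also have "\<dots> = differential A A (\<lambda>h. \<gamma> t \<otimes> h) (\<gamma> 0) (velocity A \<gamma> 0)"
    by (rule GG.velocity_compose(2)[OF one_parameter_diff[OF assms]])
      (rule left_mult_diff; rule one_parameter_in[OF assms])
  finally show ?thesis by (simp add: left_invariant_field_def v0 z)
qed

lemma one_parameter_pow:
  assumes "one_parameter_subgroup G A u \<gamma>"
  shows "\<gamma> (real n * t) = \<gamma> t [^] n"
proof (induction n)
  case 0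
  then show ?case using one_parameter_zero[OF assms] by simp
next
  case (Suc n)
  have "\<gamma> (real n * t + t) = \<gamma> (real n * t) \<otimes> \<gamma> t" using assms unfolding one_parameter_subgroup_def by blast
  moreover have "real (Suc n) * t = real n * t + t" by (simp add: algebra_simps)
  ultimately show ?case using Suc by simp
qed

text \<open>Near 0 both curves solve the same Lipschitz equation in a chart; for arbitrary t the
  value is the n-th power of the value at t / n.\<close>

lemma one_parameter_unique:
  assumes u: "u \<in> \<gg>" and g1: "one_parameter_subgroup G A u \<gamma>1" and g2: "one_parameter_subgroup G A u \<gamma>2"
  shows "\<gamma>1 = \<gamma>2"
proof -
  obtain c where c: "c \<in> A" "\<one> \<in> fst c" using chart_at[OF one_closed] by blast
  obtain r where r: "r > 0" "cball (snd c \<one>) r \<subseteq> snd c ` fst c"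
    using chart_open[OF c(1)] c(2) open_contains_cball by blast
  obtain K where K: "K-lipschitz_on (cball (snd c \<one>) r) (lifc c u)"
    using smooth_on_lipschitz_cball[OF lifc_smooth[OF u c(1)] r(2)] by blast
  have loc: "\<forall>\<^sub>F t in nhds 0. \<gamma> t \<in> fst c \<and> (snd c \<circ> \<gamma>) t \<in> cball (snd c \<one>) r"
    if g: "one_parameter_subgroup G A u \<gamma>" for \<gamma>
  proof -
    have g0: "\<gamma> 0 \<in> fst c" using one_parameter_zero[OF g] c by simp
    note gd = curve_diffD[OF one_parameter_diff[OF g] c(1) g0]
    have "isCont (snd c \<circ> \<gamma>) 0" using gd(2) by (rule has_vector_derivative_continuous)
    then have "\<forall>\<^sub>F t in nhds 0. (snd c \<circ> \<gamma>) t \<in> ball (snd c \<one>) r"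
      by (rule eventually_nhds_compose_continuous[rotated])
        (rule eventually_nhds_in_open; use r one_parameter_zero[OF g] in simp)
    then show ?thesis using gd(1) by eventually_elim simp
  qed
  have der: "((snd c \<circ> \<gamma>) has_vector_derivative lifc c u ((snd c \<circ> \<gamma>) t)) (at t)"
    if g: "one_parameter_subgroup G A u \<gamma>" "\<gamma> t \<in> fst c" for \<gamma> t
    using curve_diffD(2)[OF one_parameter_diff[OF g(1)] c(1) g(2)] one_parameter_velocity[OF g(1)] c(1) g(2)
    by (simp add: lifc_def)
  obtain \<delta> where \<delta>: "\<delta> > 0" and in': "\<And>t. \<bar>t\<bar> < \<delta> \<Longrightarrow> (\<gamma>1 t \<in> fst c \<and> (snd c \<circ> \<gamma>1) t \<in> cball (snd c \<one>) r) \<and>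
     (\<gamma>2 t \<in> fst c \<and> (snd c \<circ> \<gamma>2) t \<in> cball (snd c \<one>) r)"
    using eventually_conj[OF loc[OF g1] loc[OF g2]] unfolding eventually_nhds_metric by (auto simp: dist_real_def)
  have small: "\<gamma>1 t = \<gamma>2 t" if t: "\<bar>t\<bar> < \<delta>" for t
  proof -
    have "(snd c \<circ> \<gamma>1) t = (snd c \<circ> \<gamma>2) t"
    proof (rule ode_unique[OF K, of \<delta>])
      fix t assume "\<bar>t\<bar> < \<delta>"
      note i = in'[OF this]
      show "(snd c \<circ> \<gamma>1) t \<in> cball (snd c \<one>) r \<and> ((snd c \<circ> \<gamma>1) has_vector_derivative lifc c u ((snd c \<circ> \<gamma>1) t)) (at t)"
        using i der[OF g1] by blast
      show "(snd c \<circ> \<gamma>2) t \<in> cball (snd c \<one>) r \<and> ((snd c \<circ> \<gamma>2) has_vector_derivative lifc c u ((snd c \<circ> \<gamma>2) t)) (at t)"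
        using i der[OF g2] by blast
    qed (use t one_parameter_zero[OF g1] one_parameter_zero[OF g2] in simp_all)
    then show ?thesis using in'[OF t] chart_inj[OF c(1)] by (auto dest: inj_onD)
  qed
  show ?thesis
  proof
    fix t
    obtain n :: nat where n: "\<bar>t\<bar> / \<delta> < real n" using reals_Archimedean2 by blast
    then have n0: "n > 0" using \<delta> by (cases n) (auto simp: field_simps)
    then have "\<bar>t / real n\<bar> < \<delta>" using n \<delta> by (simp add: field_simps)
    then have "\<gamma>1 (t / real n) = \<gamma>2 (t / real n)" by (rule small)
    then show "\<gamma>1 t = \<gamma>2 t"
      using one_parameter_pow[OF g1, of n "t / real n"] one_parameter_pow[OF g2, of n "t / real n"] n0 by simp
  qed
qed

text \<open>The integral curve of the left invariant field through the identity exists for short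
  times in one chart. Uniqueness of solutions makes it a local homomorphism, and the powers g(t/n)^n
  extend it to all times.\<close>

lemma one_parameter_exists:
  assumes u: "u \<in> \<gg>"
  shows "\<exists>\<gamma>. one_parameter_subgroup G A u \<gamma>"
proof -
  obtain c where c: "c \<in> A" "\<one> \<in> fst c" using chart_at[OF one_closed] by blast
  let ?U = "snd c ` fst c" and ?x0 = "snd c \<one>" and ?f = "lifc c u"
  have U: "open ?U" "?x0 \<in> ?U" using chart_open[OF c(1)] c(2) by auto
  obtain \<epsilon> x where \<epsilon>: "\<epsilon> > 0" and x0: "x 0 = ?x0" and xs: "smooth_on {-\<epsilon><..<\<epsilon>} x"
    and x: "\<And>t. \<bar>t\<bar> < \<epsilon> \<Longrightarrow> x t \<in> ?U \<and> (x has_vector_derivative ?f (x t)) (at t)"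
    using ode_exists[OF U lifc_smooth[OF u c(1)]] by blast
  obtain r where r: "r > 0" "cball ?x0 r \<subseteq> ?U" using U open_contains_cball by blast
  obtain K where K: "K-lipschitz_on (cball ?x0 r) ?f"
    using smooth_on_lipschitz_cball[OF lifc_smooth[OF u c(1)] r(2)] by blast
  define g where "g t = chart_inv c (x t)" for t
  have g: "g t \<in> fst c" "g t \<in> carrier G" "snd c (g t) = x t" if "\<bar>t\<bar> < \<epsilon>" for t
    using x[OF that] chart_inv_in[of "x t" c] chart_inv_right[of "x t" c] chart_carrier[OF c(1)] by (auto simp: g_def)
  have g0: "g 0 = \<one>" using c by (simp add: g_def x0)
  let ?m = "mrep c c c"
  have x00: "(?x0, ?x0) \<in> mdom c c c" by (rule mdomI) (use c in auto)
  have "isCont ?m (?x0, ?x0)"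
    by (rule differentiable_imp_continuous_within[OF smooth_on_imp_differentiable[OF mult_smooth(2)[OF c(1) c(1) c(1)] x00]])
  moreover have mx: "?m (?x0, ?x0) = ?x0" using c by (simp add: mrep_def)
  have "\<forall>\<^sub>F z in nhds (?m (?x0, ?x0)). z \<in> ball ?x0 r"
    unfolding mx by (rule eventually_nhds_in_open) (use r in auto)
  ultimately have "\<forall>\<^sub>F z in nhds (?x0, ?x0). ?m z \<in> ball ?x0 r"
    by (rule eventually_nhds_compose_continuous[rotated])
  moreover have "\<forall>\<^sub>F z in nhds (?x0, ?x0). z \<in> mdom c c c"
    by (rule eventually_nhds_in_open[OF mult_smooth(1)[OF c(1) c(1) c(1)] x00])
  ultimately have "\<forall>\<^sub>F z in nhds (?x0, ?x0). z \<in> mdom c c c \<and> ?m z \<in> ball ?x0 r"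
    by eventually_elim simp
  \<comment> \<open>On P x P multiplication stays in the chart and inside the ball on which the
    field has Lipschitz constant K, as \<open>ode_unique\<close> needs.\<close>
  then obtain P where P: "open P" "?x0 \<in> P" "\<And>p q. p \<in> P \<Longrightarrow> q \<in> P \<Longrightarrow> (p, q) \<in> mdom c c c \<and> ?m (p, q) \<in> ball ?x0 r"
  proof -
    assume that: "\<And>P. open P \<Longrightarrow> ?x0 \<in> P \<Longrightarrow> (\<And>p q. p \<in> P \<Longrightarrow> q \<in> P \<Longrightarrow> (p, q) \<in> mdom c c c \<and> ?m (p, q) \<in> ball ?x0 r) \<Longrightarrow> thesis"
    assume "\<forall>\<^sub>F z in nhds (?x0, ?x0). z \<in> mdom c c c \<and> ?m z \<in> ball ?x0 r"
    then obtain S where S: "open S" "(?x0, ?x0) \<in> S" "\<And>z. z \<in> S \<Longrightarrow> z \<in> mdom c c c \<and> ?m z \<in> ball ?x0 r"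
      unfolding eventually_nhds by blast
    obtain P Q where PQ: "open P" "open Q" "(?x0, ?x0) \<in> P \<times> Q" "P \<times> Q \<subseteq> S"
      using S(1,2) open_prod_elim by metis
    show thesis
    proof (rule that[of "P \<inter> Q"])
      fix p q assume "p \<in> P \<inter> Q" "q \<in> P \<inter> Q"
      then have "(p, q) \<in> S" using PQ(4) by blast
      then show "(p, q) \<in> mdom c c c \<and> ?m (p, q) \<in> ball ?x0 r" by (rule S(3))
    qed (use PQ in auto)
  qed
  have contx: "isCont x 0" using x[of 0] \<epsilon> has_vector_derivative_continuous by auto
  have "\<forall>\<^sub>F t in nhds 0. x t \<in> P \<inter> ball ?x0 r"
    by (rule eventually_nhds_compose_continuous[OF _ contx], rule eventually_nhds_in_open)
      (use P(1,2) r(1) x0 in \<open>auto intro!: open_Int\<close>)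
  then obtain \<delta>' where \<delta>': "\<delta>' > 0" "\<And>t. \<bar>t\<bar> < \<delta>' \<Longrightarrow> x t \<in> P \<inter> ball ?x0 r"
    unfolding eventually_nhds_metric by (auto simp: dist_real_def)
  \<comment> \<open>Halving keeps s + t in the range of definition when |s| and |t| are below
    \<delta>.\<close>
  define \<delta> where "\<delta> = min \<delta>' \<epsilon> / 2"
  have \<delta>: "\<delta> > 0" "2 * \<delta> \<le> \<delta>'" "2 * \<delta> \<le> \<epsilon>" using \<delta>'(1) \<epsilon> by (auto simp: \<delta>_def)
  have loc_hom: "g (s + t) = g s \<otimes> g t" if s: "\<bar>s\<bar> < \<delta>" and t: "\<bar>t\<bar> < \<delta>" for s t
  proof -
    have small: "\<bar>s + t\<bar> < \<epsilon>" "\<bar>s + t\<bar> < \<delta>'" "\<bar>s\<bar> < \<epsilon>" "\<bar>t\<bar> < \<epsilon>" "\<bar>s\<bar> < \<delta>'" "\<bar>t\<bar> < \<delta>'" if "\<bar>t\<bar> < \<delta>" for t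
      using s that \<delta> by linarith+
    have prod: "g s \<otimes> g t \<in> fst c" "?m (x s, x t) = snd c (g s \<otimes> g t)" "snd c (g s \<otimes> g t) \<in> cball ?x0 r" if t: "\<bar>t\<bar> < \<delta>" for t
    proof -
      note sm = small[OF t]
      have pq: "(x s, x t) \<in> mdom c c c" "?m (x s, x t) \<in> ball ?x0 r"
        using P(3)[of "x s" "x t"] \<delta>'(2)[OF sm(5)] \<delta>'(2)[OF sm(6)] by auto
      show mm: "?m (x s, x t) = snd c (g s \<otimes> g t)" by (simp add: mrep_def g_def)
      obtain g' h' where gh: "x s = snd c g'" "x t = snd c h'" "g' \<in> fst c" "h' \<in> fst c" "g' \<otimes> h' \<in> fst c"
        using pq(1) by (auto simp: mdom_def)
      then show "g s \<otimes> g t \<in> fst c" using c(1) by (simp add: g_def)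
      show "snd c (g s \<otimes> g t) \<in> cball ?x0 r" using pq(2) mm by simp
    qed
    \<comment> \<open>As functions of t, x(s + t) and the coordinates of the product of g s and g t
      solve the same equation, since left translation by g s maps the field to itself.\<close>
    have "x (s + t) = snd c (g s \<otimes> g t)"
    proof (rule ode_unique[OF K, where x="\<lambda>t. x (s + t)" and y="\<lambda>t. snd c (g s \<otimes> g t)" and d=\<delta>])
      fix t assume t: "\<bar>t\<bar> < \<delta>"
      note sm = small[OF t]
      have "((\<lambda>t. s + t) has_vector_derivative 1) (at t)" by (auto intro!: derivative_eq_intros)
      from vector_diff_chain_at[OF this x[OF sm(1), THEN conjunct2]]
      show "x (s + t) \<in> cball ?x0 r \<and> ((\<lambda>t. x (s + t)) has_vector_derivative ?f (x (s + t))) (at t)"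
        using \<delta>'(2)[OF sm(2)] by (auto simp: o_def)
      have evg: "\<forall>\<^sub>F q in nhds t. q \<in> {-\<epsilon><..<\<epsilon>}"
        by (rule eventually_nhds_in_open) (use sm(4) in auto)
      have gin: "\<forall>\<^sub>F q in nhds t. g q \<in> fst c" using evg by eventually_elim (rule g(1), auto)
      have "\<forall>\<^sub>F q in nhds t. x q = (snd c \<circ> g) q" using evg
      proof eventually_elim
        case (elim q)
        then have "\<bar>q\<bar> < \<epsilon>" by auto
        then show ?case by (simp add: g(3))
      qed
      then have dg: "((snd c \<circ> g) has_vector_derivative ?f (x t)) (at t)"
        using x[OF sm(4)] has_derivative_transform_eventually_at unfolding has_vector_derivative_def by blast
      have vg: "velocity A g t = lif u (g t)"
        unfolding velocity_coord(2)[OF c(1) g(1)[OF sm(4)] gin dg]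
        using coord_tangent_eq[OF lif_in[OF u g(2)[OF sm(4)]] c(1) g(1)[OF sm(4)]] by (simp add: lifc_def g_def)
      have cg: "curve_diff A g t" by (rule velocity_coord(1)[OF c(1) g(1)[OF sm(4)] gin dg])
      note md = left_mult_diff[OF g(2)[OF sm(3)] g(2)[OF sm(4)]]
      have "velocity A (\<lambda>q. g s \<otimes> g q) t = lif u (g s \<otimes> g t)"
        by (subst GG.velocity_compose(2)[OF cg md]) (simp add: vg lif_invariant[OF u g(2)[OF sm(3)] g(2)[OF sm(4)]])
      then have "((snd c \<circ> (\<lambda>q. g s \<otimes> g q)) has_vector_derivative lif u (g s \<otimes> g t) c) (at t)"
        using curve_diffD(2)[OF GG.velocity_compose(1)[OF cg md] c(1) prod(1)[OF t]] by simp
      then show "snd c (g s \<otimes> g t) \<in> cball ?x0 r \<and>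
          ((\<lambda>t. snd c (g s \<otimes> g t)) has_vector_derivative ?f (snd c (g s \<otimes> g t))) (at t)"
        using prod(1,3)[OF t] c(1) by (simp add: lifc_def o_def)
    next
      show "x (s + 0) = snd c (g s \<otimes> g 0)" using g[of s] s \<delta> g0 by simp
    qed (rule t)
    then have "chart_inv c (x (s + t)) = g s \<otimes> g t" using prod(1)[OF t] c(1) by simp
    then show ?thesis by (simp add: g_def)
  qed
  have gcar: "g t \<in> carrier G" if "\<bar>t\<bar> < \<delta>" for t using g(2) that \<delta> by auto
  have loc_pow: "\<bar>real n * t\<bar> < \<delta> \<Longrightarrow> g (real n * t) = g t [^] n" for n t
  proof (induction n)
    case 0
    then show ?case by (simp add: g0)
  next
    case (Suc n)
    have "\<bar>real n * t\<bar> \<le> \<bar>real (Suc n) * t\<bar>" "\<bar>t\<bar> \<le> \<bar>real (Suc n) * t\<bar>"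
      by (auto simp: abs_mult intro!: mult_right_mono mult_left_mono) (simp add: algebra_simps)
    then have "\<bar>real n * t\<bar> < \<delta>" "\<bar>t\<bar> < \<delta>" using Suc.prems by linarith+
    then show ?case using Suc.IH loc_hom[of "real n * t" t] by (simp add: algebra_simps)
  qed
  \<comment> \<open>Adding 1 to the ceiling makes the exponent n positive and larger than |t| /
    \<delta>, so t / n lies strictly inside the range of g.\<close>
  define \<Gamma> where "\<Gamma> t = g (t / real (nat \<lceil>\<bar>t\<bar> / \<delta>\<rceil> + 1)) [^] (nat \<lceil>\<bar>t\<bar> / \<delta>\<rceil> + 1)" for t
  have big: "\<bar>t / real n\<bar> < \<delta> \<longleftrightarrow> \<bar>t\<bar> / \<delta> < real n" if "n > 0" for n :: nat and t
    using \<delta>(1) that by (simp add: field_simps)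
  \<comment> \<open>Two admissible exponents n and k are compared at t / (n k).\<close>
  have indep: "g (t / real n) [^] n = g (t / real k) [^] k"
    if nk: "n > 0" "k > 0" "\<bar>t / real n\<bar> < \<delta>" "\<bar>t / real k\<bar> < \<delta>" for n k :: nat and t
  proof -
    have le: "\<bar>t / real (n * k)\<bar> \<le> \<bar>t / real n\<bar>"
      using nk(1,2) mult_left_mono[of 1 "real k" "\<bar>t\<bar>"] by (auto simp: field_simps)
    have car: "g (t / real (n * k)) \<in> carrier G" using le nk(3) by (intro gcar) linarith
    have "g (t / real n) = g (t / real (n * k)) [^] k"
      using loc_pow[of k "t / real (n * k)"] nk by simp
    moreover have "g (t / real k) = g (t / real (n * k)) [^] n"
      using loc_pow[of n "t / real (n * k)"] nk by simp
    ultimately show ?thesis using car by (simp add: nat_pow_pow mult.commute)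
  qed
  have \<Gamma>: "\<Gamma> t = g (t / real n) [^] n" if "n > 0" "\<bar>t\<bar> / \<delta> < real n" for n :: nat and t
  proof -
    have "\<bar>t\<bar> / \<delta> < real (nat \<lceil>\<bar>t\<bar> / \<delta>\<rceil> + 1)"
      using real_nat_ceiling_ge[of "\<bar>t\<bar> / \<delta>"] by linarith
    then show ?thesis
      unfolding \<Gamma>_def using that by (intro indep) (simp_all only: big)
  qed
  have \<Gamma>_small: "\<Gamma> t = g t" if "\<bar>t\<bar> < \<delta>" for t
    using \<Gamma>[of 1 t] that \<delta>(1) gcar[OF that] by simp
  have \<Gamma>_hom: "\<Gamma> (s + t) = \<Gamma> s \<otimes> \<Gamma> t" for s t
  proof -
    obtain n :: nat where n: "(\<bar>s\<bar> + \<bar>t\<bar>) / \<delta> < real n" using reals_Archimedean2 by blast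
    have "\<bar>s\<bar> / \<delta> \<le> (\<bar>s\<bar> + \<bar>t\<bar>) / \<delta>" "\<bar>t\<bar> / \<delta> \<le> (\<bar>s\<bar> + \<bar>t\<bar>) / \<delta>" "\<bar>s + t\<bar> / \<delta> \<le> (\<bar>s\<bar> + \<bar>t\<bar>) / \<delta>"
      using \<delta>(1) by (auto intro!: divide_right_mono)
    then have nn: "\<bar>s\<bar> / \<delta> < real n" "\<bar>t\<bar> / \<delta> < real n" "\<bar>s + t\<bar> / \<delta> < real n" using n by linarith+
    have n0: "n > 0" using nn(1) \<delta>(1) by (cases n) (auto simp: field_simps)
    have sm: "\<bar>s / real n\<bar> < \<delta>" "\<bar>t / real n\<bar> < \<delta>" using big[OF n0] nn by auto
    have h: "g ((s + t) / real n) = g (s / real n) \<otimes> g (t / real n)"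
      using loc_hom[OF sm] by (simp add: add_divide_distrib)
    have comm: "g (s / real n) \<otimes> g (t / real n) = g (t / real n) \<otimes> g (s / real n)"
      using loc_hom[OF sm] loc_hom[OF sm(2,1)] by (simp add: add.commute)
    show ?thesis
      unfolding \<Gamma>[OF n0 nn(1)] \<Gamma>[OF n0 nn(2)] \<Gamma>[OF n0 nn(3)] h
      by (rule pow_mult_distrib[OF comm gcar[OF sm(1)] gcar[OF sm(2)]])
  qed
  have \<Gamma>_car: "\<Gamma> t \<in> carrier G" for t
  proof -
    obtain n :: nat where n: "\<bar>t\<bar> / \<delta> < real n" using reals_Archimedean2 by blast
    then have n0: "n > 0" using \<delta>(1) by (cases n) (auto simp: field_simps)
    show ?thesis unfolding \<Gamma>[OF n0 n] using gcar[of "t / real n"] big[OF n0, of t] n by simp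
  qed
  have "smooth_curve A UNIV \<Gamma>"
  proof (rule smooth_curveI[OF open_UNIV])
    fix t0 :: real
    obtain d where d: "d \<in> A" "\<Gamma> t0 \<in> fst d" using chart_at[OF \<Gamma>_car] by blast
    \<comment> \<open>Near t0 the extension is \<Gamma> t0 times g(t - t0), so its smoothness
      follows from that of multiplication and of the local solution.\<close>
    define J where "J = {t0 - \<delta><..<t0 + \<delta>} \<inter> (\<lambda>t. (snd d (\<Gamma> t0), x (t - t0))) -` mdom d c d"
    have sx: "smooth_on {t0 - \<delta><..<t0 + \<delta>} (\<lambda>t. x (t - t0))"
      by (rule smooth_on_compose[OF _ xs]) (use \<delta> in \<open>auto intro!: smooth_on_diff\<close>)
    have sx2: "smooth_on {t0 - \<delta><..<t0 + \<delta>} (\<lambda>t. (snd d (\<Gamma> t0), x (t - t0)))"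
      by (rule smooth_on_Pair[OF _ _ sx]) auto
    have opJ: "open J"
      unfolding J_def by (intro continuous_open_preimage smooth_on_imp_continuous_on[OF sx2] mult_smooth d c) auto
    have J: "\<bar>t - t0\<bar> < \<delta>" "\<Gamma> t = \<Gamma> t0 \<otimes> g (t - t0)" "\<Gamma> t \<in> fst d"
        "mrep d c d (snd d (\<Gamma> t0), x (t - t0)) = snd d (\<Gamma> t)" if "t \<in> J" for t
    proof -
      show t: "\<bar>t - t0\<bar> < \<delta>" using that by (auto simp: J_def)
      show eq: "\<Gamma> t = \<Gamma> t0 \<otimes> g (t - t0)" using \<Gamma>_hom[of t0 "t - t0"] \<Gamma>_small[OF t] by simp
      show "mrep d c d (snd d (\<Gamma> t0), x (t - t0)) = snd d (\<Gamma> t)"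
        using d by (simp add: mrep_def eq g_def)
      have "(snd d (\<Gamma> t0), x (t - t0)) \<in> mdom d c d" using that by (simp add: J_def)
      then obtain g' h' where gh: "snd d (\<Gamma> t0) = snd d g'" "x (t - t0) = snd c h'" "g' \<in> fst d" "h' \<in> fst c" "g' \<otimes> h' \<in> fst d"
        by (auto simp: mdom_def)
      have "g' = \<Gamma> t0" using gh(1,3) d chart_inj[OF d(1)] by (auto dest: inj_onD)
      moreover have "h' = g (t - t0)" using gh(2,4) c by (simp add: g_def)
      ultimately show "\<Gamma> t \<in> fst d" using gh(5) eq by simp
    qed
    have "smooth_on J (\<lambda>t. mrep d c d (snd d (\<Gamma> t0), x (t - t0)))"
      by (rule smooth_on_compose[OF opJ mult_smooth(2)[OF d(1) c(1) d(1)] smooth_on_subset[OF sx2]]) (auto simp: J_def)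
    then have "smooth_on J (snd d \<circ> \<Gamma>)"
      by (rule smooth_on_cong[OF opJ, THEN iffD1, rotated]) (simp add: J)
    moreover have "t0 \<in> J"
    proof -
      have "(snd d (\<Gamma> t0), snd c \<one>) \<in> mdom d c d" by (rule mdomI) (use d c \<Gamma>_car in auto)
      then show ?thesis using \<delta>(1) by (simp add: J_def x0)
    qed
    moreover have "\<Gamma> ` J \<subseteq> fst d" using J(3) by blast
    ultimately show "\<exists>J c. open J \<and> t0 \<in> J \<and> c \<in> A \<and> \<Gamma> ` J \<subseteq> fst c \<and> smooth_on J (snd c \<circ> \<Gamma>)"
      using opJ d(1) by blast
  qed
  moreover have "velocity A \<Gamma> 0 = u"
  proof -
    have ev: "\<forall>\<^sub>F t in nhds 0. t \<in> {-\<delta><..<\<delta>}"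
      by (rule eventually_nhds_in_open) (use \<delta> in auto)
    have sm: "\<bar>t\<bar> < \<delta>" "\<bar>t\<bar> < \<epsilon>" if "t \<in> {-\<delta><..<\<delta>}" for t using that \<delta> by auto
    have "\<forall>\<^sub>F t in nhds 0. x t = (snd c \<circ> \<Gamma>) t" using ev
      by eventually_elim (simp add: \<Gamma>_small[OF sm(1)] g(3)[OF sm(2)])
    moreover have "(x has_vector_derivative ?f ?x0) (at 0)" using x[of 0] \<epsilon> x0 by simp
    ultimately have D: "((snd c \<circ> \<Gamma>) has_vector_derivative ?f ?x0) (at 0)"
      using has_derivative_transform_eventually_at unfolding has_vector_derivative_def by blast
    have inc: "\<forall>\<^sub>F t in nhds 0. \<Gamma> t \<in> fst c" using ev
      by eventually_elim (simp add: \<Gamma>_small[OF sm(1)] g(1)[OF sm(2)])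
    have G0: "\<Gamma> 0 = \<one>" using \<Gamma>_small[of 0] \<delta>(1) g0 by simp
    have "velocity A \<Gamma> 0 = coord_tangent A c (\<Gamma> 0) (?f ?x0)"
      by (rule velocity_coord(2)[OF c(1) _ inc D]) (simp add: G0 c)
    then show ?thesis
      using coord_tangent_eq[OF u[unfolded lie_algebra_def] c] c by (simp add: G0 lifc_def lif_one[OF u])
  qed
  ultimately show ?thesis unfolding one_parameter_subgroup_def using \<Gamma>_hom by blast
qed

lemma one_parameter_scale:
  assumes g: "one_parameter_subgroup G A u \<gamma>"
  shows "one_parameter_subgroup G A (r *\<^sub>R u) (\<lambda>t. \<gamma> (r * t))"
proof -
  have sm: "smooth_curve A UNIV \<gamma>" using g unfolding one_parameter_subgroup_def by blast
  have "smooth_curve A UNIV (\<lambda>t. \<gamma> (r * t))"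
  proof (rule smooth_curveI[OF open_UNIV])
    fix t
    obtain c where c: "c \<in> A" "\<gamma> (r * t) \<in> fst c" using chart_at[OF one_parameter_in[OF g]] by blast
    let ?J = "{t \<in> UNIV. \<gamma> t \<in> fst c}"
    have J: "open ?J" "smooth_on ?J (snd c \<circ> \<gamma>)"
      using sm c(1) by (auto simp: smooth_curve_def Let_def)
    let ?I = "(\<lambda>t. r * t) -` ?J"
    have I: "open ?I" by (rule open_vimage[OF J(1)]) (intro continuous_intros)
    have "smooth_on ?I (\<lambda>t. (snd c \<circ> \<gamma>) (r * t))"
      by (rule smooth_on_compose[OF I J(2) smooth_on_mult[OF I smooth_on_const smooth_on_id]]) auto
    then show "\<exists>J c. open J \<and> t \<in> J \<and> c \<in> A \<and> (\<lambda>t. \<gamma> (r * t)) ` J \<subseteq> fst c \<and> smooth_on J (snd c \<circ> (\<lambda>t. \<gamma> (r * t)))"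
      using I c by (intro exI[of _ ?I] exI[of _ c]) (auto simp: o_def)
  qed
  moreover have "velocity A (\<lambda>t. \<gamma> (r * t)) 0 = r *\<^sub>R u"
  proof -
    have gd: "curve_diff A \<gamma> (r * 0)" by (rule one_parameter_diff[OF g])
    have g0: "\<gamma> (r * 0) = \<one>" using one_parameter_zero[OF g] by simp
    have v0: "velocity A \<gamma> (r * 0) = u" using g by (simp add: one_parameter_subgroup_def)
    obtain c where c: "c \<in> A" "\<gamma> (r * 0) \<in> fst c" using chart_at[OF one_parameter_in[OF g]] by blast
    note gc = curve_diffD[OF gd c]
    have "isCont (\<lambda>t. r * t) 0" by (intro continuous_intros)
    then have ev: "\<forall>\<^sub>F t in nhds 0. \<gamma> (r * t) \<in> fst c"
      using eventually_nhds_compose_continuous[where f="\<lambda>t. r * t" and x=0 and P="\<lambda>z. \<gamma> z \<in> fst c"] gc(1) by blast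
    have "((\<lambda>t. r * t) has_vector_derivative r) (at 0)" by (auto intro!: derivative_eq_intros)
    from vector_diff_chain_at[OF this gc(2)]
    have D: "((snd c \<circ> (\<lambda>t. \<gamma> (r * t))) has_vector_derivative r *\<^sub>R u c) (at 0)"
      unfolding v0 by (simp add: o_def)
    have "velocity A (\<lambda>t. \<gamma> (r * t)) 0 = coord_tangent A c (\<gamma> (r * 0)) (r *\<^sub>R u c)"
      by (rule velocity_coord(2)[OF c ev D])
    also have "\<dots> = r *\<^sub>R coord_tangent A c (\<gamma> (r * 0)) (u c)"
      by (rule linear_scale[OF coord_tangent_linear[OF c]])
    also have "coord_tangent A c (\<gamma> (r * 0)) (u c) = u"
      using coord_tangent_eq[OF velocity_in[OF gd] c] unfolding v0 .
    finally show ?thesis .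
  qed
  ultimately show ?thesis
    using g unfolding one_parameter_subgroup_def by (auto simp: distrib_left)
qed

text \<open>\<open>lie_exp\<close> evaluates at time 1 the subgroup with velocity t u, which is
  \<gamma> with its parameter multiplied by t.\<close>

lemma lie_exp_eq:
  assumes u: "u \<in> \<gg>" and g: "one_parameter_subgroup G A u \<gamma>"
  shows "lie_exp G A (t *\<^sub>R u) = \<gamma> t"
proof -
  have tu: "t *\<^sub>R u \<in> \<gg>" using subspace_scale[OF subspace_lie_algebra u] .
  have "(THE \<gamma>. one_parameter_subgroup G A (t *\<^sub>R u) \<gamma>) = (\<lambda>s. \<gamma> (t * s))"
    using one_parameter_scale[OF g] one_parameter_unique[OF tu] by (intro the_equality) blast+
  then show ?thesis by (simp add: lie_exp_def)
qed

end

section \<open>Homogeneous spaces\<close>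

text \<open>Since the derivative at x0 is the identity, so is that of the inverse at f x0. The
  inverse function theorem expects derivatives that are continuous as bounded operators; in finite
  dimension this is checked vector by vector.\<close>

lemma local_right_inverse:
  fixes f :: "'a::euclidean_space \<Rightarrow> 'a"
  assumes U: "open U" "x0 \<in> U" and f: "smooth_on U f" and id: "frechet_derivative f (at x0) = (\<lambda>w. w)"
  obtains V g where "open V" "f x0 \<in> V" "g (f x0) = x0" "(g has_derivative (\<lambda>w. w)) (at (f x0))"
    "\<And>y. y \<in> V \<Longrightarrow> g y \<in> U \<and> f (g y) = y"
proof -
  define f' where "f' x = Blinfun (frechet_derivative f (at x))" for x
  have ap: "blinfun_apply (f' x) = frechet_derivative f (at x)" if "x \<in> U" for x
    unfolding f'_def using has_derivative_bounded_linear[OF smooth_on_has_derivative[OF f that]]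
    by (rule bounded_linear_Blinfun_apply)
  have der: "(f has_derivative blinfun_apply (f' x)) (at x)" if "x \<in> U" for x
    using smooth_on_has_derivative[OF f that] ap[OF that] by simp
  have cont: "continuous_on U f'"
  proof (rule continuous_on_blinfun_componentwise)
    fix i :: 'a
    show "continuous_on U (\<lambda>x. blinfun_apply (f' x) i)"
      using smooth_on_imp_continuous_on[OF smooth_on_frechet[OF f], of i]
      by (rule continuous_on_eq) (simp add: ap)
  qed
  have one: "f' x0 = id_blinfun"
    by (rule blinfun_eqI) (simp add: ap U(2) id)
  have inv: "id_blinfun o\<^sub>L f' x0 = id_blinfun"
    unfolding one by (rule blinfun_eqI) simp
  show ?thesis
  proof (rule inverse_function_theorem[OF U(1) _ cont U(2) inv])
    show "(f has_derivative blinfun_apply (f' x)) (at x)" if "x \<in> U" for x by (rule der[OF that])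
    fix U' V g g'
    assume V: "open V" "f x0 \<in> V" and sub: "U' \<subseteq> U" "x0 \<in> U'" and hom: "homeomorphism U' V f g"
      and g: "\<And>y. y \<in> V \<Longrightarrow> (g has_derivative (g' y)) (at y)"
      and g': "\<And>y. y \<in> V \<Longrightarrow> g' y = Hilbert_Choice.inv (blinfun_apply (f' (g y)))"
    have g0: "g (f x0) = x0" using sub(2) hom by (simp add: homeomorphism_def)
    have "g' (f x0) = Hilbert_Choice.inv (\<lambda>w. w)"
      using g'[OF V(2)] unfolding g0 ap[OF U(2)] id .
    then have "g' (f x0) = (\<lambda>w. w)" by (simp add: inv_id[unfolded id_def])
    then have "(g has_derivative (\<lambda>w. w)) (at (f x0))" using g[OF V(2)] by simp
    moreover have "g y \<in> U \<and> f (g y) = y" if "y \<in> V" for y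
    proof -
      have "g y \<in> U'" "f (g y) = y" using hom that unfolding homeomorphism_def by blast+
      then show ?thesis using sub(1) by blast
    qed
    ultimately show thesis using that[of V g, OF V g0] by blast
  qed
qed

context mfd_map2
begin

text \<open>A submersion has local right inverses, so differentiability may be tested after composition.\<close>

lemma map_diff_from_submersion:
  assumes f: "smooth_map A B f" and p: "p \<in> points A"
    and surj: "differential A B f p ` tangent_space A p = tangent_space B (f p)"
    and gf: "map_diff A C (\<lambda>q. g (f q)) p"
  shows "map_diff B C g (f p)"
proof -
  obtain c where c: "c \<in> A" "p \<in> fst c" using p by auto
  have md: "map_diff A B f p" by (rule F.smooth_map_diff[OF f p])
  obtain d where d: "d \<in> B" "f p \<in> fst d" using md by (auto simp: map_diff_def)
  obtain k where k: "k \<in> C" "g (f p) \<in> fst k" using gf by (auto simp: map_diff_def)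
  define W where "W = snd c ` {p \<in> fst c. f p \<in> fst d}"
  have W: "open W" "smooth_on W (rep f c d)"
    using f c(1) d(1) unfolding smooth_map_def Let_def W_def by blast+
  have x0: "snd c p \<in> W" using c d by (auto simp: W_def)
  have Win: "f (chart_inv c x) \<in> fst d" if "x \<in> W" for x using that c(1) by (auto simp: W_def)
  let ?x0 = "snd c p" and ?p' = "frechet_derivative (rep f c d) (at (snd c p))"
  have lin: "linear ?p'" by (rule linear_frechet_derivative[OF F.map_diffD(2)[OF md c d]])
  have "surj ?p'"
  proof (rule surjI[where f="\<lambda>w. (SOME v. ?p' v = w)"])
    fix w
    have "coord_tangent B d (f p) w \<in> differential A B f p ` tangent_space A p"
      unfolding surj by (rule F.N.coord_tangent_in[OF d])
    then obtain \<xi> where \<xi>: "\<xi> \<in> tangent_space A p" "coord_tangent B d (f p) w = differential A B f p \<xi>" by auto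
    have "?p' (\<xi> c) = w"
      using F.differential_apply[OF md \<xi>(1) c d] F.N.coord_tangent_apply[OF d, of w] unfolding \<xi>(2) by simp
    then show "?p' (SOME v. ?p' v = w) = w" by (rule someI)
  qed
  then obtain R where R: "linear R" "?p' \<circ> R = id"
    using linear_surjective_right_inverse[OF lin] by blast
  \<comment> \<open>Restricting f to the affine slice x0 + R z, with R a linear right inverse of the
    derivative, gives a map whose derivative at 0 is the identity.\<close>
  define h where "h z = rep f c d (?x0 + R z)" for z
  define U where "U = (\<lambda>z. ?x0 + R z) -` W"
  have bl: "bounded_linear R" using R(1) by (simp add: linear_conv_bounded_linear)
  have sR: "smooth_on S (\<lambda>z. ?x0 + R z)" if "open S" for S
    by (intro smooth_on_add that smooth_on_const smooth_on_bounded_linear bl)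
  have U: "open U" unfolding U_def
    using smooth_on_imp_continuous_on[OF sR[OF open_UNIV]] by (intro open_vimage W(1))
  have U0: "0 \<in> U" using x0 linear_0[OF R(1)] by (simp add: U_def)
  have hs: "smooth_on U h"
    unfolding h_def by (rule smooth_on_compose[OF U W(2) sR[OF U]]) (auto simp: U_def)
  have "((\<lambda>z. ?x0 + R z) has_derivative R) (at 0)"
    by (auto intro!: derivative_eq_intros bounded_linear_imp_has_derivative bl)
  then have "(h has_derivative (\<lambda>w. ?p' (R w))) (at 0)"
    unfolding h_def by (rule has_derivative_compose)
      (use F.map_diffD(3)[OF md c d] linear_0[OF R(1)] in \<open>simp add: o_def\<close>)
  then have "frechet_derivative h (at 0) = (\<lambda>w. w)"
    using R(2) by (simp add: frechet_derivative_eq fun_eq_iff)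
  then obtain V r where V: "open V" "h 0 \<in> V" "r (h 0) = 0" "(r has_derivative (\<lambda>w. w)) (at (h 0))"
    and r: "\<And>y. y \<in> V \<Longrightarrow> r y \<in> U \<and> h (r y) = y"
    using local_right_inverse[OF U U0 hs] by metis
  have h0: "h 0 = snd d (f p)" using c linear_0[OF R(1)] by (simp add: h_def)
  define \<sigma> where "\<sigma> y = ?x0 + R (r y)" for y
  have \<sigma>0: "\<sigma> (snd d (f p)) = ?x0" using V(3) linear_0[OF R(1)] by (simp add: \<sigma>_def h0)
  have \<sigma>d: "(\<sigma> has_derivative R) (at (snd d (f p)))"
    unfolding \<sigma>_def using V(4)[unfolded h0] 
    by (auto intro!: derivative_eq_intros bounded_linear.has_derivative[OF bl])
  have evV: "\<forall>\<^sub>F y in nhds (snd d (f p)). y \<in> V"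
    by (rule eventually_nhds_in_open[OF V(1)]) (use V(2) h0 in simp)
  have inv_eq: "chart_inv d y = f (chart_inv c (\<sigma> y))" if "y \<in> V" for y
  proof -
    have "\<sigma> y \<in> W" "rep f c d (\<sigma> y) = y" using r[OF that] by (auto simp: U_def h_def \<sigma>_def)
    then show ?thesis using F.N.chart_inv_left[OF d(1) Win[of "\<sigma> y"]] by simp
  qed
  have cont: "isCont \<sigma> (snd d (f p))" by (rule has_derivative_continuous[OF \<sigma>d])
  note mk = GF.map_diffD[OF gf c k]
  have "\<forall>\<^sub>F y in nhds (snd d (f p)). g (f (chart_inv c (\<sigma> y))) \<in> fst k"
    by (rule eventually_nhds_compose_continuous[OF _ cont]) (use mk(1) \<sigma>0 in simp)
  then have ev: "\<forall>\<^sub>F y in nhds (snd d (f p)). g (chart_inv d y) \<in> fst k"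
    using evV by eventually_elim (simp add: inv_eq)
  have "((\<lambda>y. rep (\<lambda>q. g (f q)) c k (\<sigma> y)) has_derivative
      (\<lambda>w. frechet_derivative (rep (\<lambda>q. g (f q)) c k) (at ?x0) (R w))) (at (snd d (f p)))"
    by (rule has_derivative_compose[OF \<sigma>d]) (use mk(3) \<sigma>0 in \<open>simp add: o_def\<close>)
  moreover have "\<forall>\<^sub>F y in nhds (snd d (f p)). rep (\<lambda>q. g (f q)) c k (\<sigma> y) = rep g d k y"
    using evV by eventually_elim (simp add: inv_eq)
  ultimately have "(rep g d k has_derivative
      (\<lambda>w. frechet_derivative (rep (\<lambda>q. g (f q)) c k) (at ?x0) (R w))) (at (snd d (f p)))"
    by (rule has_derivative_transform_eventually_at)
  then have "rep g d k differentiable (at (snd d (f p)))" unfolding differentiable_def by blast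
  then show ?thesis unfolding map_diff_def using d k ev by blast
qed

end

locale hspace = lie G X A + N: mfd Y B
  for G :: "('g, 'r) monoid_scheme" (structure) and X :: "'g topology"
    and A :: "('g, 'e::euclidean_space) chart set"
    and Y :: "'g set topology" and B :: "('g set, 'f::euclidean_space) chart set" +
  fixes H :: "'g set"
  assumes hs: "homogeneous_space G X A H Y B"
begin

sublocale P: mfd_map X A Y B ..
sublocale NN: mfd_map Y B Y B ..
sublocale NNN: mfd_map2 Y B Y B Y B ..
sublocale GP: mfd_map2 X A X A Y B ..
sublocale PN: mfd_map2 X A Y B Y B ..

section \<open>The action on the coset space\<close>

abbreviation proj :: "'g \<Rightarrow> 'g set" where "proj g \<equiv> g <# H"
abbreviation dproj :: "'g \<Rightarrow> ('g, 'e) tangent \<Rightarrow> ('g set, 'f) tangent"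
  where "dproj \<equiv> differential A B (\<lambda>g. g <# H)"
abbreviation dact :: "'g \<Rightarrow> 'g set \<Rightarrow> ('g set, 'f) tangent \<Rightarrow> ('g set, 'f) tangent"
  where "dact g \<equiv> differential B B (\<lambda>Q. g <# Q)"

lemma H_subgroup: "subgroup H G" using hs by (simp add: homogeneous_space_def)
lemma H_carrier: "H \<subseteq> carrier G" by (rule subgroup.subset[OF H_subgroup])
lemma proj_one: "proj \<one> = H" by (rule lcos_mult_one[OF H_carrier])
lemma act_proj: "g \<in> carrier G \<Longrightarrow> h \<in> carrier G \<Longrightarrow> g <# proj h = proj (g \<otimes> h)"
  by (rule lcos_m_assoc[OF H_carrier])

lemma points_B: "points B = proj ` carrier G"
proof -
  have "points B = lcosets H" using hs N.topspace_eq by (simp add: homogeneous_space_def)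
  then show ?thesis by (auto simp: LCOSETS_def)
qed

lemma proj_in: "g \<in> carrier G \<Longrightarrow> proj g \<in> points B" by (simp add: points_B)
lemma H_in: "H \<in> points B" using proj_in[OF one_closed] proj_one by simp

lemma act_in: "g \<in> carrier G \<Longrightarrow> Q \<in> points B \<Longrightarrow> g <# Q \<in> points B"
  unfolding points_B using act_proj by auto

lemma act_act: "g \<in> carrier G \<Longrightarrow> h \<in> carrier G \<Longrightarrow> Q \<in> points B \<Longrightarrow> g <# (h <# Q) = (g \<otimes> h) <# Q"
  unfolding points_B using act_proj by (auto simp: m_assoc)

lemma act_one: "Q \<in> points B \<Longrightarrow> \<one> <# Q = Q"
  unfolding points_B using act_proj by auto

lemma proj_smooth: "smooth_map A B (\<lambda>g. g <# H)" using hs by (simp add: homogeneous_space_def)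

lemma proj_diff: "g \<in> carrier G \<Longrightarrow> map_diff A B (\<lambda>g. g <# H) g"
  by (rule P.smooth_map_diff[OF proj_smooth]) (simp add: points_eq)

lemma proj_submersion: "g \<in> carrier G \<Longrightarrow> dproj g ` tangent_space A g = tangent_space B (proj g)"
  using hs by (simp add: homogeneous_space_def)

lemma act_proj_diff:
  assumes "g \<in> carrier G" "h \<in> carrier G"
  shows "map_diff A B (\<lambda>q. g <# proj q) h"
    and "\<xi> \<in> tangent_space A h \<Longrightarrow> differential A B (\<lambda>q. g <# proj q) h \<xi>
      = dproj (g \<otimes> h) (differential A A (\<lambda>q. g \<otimes> q) h \<xi>)"
proof -
  note c = GP.differential_compose[OF left_mult_diff[OF assms] proj_diff[OF m_closed[OF assms]]]
  have eq: "proj (g \<otimes> q) = g <# proj q" if "q \<in> points A" for q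
    using act_proj[OF assms(1), of q] that by (simp add: points_eq)
  show "map_diff A B (\<lambda>q. g <# proj q) h" by (rule P.map_diff_cong[OF eq c(1)])
  have "differential A B (\<lambda>q. g <# proj q) h \<xi> = differential A B (\<lambda>q. proj (g \<otimes> q)) h \<xi>"
    by (rule P.differential_cong) (use eq assms in \<open>auto simp: points_eq\<close>)
  then show "\<xi> \<in> tangent_space A h \<Longrightarrow> differential A B (\<lambda>q. g <# proj q) h \<xi>
      = dproj (g \<otimes> h) (differential A A (\<lambda>q. g \<otimes> q) h \<xi>)"
    using c(2) by simp
qed

text \<open>Composed with the projection, the action becomes a left translation followed by the
  projection, which is differentiable on G; the submersion property lets this descend to the
  cosets.\<close>

lemma act_diff:
  assumes "g \<in> carrier G" "Q \<in> points B"
  shows "map_diff B B (\<lambda>Q. g <# Q) Q"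
proof -
  obtain h where h: "h \<in> carrier G" "Q = proj h" using assms(2) by (auto simp: points_B)
  show ?thesis
    unfolding h(2)
    by (rule PN.map_diff_from_submersion[OF proj_smooth _ proj_submersion[OF h(1)] act_proj_diff(1)[OF assms(1) h(1)]])
      (simp add: points_eq h)
qed

lemma dact_dproj:
  assumes "g \<in> carrier G" "h \<in> carrier G" "\<xi> \<in> tangent_space A h"
  shows "dact g (proj h) (dproj h \<xi>) = dproj (g \<otimes> h) (differential A A (\<lambda>q. g \<otimes> q) h \<xi>)"
  using PN.differential_compose(2)[OF proj_diff[OF assms(2)] act_diff[OF assms(1) proj_in[OF assms(2)]] assms(3)]
    act_proj_diff(2)[OF assms] by simp

lemma dact_in:
  "g \<in> carrier G \<Longrightarrow> Q \<in> points B \<Longrightarrow> \<xi> \<in> tangent_space B Q \<Longrightarrow> dact g Q \<xi> \<in> tangent_space B (g <# Q)"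
  using NN.differential_in[OF act_diff] by blast

lemma dact_linear:
  "g \<in> carrier G \<Longrightarrow> Q \<in> points B \<Longrightarrow> \<xi> \<in> tangent_space B Q \<Longrightarrow> \<eta> \<in> tangent_space B Q \<Longrightarrow>
    dact g Q (r *\<^sub>R \<xi> + \<eta>) = r *\<^sub>R dact g Q \<xi> + dact g Q \<eta>"
  using NN.differential_linear[OF act_diff] by blast

lemma dact_inverse:
  assumes g: "g \<in> carrier G" and Q: "Q \<in> points B" and \<xi>: "\<xi> \<in> tangent_space B Q"
  shows "dact (inv g) (g <# Q) (dact g Q \<xi>) = \<xi>"
proof -
  have "dact (inv g) (g <# Q) (dact g Q \<xi>) = differential B B (\<lambda>Q. inv g <# (g <# Q)) Q \<xi>"
    by (rule NNN.differential_compose(2)[OF act_diff[OF g Q] act_diff[OF inv_closed[OF g] act_in[OF g Q]] \<xi>])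
  also have "\<dots> = differential B B (\<lambda>Q. Q) Q \<xi>"
    by (rule NN.differential_cong[OF _ Q]) (simp add: act_act g act_one)
  also have "\<dots> = \<xi>" by (rule N.differential_id(2)[OF \<xi> Q])
  finally show ?thesis .
qed

subsection \<open>The isotropy representation\<close>

abbreviation \<iota>0 :: "('g, 'e) tangent \<Rightarrow> ('g set, 'f) tangent"
  where "\<iota>0 \<equiv> dproj \<one>"

lemma \<iota>0_in: "u \<in> \<gg> \<Longrightarrow> \<iota>0 u \<in> tangent_space B H"
  using P.differential_in[OF proj_diff[OF one_closed]] proj_one by (simp add: lie_algebra_def)

lemma \<iota>0_linear: "u \<in> \<gg> \<Longrightarrow> w \<in> \<gg> \<Longrightarrow> \<iota>0 (r *\<^sub>R u + w) = r *\<^sub>R \<iota>0 u + \<iota>0 w"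
  using P.differential_linear[OF proj_diff[OF one_closed]] by (simp add: lie_algebra_def)

lemma \<iota>0_surj: "\<iota>0 ` \<gg> = tangent_space B H"
  using proj_submersion[OF one_closed] proj_one by (simp add: lie_algebra_def)

lemma proj_velocity:
  assumes u: "u \<in> \<gg>" 
  shows "velocity B (\<lambda>t. proj (lie_exp G A (t *\<^sub>R u))) 0 = \<iota>0 u"
proof -
  obtain \<gamma> where g: "one_parameter_subgroup G A u \<gamma>" using one_parameter_exists[OF u] by blast
  have v: "velocity A \<gamma> 0 = u" using g by (simp add: one_parameter_subgroup_def)
  have md: "map_diff A B (\<lambda>g. g <# H) (\<gamma> 0)" unfolding one_parameter_zero[OF g] by (rule proj_diff[OF one_closed])
  show ?thesis
    using P.velocity_compose(2)[OF one_parameter_diff[OF g] md] v one_parameter_zero[OF g]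
    by (simp add: lie_exp_eq[OF u g])
qed

lemma origin_tangent_eq: "u \<in> \<gg> \<Longrightarrow> origin_tangent G A H B u = \<iota>0 u"
  using proj_velocity by (simp add: origin_tangent_def)

text \<open>For u in the isotropy algebra the curve exp(tu)H is constant, so its velocity
  vanishes.\<close>

lemma subgroup_algebra_kernel:
  assumes "u \<in> subgroup_algebra G A H"
  shows "u \<in> \<gg>" "\<iota>0 u = 0"
proof -
  show u: "u \<in> \<gg>" using assms unfolding subgroup_algebra_def by blast
  have in_H: "lie_exp G A (t *\<^sub>R u) \<in> H" for t using assms unfolding subgroup_algebra_def by blast
  have "proj (lie_exp G A (t *\<^sub>R u)) = H" for t
    by (rule coset_join3[OF subsetD[OF H_carrier in_H] H_subgroup in_H])
  then have "\<iota>0 u = velocity B (\<lambda>t. H) 0" using proj_velocity[OF u] by simp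
  then show "\<iota>0 u = 0" using N.curve_diff_const(2)[OF H_in] by simp
qed

lemma reductiveD:
  assumes "reductive_decomposition G A H \<mm>"
  shows "subspace \<mm>" "w \<in> \<mm> \<Longrightarrow> w \<in> \<gg>"
    and "u \<in> \<gg> \<Longrightarrow> \<exists>Z w. Z \<in> subgroup_algebra G A H \<and> w \<in> \<mm> \<and> u = Z + w"
proof -
  show "subspace \<mm>" using assms unfolding reductive_decomposition_def by (elim conjE)
  have "\<mm> \<subseteq> \<gg>" using assms unfolding reductive_decomposition_def by (elim conjE)
  then show "w \<in> \<mm> \<Longrightarrow> w \<in> \<gg>" by (rule subsetD)
  have "\<forall>X\<in>\<gg>. \<exists>Z\<in>subgroup_algebra G A H. \<exists>w\<in>\<mm>. X = Z + w"
    using assms unfolding reductive_decomposition_def by (elim conjE)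
  then show "u \<in> \<gg> \<Longrightarrow> \<exists>Z w. Z \<in> subgroup_algebra G A H \<and> w \<in> \<mm> \<and> u = Z + w" by blast
qed

lemma \<iota>0_diff:
  assumes "u \<in> \<gg>" "w \<in> \<gg>"
  shows "\<iota>0 (u - w) = \<iota>0 u - \<iota>0 w"
proof -
  have "\<iota>0 ((- 1) *\<^sub>R w + u) = (- 1) *\<^sub>R \<iota>0 w + \<iota>0 u" by (rule \<iota>0_linear[OF assms(2,1)])
  then show ?thesis unfolding scaleR_minus1_left by (simp only: uminus_add_conv_diff)
qed

text \<open>Two candidates for the component differ by an element of \<mm> that
  \<open>\<iota>0\<close> kills. Injectivity of \<open>\<iota>0\<close> on \<mm> is a premise here;
  it will come from definiteness of the inner product.\<close>

lemma m_component:
  assumes red: "reductive_decomposition G A H \<mm>" 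
    and inj: "\<And>w. w \<in> \<mm> \<Longrightarrow> \<iota>0 w = 0 \<Longrightarrow> w = 0" and u: "u \<in> \<gg>"
  shows "m_component G A H \<mm> u \<in> \<mm>" "\<iota>0 (m_component G A H \<mm> u) = \<iota>0 u"
proof -
  note m = reductiveD(1,2)[OF red]
  note sub = \<iota>0_diff
  obtain Z w where Zw: "Z \<in> subgroup_algebra G A H" "w \<in> \<mm>" "u = Z + w"
    using reductiveD(3)[OF red u] by blast
  have "\<exists>!w. w \<in> \<mm> \<and> u - w \<in> subgroup_algebra G A H"
  proof (rule ex1I[of _ w])
    have "u - w = Z" using Zw(3) by simp
    then show "w \<in> \<mm> \<and> u - w \<in> subgroup_algebra G A H" using Zw(1,2) by simp
    fix w' assume w': "w' \<in> \<mm> \<and> u - w' \<in> subgroup_algebra G A H"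
    have wg: "w \<in> \<gg>" "w' \<in> \<gg>" using w' Zw(2) m(2) by blast+
    have "\<iota>0 (u - w') = 0" using w' subgroup_algebra_kernel(2) by blast
    moreover have "u - w = Z" using Zw(3) by simp
    then have "\<iota>0 (u - w) = 0" using subgroup_algebra_kernel(2)[OF Zw(1)] by simp
    ultimately have "\<iota>0 (w' - w) = 0"
      unfolding sub[OF wg(2,1)] sub[OF u wg(1)] sub[OF u wg(2)] by simp
    moreover have "w' - w \<in> \<mm>" using subspace_diff[OF m(1)] w' Zw(2) by blast
    ultimately have "w' - w = 0" using inj by blast
    then show "w' = w" by simp
  qed
  then have *: "m_component G A H \<mm> u \<in> \<mm> \<and> u - m_component G A H \<mm> u \<in> subgroup_algebra G A H"
    unfolding m_component_def by (rule theI')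
  then show "m_component G A H \<mm> u \<in> \<mm>" by blast
  have "\<iota>0 (u - m_component G A H \<mm> u) = 0" using * subgroup_algebra_kernel(2) by blast
  moreover have "m_component G A H \<mm> u \<in> \<gg>" using * m(2) by blast
  ultimately show "\<iota>0 (m_component G A H \<mm> u) = \<iota>0 u" by (simp add: sub[OF u])
qed

lemma \<iota>0_m_surj:
  assumes red: "reductive_decomposition G A H \<mm>"
  shows "\<iota>0 ` \<mm> = tangent_space B H"
proof -
  have m: "\<mm> \<subseteq> \<gg>" using reductiveD(2)[OF red] by blast
  have "\<iota>0 u \<in> \<iota>0 ` \<mm>" if u: "u \<in> \<gg>" for u
  proof -
    obtain Z w where Zw: "Z \<in> subgroup_algebra G A H" "w \<in> \<mm>" "u = Z + w"
      using reductiveD(3)[OF red u] by blast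
    have "w \<in> \<gg>" using Zw(2) m by blast
    then have "\<iota>0 u = \<iota>0 Z + \<iota>0 w"
      using \<iota>0_linear[OF subgroup_algebra_kernel(1)[OF Zw(1)], of w 1] Zw(3) by simp
    then show ?thesis using subgroup_algebra_kernel(2)[OF Zw(1)] Zw(2) by simp
  qed
  then have "\<iota>0 ` \<gg> \<subseteq> \<iota>0 ` \<mm>" by (rule image_subsetI)
  moreover have "\<iota>0 ` \<mm> \<subseteq> \<iota>0 ` \<gg>" by (rule image_mono[OF m])
  ultimately show ?thesis using \<iota>0_surj by (simp only: subset_antisym)
qed

subsection \<open>A moving frame\<close>

text \<open>Transporting \<open>T\<^sub>H(G/H)\<close> along the curve \<open>g\<^sub>t\<close> that is straight in a chart \<open>c\<close> of the group:
  \<open>fcurve\<close> is the projected curve and \<open>fmove\<close> the transported vector, both in the chart \<open>d\<close>.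
  The antisymmetric part of the derivative of the frame is the Lie bracket.\<close>

definition fdom :: "('g, 'e) chart \<Rightarrow> ('g set, 'f) chart \<Rightarrow> 'e set"
  where "fdom c d = snd c ` {g \<in> fst c. proj g \<in> fst d}"

definition fvec :: "('g, 'e) chart \<Rightarrow> ('g set, 'f) chart \<Rightarrow> ('g, 'e) tangent \<Rightarrow> 'e \<Rightarrow> 'f"
  where "fvec c d w = (\<lambda>x. frechet_derivative (rep (\<lambda>g. g <# H) c d) (at x) (lifc c w x))"

definition fcurve where "fcurve c d u t = rep (\<lambda>g. g <# H) c d (snd c \<one> + t *\<^sub>R u c)"
definition fmove where "fmove c d u w t = fvec c d w (snd c \<one> + t *\<^sub>R u c)"
definition fgamma where "fgamma c d u w = frechet_derivative (fvec c d w) (at (snd c \<one>)) (u c)"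

text \<open>\<open>fvec c d w\<close> is the projection of the left invariant field of w, whose
  value over g is \<open>\<iota>0 w\<close> moved by g. Its derivative \<open>fgamma\<close>
  consists of the differential of the projection applied to the derivative of the field, and a
  Hessian of the projection; the Hessian is symmetric in u and w, so antisymmetrising leaves the
  bracket. A single \<open>fgamma\<close> depends on the charts, like Christoffel symbols.\<close>

lemma moving_frame:
  assumes c: "c \<in> A" "\<one> \<in> fst c" and d: "d \<in> B" "H \<in> fst d"
    and u: "u \<in> \<gg>" and w: "w \<in> \<gg>"
  shows "\<forall>\<^sub>F t in nhds 0. \<exists>g\<in>carrier G. g <# H \<in> fst d \<and> fcurve c d u t = snd d (g <# H) \<and>
      (\<forall>w\<in>\<gg>. fmove c d u w t = dact g H (\<iota>0 w) d)"
    and "fcurve c d u 0 = snd d H" and "(fcurve c d u has_vector_derivative \<iota>0 u d) (at 0)"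
    and "fmove c d u w 0 = \<iota>0 w d" and "(fmove c d u w has_vector_derivative fgamma c d u w) (at 0)"
    and "fgamma c d u w - fgamma c d w u = \<iota>0 (lbr u w) d"
proof -
  let ?p = "rep (\<lambda>g. g <# H) c d" and ?x0 = "snd c \<one>"
  have W: "open (fdom c d)" "smooth_on (fdom c d) ?p"
    using proj_smooth c(1) d(1) unfolding smooth_map_def Let_def fdom_def by blast+
  have x0: "?x0 \<in> fdom c d" using c d proj_one by (auto simp: fdom_def)
  have \<iota>d: "\<iota>0 w d = frechet_derivative ?p (at ?x0) (w c)" if "w \<in> \<gg>" for w
    using P.differential_apply[OF proj_diff[OF one_closed] _ c d(1)] that d(2) proj_one
    by (simp add: lie_algebra_def)
  have lc: "lifc c w ?x0 = w c" if "w \<in> \<gg>" for w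
    using c by (simp add: lifc_def lif_one[OF that])
  have line: "((\<lambda>t. ?x0 + t *\<^sub>R u c) has_vector_derivative u c) (at t)" for t
    by (auto intro!: derivative_eq_intros)
  then have cont: "isCont (\<lambda>t. ?x0 + t *\<^sub>R u c) 0" by (rule has_vector_derivative_continuous)
  have "\<forall>\<^sub>F t in nhds 0. ?x0 + t *\<^sub>R u c \<in> fdom c d"
    using eventually_nhds_compose_continuous[where f="\<lambda>t. ?x0 + t *\<^sub>R u c" and x=0 and P="\<lambda>x. x \<in> fdom c d", OF _ cont]
      eventually_nhds_in_open[OF W(1) x0] by simp
  then show "\<forall>\<^sub>F t in nhds 0. \<exists>g\<in>carrier G. g <# H \<in> fst d \<and> fcurve c d u t = snd d (g <# H) \<and>
      (\<forall>w\<in>\<gg>. fmove c d u w t = dact g H (\<iota>0 w) d)"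
  proof eventually_elim
    case (elim t)
    then obtain g where g: "g \<in> fst c" "proj g \<in> fst d" "?x0 + t *\<^sub>R u c = snd c g" by (auto simp: fdom_def)
    have gc: "g \<in> carrier G" by (rule chart_carrier[OF c(1) g(1)])
    have "fmove c d u w t = dact g H (\<iota>0 w) d" if w: "w \<in> \<gg>" for w
    proof -
      have "dact g H (\<iota>0 w) = dproj g (lif w g)"
        using dact_dproj[OF gc one_closed, of w] w gc proj_one by (simp add: left_invariant_field_def lie_algebra_def)
      then have "dact g H (\<iota>0 w) d = frechet_derivative ?p (at (snd c g)) (lif w g c)"
        using P.differential_apply[OF proj_diff[OF gc] lif_in[OF w gc] c(1) g(1) d(1) g(2)] by simp
      then show ?thesis using g c by (simp add: fmove_def fvec_def lifc_def)
    qed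
    moreover have "fcurve c d u t = snd d (g <# H)" using g c by (simp add: fcurve_def)
    ultimately show ?case using gc g(2) by blast
  qed
  show "fcurve c d u 0 = snd d H" using c proj_one by (simp add: fcurve_def)
  have dp: "(?p has_derivative frechet_derivative ?p (at ?x0)) (at ?x0)"
    by (rule smooth_on_has_derivative[OF W(2) x0])
  have lp: "linear (frechet_derivative ?p (at ?x0))" by (rule has_derivative_linear[OF dp])
  show "(fcurve c d u has_vector_derivative \<iota>0 u d) (at 0)"
    using line_has_derivative[of ?p ?x0 0 "u c"] smooth_on_imp_differentiable[OF W(2) x0]
    unfolding \<iota>d[OF u] fcurve_def by simp
  show "fmove c d u w 0 = \<iota>0 w d" by (simp add: fmove_def fvec_def lc[OF w] \<iota>d[OF w])
  have D: "(fvec c d w has_derivative (\<lambda>v. frechet_derivative ?p (at ?x0) (frechet_derivative (lifc c w) (at ?x0) v)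
        + frechet_derivative (\<lambda>z. frechet_derivative ?p (at z) (w c)) (at ?x0) v)) (at ?x0)"
    if w: "w \<in> \<gg>" for w
    using frechet_derivative_apply_has_derivative[OF W(1) x0 W(2) frechet_derivative_works_at[OF lifc_differentiable[OF w c]]]
    unfolding fvec_def lc[OF w] .
  have dv: "fvec c d w differentiable (at ?x0)" using D[OF w] unfolding differentiable_def by blast
  show "(fmove c d u w has_vector_derivative fgamma c d u w) (at 0)"
    using line_has_derivative[of "fvec c d w" ?x0 0 "u c"] dv unfolding fmove_def fgamma_def by simp
  have g: "fgamma c d u w = frechet_derivative ?p (at ?x0) (frechet_derivative (lifc c w) (at ?x0) (u c))
        + frechet_derivative (\<lambda>z. frechet_derivative ?p (at z) (w c)) (at ?x0) (u c)"
    if "u \<in> \<gg>" "w \<in> \<gg>" for u w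
    unfolding fgamma_def frechet_derivative_eq[OF D[OF that(2)]] ..
  show "fgamma c d u w - fgamma c d w u = \<iota>0 (lbr u w) d"
    unfolding g[OF u w] g[OF w u] \<iota>d[OF lie_bracket_in[OF u w]] lie_bracket_coord[OF u w c] linear_diff[OF lp]
    using second_derivative_symmetric[OF W(1) x0 W(2), of "u c" "w c"] by simp
qed

end

section \<open>Uniqueness of the Riemannian metric and the 1-form\<close>

text \<open>Five nonzero nodes determine a quartic. The value t = 0 is left out because the identity
  that this serves arises after division by a power of t.\<close>

lemma quartic_zero:
  fixes c0 c1 c2 c3 c4 :: real
  assumes "\<And>t. t \<noteq> 0 \<Longrightarrow> c0 + c1 * t + c2 * t^2 + c3 * t^3 + c4 * t^4 = 0"
  shows "c0 = 0" "c1 = 0" "c2 = 0" "c3 = 0" "c4 = 0"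
  using assms[of 1] assms[of "-1"] assms[of 2] assms[of "-2"] assms[of 3]
  by (auto simp: field_simps)

lemma poly_zero_near_imp_zero:
  fixes p :: "real poly"
  assumes "e > 0" "\<And>t. \<bar>t\<bar> < e \<Longrightarrow> poly p t = 0"
  shows "p = 0"
proof (rule ccontr)
  assume "p \<noteq> 0"
  then have "finite {t. poly p t = 0}" by (rule poly_roots_finite)
  moreover have "{-e<..<e} \<subseteq> {t. poly p t = 0}" using assms(2) by auto
  ultimately have "finite {-e<..<e}" using finite_subset by blast
  then show False using assms(1) by (simp add: infinite_Ioo)
qed

lemma line_in_open:
  fixes y u :: "'v::real_normed_vector"
  assumes "open D" "y \<in> D"
  obtains e where "e > 0" "\<And>t. \<bar>t\<bar> < e \<Longrightarrow> y + t *\<^sub>R u \<in> D"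
proof -
  have "isCont (\<lambda>t. y + t *\<^sub>R u) (0::real)" by (intro continuous_intros)
  then have "\<forall>\<^sub>F t in nhds 0. y + t *\<^sub>R u \<in> D"
    by (rule eventually_nhds_compose_continuous[rotated])
      (use assms in \<open>auto intro: eventually_nhds_in_open\<close>)
  then show ?thesis using that unfolding eventually_nhds_metric by (auto simp: dist_real_def)
qed

text \<open>Along the null space of \<open>\<beta>\<close> the squared relation between the square roots shows that
  \<open>\<beta>' = c \<beta>\<close>; comparing coefficients along lines leaving the null space then forces \<open>c = 1\<close>,
  since otherwise the Cauchy-Schwarz inequality would be an equality for independent vectors.\<close>

lemma metric_and_form_unique:
  fixes a a' :: "'v::euclidean_space \<Rightarrow> 'v \<Rightarrow> real" and b b' :: "'v \<Rightarrow> real"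
  assumes dim: "DIM('v) \<ge> 2"
    and a: "bilinear a" "\<And>x y. a x y = a y x" "\<And>x. x \<noteq> 0 \<Longrightarrow> a x x > 0"
    and a': "bilinear a'" "\<And>x y. a' x y = a' y x" "\<And>x. x \<noteq> 0 \<Longrightarrow> a' x x > 0"
    and b: "linear b" and b': "linear b'"
    and D: "open D" "y0 \<in> D"
    and pos: "\<And>y. y \<in> D \<Longrightarrow> b y > sqrt (a y y)" "\<And>y. y \<in> D \<Longrightarrow> b' y > sqrt (a' y y)"
    and eq: "\<And>y. y \<in> D \<Longrightarrow> (b y)\<^sup>2 / (b y - sqrt (a y y)) = (b' y)\<^sup>2 / (b' y - sqrt (a' y y))"
  shows "b = b'" and "a = a'"
proof -
  note bsimps = bilinear_ladd bilinear_radd bilinear_lmul bilinear_rmul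
  have lb: "b (y + t *\<^sub>R u) = b y + t * b u" "b' (y + t *\<^sub>R u) = b' y + t * b' u" for y u t
    by (simp_all add: linear_add[OF b] linear_scale[OF b] linear_add[OF b'] linear_scale[OF b'])
  have la: "a (y + t *\<^sub>R u) (y + t *\<^sub>R u) = a y y + 2 * t * a y u + t^2 * a u u" for y u t
    using a(2)[of u y] by (simp add: bsimps[OF a(1)] power2_eq_square algebra_simps)
  have la': "a' (y + t *\<^sub>R u) (y + t *\<^sub>R u) = a' y y + 2 * t * a' y u + t^2 * a' u u" for y u t
    using a'(2)[of u y] by (simp add: bsimps[OF a'(1)] power2_eq_square algebra_simps)
  have a_ge: "a y y \<ge> 0" for y using a(3)[of y] bilinear_lzero[OF a(1)] by (cases "y = 0") auto
  have a'_ge: "a' y y \<ge> 0" for y using a'(3)[of y] bilinear_lzero[OF a'(1)] by (cases "y = 0") auto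
  \<comment> \<open>Isolating the two square roots and squaring twice gives an identity that is
    polynomial in y.\<close>
  have onD: "((b' y)^4 * a y y + (b y)^4 * a' y y - (b y)^2 * (b' y)^2 * (b' y - b y)^2)^2
      = 4 * (b y)^4 * (b' y)^4 * a y y * a' y y" if y: "y \<in> D" for y
  proof -
    define B C p q where "B = b y" and "C = b' y" and "p = sqrt (a y y)" and "q = sqrt (a' y y)"
    have pq: "a y y = p^2" "a' y y = q^2" using a_ge a'_ge by (auto simp: p_def q_def)
    have "B - p > 0" "C - q > 0" "B^2 / (B - p) = C^2 / (C - q)"
      using pos[OF y] eq[OF y] by (auto simp: B_def C_def p_def q_def)
    then have "B^2 * (C - q) = C^2 * (B - p)" by (simp add: field_simps)
    then have "C^2 * p - B^2 * q = B * C * (C - B)" by (simp add: algebra_simps power2_eq_square)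
    then have "(C^2 * p - B^2 * q)^2 = (B * C * (C - B))^2" by simp
    then have "C^4 * p^2 + B^4 * q^2 - B^2 * C^2 * (C - B)^2 = 2 * B^2 * C^2 * p * q"
      by (simp add: power2_eq_square power4_eq_xxxx algebra_simps)
    then have "(C^4 * p^2 + B^4 * q^2 - B^2 * C^2 * (C - B)^2)^2 = (2 * B^2 * C^2 * p * q)^2" by simp
    also have "\<dots> = 4 * B^4 * C^4 * p^2 * q^2" by (simp add: power2_eq_square power4_eq_xxxx algebra_simps)
    finally show ?thesis by (simp add: pq B_def C_def)
  qed
  \<comment> \<open>Along the line from y0 to y both sides are polynomials in the parameter that
    agree near 0, hence also at 1.\<close>
  have everywhere: "((b' y)^4 * a y y + (b y)^4 * a' y y - (b y)^2 * (b' y)^2 * (b' y - b y)^2)^2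
      = 4 * (b y)^4 * (b' y)^4 * a y y * a' y y" for y
  proof -
    define u where "u = y - y0"
    define B C p q where "B = [:b y0, b u:]" and "C = [:b' y0, b' u:]" and
      "p = [:a y0 y0, 2 * a y0 u, a u u:]" and "q = [:a' y0 y0, 2 * a' y0 u, a' u u:]"
    have ev: "poly B t = b (y0 + t *\<^sub>R u)" "poly C t = b' (y0 + t *\<^sub>R u)"
      "poly p t = a (y0 + t *\<^sub>R u) (y0 + t *\<^sub>R u)" "poly q t = a' (y0 + t *\<^sub>R u) (y0 + t *\<^sub>R u)" for t
      by (simp_all add: B_def C_def p_def q_def lb la la' algebra_simps power2_eq_square)
    define P where "P = (C^4 * p + B^4 * q - B^2 * C^2 * (C - B)^2)^2 - 4 * B^4 * C^4 * p * q"
    obtain e where e: "e > 0" "\<And>t. \<bar>t\<bar> < e \<Longrightarrow> y0 + t *\<^sub>R u \<in> D"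
      using line_in_open[OF D] by blast
    have "poly P t = 0" if "\<bar>t\<bar> < e" for t
      using onD[OF e(2)[OF that]] by (simp add: P_def ev)
    then have "P = 0" by (rule poly_zero_near_imp_zero[OF e(1)])
    then have "poly P 1 = 0" by simp
    then show ?thesis by (simp add: P_def ev u_def)
  qed
  \<comment> \<open>Where b vanishes the identity reads (b'^4 a)^2 = 0.\<close>
  have ker: "b' y = 0" if "b y = 0" for y
  proof (cases "y = 0")
    case False
    then have "a y y > 0" by (rule a(3))
    then show ?thesis using everywhere[of y] that by simp
  qed (simp add: linear_0[OF b'])
  have by0: "b y0 > 0" "b' y0 > 0"
    using pos[OF D(2)] real_sqrt_ge_zero[OF a_ge[of y0]] real_sqrt_ge_zero[OF a'_ge[of y0]] by linarith+
  define c where "c = b' y0 / b y0"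
  have c: "c > 0" using by0 by (simp add: c_def)
  have bc: "b' y = c * b y" for y
  proof -
    have "b (y + (- (b y / b y0)) *\<^sub>R y0) = 0" using by0 by (simp only: lb) simp
    then have "b' (y + (- (b y / b y0)) *\<^sub>R y0) = 0" by (rule ker)
    then show ?thesis using by0 unfolding lb by (simp add: c_def field_simps)
  qed
  \<comment> \<open>Here dimension at least two enters: the kernel of b contains a nonzero vector,
    and the identity is examined on a line leaving it.\<close>
  have "\<exists>w. w \<noteq> 0 \<and> b w = 0"
  proof -
    have "\<not> inj b"
    proof
      assume "inj b"
      then have "dim (UNIV :: 'v set) \<le> dim (UNIV :: real set)"
        using dim_image_eq[OF b, of UNIV] dim_subset_UNIV[of "range b"] by (simp add: dim_UNIV)
      then show False using dim by (simp add: dim_UNIV)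
    qed
    then show ?thesis using linear_injective_0[OF b] by blast
  qed
  then obtain w where w: "w \<noteq> 0" "b w = 0" by blast
  \<comment> \<open>With b' = c b the identity, divided by B^8, becomes (c^4 p - q - k^2 B^2)^2 = 4
    k^2 B^2 q for k = c (c - 1). On the line B = t b(y0), so k B = \<kappa> t.\<close>
  define k where "k = c * (c - 1)"
  define \<kappa> where "\<kappa> = k * b y0"
  define e0 e1 e2 where "e0 = c^4 * a w w - a' w w" and "e1 = c^4 * a w y0 - a' w y0"
    and "e2 = c^4 * a y0 y0 - a' y0 y0 - \<kappa>^2"
  define q0 q1 q2 where "q0 = a' w w" and "q1 = a' w y0" and "q2 = a' y0 y0"
  have line: "(e0 + 2 * t * e1 + t^2 * e2)^2 = 4 * (\<kappa> * t)^2 * (q0 + 2 * t * q1 + t^2 * q2)" if t: "t \<noteq> 0" for t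
  proof -
    define z where "z = w + t *\<^sub>R y0"
    define B p q where "B = b z" and "p = a z z" and "q = a' z z"
    have B: "B = t * b y0" using w by (simp add: B_def z_def lb)
    then have B0: "B \<noteq> 0" using t by0 by simp
    have "((c * B)^4 * p + B^4 * q - B^2 * (c * B)^2 * (c * B - B)^2)^2 = 4 * B^4 * (c * B)^4 * p * q"
      using everywhere[of z] by (simp add: bc B_def p_def q_def)
    moreover have "(c * B)^4 * p + B^4 * q - B^2 * (c * B)^2 * (c * B - B)^2 = B^4 * (c^4 * p + q - k^2 * B^2)"
      by (simp add: k_def power2_eq_square power4_eq_xxxx algebra_simps)
    moreover have "4 * B^4 * (c * B)^4 * p * q = B^4 * B^4 * (4 * c^4 * p * q)"
      by (simp add: power_mult_distrib algebra_simps)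
    ultimately have "(B^4 * B^4) * (c^4 * p + q - k^2 * B^2)^2 = (B^4 * B^4) * (4 * c^4 * p * q)"
      by (simp add: power_mult_distrib power2_eq_square mult_ac)
    then have "(c^4 * p + q - k^2 * B^2)^2 = 4 * c^4 * p * q" using B0 by simp
    then have "(c^4 * p - q - k^2 * B^2)^2 = 4 * (k * B)^2 * q"
      by (simp add: power2_eq_square algebra_simps)
    moreover have "k * B = \<kappa> * t" by (simp add: B \<kappa>_def)
    moreover have "p = a w w + 2 * t * a w y0 + t^2 * a y0 y0" "q = q0 + 2 * t * q1 + t^2 * q2"
      unfolding p_def q_def z_def la la' q0_def q1_def q2_def by simp_all
    moreover have "k^2 * B^2 = t^2 * \<kappa>^2" by (simp add: B \<kappa>_def power_mult_distrib)
    ultimately have "(c^4 * (a w w + 2 * t * a w y0 + t^2 * a y0 y0) - (q0 + 2 * t * q1 + t^2 * q2) - t^2 * \<kappa>^2)^2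
       = 4 * (\<kappa> * t)^2 * (q0 + 2 * t * q1 + t^2 * q2)" by simp
    moreover have "c^4 * (a w w + 2 * t * a w y0 + t^2 * a y0 y0) - (q0 + 2 * t * q1 + t^2 * q2) - t^2 * \<kappa>^2
       = e0 + 2 * t * e1 + t^2 * e2"
      by (simp add: e0_def e1_def e2_def q0_def q1_def q2_def algebra_simps)
    ultimately show ?thesis by simp
  qed
  have coeff: "e0^2 + (4 * e0 * e1) * t + (4 * e1^2 + 2 * e0 * e2 - 4 * \<kappa>^2 * q0) * t^2
     + (4 * e1 * e2 - 8 * \<kappa>^2 * q1) * t^3 + (e2^2 - 4 * \<kappa>^2 * q2) * t^4 = 0" if "t \<noteq> 0" for t
    using line[OF that] by (simp add: power2_eq_square power3_eq_cube power4_eq_xxxx algebra_simps)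
  note co = quartic_zero[OF coeff]
  have e0: "e0 = 0" using co(1) by simp
  have e1: "e1^2 = \<kappa>^2 * q0" "e1 * e2 = 2 * \<kappa>^2 * q1" "e2^2 = 4 * \<kappa>^2 * q2"
    using co(3-5) e0 by simp_all
  \<comment> \<open>If \<kappa> were nonzero, the coefficients would give equality in Cauchy-Schwarz
    for a' on w and y0, making them dependent; but b vanishes on w and not on y0.\<close>
  have "\<kappa> = 0"
  proof (rule ccontr)
    assume k0: "\<kappa> \<noteq> 0"
    have "(2 * \<kappa>^2 * q1)^2 = (\<kappa>^2 * q0) * (4 * \<kappa>^2 * q2)"
      unfolding e1(1,3)[symmetric] e1(2)[symmetric] by (simp add: power_mult_distrib)
    then have "(4 * \<kappa>^4) * q1^2 = (4 * \<kappa>^4) * (q0 * q2)"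
      by (simp add: power2_eq_square power4_eq_xxxx algebra_simps)
    then have cs: "q1^2 = q0 * q2" using k0 by simp
    define x where "x = q0 *\<^sub>R y0 + (- q1) *\<^sub>R w"
    have "a' x x = q0^2 * q2 - 2 * q0 * q1^2 + q1^2 * q0"
      using a'(2)[of y0 w] by (simp add: x_def bsimps[OF a'(1)] bilinear_lsub[OF a'(1)] bilinear_rsub[OF a'(1)]
          q0_def q1_def q2_def power2_eq_square algebra_simps)
    also have "\<dots> = 0" unfolding cs by (simp add: power2_eq_square algebra_simps)
    finally have "x = 0" using a'(3)[of x] by fastforce
    then have "b x = 0" by (simp add: linear_0[OF b])
    moreover have "b x = q0 * b y0"
      using w by (simp add: x_def linear_add[OF b] linear_scale[OF b] linear_neg[OF b] linear_diff[OF b])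
    ultimately show False using a'(3)[OF w(1)] by0 by (simp add: q0_def)
  qed
  then have "c = 1" using by0 c by (simp add: \<kappa>_def k_def)
  then show bb: "b = b'" using bc by auto
  \<comment> \<open>With equal forms the common value of F determines the square root, so the two
    quadratic forms agree on D; polynomial continuation and polarisation do the rest.\<close>
  have "a y y = a' y y" if y: "y \<in> D" for y
  proof -
    have "b y > 0" using pos(1)[OF y] real_sqrt_ge_zero[OF a_ge[of y]] by linarith
    then have "b y - sqrt (a y y) = b y - sqrt (a' y y)"
      using eq[OF y] pos[OF y] bb by (simp add: field_simps)
    then show ?thesis by simp
  qed
  then have diag: "a y y = a' y y" for y
  proof -
    assume on: "\<And>y. y \<in> D \<Longrightarrow> a y y = a' y y"
    define u where "u = y - y0"
    define P where "P = [:a y0 y0 - a' y0 y0, 2 * a y0 u - 2 * a' y0 u, a u u - a' u u:]"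
    have ev: "poly P t = a (y0 + t *\<^sub>R u) (y0 + t *\<^sub>R u) - a' (y0 + t *\<^sub>R u) (y0 + t *\<^sub>R u)" for t
      by (simp add: P_def la la' algebra_simps power2_eq_square)
    obtain e where e: "e > 0" "\<And>t. \<bar>t\<bar> < e \<Longrightarrow> y0 + t *\<^sub>R u \<in> D"
      using line_in_open[OF D] by blast
    have "poly P t = 0" if "\<bar>t\<bar> < e" for t
      using on[OF e(2)[OF that]] by (simp add: ev)
    then have "P = 0" by (rule poly_zero_near_imp_zero[OF e(1)])
    then have "poly P 1 = 0" by simp
    then show ?thesis by (simp only: ev) (simp add: u_def)
  qed
  show "a = a'"
  proof (intro ext)
    fix x y
    show "a x y = a' x y"
      using diag[of "x + 1 *\<^sub>R y"] diag[of x] diag[of y] unfolding la la' by simp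
  qed
qed

section \<open>Determinants\<close>

definition outer :: "real ^ 'n \<Rightarrow> real ^ 'n \<Rightarrow> real ^ 'n ^ 'n"
  where "outer u v = (\<chi> i j. u $ i * v $ j)"

lemma outer_mult_left: "A ** outer u v = outer (A *v u) v"
  by (simp add: vec_eq_iff outer_def matrix_matrix_mult_def matrix_vector_mult_def sum_distrib_left sum_distrib_right mult_ac)

lemma outer_mult_right: "outer u v ** A = outer u (transpose A *v v)"
  by (simp add: vec_eq_iff outer_def matrix_matrix_mult_def matrix_vector_mult_def transpose_def sum_distrib_left mult_ac)

lemma outer_mult_outer: "outer u v ** outer x y = (v \<bullet> x) *\<^sub>R outer u y"
  by (simp add: vec_eq_iff outer_def matrix_matrix_mult_def inner_vec_def sum_distrib_left sum_distrib_right mult_ac)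

lemma matrix_mult_add_left: "(B + C) ** A = B ** A + C ** (A :: real ^ 'n ^ 'm)"
  by (simp add: vec_eq_iff matrix_matrix_mult_def distrib_right sum.distrib)

lemma matrix_mult_scaleR_left: "(r *\<^sub>R B) ** A = r *\<^sub>R (B ** (A :: real ^ 'n ^ 'm))"
  by (simp add: vec_eq_iff matrix_matrix_mult_def sum_distrib_left mult_ac)

lemma matrix_mult_scaleR_right: "B ** (r *\<^sub>R A) = r *\<^sub>R (B ** (A :: real ^ 'n ^ 'm))"
  by (simp add: vec_eq_iff matrix_matrix_mult_def sum_distrib_left mult_ac)

lemma outer_scale: "outer (r *\<^sub>R u) v = r *\<^sub>R outer u v"
  by (simp add: vec_eq_iff outer_def mult_ac)

lemma det_identity_row:
  fixes r :: "real ^ 'n"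
  shows "det (\<chi> i. if i = k then r else axis i 1) = r $ k"
proof -
  define A :: "real ^ 'n ^ 'n" where "A = (\<chi> i. if i = k then r $ k *s axis k 1 else axis i 1)"
  let ?x = "\<Sum>j\<in>UNIV - {k}. r $ j *\<^sub>R axis j (1::real)"
  have row: "row i A = (if i = k then r $ k *s axis k 1 else axis i 1)" for i
    by (simp add: row_def vec_eq_iff A_def)
  have "?x \<in> span {row j A | j. j \<noteq> k}"
  proof (intro span_sum span_scale span_base)
    fix j assume "j \<in> UNIV - {k}"
    then have "axis j 1 = row j A" "j \<noteq> k" by (auto simp: row)
    then show "axis j 1 \<in> {row j A | j. j \<noteq> k}" by blast
  qed
  then have "det (\<chi> i. if i = k then row k A + ?x else row i A) = det A"
    by (intro det_row_span) (simp only: span_vec_eq)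
  moreover have req: "r = row k A + ?x"
  proof -
    have "r = (\<Sum>j\<in>UNIV. r $ j *\<^sub>R axis j 1)"
      using basis_expansion[of r] by (simp add: scalar_mult_eq_scaleR)
    also have "\<dots> = r $ k *\<^sub>R axis k 1 + ?x" by (subst sum.remove[of _ k]) auto
    finally show ?thesis by (simp add: row scalar_mult_eq_scaleR)
  qed
  have "(if i = k then row k A + ?x else row i A) = (if i = k then r else axis i 1)" for i
  proof (cases "i = k")
    case True
    show ?thesis unfolding if_P[OF True] by (rule req[symmetric])
  next
    case False
    then show ?thesis by (simp add: row)
  qed
  then have "(\<chi> i. if i = k then row k A + ?x else row i A) = (\<chi> i. if i = k then r else axis i 1)"
    by presburger
  moreover have "det A = r $ k * det (\<chi> i. if i = k then axis k 1 else (axis i 1 :: real ^ 'n))"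
    unfolding A_def by (rule det_row_mul)
  moreover have "(\<chi> i. if i = k then axis k 1 else (axis i 1 :: real ^ 'n)) = mat 1"
    by (auto simp: vec_eq_iff mat_def axis_def)
  ultimately show ?thesis by simp
qed

text \<open>An orthogonal map carries u to a multiple of a coordinate vector; the matrix then
  differs from the identity in one row only.\<close>

lemma det_identity_plus_outer:
  fixes u v :: "real ^ 'n"
  shows "det (mat 1 + outer u v) = 1 + u \<bullet> v"
proof -
  fix k :: 'n
  obtain f :: "real ^ 'n \<Rightarrow> real ^ 'n" where f: "orthogonal_transformation f" "f u = norm u *\<^sub>R axis k 1"
    using orthogonal_transformation_exists[of u "norm u *\<^sub>R axis k 1"] by auto
  define P where "P = matrix f"
  have P: "orthogonal_matrix P" "P *v x = f x" for x
    using f(1) by (auto simp: P_def orthogonal_transformation_matrix matrix_works orthogonal_transformation_linear)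
  have PP: "P ** transpose P = mat 1" using P(1) by (simp add: orthogonal_matrix_def)
  have "P ** (mat 1 + outer u v) ** transpose P = mat 1 + outer (f u) (f v)"
    by (simp add: matrix_add_ldistrib matrix_mult_add_left PP outer_mult_left outer_mult_right P(2))
  then have "det (mat 1 + outer (f u) (f v)) = det P * det (mat 1 + outer u v) * det (transpose P)"
    by (metis det_mul)
  also have "\<dots> = det (mat 1 + outer u v) * (det P * det (transpose P))" by simp
  also have "det P * det (transpose P) = 1" using PP by (metis det_I det_mul)
  finally have "det (mat 1 + outer u v) = det (mat 1 + outer (f u) (f v))" by simp
  also have "mat 1 + outer (f u) (f v) = (\<chi> i. if i = k then axis k 1 + norm u *\<^sub>R f v else axis i 1)"
    by (auto simp: vec_eq_iff f(2) outer_def mat_def axis_def)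
  also have "det \<dots> = 1 + norm u * f v $ k" by (simp add: det_identity_row)
  also have "norm u * f v $ k = f u \<bullet> f v" by (simp add: f(2) inner_axis')
  also have "\<dots> = u \<bullet> v" using f(1) by (simp add: orthogonal_transformation_def)
  finally show ?thesis .
qed

lemma det_scaleR: "det (r *\<^sub>R A) = r ^ CARD('n) * det (A :: real ^ 'n ^ 'n)"
proof -
  have "r *\<^sub>R A = (\<chi> i. r *s (A $ i))" by (simp add: vec_eq_iff)
  then show ?thesis using det_rows_mul[of "\<lambda>_. r" "\<lambda>i. A $ i"] by simp
qed

text \<open>The matrix has the shape of the fundamental tensor in terms of p and \<theta>. It
  factors into two shears carrying \<mu> and two rank-one perturbations of the identity;
  orthogonality of p and \<theta> makes the shears unimodular.\<close>

lemma det_split_metric: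
  fixes p \<theta> :: "real ^ 'n"
  assumes "p \<bullet> p = 1" "p \<bullet> \<theta> = 0" "\<rho> \<noteq> 0"
  shows "det (\<chi> i j. (if i = j then \<rho> else 0) + (c - \<rho>) * (p $ i * p $ j) + (\<kappa> + \<mu>\<^sup>2 * c) * (\<theta> $ i * \<theta> $ j)
      + \<mu> * c * (p $ i * \<theta> $ j + \<theta> $ i * p $ j)) = \<rho> ^ CARD('n) * (c / \<rho>) * (1 + \<kappa> * (\<theta> \<bullet> \<theta>) / \<rho>)"
proof -
  let ?I = "mat 1 :: real ^ 'n ^ 'n"
  have \<theta>p: "\<theta> \<bullet> p = 0" using assms(2) by (simp add: inner_commute)
  let ?Q = "(?I + outer (\<mu> *\<^sub>R \<theta>) p) ** (\<rho> *\<^sub>R (?I + outer (((c - \<rho>) / \<rho>) *\<^sub>R p) p))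
      ** (?I + outer ((\<kappa> / \<rho>) *\<^sub>R \<theta>) \<theta>) ** (?I + outer (\<mu> *\<^sub>R p) \<theta>)"
  have "?Q = \<rho> *\<^sub>R ?I + (c - \<rho>) *\<^sub>R outer p p + (\<kappa> + \<mu>\<^sup>2 * c) *\<^sub>R outer \<theta> \<theta> + (\<mu> * c) *\<^sub>R (outer p \<theta> + outer \<theta> p)"
    using assms(3)
    by (simp add: matrix_add_ldistrib matrix_mult_add_left outer_scale outer_mult_outer assms \<theta>p
        matrix_mult_scaleR_left matrix_mult_scaleR_right scaleR_add_right inner_commute)
      (simp add: vec_eq_iff field_simps power2_eq_square)
  also have "\<dots> = (\<chi> i j. (if i = j then \<rho> else 0) + (c - \<rho>) * (p $ i * p $ j) + (\<kappa> + \<mu>\<^sup>2 * c) * (\<theta> $ i * \<theta> $ j)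
      + \<mu> * c * (p $ i * \<theta> $ j + \<theta> $ i * p $ j))"
    by (simp add: vec_eq_iff outer_def mat_def)
  finally have "det (\<chi> i j. (if i = j then \<rho> else 0) + (c - \<rho>) * (p $ i * p $ j) + (\<kappa> + \<mu>\<^sup>2 * c) * (\<theta> $ i * \<theta> $ j)
      + \<mu> * c * (p $ i * \<theta> $ j + \<theta> $ i * p $ j)) = det ?Q" by simp
  also have "\<dots> = (1 + \<mu> * (\<theta> \<bullet> p)) * (\<rho> ^ CARD('n) * (1 + (c - \<rho>) / \<rho> * (p \<bullet> p)))
      * (1 + \<kappa> / \<rho> * (\<theta> \<bullet> \<theta>)) * (1 + \<mu> * (p \<bullet> \<theta>))"
    by (simp only: det_mul det_scaleR det_identity_plus_outer inner_scaleR_left)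
  also have "\<dots> = \<rho> ^ CARD('n) * (c / \<rho>) * (1 + \<kappa> * (\<theta> \<bullet> \<theta>) / \<rho>)"
    using assms(3) by (simp add: assms \<theta>p field_simps)
  finally show ?thesis .
qed

section \<open>The metric on a single tangent space\<close>

text \<open>\<open>\<beta> = w \<bullet> z\<close> and \<open>\<alpha> = norm z\<close>. The Hessian is expressed by \<open>p = z / \<alpha>\<close> and the part
  \<open>\<theta> = w - s p\<close> of \<open>w\<close> orthogonal to \<open>p\<close>; with \<open>\<phi> = s\<^sup>2/(s - 1)\<close> the coefficients are
  \<open>\<rho> = \<phi>(\<phi> - s\<phi>')\<close>, \<open>c = \<phi>\<^sup>2\<close>, \<open>\<mu> = \<phi>'/\<phi>\<close>, \<open>\<kappa> = \<phi>\<phi>''\<close>.\<close>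

definition sf :: "'v::real_inner \<Rightarrow> 'v \<Rightarrow> real" where "sf w z = (w \<bullet> z) / norm z"
definition pf :: "'v::real_inner \<Rightarrow> 'v" where "pf z = (1 / norm z) *\<^sub>R z"
definition thf :: "'v::real_inner \<Rightarrow> 'v \<Rightarrow> 'v" where "thf w z = w - sf w z *\<^sub>R pf z"
definition rhof :: "real \<Rightarrow> real" where "rhof s = s^4 / (s - 1)^3"
definition cf :: "real \<Rightarrow> real" where "cf s = s^4 / (s - 1)^2"
definition muf :: "real \<Rightarrow> real" where "muf s = (s - 2) / (s * (s - 1))"
definition kapf :: "real \<Rightarrow> real" where "kapf s = 2 * s^2 / (s - 1)^4"

definition Lf :: "'v::real_inner \<Rightarrow> 'v \<Rightarrow> real"
  where "Lf w z = ((w \<bullet> z)\<^sup>2 / (w \<bullet> z - norm z))\<^sup>2"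

definition dLf :: "'v::real_inner \<Rightarrow> 'v \<Rightarrow> 'v \<Rightarrow> real"
  where "dLf w z u = 2 * norm z * cf (sf w z) * (pf z \<bullet> u + muf (sf w z) * (thf w z \<bullet> u))"

definition hLf :: "'v::real_inner \<Rightarrow> 'v \<Rightarrow> 'v \<Rightarrow> 'v \<Rightarrow> real"
  where "hLf w z u v = (let s = sf w z; p = pf z; \<theta> = thf w z in
    2 * (rhof s * (u \<bullet> v) + (cf s - rhof s) * ((p \<bullet> u) * (p \<bullet> v))
      + (kapf s + (muf s)\<^sup>2 * cf s) * ((\<theta> \<bullet> u) * (\<theta> \<bullet> v))
      + muf s * cf s * ((p \<bullet> u) * (\<theta> \<bullet> v) + (\<theta> \<bullet> u) * (p \<bullet> v))))"

section \<open>First and second fibre derivatives of F^2\<close>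

lemma has_derivative_norm_at:
  "z \<noteq> 0 \<Longrightarrow> (norm has_derivative (\<lambda>u. (z \<bullet> u) / norm z)) (at (z::'v::real_inner))"
  using has_derivative_norm[of z] by (simp add: sgn_div_norm inner_commute divide_inverse mult.commute)

text \<open>Dictionary from inner products with z and w to the orthogonal pair p, \<theta>;
  rewritten with it, the derivative formulas become algebraic identities.\<close>

lemma fiber_atoms:
  fixes z w :: "'v::real_inner"
  assumes "z \<noteq> 0"
  shows "w \<bullet> z = sf w z * norm z" "z \<bullet> u = norm z * (pf z \<bullet> u)"
    "w \<bullet> u = thf w z \<bullet> u + sf w z * (pf z \<bullet> u)"
    "pf z \<bullet> pf z = 1" "pf z \<bullet> thf w z = 0" "pf z \<bullet> w = sf w z"
    "thf w z \<bullet> w = w \<bullet> w - (sf w z)\<^sup>2" "thf w z \<bullet> thf w z = w \<bullet> w - (sf w z)\<^sup>2"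
proof -
  have n: "norm z \<noteq> 0" using assms by simp
  show 1: "w \<bullet> z = sf w z * norm z" using n by (simp add: sf_def)
  show "z \<bullet> u = norm z * (pf z \<bullet> u)" using n by (simp add: pf_def)
  show "w \<bullet> u = thf w z \<bullet> u + sf w z * (pf z \<bullet> u)" by (simp add: thf_def inner_diff_left)
  show 4: "pf z \<bullet> pf z = 1" using n by (simp add: pf_def dot_square_norm power2_eq_square)
  show 6: "pf z \<bullet> w = sf w z" by (simp add: pf_def sf_def inner_commute)
  show 5: "pf z \<bullet> thf w z = 0" by (simp add: thf_def inner_diff_right 4 6)
  show 7: "thf w z \<bullet> w = w \<bullet> w - (sf w z)\<^sup>2"
    by (simp add: thf_def inner_diff_left 6 power2_eq_square)
  show "thf w z \<bullet> thf w z = w \<bullet> w - (sf w z)\<^sup>2"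
    using 5 7 by (simp add: thf_def[of w z] inner_diff_right inner_commute)
qed

lemma sf_has_derivative:
  assumes "z \<noteq> 0"
  shows "(sf w has_derivative (\<lambda>u. (thf w z \<bullet> u) / norm z)) (at (z::'v::real_inner))"
proof -
  have n: "norm z \<noteq> 0" using assms by simp
  have "((\<lambda>z. (w \<bullet> z) / norm z) has_derivative
      (\<lambda>u. ((w \<bullet> u) * norm z - (w \<bullet> z) * ((z \<bullet> u) / norm z)) / (norm z * norm z))) (at z)"
    by (rule has_derivative_divide'[OF has_derivative_inner_right[OF has_derivative_ident] has_derivative_norm_at[OF assms] n])
  then show ?thesis
    unfolding sf_def[abs_def]
  proof (rule has_derivative_eq_rhs, intro ext)
    fix u
    show "((w \<bullet> u) * norm z - (w \<bullet> z) * ((z \<bullet> u) / norm z)) / (norm z * norm z) = (thf w z \<bullet> u) / norm z"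
      unfolding fiber_atoms(1)[OF assms, of w] fiber_atoms(2)[OF assms, of u] fiber_atoms(3)[OF assms, of w u]
      using n by (simp add: field_simps)
  qed
qed

lemma Lf_sf:
  assumes "z \<noteq> 0"
  shows "Lf w z = (norm z)\<^sup>2 * cf (sf w z)"
proof -
  have n: "norm z \<noteq> 0" using assms by simp
  have "sf w z * norm z - norm z = norm z * (sf w z - 1)" by (simp add: algebra_simps)
  then show ?thesis
    using n by (simp add: Lf_def fiber_atoms(1)[OF assms] cf_def power_mult_distrib power_divide)
      (simp add: power2_eq_square power4_eq_xxxx)
qed

text \<open>\<open>muf s * cf s\<close> is \<phi>\<phi>', half the derivative of \<phi>^2. It is
  treated as one quantity, since the factor s in the denominator of \<open>muf\<close>
  cancels.\<close>

lemma mucf_eq: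
  assumes "s \<noteq> 0"
  shows "muf s * cf s = (s^4 - 2 * s^3) / (s - 1)^3"
proof -
  define d where "d = s - 1"
  have "muf s * cf s = (s - 2) * s^3 / d^3"
    using assms by (simp add: muf_def cf_def d_def[symmetric] power2_eq_square power3_eq_cube power4_eq_xxxx)
  then show ?thesis by (simp add: d_def power3_eq_cube power4_eq_xxxx left_diff_distrib)
qed

lemma cf_has_derivative:
  assumes "s \<noteq> 0" "s \<noteq> 1"
  shows "(cf has_real_derivative 2 * (muf s * cf s)) (at s)"
proof -
  define d where "d = s - 1"
  have d: "d \<noteq> 0" "s = d + 1" using assms by (auto simp: d_def)
  have "((\<lambda>s. s^4 / (s - 1)^2) has_real_derivative
      (4 * s^3 * (s - 1)^2 - s^4 * (2 * (s - 1))) / ((s - 1)^2 * (s - 1)^2)) (at s)"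
    by (rule DERIV_divide) (use assms in \<open>auto intro!: derivative_eq_intros\<close>)
  moreover have "(4 * s^3 * (s - 1)^2 - s^4 * (2 * (s - 1))) / ((s - 1)^2 * (s - 1)^2) = 2 * ((s^4 - 2 * s^3) / (s - 1)^3)"
  proof -
    have "4 * s^3 * d^2 - s^4 * (2 * d) = d * (2 * (s^4 - 2 * s^3))"
      by (simp add: d_def power2_eq_square power3_eq_cube power4_eq_xxxx algebra_simps)
    then show ?thesis unfolding d_def[symmetric] using d(1) by (simp add: power2_eq_square power3_eq_cube)
  qed
  ultimately have "((\<lambda>s. s^4 / (s - 1)^2) has_real_derivative 2 * (muf s * cf s)) (at s)"
    by (simp only: mucf_eq[OF assms(1)])
  then show ?thesis
    by (rule has_field_derivative_transform_within_open[OF _ open_UNIV UNIV_I]) (simp add: cf_def)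
qed

lemma kapf_eq: "s \<noteq> 0 \<Longrightarrow> kapf s + (muf s)\<^sup>2 * cf s = (s^4 - 4 * s^3 + 6 * s^2) / (s - 1)^4"
proof -
  assume s: "s \<noteq> 0"
  have "(muf s)\<^sup>2 * cf s = (s - 2)^2 * s^2 / (s - 1)^4"
    using s by (simp add: muf_def cf_def power2_eq_square power4_eq_xxxx mult_ac)
  then show ?thesis
    by (simp add: kapf_def add_divide_distrib[symmetric])
      (simp add: power2_eq_square power3_eq_cube power4_eq_xxxx algebra_simps)
qed

text \<open>The right side is \<phi>\<phi>'' + \<phi>'^2, the derivative of \<phi>\<phi>'.\<close>

lemma mucf_has_derivative:
  assumes "s \<noteq> 0" "s \<noteq> 1"
  shows "((\<lambda>s. muf s * cf s) has_real_derivative kapf s + (muf s)\<^sup>2 * cf s) (at s)"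
proof -
  define d where "d = s - 1"
  have d: "d \<noteq> 0" "s = d + 1" using assms by (auto simp: d_def)
  have "((\<lambda>s. (s^4 - 2 * s^3) / (s - 1)^3) has_real_derivative
      ((4 * s^3 - 6 * s^2) * (s - 1)^3 - (s^4 - 2 * s^3) * (3 * (s - 1)^2)) / ((s - 1)^3 * (s - 1)^3)) (at s)"
    by (rule DERIV_divide) (use assms in \<open>auto intro!: derivative_eq_intros\<close>)
  moreover have "((4 * s^3 - 6 * s^2) * (s - 1)^3 - (s^4 - 2 * s^3) * (3 * (s - 1)^2)) / ((s - 1)^3 * (s - 1)^3)
      = (s^4 - 4 * s^3 + 6 * s^2) / (s - 1)^4"
  proof -
    have "(4 * s^3 - 6 * s^2) * d - (s^4 - 2 * s^3) * 3 = s^4 - 4 * s^3 + 6 * s^2"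
      by (simp add: d_def power2_eq_square power3_eq_cube power4_eq_xxxx algebra_simps)
    moreover have "a * d^3 - b * (3 * d^2) = d^2 * (a * d - b * 3)" for a b :: real
      by (simp add: power2_eq_square power3_eq_cube algebra_simps)
    ultimately have "(4 * s^3 - 6 * s^2) * d^3 - (s^4 - 2 * s^3) * (3 * d^2) = d^2 * (s^4 - 4 * s^3 + 6 * s^2)"
      by simp
    then show ?thesis unfolding d_def[symmetric] using d(1) by (simp add: power2_eq_square power3_eq_cube power4_eq_xxxx)
  qed
  ultimately have "((\<lambda>s. (s^4 - 2 * s^3) / (s - 1)^3) has_real_derivative kapf s + (muf s)\<^sup>2 * cf s) (at s)"
    by (simp only: kapf_eq[OF assms(1)])
  then show ?thesis
    by (rule has_field_derivative_transform_within_open[where S="- {0}"]) (use assms in \<open>auto simp: mucf_eq\<close>)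
qed

lemma rhof_eq: 
  assumes "s \<noteq> 0" "s \<noteq> 1"
  shows "rhof s = cf s - s * (muf s * cf s)"
proof -
  define d where "d = s - 1"
  have d: "d \<noteq> 0" using assms by (auto simp: d_def)
  have c: "cf s = s^4 * d / d^3" using d by (simp add: cf_def d_def[symmetric] power2_eq_square power3_eq_cube)
  have "s^4 * d - s * (s^4 - 2 * s^3) = s^4"
    by (simp add: d_def power2_eq_square power3_eq_cube power4_eq_xxxx algebra_simps)
  then show ?thesis
    unfolding mucf_eq[OF assms(1)] unfolding c d_def[symmetric] rhof_def by (simp add: diff_divide_distrib[symmetric])
qed

lemma Lf_has_derivative:
  assumes z: "z \<noteq> 0" and s: "sf w z \<noteq> 0" "sf w z \<noteq> 1"
  shows "(Lf w has_derivative dLf w z) (at (z::'v::real_inner))"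
proof -
  have "((\<lambda>z. (norm z)\<^sup>2 * cf (sf w z)) has_derivative dLf w z) (at z)"
    by (rule has_derivative_eq_rhs, rule has_derivative_mult[OF has_derivative_power[OF has_derivative_norm_at[OF z]]
        has_derivative_compose[OF sf_has_derivative[OF z] cf_has_derivative[OF s, unfolded has_field_derivative_def]]])
      (use z in \<open>simp add: fun_eq_iff dLf_def fiber_atoms(2)[OF z] power2_eq_square algebra_simps\<close>)
  then show ?thesis
    by (rule has_derivative_transform_within_open[of _ _ _ _ "- {0}"]) (use z in \<open>auto simp: Lf_sf\<close>)
qed

text \<open>With z and w in place of p and \<theta> the direction v meets only vectors that are
  simple to differentiate, which \<open>dLf_has_derivative\<close> exploits.\<close>

lemma dLf_eq:
  assumes z: "z \<noteq> 0" and s: "sf w z \<noteq> 0" "sf w z \<noteq> 1"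
  shows "dLf w z v = 2 * (rhof (sf w z) * (z \<bullet> v) + norm z * (muf (sf w z) * cf (sf w z)) * (w \<bullet> v))"
  unfolding dLf_def rhof_eq[OF s] fiber_atoms(2)[OF z, of v] fiber_atoms(3)[OF z, of w v]
  by (simp add: algebra_simps)

lemma rhof_has_derivative:
  assumes "s \<noteq> 0" "s \<noteq> 1"
  shows "(rhof has_real_derivative muf s * cf s - s * (kapf s + (muf s)\<^sup>2 * cf s)) (at s)"
proof -
  have "((\<lambda>s. cf s - s * (muf s * cf s)) has_real_derivative
      2 * (muf s * cf s) - (1 * (muf s * cf s) + (kapf s + (muf s)\<^sup>2 * cf s) * s)) (at s)"
    by (intro DERIV_diff DERIV_mult DERIV_ident cf_has_derivative mucf_has_derivative assms)
  then have "(rhof has_real_derivative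
      2 * (muf s * cf s) - (1 * (muf s * cf s) + (kapf s + (muf s)\<^sup>2 * cf s) * s)) (at s)"
    by (rule has_field_derivative_transform_within_open[where S="- {0, 1}"])
      (use assms in \<open>auto simp: rhof_eq\<close>)
  then show ?thesis by (simp add: algebra_simps)
qed

lemma dLf_has_derivative:
  assumes z: "z \<noteq> 0" and s: "sf w z \<noteq> 0" "sf w z \<noteq> 1"
  shows "((\<lambda>z. dLf w z v) has_derivative (\<lambda>u. hLf w z u v)) (at (z::'v::real_inner))"
proof -
  define S where "S = {z. z \<noteq> 0 \<and> sf w z \<noteq> 0 \<and> sf w z \<noteq> 1}"
  have "open (- {0} \<inter> sf w -` (- {0, 1}))"
    by (intro continuous_open_preimage) (auto intro!: continuous_at_imp_continuous_on 
        has_derivative_continuous[OF sf_has_derivative])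
  then have S: "open S" by (rule back_subst) (auto simp: S_def)
  note R = has_derivative_compose[OF sf_has_derivative[OF z, of w] rhof_has_derivative[OF s, unfolded has_field_derivative_def]]
  note M = has_derivative_compose[OF sf_has_derivative[OF z, of w] mucf_has_derivative[OF s, unfolded has_field_derivative_def]]
  have "((\<lambda>z. 2 * (rhof (sf w z) * (z \<bullet> v) + norm z * (muf (sf w z) * cf (sf w z)) * (w \<bullet> v)))
      has_derivative (\<lambda>u. hLf w z u v)) (at z)"
  proof (rule has_derivative_eq_rhs[OF has_derivative_mult_right[OF has_derivative_add[OF
        has_derivative_mult[OF R has_derivative_inner_left[OF has_derivative_ident]]
        has_derivative_mult_left[OF has_derivative_mult[OF has_derivative_norm_at[OF z] M]]]]], intro ext)
    fix u
    show "2 * (rhof (sf w z) * (u \<bullet> v) + (muf (sf w z) * cf (sf w z) - sf w z * (kapf (sf w z) + (muf (sf w z))\<^sup>2 * cf (sf w z)))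
        * ((thf w z \<bullet> u) / norm z) * (z \<bullet> v)
      + (norm z * ((kapf (sf w z) + (muf (sf w z))\<^sup>2 * cf (sf w z)) * ((thf w z \<bullet> u) / norm z))
        + (z \<bullet> u) / norm z * (muf (sf w z) * cf (sf w z))) * (w \<bullet> v)) = hLf w z u v"
      unfolding fiber_atoms(2)[OF z, of v] fiber_atoms(2)[OF z, of u] fiber_atoms(3)[OF z, of w v] hLf_def Let_def rhof_eq[OF s]
      using z by (simp add: field_simps)
  qed
  then show ?thesis
    by (rule has_derivative_transform_within_open[OF _ S]) (use z s in \<open>auto simp: S_def dLf_eq\<close>)
qed

section \<open>The determinant of the fundamental tensor and the function A\<close>

text \<open>The cubic in the denominator of A. For s > 1 it is, up to a positive factor, \<rho> +
  \<kappa>(b^2 - s^2), which governs both the determinant and the geodesic equation.\<close>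

definition N3 :: "real \<Rightarrow> real \<Rightarrow> real" where "N3 b2 s = s^3 - 3 * s\<^sup>2 + 2 * b2"

text \<open>The logarithm of the square root of \<rho>^n N3 / s^2, the determinant computed in
  \<open>det_hLf\<close>.\<close>

definition Tf :: "nat \<Rightarrow> real \<Rightarrow> real \<Rightarrow> real"
  where "Tf n b2 s = (real n * (4 * ln s - 3 * ln (s - 1)) + ln (N3 b2 s) - 2 * ln s) / 2"

definition Af :: "nat \<Rightarrow> real \<Rightarrow> real \<Rightarrow> real"
  where "Af n b2 s = (- (real n + 1) * s ^ 5 + (7 * real n + 1) * s ^ 4 - 12 * real n * s ^ 3
             + 2 * (2 - real n) * b2 * s\<^sup>2 + 4 * (2 * real n - 1) * b2 * s)
          / (2 * (s ^ 3 - 3 * s\<^sup>2 + 2 * b2)\<^sup>2)"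

text \<open>Here A originates: it is -T'(s) s^2 (s - 1) / N3. The factor beside T' is the one that
  multiplies the brackets when the geodesic equation is solved for the change of s.\<close>

lemma Tf_has_derivative:
  assumes "s > 1" "N3 b2 s > 0"
  shows "(Tf n b2 has_real_derivative - Af n b2 s * N3 b2 s / (s\<^sup>2 * (s - 1))) (at s)"
proof -
  have "(Tf n b2 has_real_derivative (real n * (4 / s - 3 / (s - 1)) + (3 * s\<^sup>2 - 6 * s) / N3 b2 s - 2 / s) / 2) (at s)"
    unfolding Tf_def[abs_def] N3_def
    by (rule derivative_eq_intros refl | use assms in \<open>simp add: N3_def\<close>)+
  moreover have "(real n * (4 / s - 3 / (s - 1)) + (3 * s\<^sup>2 - 6 * s) / N3 b2 s - 2 / s) / 2
      = - Af n b2 s * N3 b2 s / (s\<^sup>2 * (s - 1))"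
  proof -
    \<comment> \<open>Eliminating b2 in favour of the denominator k turns the claim into a
      polynomial identity in s and k.\<close>
    define k where "k = N3 b2 s"
    have k: "k > 0" and b2: "2 * b2 = k - s^3 + 3 * s\<^sup>2" using assms(2) by (auto simp: k_def N3_def)
    have Ak: "Af n b2 s = (- (real n + 1) * s ^ 5 + (7 * real n + 1) * s ^ 4 - 12 * real n * s ^ 3
             + (2 - real n) * (2 * b2) * s\<^sup>2 + 2 * (2 * real n - 1) * (2 * b2) * s) / (2 * k\<^sup>2)"
      by (simp add: Af_def k_def N3_def algebra_simps)
    show ?thesis
      unfolding Ak b2 k_def[symmetric] using assms(1) k
      by (simp add: divide_simps, simp add: power2_eq_square power3_eq_cube power4_eq_xxxx power_numeral_reduce algebra_simps)
  qed
  ultimately show ?thesis by simp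
qed

lemma rho_kappa:
  assumes "s > 1"
  shows "rhof s + kapf s * (b2 - s\<^sup>2) = rhof s * N3 b2 s / (s\<^sup>2 * (s - 1))" and "rhof s > 0"
proof -
  show "rhof s + kapf s * (b2 - s\<^sup>2) = rhof s * N3 b2 s / (s\<^sup>2 * (s - 1))"
  proof -
    define d where "d = s - 1"
    have d: "d > 0" "s > 0" using assms by (auto simp: d_def)
    have "rhof s = s^4 * d / d^4" "kapf s = 2 * s^2 / d^4"
      using d by (simp_all add: rhof_def kapf_def d_def[symmetric] power3_eq_cube power4_eq_xxxx)
    moreover have "rhof s * N3 b2 s / (s\<^sup>2 * d) = s\<^sup>2 * N3 b2 s / d^4"
      using d by (simp add: rhof_def d_def[symmetric] power2_eq_square power3_eq_cube power4_eq_xxxx)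
    moreover have "s^4 * d + 2 * s^2 * (b2 - s\<^sup>2) = s\<^sup>2 * N3 b2 s"
      by (simp add: d_def N3_def power2_eq_square power3_eq_cube power4_eq_xxxx algebra_simps)
    ultimately show ?thesis
      unfolding d_def[symmetric] by (simp add: add_divide_distrib[symmetric])
  qed
  show "rhof s > 0" using assms by (simp add: rhof_def)
qed

text \<open>Positive definiteness is tested on q = \<theta> - \<mu> |\<theta>|^2 p, the direction in
  the plane of p and \<theta> that is tangent to the indicatrix; there the Hessian is 2 |\<theta>|^2
  (\<rho> + \<kappa> |\<theta>|^2). For \<theta> = 0 the cubic is s^2 (s - 1).\<close>

lemma N3_pos:
  fixes z w :: "'v::real_inner"
  assumes z: "z \<noteq> 0" and s: "sf w z > 1" and pd: "\<And>u. u \<noteq> 0 \<Longrightarrow> hLf w z u u > 0"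
  shows "N3 (w \<bullet> w) (sf w z) > 0"
proof -
  define s \<theta> p t where "s = sf w z" and "\<theta> = thf w z" and "p = pf z" and "t = \<theta> \<bullet> \<theta>"
  have s1: "s > 1" using s by (simp add: s_def)
  have t: "t = w \<bullet> w - s\<^sup>2" using fiber_atoms(8)[OF z] by (simp add: t_def s_def \<theta>_def)
  have pp: "p \<bullet> p = 1" "p \<bullet> \<theta> = 0" "\<theta> \<bullet> p = 0" using fiber_atoms(4)[OF z] fiber_atoms(5)[OF z] by (auto simp: p_def \<theta>_def inner_commute)
  show ?thesis
  proof (cases "\<theta> = 0")
    case True
    then have "w \<bullet> w = s\<^sup>2" using t by (simp add: t_def)
    then have "N3 (w \<bullet> w) s = s\<^sup>2 * (s - 1)" by (simp add: N3_def power2_eq_square power3_eq_cube algebra_simps)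
    then show ?thesis using s1 by (simp add: s_def[symmetric])
  next
    case False
    then have t0: "t > 0" by (simp add: t_def)
    define q where "q = \<theta> - (muf s * t) *\<^sub>R p"
    have q: "\<theta> \<bullet> q = t" "p \<bullet> q = - muf s * t" "q \<bullet> q = t + (muf s * t)\<^sup>2"
      using pp by (auto simp: q_def inner_diff_left inner_diff_right t_def power2_eq_square)
    then have "q \<noteq> 0" using t0 by auto
    then have "hLf w z q q > 0" by (rule pd)
    moreover have "hLf w z q q = 2 * (t * (rhof s + kapf s * t))"
      unfolding hLf_def Let_def s_def[symmetric] p_def[symmetric] \<theta>_def[symmetric] q
      by (simp add: power2_eq_square algebra_simps)
    ultimately have "rhof s + kapf s * (w \<bullet> w - s\<^sup>2) > 0" using t0 t by (simp add: zero_less_mult_iff)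
    then have "rhof s * N3 (w \<bullet> w) s / (s\<^sup>2 * (s - 1)) > 0" unfolding rho_kappa(1)[OF s1] .
    moreover have "s\<^sup>2 * (s - 1) > 0" using s1 by simp
    ultimately have "rhof s * N3 (w \<bullet> w) s > 0" by (simp only: zero_less_divide_iff) auto
    then show ?thesis using rho_kappa(2)[OF s1] by (simp add: s_def[symmetric] zero_less_mult_iff)
  qed
qed

lemma det_hLf:
  fixes z w :: "real ^ 'n"
  assumes z: "z \<noteq> 0" and s: "sf w z > 1"
  shows "det (\<chi> i j. 1/2 * hLf w z (axis i 1) (axis j 1))
    = rhof (sf w z) ^ CARD('n) * N3 (w \<bullet> w) (sf w z) / (sf w z)\<^sup>2"
proof -
  define s where "s = sf w z"
  have s1: "s > 1" using s by (simp add: s_def)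
  have "(\<chi> i j. 1/2 * hLf w z (axis i 1) (axis j 1)) = (\<chi> i j. (if i = j then rhof s else 0) + (cf s - rhof s) * (pf z $ i * pf z $ j)
      + (kapf s + (muf s)\<^sup>2 * cf s) * (thf w z $ i * thf w z $ j)
      + muf s * cf s * (pf z $ i * thf w z $ j + thf w z $ i * pf z $ j))"
    by (simp add: vec_eq_iff hLf_def Let_def s_def inner_axis) (simp add: axis_def)
  then have "det (\<chi> i j. 1/2 * hLf w z (axis i 1) (axis j 1))
      = rhof s ^ CARD('n) * (cf s / rhof s) * (1 + kapf s * (thf w z \<bullet> thf w z) / rhof s)"
    using det_split_metric[OF fiber_atoms(4)[OF z] fiber_atoms(5)[OF z], of "rhof s"] rho_kappa(2)[OF s1] by simp
  also have "1 + kapf s * (thf w z \<bullet> thf w z) / rhof s = N3 (w \<bullet> w) s / (s\<^sup>2 * (s - 1))"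
  proof -
    have "(rhof s + kapf s * (w \<bullet> w - s\<^sup>2)) / rhof s = N3 (w \<bullet> w) s / (s\<^sup>2 * (s - 1))"
      unfolding rho_kappa(1)[OF s1] using rho_kappa(2)[OF s1] by simp
    then show ?thesis
      unfolding fiber_atoms(8)[OF z] s_def[symmetric] using rho_kappa(2)[OF s1] by (simp add: add_divide_distrib)
  qed
  also have "cf s / rhof s = s - 1"
    using s1 by (simp add: cf_def rhof_def power2_eq_square power3_eq_cube)
  also have "rhof s ^ CARD('n) * (s - 1) * (N3 (w \<bullet> w) s / (s\<^sup>2 * (s - 1)))
      = rhof s ^ CARD('n) * N3 (w \<bullet> w) s / s\<^sup>2"
  proof -
    have "s - 1 \<noteq> 0" using s1 by simp
    then show ?thesis by simp
  qed
  finally show ?thesis by (simp add: s_def)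
qed

lemma ln_sqrt_det_hLf:
  fixes z w :: "real ^ 'n"
  assumes z: "z \<noteq> 0" and s: "sf w z > 1" and N: "N3 (w \<bullet> w) (sf w z) > 0"
  shows "ln (sqrt (det (\<chi> i j. 1/2 * hLf w z (axis i 1) (axis j 1)))) = Tf CARD('n) (w \<bullet> w) (sf w z)"
    and "det (\<chi> i j. 1/2 * hLf w z (axis i 1) (axis j 1)) > 0"
proof -
  show pos: "det (\<chi> i j. 1/2 * hLf w z (axis i 1) (axis j 1)) > 0"
    unfolding det_hLf[OF z s] using N s rho_kappa(2)[OF s] by simp
  have "ln (rhof (sf w z)) = 4 * ln (sf w z) - 3 * ln (sf w z - 1)"
    using s by (simp add: rhof_def ln_div ln_realpow)
  then have "ln (det (\<chi> i j. 1/2 * hLf w z (axis i 1) (axis j 1))) = 2 * Tf CARD('n) (w \<bullet> w) (sf w z)"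
    unfolding det_hLf[OF z s] Tf_def using s N rho_kappa(2)[OF s]
    by (simp add: ln_div ln_mult ln_realpow)
  then show "ln (sqrt (det (\<chi> i j. 1/2 * hLf w z (axis i 1) (axis j 1)))) = Tf CARD('n) (w \<bullet> w) (sf w z)"
    using pos by (simp add: ln_sqrt)
qed

text \<open>\<open>\<eta>\<close> is the covariant acceleration of a geodesic; the hypotheses are its geodesic equation
  paired with \<open>z\<close> and with \<open>w\<close>, where \<open>x = [z, w]\<close>.\<close>

lemma S_from_acceleration:
  fixes z w \<eta> x :: "'v::real_inner"
  assumes z: "z \<noteq> 0" and s: "sf w z > 1"
    and h1: "dLf w z \<eta> = 0" and h2: "hLf w z \<eta> w = dLf w z x"
  shows "- Af n (w \<bullet> w) (sf w z) * N3 (w \<bullet> w) (sf w z) / ((sf w z)\<^sup>2 * (sf w z - 1)) * ((thf w z \<bullet> \<eta>) / norm z)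
    = Af n (w \<bullet> w) (sf w z) / norm z * (- (x \<bullet> z))
      + Af n (w \<bullet> w) (sf w z) * (1 - 2 / sf w z) * (- (x \<bullet> w))"
proof -
  define s p \<theta> A k where "s = sf w z" and "p = pf z" and "\<theta> = thf w z"
    and "A = Af n (w \<bullet> w) (sf w z)" and "k = N3 (w \<bullet> w) (sf w z)"
  have s1: "s > 1" using s by (simp add: s_def)
  have nz: "norm z > 0" using z by simp
  have c0: "cf s > 0" using s1 by (simp add: cf_def)
  have "p \<bullet> \<eta> + muf s * (\<theta> \<bullet> \<eta>) = 0"
    using h1 nz c0 by (simp add: dLf_def s_def p_def \<theta>_def)
  \<comment> \<open>The equation paired with z expresses the p-component of \<eta>; the single
    unknown left is \<open>\<theta> \<bullet> \<eta>\<close>, which the equation paired with w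
    determines.\<close>
  then have p\<eta>: "p \<bullet> \<eta> = - muf s * (\<theta> \<bullet> \<eta>)" by simp
  have w\<eta>: "\<eta> \<bullet> w = \<theta> \<bullet> \<eta> + s * (p \<bullet> \<eta>)" using fiber_atoms(3)[OF z, of w \<eta>] by (simp add: s_def p_def \<theta>_def inner_commute)
  have tw: "\<theta> \<bullet> w = w \<bullet> w - s\<^sup>2" "p \<bullet> w = s" using fiber_atoms(6,7)[OF z] by (auto simp: s_def p_def \<theta>_def)
  have "hLf w z \<eta> w = 2 * ((\<theta> \<bullet> \<eta>) * (rhof s + kapf s * (w \<bullet> w - s\<^sup>2)))"
    unfolding hLf_def Let_def s_def[symmetric] p_def[symmetric] \<theta>_def[symmetric] w\<eta> tw p\<eta>
    by (simp add: power2_eq_square algebra_simps)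
  also have "\<dots> = 2 * (\<theta> \<bullet> \<eta>) * rhof s * k / (s\<^sup>2 * (s - 1))"
    unfolding rho_kappa(1)[OF s1] by (simp add: k_def s_def)
  finally have e1: "2 * (\<theta> \<bullet> \<eta>) * rhof s * k / (s\<^sup>2 * (s - 1)) = dLf w z x" using h2 by simp
  have "dLf w z x = 2 * (rhof s * (x \<bullet> z) + norm z * (muf s * cf s) * (x \<bullet> w))"
    using dLf_eq[OF z, of w x] s by (simp add: s_def inner_commute)
  also have "muf s * cf s = rhof s * (1 - 2 / s)"
    using s1 by (simp add: mucf_eq rhof_def right_diff_distrib diff_divide_distrib power3_eq_cube power4_eq_xxxx)
  finally have e3: "dLf w z x = 2 * (rhof s * (x \<bullet> z) + norm z * (rhof s * (1 - 2 / s)) * (x \<bullet> w))" .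
  have "rhof s * ((\<theta> \<bullet> \<eta>) * k / (s\<^sup>2 * (s - 1))) = dLf w z x / 2"
    unfolding e1[symmetric] by simp
  also have "\<dots> = rhof s * ((x \<bullet> z) + norm z * (1 - 2 / s) * (x \<bullet> w))"
    unfolding e3 by (simp add: distrib_left mult_ac)
  finally have "rhof s * ((\<theta> \<bullet> \<eta>) * k / (s\<^sup>2 * (s - 1))) = rhof s * ((x \<bullet> z) + norm z * (1 - 2 / s) * (x \<bullet> w))" .
  then have e2: "(\<theta> \<bullet> \<eta>) * k / (s\<^sup>2 * (s - 1)) = (x \<bullet> z) + norm z * (1 - 2 / s) * (x \<bullet> w)"
    using rho_kappa(2)[OF s1] by (simp only: mult_cancel_left) auto
  have "- A * k / (s\<^sup>2 * (s - 1)) * ((\<theta> \<bullet> \<eta>) / norm z) = - A / norm z * ((\<theta> \<bullet> \<eta>) * k / (s\<^sup>2 * (s - 1)))"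
    by (simp add: mult_ac)
  also have "\<dots> = A / norm z * (- (x \<bullet> z)) + A * (1 - 2 / s) * (- (x \<bullet> w))"
    unfolding e2 using nz by (simp add: field_simps)
  finally show ?thesis by (simp add: A_def k_def s_def \<theta>_def)
qed

section \<open>Linear change of variables for Lebesgue measure\<close>

text \<open>The library proves the transformation formula for well-ordered index types only. An arbitrary
  finite index type is therefore replaced by a copy that carries a well-order.\<close>

typedef 'a wo = "UNIV :: 'a set" morphisms of_wo to_wo ..

lemma of_wo_simps [simp]: "of_wo (to_wo x) = x" "to_wo (of_wo y) = y"
  by (simp_all add: to_wo_inverse of_wo_inverse)

lemma bij_of_wo: "bij of_wo"
  by (metis bijI' of_wo_simps)

definition enum_index :: "'a::finite \<Rightarrow> nat" where "enum_index = (SOME f. inj f)"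

lemma inj_enum_index: "inj (enum_index :: 'a::finite \<Rightarrow> nat)"
proof -
  have "\<exists>f n. f ` (UNIV :: 'a set) = {i :: nat. i < n} \<and> inj f"
    by (rule finite_imp_inj_to_nat_seg[OF finite_class.finite])
  then obtain f :: "'a \<Rightarrow> nat" where "inj f" by (elim exE conjE)
  then show ?thesis unfolding enum_index_def by (rule someI[where P=inj])
qed

instance wo :: (finite) finite
proof
  have "(UNIV :: 'a wo set) = range to_wo" by (metis of_wo_simps(2) surjI)
  then show "finite (UNIV :: 'a wo set)" by (metis finite finite_imageI)
qed

instantiation wo :: (finite) wellorder
begin

definition less_eq_wo :: "'a wo \<Rightarrow> 'a wo \<Rightarrow> bool"
  where "less_eq_wo x y \<longleftrightarrow> enum_index (of_wo x) \<le> enum_index (of_wo y)"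

definition less_wo :: "'a wo \<Rightarrow> 'a wo \<Rightarrow> bool"
  where "less_wo x y \<longleftrightarrow> enum_index (of_wo x) < enum_index (of_wo y)"

instance
proof
  fix P :: "'a wo \<Rightarrow> bool" and a
  assume step: "\<And>x. (\<And>y. y < x \<Longrightarrow> P y) \<Longrightarrow> P x"
  have "\<forall>a. enum_index (of_wo a) = n \<longrightarrow> P a" for n
  proof (induction n rule: less_induct)
    case (less n)
    show ?case
    proof (intro allI impI)
      fix a :: "'a wo" assume a: "enum_index (of_wo a) = n"
      show "P a"
      proof (rule step)
        fix y assume "y < a"
        then have "enum_index (of_wo y) < n" unfolding less_wo_def a .
        then show "P y" using less by blast
      qed
    qed
  qed
  then show "P a" by blast
next
  fix x y :: "'a wo"
  assume "x \<le> y" "y \<le> x"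
  then have "enum_index (of_wo x) = enum_index (of_wo y)" unfolding less_eq_wo_def by (rule antisym)
  then have "of_wo x = of_wo y" by (rule injD[OF inj_enum_index])
  then have "to_wo (of_wo x) = to_wo (of_wo y)" by (rule arg_cong)
  then show "x = y" unfolding of_wo_simps .
qed (unfold less_eq_wo_def less_wo_def, linarith+)

end

definition to_wo_vec :: "real ^ 'n \<Rightarrow> real ^ 'n wo" where "to_wo_vec x = (\<chi> i. x $ of_wo i)"
definition of_wo_vec :: "real ^ 'n wo \<Rightarrow> real ^ 'n" where "of_wo_vec x = (\<chi> i. x $ to_wo i)"

lemma wo_vec_inverse [simp]: "of_wo_vec (to_wo_vec x) = x" "to_wo_vec (of_wo_vec y) = y"
  by (simp_all add: of_wo_vec_def to_wo_vec_def vec_eq_iff)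

lemma linear_wo_vec: "linear to_wo_vec" "linear of_wo_vec"
  by (auto intro!: linearI simp: of_wo_vec_def to_wo_vec_def vec_eq_iff)

lemma prod_Basis_vec: "(\<Prod>b\<in>Basis. (x :: real ^ 'n) \<bullet> b) = (\<Prod>i\<in>UNIV. x $ i)"
proof -
  have B: "(Basis :: (real ^ 'n) set) = range (\<lambda>i. axis i 1)" by (auto simp: Basis_vec_def)
  have "inj (\<lambda>i. axis i 1 :: real ^ 'n)" by (auto intro!: injI simp: axis_eq_axis)
  then show ?thesis unfolding B by (simp add: prod.reindex inner_axis)
qed

lemma lborel_to_wo_vec: "distr lborel borel (to_wo_vec :: real ^ 'n \<Rightarrow> _) = lborel"
proof (rule lborel_eqI[symmetric])
  fix l u :: "real ^ 'n wo"
  assume lu: "\<And>b. b \<in> Basis \<Longrightarrow> l \<bullet> b \<le> u \<bullet> b"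
  have le: "l $ i \<le> u $ i" for i using lu[of "axis i 1"] by (simp add: inner_axis axis_in_Basis_iff)
  have meas: "to_wo_vec \<in> borel_measurable (borel :: (real ^ 'n) measure)"
    by (intro borel_measurable_continuous_onI linear_continuous_on) (simp add: linear_conv_bounded_linear[symmetric] linear_wo_vec)
  have pre: "to_wo_vec -` box l u = box (of_wo_vec l) (of_wo_vec u)"
  proof (intro Set.set_eqI iffI)
    fix x :: "real ^ 'n"
    assume "x \<in> to_wo_vec -` box l u"
    then have "\<forall>i. l $ i < x $ of_wo i \<and> x $ of_wo i < u $ i" by (simp add: mem_box_cart to_wo_vec_def)
    then show "x \<in> box (of_wo_vec l) (of_wo_vec u)" by (simp add: mem_box_cart of_wo_vec_def) (metis of_wo_simps(1))
  next
    fix x :: "real ^ 'n"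
    assume "x \<in> box (of_wo_vec l) (of_wo_vec u)"
    then have "\<forall>i. l $ to_wo i < x $ i \<and> x $ i < u $ to_wo i" by (simp add: mem_box_cart of_wo_vec_def)
    then show "x \<in> to_wo_vec -` box l u" by (simp add: mem_box_cart to_wo_vec_def) (metis of_wo_simps(2))
  qed
  have "emeasure (distr lborel borel to_wo_vec) (box l u) = emeasure lborel (box (of_wo_vec l) (of_wo_vec u))"
    using meas by (subst emeasure_distr) (auto simp: pre)
  also have "\<dots> = (\<Prod>b\<in>Basis. (of_wo_vec u - of_wo_vec l) \<bullet> b)"
    by (rule emeasure_lborel_box) (auto simp: Basis_vec_def inner_axis of_wo_vec_def le)
  also have "(\<Prod>b\<in>Basis. (of_wo_vec u - of_wo_vec l) \<bullet> b) = (\<Prod>b\<in>Basis. (u - l) \<bullet> b)"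
    unfolding prod_Basis_vec
    by (rule prod.reindex_bij_betw[OF bij_of_wo, symmetric, THEN trans]) (simp add: of_wo_vec_def)
  finally show "emeasure (distr lborel borel to_wo_vec) (box l u) = (\<Prod>b\<in>Basis. (u - l) \<bullet> b)" .
qed simp

text \<open>Conjugation sends a transposition to a transposition, so induction over transpositions
  preserves the sign.\<close>

lemma sign_conjugate:
  fixes p :: "'a::finite \<Rightarrow> 'a" and f :: "'a \<Rightarrow> 'b::finite"
  assumes f: "bij f" and p: "p permutes UNIV"
  shows "sign (f \<circ> p \<circ> inv_into UNIV f) = sign p"
  using p finite_class.finite[of "UNIV :: 'a set"]
proof (induction p rule: permutes_induct)
  case id
  have "f \<circ> id \<circ> inv_into UNIV f = id" using f by (simp add: fun_eq_iff bij_is_surj surj_f_inv_f)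
  then show ?case by simp
next
  case (swap a b p)
  let ?q = "f \<circ> p \<circ> inv_into UNIV f"
  have eq: "f \<circ> (Transposition.transpose a b \<circ> p) \<circ> inv_into UNIV f = Transposition.transpose (f a) (f b) \<circ> ?q"
    using f by (auto simp: fun_eq_iff Transposition.transpose_def bij_is_inj inj_eq)
  have "bij ?q" using f swap by (intro bij_comp) (auto simp: bij_imp_bij_inv permutes_bij)
  then have "?q permutes UNIV" by (rule bij_imp_permutes) simp
  then have "permutation ?q" unfolding permutation_permutes using finite_class.finite by blast
  moreover have "permutation p" using swap.hyps unfolding permutation_permutes using finite_class.finite by blast
  ultimately have perm: "permutation ?q" "permutation p" by blast+
  have "sign (Transposition.transpose (f a) (f b) \<circ> ?q) = sign (Transposition.transpose (f a) (f b)) * sign ?q"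
    by (rule sign_compose[OF permutation_swap_id perm(1)])
  also have "\<dots> = sign (Transposition.transpose a b) * sign p"
    unfolding swap.IH sign_swap_id using f by (simp add: bij_is_inj inj_eq)
  also have "\<dots> = sign (Transposition.transpose a b \<circ> p)"
    by (rule sign_compose[OF permutation_swap_id perm(2), symmetric])
  finally show ?case unfolding eq .
qed

lemma det_reindex:
  fixes A :: "real ^ 'n ^ 'n"
  shows "det (\<chi> i j. A $ of_wo i $ of_wo j) = det A"
proof -
  have bij: "bij_betw (\<lambda>p. of_wo \<circ> p \<circ> inv_into UNIV of_wo) {p. p permutes (UNIV :: 'n wo set)} {p. p permutes (UNIV :: 'n set)}"
  proof (rule bij_betwI[where g="\<lambda>p. inv_into UNIV of_wo \<circ> p \<circ> of_wo"])
    have pb: "p permutes UNIV \<longleftrightarrow> bij p" for p :: "'b \<Rightarrow> 'b"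
      using permutes_bij bij_imp_permutes[of p UNIV] by auto
    show "(\<lambda>p. of_wo \<circ> p \<circ> inv_into UNIV of_wo) \<in> {p. p permutes (UNIV :: 'n wo set)} \<rightarrow> {p. p permutes UNIV}"
      by (auto simp: pb intro!: bij_comp bij_of_wo bij_imp_bij_inv)
    show "(\<lambda>p. inv_into UNIV of_wo \<circ> p \<circ> of_wo) \<in> {p. p permutes (UNIV :: 'n set)} \<rightarrow> {p. p permutes UNIV}"
      by (auto simp: pb intro!: bij_comp bij_of_wo bij_imp_bij_inv)
    have inv1: "inv_into UNIV of_wo (of_wo x) = x" for x :: "'n wo"
      by (rule inv_f_f[OF bij_is_inj[OF bij_of_wo]])
    have inv2: "of_wo (inv_into UNIV of_wo y) = y" for y :: 'n
      by (rule surj_f_inv_f[OF bij_is_surj[OF bij_of_wo]])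
    show "inv_into UNIV of_wo \<circ> (of_wo \<circ> p \<circ> inv_into UNIV of_wo) \<circ> of_wo = p" for p :: "'n wo \<Rightarrow> 'n wo"
      by (simp add: fun_eq_iff inv1 inv2)
    show "of_wo \<circ> (inv_into UNIV of_wo \<circ> p \<circ> of_wo) \<circ> inv_into UNIV of_wo = p" for p :: "'n \<Rightarrow> 'n"
      by (simp add: fun_eq_iff inv1 inv2)
  qed
  have pr: "(\<Prod>i\<in>UNIV. A $ i $ (of_wo \<circ> p \<circ> inv_into UNIV of_wo) i) = (\<Prod>i\<in>UNIV. A $ of_wo i $ of_wo (p i))" for p
    by (rule prod.reindex_bij_betw[OF bij_of_wo, symmetric, THEN trans])
      (simp add: inv_f_f[OF bij_is_inj[OF bij_of_wo]])
  have "det A = (\<Sum>p\<in>{p. p permutes (UNIV :: 'n wo set)}. of_int (sign (of_wo \<circ> p \<circ> inv_into UNIV of_wo))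
      * (\<Prod>i\<in>UNIV. A $ i $ (of_wo \<circ> p \<circ> inv_into UNIV of_wo) i))"
    unfolding det_def by (rule sum.reindex_bij_betw[OF bij, symmetric])
  also have "\<dots> = det (\<chi> i j. A $ of_wo i $ of_wo j)"
    unfolding det_def pr by (rule sum.cong) (simp_all add: sign_conjugate[OF bij_of_wo])
  finally show ?thesis ..
qed

text \<open>The map is conjugated to the well-ordered copy, where the transformation formula
  applies; the relabelling preserves both Lebesgue measure and the determinant.\<close>

lemma measure_linear_image_cart:
  fixes f :: "real ^ 'n \<Rightarrow> real ^ 'n"
  assumes f: "linear f" "inj f" and S: "open S" "bounded S"
  shows "measure lborel (f ` S) = \<bar>det (matrix f)\<bar> * measure lborel S"
proof -
  have lw: "linear (to_wo_vec :: real ^ 'n \<Rightarrow> _)" "linear (of_wo_vec :: _ \<Rightarrow> real ^ 'n)" by (rule linear_wo_vec)+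
  define h where "h = to_wo_vec \<circ> f \<circ> of_wo_vec"
  have h: "linear h" unfolding h_def by (intro linear_compose lw f(1))
  have wo: "measure lborel (to_wo_vec ` U) = measure lborel U" if U: "open U" for U :: "(real ^ 'n) set"
  proof -
    have meas: "to_wo_vec \<in> borel_measurable (borel :: (real ^ 'n) measure)"
      by (intro borel_measurable_continuous_onI linear_continuous_on) (simp add: linear_conv_bounded_linear[symmetric] linear_wo_vec)
    have "to_wo_vec ` U = of_wo_vec -` U" by (auto simp: image_iff) (metis wo_vec_inverse(2))
    then have op: "open (to_wo_vec ` U)"
      using open_vimage[OF U linear_continuous_on] lw(2) by (simp add: linear_conv_bounded_linear)
    have "measure lborel (to_wo_vec ` U) = measure (distr lborel borel to_wo_vec) (to_wo_vec ` U)"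
      by (simp only: lborel_to_wo_vec)
    also have "\<dots> = measure lborel (to_wo_vec -` (to_wo_vec ` U) \<inter> space lborel)"
      using meas op by (intro measure_distr) auto
    also have "to_wo_vec -` (to_wo_vec ` U) \<inter> space lborel = U"
      by (auto) (metis wo_vec_inverse(1))
    finally show ?thesis .
  qed
  have opT: "open (to_wo_vec ` S)"
  proof -
    have "to_wo_vec ` S = of_wo_vec -` S" by (auto simp: image_iff) (metis wo_vec_inverse(2))
    then show ?thesis using open_vimage[OF S(1) linear_continuous_on] lw(2) by (simp add: linear_conv_bounded_linear)
  qed
  have bT: "bounded (to_wo_vec ` S)"
    using bounded_linear_image[OF S(2)] lw(1) by (simp add: linear_conv_bounded_linear)
  have opf: "open (f ` S)" by (rule open_surjective_linear_image[OF S(1) f(1)]) (use f linear_injective_imp_surjective in blast)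
  have hS: "h ` to_wo_vec ` S = to_wo_vec ` f ` S" by (simp add: h_def image_comp o_def)
  have "open (h ` to_wo_vec ` S)"
  proof -
    have "to_wo_vec ` f ` S = of_wo_vec -` f ` S" by (auto simp: image_iff) (metis wo_vec_inverse(2))
    then show ?thesis unfolding hS using open_vimage[OF opf linear_continuous_on] lw(2) by (simp add: linear_conv_bounded_linear)
  qed
  then have "measure lborel (h ` to_wo_vec ` S) = measure lebesgue (h ` to_wo_vec ` S)"
    by (simp add: measure_completion)
  also have "\<dots> = \<bar>det (matrix h)\<bar> * measure lebesgue (to_wo_vec ` S)"
    using opT by (intro measure_lebesgue_linear_transformation bT h) (simp add: borel_open sets_completionI_sets)
  also have "measure lebesgue (to_wo_vec ` S) = measure lborel S"
    using opT by (simp add: measure_completion wo[OF S(1)])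
  also have "matrix h = (\<chi> i j. matrix f $ of_wo i $ of_wo j)"
  proof -
    have e: "of_wo_vec (axis j 1) = axis (of_wo j) 1" for j :: "'n wo"
      by (auto simp: of_wo_vec_def axis_def vec_eq_iff)
    show ?thesis by (simp add: e matrix_def h_def to_wo_vec_def)
  qed
  also have "det \<dots> = det (matrix f)" by (rule det_reindex)
  also have "measure lborel (h ` to_wo_vec ` S) = measure lborel (f ` S)" unfolding hS by (rule wo[OF opf])
  finally show ?thesis .
qed

section \<open>Geodesics as solutions of the Euler-Lagrange equation\<close>

lemma pd_pd_eq_frechet:
  assumes S: "open S" "y \<in> S" and f: "smooth_on S (f :: 'a::euclidean_space \<Rightarrow> real)"
  shows "pd (pd f w) u y = frechet_derivative (\<lambda>z. frechet_derivative f (at z) w) (at y) u"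
proof -
  have eq: "pd f w z = frechet_derivative f (at z) w" if "z \<in> S" for z
    by (rule pd_eq_frechet[OF smooth_on_imp_differentiable[OF f that]])
  have "(\<lambda>z. frechet_derivative f (at z) w) differentiable (at y)"
    by (rule smooth_on_imp_differentiable[OF smooth_on_frechet[OF f] S(2)])
  then have "pd f w differentiable (at y)"
    using frechet_derivative_cong_open(2)[OF S, of "pd f w"] eq by simp
  then have "pd (pd f w) u y = frechet_derivative (pd f w) (at y) u" by (rule pd_eq_frechet)
  also have "frechet_derivative (pd f w) (at y) = frechet_derivative (\<lambda>z. frechet_derivative f (at z) w) (at y)"
    by (rule frechet_derivative_cong_open(1)[OF S eq])
  finally show ?thesis .
qed

text \<open>\<open>lam L w\<close> is the momentum of the Lagrangian \<open>L\<close> in the direction \<open>w\<close>. The equation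
  \<open>EL L z a\<close> is the Euler-Lagrange equation at \<open>z = (x, y)\<close> for the acceleration \<open>a\<close>.\<close>

definition lam :: "(('v::euclidean_space \<times> 'v) \<Rightarrow> real) \<Rightarrow> 'v \<Rightarrow> 'v \<times> 'v \<Rightarrow> real"
  where "lam L w = (\<lambda>z. frechet_derivative L (at z) (0, w))"

definition EL :: "(('v::euclidean_space \<times> 'v) \<Rightarrow> real) \<Rightarrow> 'v \<times> 'v \<Rightarrow> 'v \<Rightarrow> bool"
  where "EL L z a \<longleftrightarrow> (\<forall>w. frechet_derivative (lam L w) (at z) (snd z, a) = frechet_derivative L (at z) (w, 0))"

section \<open>Euler-Lagrange equations in coordinates\<close>

text \<open>The last assumption is positive definiteness of the fibre Hessian; it lets the
  Euler-Lagrange equation be solved for the acceleration.\<close>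

locale lagrangian =
  fixes L :: "((real ^ 'n) \<times> (real ^ 'n)) \<Rightarrow> real" and W :: "((real ^ 'n) \<times> (real ^ 'n)) set"
  assumes W: "open W" and L: "smooth_on W L"
    and pd: "\<And>z u. z \<in> W \<Longrightarrow> u \<noteq> 0 \<Longrightarrow> frechet_derivative (lam L u) (at z) (0, u) > 0"
begin

lemma lam_smooth: "smooth_on W (lam L w)"
  unfolding lam_def by (rule smooth_on_frechet[OF L])

lemma lam_deriv_linear: "z \<in> W \<Longrightarrow> linear (frechet_derivative (lam L w) (at z))"
  by (rule linear_frechet_derivative[OF smooth_on_imp_differentiable[OF lam_smooth]])

lemma L_deriv_linear: "z \<in> W \<Longrightarrow> linear (frechet_derivative L (at z))"
  by (rule linear_frechet_derivative[OF smooth_on_imp_differentiable[OF L]])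

lemma lam_sym:
  "z \<in> W \<Longrightarrow> frechet_derivative (lam L w) (at z) (0, u) = frechet_derivative (lam L u) (at z) (0, w)"
  unfolding lam_def by (rule second_derivative_symmetric[OF W _ L])

lemma lam_add: "z \<in> W \<Longrightarrow> lam L (r *\<^sub>R u + w) z = r * lam L u z + lam L w z"
  using linear_add[OF L_deriv_linear, of z "r *\<^sub>R (0, u)" "(0, w)"] linear_scale[OF L_deriv_linear, of z r "(0, u)"]
  by (simp add: lam_def)

lemma lam_deriv_add:
  assumes z: "z \<in> W"
  shows "frechet_derivative (lam L (r *\<^sub>R u + w)) (at z) v
    = r * frechet_derivative (lam L u) (at z) v + frechet_derivative (lam L w) (at z) v"
proof -
  have "((\<lambda>z. r * lam L u z + lam L w z) has_derivative
      (\<lambda>v. r * frechet_derivative (lam L u) (at z) v + frechet_derivative (lam L w) (at z) v)) (at z)"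
    by (intro has_derivative_add has_derivative_mult_right smooth_on_has_derivative[OF lam_smooth z])
  then have "(lam L (r *\<^sub>R u + w) has_derivative
      (\<lambda>v. r * frechet_derivative (lam L u) (at z) v + frechet_derivative (lam L w) (at z) v)) (at z)"
    by (rule has_derivative_transform_within_open[OF _ W z]) (rule lam_add[symmetric])
  then show ?thesis by (simp add: frechet_derivative_eq)
qed

definition mass :: "(real ^ 'n) \<times> (real ^ 'n) \<Rightarrow> real ^ 'n ^ 'n"
  where "mass z = (\<chi> i j. frechet_derivative (lam L (axis i 1)) (at z) (0, axis j 1))"

definition force :: "(real ^ 'n) \<times> (real ^ 'n) \<Rightarrow> real ^ 'n"
  where "force z = (\<chi> i. frechet_derivative (lam L (axis i 1)) (at z) (snd z, 0) - frechet_derivative L (at z) (axis i 1, 0))"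

lemma axis_sum: "(v :: real ^ 'n) = (\<Sum>i\<in>UNIV. v $ i *\<^sub>R axis i 1)"
  using basis_expansion[of v] by (simp add: scalar_mult_eq_scaleR)

lemma mass_mult:
  assumes z: "z \<in> W"
  shows "(mass z *v a) $ i = frechet_derivative (lam L (axis i 1)) (at z) (0, a)"
proof -
  let ?l = "\<lambda>v. frechet_derivative (lam L (axis i 1)) (at z) (0, v)"
  have lin: "linear ?l"
    by (rule linear_compose[OF _ lam_deriv_linear[OF z], of "\<lambda>v. (0, v)" "axis i 1", unfolded o_def]) (auto intro!: linearI)
  have "?l a = ?l (\<Sum>j\<in>UNIV. a $ j *\<^sub>R axis j 1)" using axis_sum[of a] by simp
  also have "\<dots> = (\<Sum>j\<in>UNIV. a $ j * ?l (axis j 1))"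
    by (simp only: linear_sum[OF lin] linear_scale[OF lin] real_scaleR_def)
  finally show ?thesis by (simp add: matrix_vector_mult_def mass_def mult.commute)
qed

lemma mass_injective:
  assumes z: "z \<in> W" and v: "mass z *v v = 0"
  shows "v = 0"
proof (rule ccontr)
  assume "v \<noteq> 0"
  have comb: "frechet_derivative (lam L (\<Sum>i\<in>I. v $ i *\<^sub>R axis i 1)) (at z) u
      = (\<Sum>i\<in>I. v $ i * frechet_derivative (lam L (axis i 1)) (at z) u)" if "finite I" for I u
    using that
  proof (induction I)
    case empty
    then show ?case using lam_deriv_add[OF z, of 1 0 0 u] by simp
  next
    case (insert i I)
    then show ?case using lam_deriv_add[OF z, of "v $ i" "axis i 1" _ u] by simp
  qed
  have "frechet_derivative (lam L v) (at z) (0, v)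
      = (\<Sum>i\<in>UNIV. v $ i * frechet_derivative (lam L (axis i 1)) (at z) (0, v))"
    using comb[of UNIV "(0, v)"] axis_sum[of v] by simp
  also have "\<dots> = 0" using mass_mult[OF z, of v] by (simp add: v)
  finally show False using pd[OF z \<open>v \<noteq> 0\<close>] by simp
qed

lemma mass_det: "z \<in> W \<Longrightarrow> det (mass z) \<noteq> 0"
  using mass_injective[of z] matrix_left_invertible_ker[of "mass z"] invertible_det_nz[of "mass z"]
    invertible_left_inverse[of "mass z"] by blast

text \<open>The equation is linear in the test direction, so coordinate directions decide; there it
  is a linear system for a.\<close>

lemma EL_iff_mass:
  assumes z: "z \<in> W"
  shows "EL L z a \<longleftrightarrow> mass z *v a = - force z"
proof -
  have split: "frechet_derivative (lam L w) (at z) (snd z, a)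
      = frechet_derivative (lam L w) (at z) (snd z, 0) + frechet_derivative (lam L w) (at z) (0, a)" for w
    using linear_add[OF lam_deriv_linear[OF z], of w "(snd z, 0)" "(0, a)"] by simp
  define E where "E w = frechet_derivative (lam L w) (at z) (snd z, a) - frechet_derivative L (at z) (w, 0)" for w
  have lE: "linear E"
  proof (rule linearI)
    have "frechet_derivative L (at z) (u + w, 0) = frechet_derivative L (at z) (u, 0) + frechet_derivative L (at z) (w, 0)" for u w
      using linear_add[OF L_deriv_linear[OF z], of "(u, 0)" "(w, 0)"] by simp
    then show "E (u + w) = E u + E w" for u w
      using lam_deriv_add[OF z, of 1 u w] by (simp add: E_def)
    have "frechet_derivative L (at z) (r *\<^sub>R u, 0) = r * frechet_derivative L (at z) (u, 0)" for r u
      using linear_scale[OF L_deriv_linear[OF z], of r "(u, 0)"] by simp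
    moreover have "frechet_derivative (lam L 0) (at z) v = 0" for v using lam_deriv_add[OF z, of 1 0 0 v] by simp
    ultimately show "E (r *\<^sub>R u) = r *\<^sub>R E u" for r u
      using lam_deriv_add[OF z, of r u 0] by (simp add: E_def right_diff_distrib)
  qed
  have "EL L z a \<longleftrightarrow> (\<forall>w. E w = 0)" by (simp add: EL_def E_def)
  also have "\<dots> \<longleftrightarrow> (\<forall>i. E (axis i 1) = 0)"
  proof
    assume ax: "\<forall>i. E (axis i 1) = 0"
    show "\<forall>w. E w = 0"
    proof
      fix w
      have "E w = (\<Sum>i\<in>UNIV. w $ i *\<^sub>R E (axis i 1))"
        using axis_sum[of w] linear_sum[OF lE] linear_scale[OF lE] by (metis (no_types, lifting) sum.cong)
      then show "E w = 0" using ax by simp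
    qed
  qed blast
  also have "\<dots> \<longleftrightarrow> mass z *v a = - force z"
    by (simp add: vec_eq_iff mass_mult[OF z] force_def E_def split) (auto simp: algebra_simps)
  finally show ?thesis .
qed

text \<open>Twice the spray is the inverse mass matrix applied to the force: the factor 1/4, the 2
  of the geodesic equation and g = mass / 2 combine. Geodesics are thereby described by a condition
  that can be carried between charts.\<close>

lemma spray_coeff_eq:
  assumes z: "(x, y) \<in> W"
  shows "a + 2 *\<^sub>R spray_coeff (\<lambda>x y. L (x, y)) x y = 0 \<longleftrightarrow> EL L (x, y) a"
proof -
  define S where "S = {y'. (x, y') \<in> W}"
  have opS: "open S"
  proof -
    have "S = (\<lambda>y. (x, y)) -` W" by (auto simp: S_def)
    then show ?thesis by (elim ssubst, intro open_vimage[OF W] continuous_intros)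
  qed
  have yS: "y \<in> S" using z by (simp add: S_def)
  have pd1: "pd (\<lambda>y. L (x, y)) w y = lam L w (x, y)" if "(x, y) \<in> W" for x y w
  proof -
    have "((\<lambda>y. (x, y)) has_derivative (\<lambda>w. (0, w))) (at y)" by (auto intro!: derivative_eq_intros)
    from has_derivative_compose[OF this smooth_on_has_derivative[OF L that]]
    have d: "((\<lambda>y. L (x, y)) has_derivative (\<lambda>w. frechet_derivative L (at (x, y)) (0, w))) (at y)" .
    then have "(\<lambda>y. L (x, y)) differentiable (at y)" unfolding differentiable_def by blast
    then show ?thesis by (simp add: pd_eq_frechet frechet_derivative_eq[OF d] lam_def)
  qed
  have dlam: "((\<lambda>y. lam L w (x, y)) has_derivative (\<lambda>u. frechet_derivative (lam L w) (at (x, y)) (0, u))) (at y)"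
    "((\<lambda>x. lam L w (x, y)) has_derivative (\<lambda>u. frechet_derivative (lam L w) (at (x, y)) (u, 0))) (at x)" for w
  proof -
    have "((\<lambda>y. (x, y)) has_derivative (\<lambda>w. (0, w))) (at y)" by (auto intro!: derivative_eq_intros)
    from has_derivative_compose[OF this smooth_on_has_derivative[OF lam_smooth z]]
    show "((\<lambda>y. lam L w (x, y)) has_derivative (\<lambda>u. frechet_derivative (lam L w) (at (x, y)) (0, u))) (at y)" .
    have "((\<lambda>x. (x, y)) has_derivative (\<lambda>w. (w, 0))) (at x)" by (auto intro!: derivative_eq_intros)
    from has_derivative_compose[OF this smooth_on_has_derivative[OF lam_smooth z]]
    show "((\<lambda>x. lam L w (x, y)) has_derivative (\<lambda>u. frechet_derivative (lam L w) (at (x, y)) (u, 0))) (at x)" .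
  qed
  have pd_of: "pd f u p = f' u" if "(f has_derivative f') (at p)" for f :: "real ^ 'n \<Rightarrow> real" and f' u p
  proof -
    have "f differentiable (at p)" using that unfolding differentiable_def by blast
    then show ?thesis by (simp add: pd_eq_frechet frechet_derivative_eq[OF that])
  qed
  have pd2: "pd (pd (\<lambda>y. L (x, y)) w) u y = frechet_derivative (lam L w) (at (x, y)) (0, u)" for w u
  proof (rule pd_of)
    show "(pd (\<lambda>y. L (x, y)) w has_derivative (\<lambda>u. frechet_derivative (lam L w) (at (x, y)) (0, u))) (at y)"
      by (rule has_derivative_transform_within_open[OF dlam(1) opS yS]) (simp add: pd1 S_def)
  qed
  define S' where "S' = {x'. (x', y) \<in> W}"
  have opS': "open S'"
  proof -
    have "S' = (\<lambda>x. (x, y)) -` W" by (auto simp: S'_def)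
    then show ?thesis by (elim ssubst, intro open_vimage[OF W] continuous_intros)
  qed
  have xS': "x \<in> S'" using z by (simp add: S'_def)
  have pd3: "pd (\<lambda>x'. pd (\<lambda>y. L (x', y)) w y) u x = frechet_derivative (lam L w) (at (x, y)) (u, 0)" for w u
  proof (rule pd_of)
    show "((\<lambda>x'. pd (\<lambda>y. L (x', y)) w y) has_derivative (\<lambda>u. frechet_derivative (lam L w) (at (x, y)) (u, 0))) (at x)"
      by (rule has_derivative_transform_within_open[OF dlam(2) opS' xS']) (simp add: pd1 S'_def)
  qed
  have pd4: "pd (\<lambda>x'. L (x', y)) u x = frechet_derivative L (at (x, y)) (u, 0)" for u
  proof (rule pd_of)
    have "((\<lambda>x. (x, y)) has_derivative (\<lambda>w. (w, 0))) (at x)" by (auto intro!: derivative_eq_intros)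
    from has_derivative_compose[OF this smooth_on_has_derivative[OF L z]]
    show "((\<lambda>x'. L (x', y)) has_derivative (\<lambda>u. frechet_derivative L (at (x, y)) (u, 0))) (at x)" .
  qed
  define g where "g = (\<chi> i j. 1/2 * pd (pd (\<lambda>y. L (x, y)) (axis j 1)) (axis i 1) y :: real ^ 'n ^ 'n)"
  have g: "g = (1/2) *\<^sub>R mass (x, y)"
    by (simp add: g_def vec_eq_iff pd2 mass_def lam_sym[OF z])
  have V: "(\<Sum>k\<in>UNIV. pd (\<lambda>x'. pd (\<lambda>y. L (x', y)) (axis l 1) y) (axis k 1) x * y $ k) - pd (\<lambda>x'. L (x', y)) (axis l 1) x
      = force (x, y) $ l" for l
  proof -
    let ?l = "\<lambda>v. frechet_derivative (lam L (axis l 1)) (at (x, y)) (v, 0)"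
    have lin: "linear ?l"
      by (rule linear_compose[OF _ lam_deriv_linear[OF z], of "\<lambda>v. (v, 0)" "axis l 1", unfolded o_def]) (auto intro!: linearI)
    have "?l y = ?l (\<Sum>j\<in>UNIV. y $ j *\<^sub>R axis j 1)" using axis_sum[of y] by simp
    also have "\<dots> = (\<Sum>j\<in>UNIV. ?l (axis j 1) * y $ j)"
      by (simp only: linear_sum[OF lin] linear_scale[OF lin] real_scaleR_def mult.commute)
    finally show ?thesis by (simp add: pd3 pd4 force_def)
  qed
  have sp: "spray_coeff (\<lambda>x y. L (x, y)) x y = (1/4) *\<^sub>R (matrix_inv g *v force (x, y))"
    unfolding spray_coeff_def Let_def g_def[symmetric] V
    by (simp add: vec_eq_iff matrix_vector_mult_def)
  have "invertible g"
    unfolding invertible_det_nz g using mass_det[OF z] det_rows_mul[of "\<lambda>_. 1/2" "\<lambda>i. mass (x, y) $ i"]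
    by (simp add: vector_scalar_mult_def scaleR_vec_def)
  then have gi: "g ** matrix_inv g = mat 1" "matrix_inv g ** g = mat 1"
    unfolding invertible_def matrix_inv_def by (metis (mono_tags, lifting) someI_ex)+
  have "a + 2 *\<^sub>R spray_coeff (\<lambda>x y. L (x, y)) x y = 0 \<longleftrightarrow> a + (1/2) *\<^sub>R (matrix_inv g *v force (x, y)) = 0"
    by (simp add: sp)
  also have "\<dots> \<longleftrightarrow> g *v (a + (1/2) *\<^sub>R (matrix_inv g *v force (x, y))) = 0"
  proof
    assume "g *v (a + (1/2) *\<^sub>R (matrix_inv g *v force (x, y))) = 0"
    then have "matrix_inv g *v (g *v (a + (1/2) *\<^sub>R (matrix_inv g *v force (x, y)))) = 0" by simp
    then show "a + (1/2) *\<^sub>R (matrix_inv g *v force (x, y)) = 0"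
      by (simp only: matrix_vector_mul_assoc gi matrix_vector_mul_lid)
  qed simp
  also have "g *v (a + (1/2) *\<^sub>R (matrix_inv g *v force (x, y))) = g *v a + (1/2) *\<^sub>R force (x, y)"
    by (simp only: matrix_vector_right_distrib matrix_vector_mult_scaleR matrix_vector_mul_assoc gi matrix_vector_mul_lid)
  also have "g *v a + (1/2) *\<^sub>R force (x, y) = (1/2) *\<^sub>R (mass (x, y) *v a + force (x, y))"
    by (simp add: g scaleR_matrix_vector_assoc[symmetric] scaleR_add_right)
  also have "\<dots> = 0 \<longleftrightarrow> mass (x, y) *v a = - force (x, y)"
    by (simp add: eq_neg_iff_add_eq_0)
  finally show ?thesis using EL_iff_mass[OF z] by simp
qed

text \<open>Cramer's rule, chosen because a quotient of determinants is visibly smooth in z.\<close>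

definition accel :: "(real ^ 'n) \<times> (real ^ 'n) \<Rightarrow> real ^ 'n"
  where "accel z = (\<chi> k. det (\<chi> i j. if j = k then (- force z) $ i else mass z $ i $ j) / det (mass z))"

lemma EL_accel: "z \<in> W \<Longrightarrow> EL L z (accel z)"
  unfolding EL_iff_mass accel_def using cramer[OF mass_det] by blast

lemma accel_smooth: "smooth_on W accel"
proof (rule smooth_on_vec[OF W])
  fix k
  have m: "smooth_on W (\<lambda>z. mass z $ i $ j)" for i j
    using smooth_on_frechet[OF lam_smooth] by (simp add: mass_def)
  have f: "smooth_on W (\<lambda>z. (- force z) $ i)" for i
  proof -
    have "smooth_on W (\<lambda>z. frechet_derivative L (at z) (axis i 1, 0)
        - frechet_derivative (lam L (axis i 1)) (at z) (snd z, 0))"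
      by (intro smooth_on_diff W smooth_on_frechet L smooth_on_frechet_compose[OF W lam_smooth smooth_on_id]
          smooth_on_Pair smooth_on_snd smooth_on_const) auto
    then show ?thesis by (simp add: force_def)
  qed
  have "smooth_on W (\<lambda>z. det (\<chi> i j. if j = k then (- force z) $ i else mass z $ i $ j) / det (mass z))"
  proof (intro smooth_on_divide W smooth_on_det m mass_det)
    fix i j
    show "smooth_on W (\<lambda>z. (\<chi> i j. if j = k then (- force z) $ i else mass z $ i $ j) $ i $ j)"
      using m[of i j] f[of i] by (cases "j = k") (simp_all del: vector_uminus_component)
  qed
  then show "smooth_on W (\<lambda>z. accel z $ k)" by (simp add: accel_def)
qed

end

text \<open>Change of coordinates: the terms with second derivatives of \<open>\<tau>\<close> cancel.\<close>

lemma EL_transform: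
  fixes L L' :: "((real ^ 'n) \<times> (real ^ 'n)) \<Rightarrow> real" and \<tau> :: "real ^ 'n \<Rightarrow> real ^ 'n"
  assumes W: "lagrangian L W" and W': "lagrangian L' W'"
    and S: "open S" "x t \<in> S" and \<tau>: "smooth_on S \<tau>" and surj: "surj (frechet_derivative \<tau> (at (x t)))"
    and eq: "\<And>z. z \<in> W \<Longrightarrow> fst z \<in> S \<Longrightarrow> (\<tau> (fst z), frechet_derivative \<tau> (at (fst z)) (snd z)) \<in> W'
      \<and> L z = L' (\<tau> (fst z), frechet_derivative \<tau> (at (fst z)) (snd z))"
    and x: "(x has_vector_derivative y t) (at t)" and y: "(y has_vector_derivative a) (at t)"
    and z: "(x t, y t) \<in> W"
    and u: "((\<lambda>r. frechet_derivative \<tau> (at (x r)) (y r)) has_vector_derivative a') (at t)"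
    and EL: "EL L (x t, y t) a"
  shows "EL L' (\<tau> (x t), frechet_derivative \<tau> (at (x t)) (y t)) a'"
proof -
  interpret P: lagrangian L W by fact
  interpret Q: lagrangian L' W' by fact
  let ?d = "\<lambda>p. frechet_derivative \<tau> (at p)"
  let ?\<Phi> = "\<lambda>z. (\<tau> (fst z), ?d (fst z) (snd z))"
  let ?z = "(x t, y t)" and ?D2 = "\<lambda>p v. frechet_derivative (\<lambda>q. ?d q v) (at p)"
  have z': "?\<Phi> ?z \<in> W'" using eq[OF z] S by simp
  have d\<tau>: "(\<tau> has_derivative ?d p) (at p)" if "p \<in> S" for p by (rule smooth_on_has_derivative[OF \<tau> that])
  have lin: "linear (?d p)" if "p \<in> S" for p by (rule has_derivative_linear[OF d\<tau>[OF that]])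
  have D\<Phi>: "(?\<Phi> has_derivative (\<lambda>v. (?d (fst z) (fst v), ?d (fst z) (snd v) + ?D2 (fst z) (snd z) (fst v)))) (at z)"
    if "fst z \<in> S" for z
  proof (rule has_derivative_Pair)
    show "((\<lambda>z. \<tau> (fst z)) has_derivative (\<lambda>v. ?d (fst z) (fst v))) (at z)"
      by (rule has_derivative_compose[OF has_derivative_fst[OF has_derivative_ident] d\<tau>[OF that]])
    show "((\<lambda>z. ?d (fst z) (snd z)) has_derivative (\<lambda>v. ?d (fst z) (snd v) + ?D2 (fst z) (snd z) (fst v))) (at z)"
      by (rule frechet_derivative_along[OF S(1) that \<tau> has_derivative_fst[OF has_derivative_ident] has_derivative_snd[OF has_derivative_ident]])
  qed
  define U where "U = W \<inter> fst -` S"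
  have U: "open U" unfolding U_def by (intro open_Int P.W open_vimage S(1) continuous_intros)
  have DL: "frechet_derivative L (at z) v = frechet_derivative L' (at (?\<Phi> z))
      (?d (fst z) (fst v), ?d (fst z) (snd v) + ?D2 (fst z) (snd z) (fst v))" if "z \<in> U" for z v
  proof -
    have zs: "z \<in> W" "fst z \<in> S" using that by (auto simp: U_def)
    have "((\<lambda>z. L' (?\<Phi> z)) has_derivative (\<lambda>v. frechet_derivative L' (at (?\<Phi> z))
      (?d (fst z) (fst v), ?d (fst z) (snd v) + ?D2 (fst z) (snd z) (fst v)))) (at z)"
      by (rule has_derivative_compose[OF D\<Phi>[OF zs(2)]])
        (rule smooth_on_has_derivative[OF Q.L]; use eq[OF zs] in blast)
    then have "(L has_derivative (\<lambda>v. frechet_derivative L' (at (?\<Phi> z))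
      (?d (fst z) (fst v), ?d (fst z) (snd v) + ?D2 (fst z) (snd z) (fst v)))) (at z)"
      by (rule has_derivative_transform_within_open[OF _ U that]) (use eq in \<open>auto simp: U_def\<close>)
    then show ?thesis by (simp add: frechet_derivative_eq)
  qed
  have zc: "((\<lambda>r. (x r, y r)) has_vector_derivative (y t, a)) (at t)"
    by (rule has_vector_derivative_Pair[OF x y])
  have zU: "?z \<in> U" using z S by (simp add: U_def)
  have evU: "\<forall>\<^sub>F r in nhds t. (x r, y r) \<in> U"
    by (rule eventually_nhds_compose_continuous[OF eventually_nhds_in_open[OF U zU] has_vector_derivative_continuous[OF zc]])
  have ux: "((\<lambda>r. \<tau> (x r)) has_derivative (\<lambda>h. ?d (x t) (h *\<^sub>R y t))) (at t)"
    by (rule has_derivative_compose[OF x[unfolded has_vector_derivative_def] d\<tau>[OF S(2)]])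
  have kc: "((\<lambda>r. ?\<Phi> (x r, y r)) has_derivative (\<lambda>h. (?d (x t) (h *\<^sub>R y t), h *\<^sub>R a'))) (at t)"
    using has_derivative_Pair[OF ux u[unfolded has_vector_derivative_def]] by simp
  show ?thesis
    unfolding EL_def
  proof
    fix w'
    obtain w where w: "w' = ?d (x t) w" using surj by (metis surjD)
    \<comment> \<open>The constant direction w becomes a moving direction in the other chart; its
      velocity contributes a Hessian of \<tau>.\<close>
    have hc: "((\<lambda>r. (0, ?d (x r) w)) has_derivative (\<lambda>h. (0, ?D2 (x t) w (h *\<^sub>R y t)))) (at t)"
      using has_derivative_Pair[OF has_derivative_const has_derivative_compose[OF x[unfolded has_vector_derivative_def]
          smooth_on_has_derivative[OF smooth_on_frechet[OF \<tau>] S(2)]]] .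
    have "((\<lambda>r. lam L w (x r, y r)) has_derivative (\<lambda>h. frechet_derivative (lam L w) (at ?z) (h *\<^sub>R (y t, a)))) (at t)"
      by (rule has_derivative_compose[OF zc[unfolded has_vector_derivative_def] smooth_on_has_derivative[OF P.lam_smooth z]])
    moreover have "((\<lambda>r. lam L w (x r, y r)) has_derivative
        (\<lambda>h. frechet_derivative L' (at (?\<Phi> ?z)) (0, ?D2 (x t) w (h *\<^sub>R y t))
          + frechet_derivative (\<lambda>z. frechet_derivative L' (at z) (0, ?d (x t) w)) (at (?\<Phi> ?z)) (?d (x t) (h *\<^sub>R y t), h *\<^sub>R a'))) (at t)"
    proof (rule has_derivative_transform_eventually_at)
      show "((\<lambda>r. frechet_derivative L' (at (?\<Phi> (x r, y r))) (0, ?d (x r) w)) has_derivative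
        (\<lambda>h. frechet_derivative L' (at (?\<Phi> ?z)) (0, ?D2 (x t) w (h *\<^sub>R y t))
          + frechet_derivative (\<lambda>z. frechet_derivative L' (at z) (0, ?d (x t) w)) (at (?\<Phi> ?z)) (?d (x t) (h *\<^sub>R y t), h *\<^sub>R a'))) (at t)"
        by (rule frechet_derivative_along[OF Q.W z' Q.L kc hc])
      show "\<forall>\<^sub>F r in nhds t. frechet_derivative L' (at (?\<Phi> (x r, y r))) (0, ?d (x r) w) = lam L w (x r, y r)"
        using evU
      proof eventually_elim
        case (elim r)
        have xs: "x r \<in> S" using elim by (simp add: U_def)
        have l0: "?d (x r) 0 = 0" by (rule linear_0[OF lin[OF xs]])
        have "linear (?D2 (x r) (y r))"
          by (rule has_derivative_linear[OF smooth_on_has_derivative[OF smooth_on_frechet[OF \<tau>] xs]])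
        then have l1: "?D2 (x r) (y r) 0 = 0" by (rule linear_0)
        show ?case unfolding lam_def DL[OF elim] by (simp add: l0 l1)
      qed
    qed
    ultimately have "(\<lambda>h. frechet_derivative (lam L w) (at ?z) (h *\<^sub>R (y t, a)))
      = (\<lambda>h. frechet_derivative L' (at (?\<Phi> ?z)) (0, ?D2 (x t) w (h *\<^sub>R y t))
          + frechet_derivative (\<lambda>z. frechet_derivative L' (at z) (0, ?d (x t) w)) (at (?\<Phi> ?z)) (?d (x t) (h *\<^sub>R y t), h *\<^sub>R a'))"
      by (rule has_derivative_unique)
    from fun_cong[OF this, of 1] have e1: "frechet_derivative (lam L w) (at ?z) (y t, a)
      = frechet_derivative L' (at (?\<Phi> ?z)) (0, ?D2 (x t) w (y t))
          + frechet_derivative (lam L' w') (at (?\<Phi> ?z)) (?d (x t) (y t), a')"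
      by (simp add: lam_def w)
    have "frechet_derivative (lam L w) (at ?z) (y t, a) = frechet_derivative L (at ?z) (w, 0)"
      using EL by (simp add: EL_def)
    also have "\<dots> = frechet_derivative L' (at (?\<Phi> ?z)) (w', ?D2 (x t) (y t) w)"
      unfolding DL[OF zU] by (simp add: w linear_0[OF lin[OF S(2)]])
    also have "?D2 (x t) (y t) w = ?D2 (x t) w (y t)"
      by (rule second_derivative_symmetric[OF S \<tau>])
    also have "frechet_derivative L' (at (?\<Phi> ?z)) (w', ?D2 (x t) w (y t))
      = frechet_derivative L' (at (?\<Phi> ?z)) (w', 0) + frechet_derivative L' (at (?\<Phi> ?z)) (0, ?D2 (x t) w (y t))"
      using linear_add[OF Q.L_deriv_linear[OF z'], of "(w', 0)" "(0, ?D2 (x t) w (y t))"] by simp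
    finally show "frechet_derivative (lam L' w') (at (\<tau> (x t), ?d (x t) (y t))) (snd (\<tau> (x t), ?d (x t) (y t)), a')
        = frechet_derivative L' (at (\<tau> (x t), ?d (x t) (y t))) (w', 0)"
      using e1 by simp
  qed
qed

section \<open>The distortion\<close>

text \<open>Tangent vectors are families indexed by charts, in a function space without norm.
  Directional derivatives there are pulled back along a linear parametrisation to a space where the
  calculus above applies.\<close>

lemma pd_linear:
  assumes "linear T"
  shows "pd f (T u) (T y) = pd (\<lambda>y. f (T y)) u y" and "pd (pd f (T w)) (T u) (T y) = pd (pd (\<lambda>y. f (T y)) w) u y"
proof -
  have 1: "pd f (T u) (T y) = pd (\<lambda>y. f (T y)) u y" for u y
    by (simp add: pd_def linear_add[OF assms] linear_scale[OF assms])
  show "pd f (T u) (T y) = pd (\<lambda>y. f (T y)) u y" by (rule 1)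
  have "pd (pd f (T w)) (T u) (T y) = pd (\<lambda>y. pd f (T w) (T y)) u y"
    by (simp add: pd_def linear_add[OF assms] linear_scale[OF assms])
  then show "pd (pd f (T w)) (T u) (T y) = pd (pd (\<lambda>y. f (T y)) w) u y" by (simp only: 1)
qed

lemma pd_of_has_derivative:
  assumes "(f has_derivative f') (at p)"
  shows "pd f u p = f' u"
proof -
  have "f differentiable (at p)" using assms unfolding differentiable_def by blast
  then show ?thesis by (simp add: pd_eq_frechet frechet_derivative_eq[OF assms])
qed

lemma sf_gt_one: "norm z < w \<bullet> z \<Longrightarrow> sf w z > 1"
  using less_le_trans[of 0 "norm z"] by (cases "z = 0") (auto simp: sf_def)

lemma pd_pd_Lf:
  assumes D0: "open D0" "z \<in> D0" and f: "\<And>z. z \<in> D0 \<Longrightarrow> f z = Lf w z"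
    and pos: "\<And>z. z \<in> D0 \<Longrightarrow> z \<noteq> 0 \<and> norm z < w \<bullet> z"
  shows "pd f v z = dLf w z v" "pd (pd f v) u (z :: 'v::euclidean_space) = hLf w z u v"
proof -
  have 1: "pd f v z = dLf w z v" if z: "z \<in> D0" for z
  proof (rule pd_of_has_derivative)
    have s: "sf w z > 1" using sf_gt_one pos[OF z] by blast
    show "(f has_derivative dLf w z) (at z)"
      by (rule has_derivative_transform_within_open[OF Lf_has_derivative D0(1) z])
        (use pos[OF z] s f in auto)
  qed
  show "pd f v z = dLf w z v" by (rule 1[OF D0(2)])
  show "pd (pd f v) u z = hLf w z u v"
  proof (rule pd_of_has_derivative)
    have s: "sf w z > 1" using sf_gt_one pos[OF D0(2)] by blast
    show "(pd f v has_derivative (\<lambda>u. hLf w z u v)) (at z)"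
      by (rule has_derivative_transform_within_open[OF dLf_has_derivative D0])
        (use pos[OF D0(2)] s 1 in auto)
  qed
qed

lemma hLf_linear: "linear (\<lambda>u. hLf w z u v)" "linear (hLf w z u)"
  by (auto intro!: linearI simp: hLf_def Let_def inner_add_left inner_add_right algebra_simps)

lemma det_hLf_basis:
  fixes w z :: "real ^ 'n" and m :: "'n \<Rightarrow> real ^ 'n"
  shows "det (\<chi> i j. 1/2 * hLf w z (m i) (m j))
    = (det (\<chi> r i. m i $ r))\<^sup>2 * det (\<chi> i j. 1/2 * hLf w z (axis i 1) (axis j 1))"
proof -
  let ?N = "(\<chi> r i. m i $ r) :: real ^ 'n ^ 'n" and ?K = "(\<chi> i j. 1/2 * hLf w z (axis i 1) (axis j 1)) :: real ^ 'n ^ 'n"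
  have ax: "(v :: real ^ 'n) = (\<Sum>i\<in>UNIV. v $ i *\<^sub>R axis i 1)" for v
    using basis_expansion[of v] by (simp add: scalar_mult_eq_scaleR)
  have e1: "hLf w z u v = (\<Sum>r\<in>UNIV. u $ r * hLf w z (axis r 1) v)" for u v
    by (subst ax[of u], subst linear_sum[OF hLf_linear(1)]) (simp only: linear_scale[OF hLf_linear(1)] real_scaleR_def)
  have e2: "hLf w z u v = (\<Sum>s\<in>UNIV. v $ s * hLf w z u (axis s 1))" for u v
    by (subst ax[of v], subst linear_sum[OF hLf_linear(2)]) (simp only: linear_scale[OF hLf_linear(2)] real_scaleR_def)
  have "(\<chi> i j. 1/2 * hLf w z (m i) (m j)) = transpose ?N ** ?K ** ?N"
  proof -
    have "1/2 * hLf w z (m i) (m j) = (\<Sum>s\<in>UNIV. (\<Sum>r\<in>UNIV. m i $ r * (1/2 * hLf w z (axis r 1) (axis s 1))) * m j $ s)" for i j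
      by (subst e2, subst e1) (simp add: sum_distrib_left sum_distrib_right mult_ac)
    then show ?thesis by (simp add: vec_eq_iff matrix_matrix_mult_def transpose_def)
  qed
  then show ?thesis by (simp add: det_mul det_transpose power2_eq_square)
qed

text \<open>The minimum of s^2 / (s - 1) over s > 1 is 4, taken at s = 2. It bounds the unit ball of
  F, so that its volume is finite.\<close>

lemma four_norm_le:
  fixes b N :: real
  assumes "0 \<le> N" "N < b"
  shows "4 * N \<le> b\<^sup>2 / (b - N)"
proof -
  have "b\<^sup>2 - 4 * N * (b - N) = (b - 2 * N)\<^sup>2" by (simp add: power2_eq_square algebra_simps)
  then have "4 * N * (b - N) \<le> b\<^sup>2" using zero_le_power2[of "b - 2 * N"] by linarith
  then show ?thesis using assms by (simp add: pos_le_divide_eq)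
qed

text \<open>\<open>distortion\<close> uses a basis picked by SOME. Passing from the coordinates T to
  that basis multiplies the root of the determinant by |det M| and divides the volume of the unit
  ball by it, so the choice cancels.\<close>

lemma distortion_formula:
  fixes T :: "real ^ 'n \<Rightarrow> ('p, real ^ 'n) tangent" and w z :: "real ^ 'n"
  assumes T: "linear T" "inj T" "range T = tangent_space B P"
    and DP: "\<And>z. T z \<in> D P \<longleftrightarrow> z \<in> D0"
    and F: "\<And>z. z \<in> D0 \<Longrightarrow> F P (T z) = (w \<bullet> z)\<^sup>2 / (w \<bullet> z - norm z)"
    and D0: "open D0" and cone: "\<And>z r. z \<in> D0 \<Longrightarrow> r > 0 \<Longrightarrow> r *\<^sub>R z \<in> D0"
    and pos: "\<And>z. z \<in> D0 \<Longrightarrow> z \<noteq> 0 \<and> norm z < w \<bullet> z"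
    and N: "\<And>z. z \<in> D0 \<Longrightarrow> N3 (w \<bullet> w) (sf w z) > 0"
    and z: "z \<in> D0"
  shows "distortion B D F P (T z) = Tf CARD('n) (w \<bullet> w) (sf w z)
    - ln (measure lborel (ball (0::real^'n) 1) / measure lborel {z \<in> D0. (w \<bullet> z)\<^sup>2 / (w \<bullet> z - norm z) < 1})"
proof -
  have "tangent_basis B P (\<lambda>i. T (axis i 1))"
    unfolding tangent_basis_def
  proof (intro conjI)
    have r: "range (\<lambda>i. T (axis i 1)) = T ` Basis" by (auto simp: Basis_vec_def)
    show "inj (\<lambda>i. T (axis i 1))" using T(2) by (auto intro!: injI dest!: injD simp: axis_eq_axis)
    show "independent (range (\<lambda>i. T (axis i 1)))"
      unfolding r by (rule linear_independent_injective_image[OF T(1) independent_Basis]) (use T(2) in \<open>auto intro: inj_on_subset\<close>)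
    show "span (range (\<lambda>i. T (axis i 1))) = tangent_space B P"
      unfolding r linear_span_image[OF T(1)] T(3)[symmetric] by simp
  qed
  then have "\<exists>e. tangent_basis B P (e :: 'n \<Rightarrow> ('p, real ^ 'n) tangent)" by blast
  define e where "e = (SOME e :: 'n \<Rightarrow> ('p, real ^ 'n) tangent. tangent_basis B P e)"
  have "tangent_basis B P e" unfolding e_def by (rule someI_ex[where P="tangent_basis B P"]) fact
  then have e: "inj e" "independent (range e)" "span (range e) = range T"
    unfolding tangent_basis_def T(3) by blast+
  define m where "m i = inv_into UNIV T (e i)" for i
  have m: "T (m i) = e i" for i
  proof -
    have "e i \<in> range T" unfolding e(3)[symmetric] by (rule span_base) simp
    then show ?thesis unfolding m_def by (rule f_inv_into_f)
  qed
  define M where "M y = (\<Sum>i\<in>UNIV. y $ i *\<^sub>R m i)" for y :: "real ^ 'n"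
  have M: "linear M"
    by (auto intro!: linearI simp: M_def scaleR_add_left sum.distrib scaleR_sum_right)
  have TM: "(\<Sum>i\<in>UNIV. y $ i *\<^sub>R e i) = T (M y)" for y
    unfolding M_def linear_sum[OF T(1)] linear_scale[OF T(1)] m ..
  have injM: "inj M"
  proof (rule linear_injective_0[OF M, THEN iffD2], intro allI impI)
    fix y assume "M y = 0"
    then have "(\<Sum>i\<in>UNIV. y $ i *\<^sub>R e i) = 0" by (simp only: TM linear_0[OF T(1)])
    then have s0: "(\<Sum>v\<in>range e. (y $ inv_into UNIV e v) *\<^sub>R v) = 0"
      by (subst sum.reindex[OF e(1)]) (simp add: o_def e(1))
    have "y $ i = 0" for i
      using independentD[OF e(2) finite_imageI[OF finite_class.finite] subset_refl s0, of "e i"] by (simp add: e(1))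
    then show "y = 0" by (simp add: vec_eq_iff)
  qed
  have matM: "matrix M = (\<chi> r i. m i $ r)"
  proof -
    have "M (axis i 1) = m i" for i by (simp add: M_def axis_def if_distrib[of "\<lambda>r. r *\<^sub>R _"] cong: if_cong)
    then show ?thesis by (simp add: matrix_def)
  qed
  define S0 where "S0 = {z \<in> D0. (w \<bullet> z)\<^sup>2 / (w \<bullet> z - norm z) < 1}"
  define S where "S = M -` S0"
  have contF: "continuous_on D0 (\<lambda>z. (w \<bullet> z)\<^sup>2 / (w \<bullet> z - norm z))"
    using pos by (intro continuous_intros) force
  have "S0 = D0 \<inter> (\<lambda>z. (w \<bullet> z)\<^sup>2 / (w \<bullet> z - norm z)) -` {..<1}" by (auto simp: S0_def)
  then have opS0: "open S0" using continuous_open_preimage[OF contF D0 open_lessThan] by simp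
  have bS0: "bounded S0"
  proof (rule boundedI)
    fix z assume "z \<in> S0"
    then have z: "z \<in> D0" "(w \<bullet> z)\<^sup>2 / (w \<bullet> z - norm z) < 1" by (auto simp: S0_def)
    show "norm z \<le> 1" using four_norm_le[of "norm z" "w \<bullet> z"] pos[OF z(1)] z(2) norm_ge_zero[of z] by linarith
  qed
  have neS0: "S0 \<noteq> {}"
  proof -
    define f where "f = (w \<bullet> z)\<^sup>2 / (w \<bullet> z - norm z)"
    have nz: "norm z > 0" using pos[OF z] by simp
    have f: "f > 0" using four_norm_le[OF norm_ge_zero, of z "w \<bullet> z"] pos[OF z] nz unfolding f_def by linarith
    \<comment> \<open>By homogeneity this scales the value of F to 1/2.\<close>
    define r where "r = 1 / (2 * f)"
    have r: "r > 0" using f by (simp add: r_def)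
    have "(w \<bullet> (r *\<^sub>R z))\<^sup>2 / (w \<bullet> (r *\<^sub>R z) - norm (r *\<^sub>R z)) = (r * r * (w \<bullet> z)\<^sup>2) / (r * (w \<bullet> z - norm z))"
      using r by (simp add: power_mult_distrib power2_eq_square right_diff_distrib mult_ac)
    also have "\<dots> = r * f" using r by (simp add: f_def)
    also have "\<dots> < 1" using f by (simp add: r_def)
    finally have "r *\<^sub>R z \<in> S0" using cone[OF z r] by (simp add: S0_def)
    then show ?thesis by blast
  qed
  \<comment> \<open>Volume 0 would turn the density into a division by zero; a nonempty open set is
    not negligible.\<close>
  have posS0: "measure lborel S0 > 0"
  proof -
    have lm: "S0 \<in> lmeasurable" using opS0 bS0 by (rule lmeasurable_open[rotated])
    have "\<not> negligible S0" by (rule open_not_negligible[OF opS0 neS0])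
    then have "measure lebesgue S0 \<noteq> 0" using lm negligible_iff_measure by blast
    then show ?thesis using opS0 by (simp add: measure_completion zero_less_measure_iff)
  qed
  have contM: "continuous_on UNIV M" using M by (simp add: linear_continuous_on linear_conv_bounded_linear)
  have opS: "open S" unfolding S_def by (rule open_vimage[OF opS0 contM])
  obtain g where g: "linear g" "g \<circ> M = id" using linear_injective_left_inverse[OF M injM] by blast
  have bS: "bounded S"
  proof (rule bounded_subset)
    show "bounded (g ` S0)" using bounded_linear_image[OF bS0] g(1) by (simp add: linear_conv_bounded_linear)
    show "S \<subseteq> g ` S0"
    proof
      fix y assume "y \<in> S"
      then have "M y \<in> S0" by (simp add: S_def)
      moreover have "y = g (M y)" using g(2) by (simp add: fun_eq_iff)
      ultimately show "y \<in> g ` S0" by blast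
    qed
  qed
  have "M ` S = S0"
    unfolding S_def using linear_inj_imp_surj[OF M injM] by (rule surj_image_vimage_eq)
  then have vol: "measure lborel S0 = \<bar>det (matrix M)\<bar> * measure lborel S"
    using measure_linear_image_cart[OF M injM opS bS] by simp
  have Sset: "{y. (\<Sum>i\<in>UNIV. y $ i *\<^sub>R e i) \<in> D P \<and> F P (\<Sum>i\<in>UNIV. y $ i *\<^sub>R e i) < 1} = S"
    unfolding TM DP using F by (auto simp: S_def S0_def)
  have FT: "fundamental_tensor F P (T z) (e i) (e j) = 1/2 * hLf w z (m i) (m j)" for i j
  proof -
    have "fundamental_tensor F P (T z) (e i) (e j) = 1/2 * pd (pd (\<lambda>z. (F P (T z))\<^sup>2) (m j)) (m i) z"
      unfolding fundamental_tensor_def m[symmetric] pd_linear(2)[OF T(1)] ..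
    also have "pd (pd (\<lambda>z. (F P (T z))\<^sup>2) (m j)) (m i) z = hLf w z (m i) (m j)"
      by (rule pd_pd_Lf(2)[OF D0 z]) (use F pos in \<open>auto simp: Lf_def\<close>)
    finally show ?thesis .
  qed
  let ?K = "det (\<chi> i j. 1/2 * hLf w z (axis i 1) (axis j 1))" and ?V = "measure lborel (ball (0::real^'n) 1)"
  have s1: "sf w z > 1" using sf_gt_one pos[OF z] by blast
  note K = ln_sqrt_det_hLf[OF _ s1 N[OF z]]
  have V: "?V > 0" by (rule content_ball_pos) simp
  have "distortion B D F P (T z) = ln (sqrt (det (\<chi> i j. 1/2 * hLf w z (m i) (m j))) / (?V / measure lborel S))"
    unfolding distortion_def e_def[symmetric] Let_def bh_density_def Sset FT ..
  also have "det (\<chi> i j. 1/2 * hLf w z (m i) (m j)) = (det (matrix M))\<^sup>2 * ?K"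
    unfolding matM by (rule det_hLf_basis)
  also have "sqrt ((det (matrix M))\<^sup>2 * ?K) = \<bar>det (matrix M)\<bar> * sqrt ?K"
    by (simp add: real_sqrt_mult)
  also have "\<bar>det (matrix M)\<bar> * sqrt ?K / (?V / measure lborel S) = sqrt ?K / (?V / measure lborel S0)"
    unfolding vol by simp
  also have "ln \<dots> = ln (sqrt ?K) - ln (?V / measure lborel S0)"
  proof -
    have lnd: "ln (x / y) = ln x - ln y" if "x > 0" "y > 0" for x y :: real using that by (simp add: ln_div)
    show ?thesis
    proof (rule lnd)
      show "sqrt ?K > 0" using K(2) pos[OF z] by simp
      show "?V / measure lborel S0 > 0" by (rule divide_pos_pos[OF V posS0])
    qed
  qed
  also have "ln (sqrt ?K) = Tf CARD('n) (w \<bullet> w) (sf w z)" using K(1) pos[OF z] by blast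
  finally show ?thesis unfolding S0_def .
qed

section \<open>Invariant infinite series metrics\<close>

locale finsler_hspace = hspace G X A Y B H
  for G :: "('g, 'r) monoid_scheme" (structure) and X :: "'g topology"
    and A :: "('g, 'e::euclidean_space) chart set"
    and Y :: "'g set topology" and B :: "('g set, real ^ 'n) chart set" and H :: "'g set" +
  fixes D :: "'g set \<Rightarrow> ('g set, real ^ 'n) tangent set"
    and F \<beta> :: "'g set \<Rightarrow> ('g set, real ^ 'n) tangent \<Rightarrow> real"
    and a :: "'g set \<Rightarrow> ('g set, real ^ 'n) tangent \<Rightarrow> ('g set, real ^ 'n) tangent \<Rightarrow> real"
  assumes ism: "infinite_series_metric B D a \<beta> F" and finv: "invariant_finsler G B D F"
begin

lemmas metric_conds = ism[unfolded infinite_series_metric_def]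

lemmas riemannian = metric_conds[THEN conjunct1, unfolded riemannian_metric_def]
  and form = metric_conds[THEN conjunct2, THEN conjunct1, unfolded one_form_def]
  and finsler = metric_conds[THEN conjunct2, THEN conjunct2, THEN conjunct1, unfolded finsler_metric_def Let_def]

lemma a_sym: "P \<in> points B \<Longrightarrow> \<xi> \<in> tangent_space B P \<Longrightarrow> \<eta> \<in> tangent_space B P \<Longrightarrow> a P \<xi> \<eta> = a P \<eta> \<xi>"
  by (rule riemannian[THEN conjunct1, THEN bspec, THEN bspec, THEN conjunct1, THEN bspec, THEN conjunct1])

lemma a_lin: "P \<in> points B \<Longrightarrow> \<xi> \<in> tangent_space B P \<Longrightarrow> \<eta> \<in> tangent_space B P \<Longrightarrow> \<zeta> \<in> tangent_space B P
    \<Longrightarrow> a P (r *\<^sub>R \<xi> + \<eta>) \<zeta> = r * a P \<xi> \<zeta> + a P \<eta> \<zeta>"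
  by (rule riemannian[THEN conjunct1, THEN bspec, THEN bspec, THEN conjunct1, THEN bspec, THEN conjunct2, THEN bspec, THEN spec])

lemma a_pos: "P \<in> points B \<Longrightarrow> \<xi> \<in> tangent_space B P \<Longrightarrow> \<xi> \<noteq> 0 \<Longrightarrow> a P \<xi> \<xi> > 0"
  by (rule riemannian[THEN conjunct1, THEN bspec, THEN bspec, THEN conjunct2, THEN mp])

lemma a_smooth: "d \<in> B \<Longrightarrow> smooth_on (snd d ` fst d)
    (\<lambda>x. a (chart_inv d x) (coord_tangent B d (chart_inv d x) u) (coord_tangent B d (chart_inv d x) w))"
  by (rule riemannian[THEN conjunct2, THEN bspec, THEN spec, THEN spec])

lemma \<beta>_lin: "P \<in> points B \<Longrightarrow> \<xi> \<in> tangent_space B P \<Longrightarrow> \<eta> \<in> tangent_space B P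
    \<Longrightarrow> \<beta> P (r *\<^sub>R \<xi> + \<eta>) = r * \<beta> P \<xi> + \<beta> P \<eta>"
  by (rule form[THEN conjunct1, THEN bspec, THEN bspec, THEN bspec, THEN spec])

lemma \<beta>_smooth: "d \<in> B \<Longrightarrow> smooth_on (snd d ` fst d)
    (\<lambda>x. \<beta> (chart_inv d x) (coord_tangent B d (chart_inv d x) u))"
  by (rule form[THEN conjunct2, THEN bspec, THEN spec])

lemma F_eq: "P \<in> points B \<Longrightarrow> \<xi> \<in> D P \<Longrightarrow> F P \<xi> = (\<beta> P \<xi>)\<^sup>2 / (\<beta> P \<xi> - sqrt (a P \<xi> \<xi>))"
  by (rule metric_conds[THEN conjunct2, THEN conjunct2, THEN conjunct2, THEN bspec, THEN bspec])

lemma D_ne: "P \<in> points B \<Longrightarrow> D P \<noteq> {}"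
  by (rule finsler[THEN conjunct1, THEN bspec, THEN conjunct1])

lemma D_sub: "P \<in> points B \<Longrightarrow> \<xi> \<in> D P \<Longrightarrow> \<xi> \<in> tangent_space B P \<and> \<xi> \<noteq> 0"
  using finsler[THEN conjunct1, THEN bspec, THEN conjunct2, THEN conjunct1, THEN subsetD, of P \<xi>] by simp

lemma F_ge: "P \<in> points B \<Longrightarrow> \<xi> \<in> D P \<Longrightarrow> F P \<xi> \<ge> 0"
  by (rule finsler[THEN conjunct1, THEN bspec, THEN conjunct2, THEN conjunct2, THEN bspec, THEN conjunct1])

lemma D_cone: "P \<in> points B \<Longrightarrow> \<xi> \<in> D P \<Longrightarrow> r > 0 \<Longrightarrow> r *\<^sub>R \<xi> \<in> D P"
  by (rule finsler[THEN conjunct1, THEN bspec, THEN conjunct2, THEN conjunct2, THEN bspec, THEN conjunct2, THEN conjunct1,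
        THEN spec, THEN mp, THEN conjunct1])

lemma F_hom: "P \<in> points B \<Longrightarrow> \<xi> \<in> D P \<Longrightarrow> r > 0 \<Longrightarrow> F P (r *\<^sub>R \<xi>) = r * F P \<xi>"
  by (rule finsler[THEN conjunct1, THEN bspec, THEN conjunct2, THEN conjunct2, THEN bspec, THEN conjunct2, THEN conjunct1,
        THEN spec, THEN mp, THEN conjunct2])

lemma FT_pos: "P \<in> points B \<Longrightarrow> \<xi> \<in> D P \<Longrightarrow> u \<in> tangent_space B P \<Longrightarrow> u \<noteq> 0 \<Longrightarrow> fundamental_tensor F P \<xi> u u > 0"
  using finsler[THEN conjunct1, THEN bspec, THEN conjunct2, THEN conjunct2, THEN bspec, THEN conjunct2, THEN conjunct2, THEN bspec, of P \<xi> u]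
  by simp

section \<open>The local Lagrangian of F and the domain of F\<close>

definition Wd :: "('g set, real ^ 'n) chart \<Rightarrow> ((real ^ 'n) \<times> (real ^ 'n)) set"
  where "Wd d = {(x, y). x \<in> snd d ` fst d \<and> coord_tangent B d (chart_inv d x) y \<in> D (chart_inv d x)}"

definition Lc :: "('g set, real ^ 'n) chart \<Rightarrow> (real ^ 'n) \<times> (real ^ 'n) \<Rightarrow> real"
  where "Lc d z = (local_expr B F d (fst z) (snd z))\<^sup>2"

lemma Wd_open: "d \<in> B \<Longrightarrow> open (Wd d)" and F_smooth: "d \<in> B \<Longrightarrow> smooth_on (Wd d) (\<lambda>(x, y). local_expr B F d x y)"
  unfolding Wd_def
  by (rule finsler[THEN conjunct2, THEN bspec, THEN conjunct1], assumption,
      rule finsler[THEN conjunct2, THEN bspec, THEN conjunct2])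

lemma Lc_smooth: "d \<in> B \<Longrightarrow> smooth_on (Wd d) (Lc d)"
  using smooth_on_mult[OF Wd_open F_smooth F_smooth] by (simp add: Lc_def[abs_def] power2_eq_square case_prod_beta)

lemma in_Wd: "d \<in> B \<Longrightarrow> P \<in> fst d \<Longrightarrow> (snd d P, y) \<in> Wd d \<longleftrightarrow> coord_tangent B d P y \<in> D P"
  by (simp add: Wd_def)

lemma Lc_eq: "d \<in> B \<Longrightarrow> P \<in> fst d \<Longrightarrow> Lc d (snd d P, y) = (F P (coord_tangent B d P y))\<^sup>2"
  by (simp add: Lc_def local_expr_def)

text \<open>The fibre Hessian of \<open>Lc d\<close> is twice the fundamental tensor in the
  coordinates of d, which supplies positive definiteness.\<close>

lemma lagrangian: 
  assumes d: "d \<in> B"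
  shows "lagrangian (Lc d) (Wd d)"
proof
  show "open (Wd d)" by (rule Wd_open[OF d])
  show "smooth_on (Wd d) (Lc d)" by (rule Lc_smooth[OF d])
  fix z u assume z: "z \<in> Wd d" and u: "u \<noteq> (0 :: real ^ 'n)"
  obtain P y where P: "P \<in> fst d" "z = (snd d P, y)" using z by (cases z) (auto simp: Wd_def)
  let ?T = "coord_tangent B d P"
  have PB: "P \<in> points B" using P d by blast
  have T: "linear ?T" by (rule N.coord_tangent_linear[OF d P(1)])
  have u0: "?T u \<noteq> 0" using u N.coord_tangent_apply[OF d P(1), of u] by auto
  have yD: "?T y \<in> D P" using z P in_Wd[OF d P(1)] by simp
  define S where "S = (\<lambda>y. (snd d P, y)) -` Wd d"
  have S: "open S" unfolding S_def by (rule open_vimage[OF Wd_open[OF d]]) (intro continuous_intros)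
  have yS: "y \<in> S" using z P by (simp add: S_def)
  let ?f = "\<lambda>y. Lc d (snd d P, y)"
  have fs: "smooth_on S ?f"
    by (rule smooth_on_compose[OF S Lc_smooth[OF d] smooth_on_Pair[OF S smooth_on_const smooth_on_id]]) (auto simp: S_def)
  have fr: "frechet_derivative ?f (at y) w = lam (Lc d) w (snd d P, y)" if "y \<in> S" for y w
  proof -
    have "((\<lambda>y. (snd d P, y)) has_derivative (\<lambda>w. (0, w))) (at y)" by (auto intro!: derivative_eq_intros)
    from has_derivative_compose[OF this smooth_on_has_derivative[OF Lc_smooth[OF d]]] that
    have "(?f has_derivative (\<lambda>w. frechet_derivative (Lc d) (at (snd d P, y)) (0, w))) (at y)" by (simp add: S_def)
    then show ?thesis by (simp add: frechet_derivative_eq lam_def)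
  qed
  have lams: "smooth_on (Wd d) (lam (Lc d) u)" unfolding lam_def by (rule smooth_on_frechet[OF Lc_smooth[OF d]])
  have "((\<lambda>y. (snd d P, y)) has_derivative (\<lambda>w. (0, w))) (at y)" by (auto intro!: derivative_eq_intros)
  from has_derivative_compose[OF this smooth_on_has_derivative[OF lams]] yS
  have d2: "((\<lambda>y. lam (Lc d) u (snd d P, y)) has_derivative (\<lambda>w. frechet_derivative (lam (Lc d) u) (at (snd d P, y)) (0, w))) (at y)"
    by (simp add: S_def)
  have "2 * fundamental_tensor F P (?T y) (?T u) (?T u) = pd (pd (\<lambda>y. (F P (?T y))\<^sup>2) u) u y"
    unfolding fundamental_tensor_def pd_linear(2)[OF T] by simp
  also have "(\<lambda>y. (F P (?T y))\<^sup>2) = ?f" by (rule ext) (simp add: Lc_eq[OF d P(1)])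
  also have "pd (pd ?f u) u y = frechet_derivative (\<lambda>y. frechet_derivative ?f (at y) u) (at y) u"
    by (rule pd_pd_eq_frechet[OF S yS fs])
  also have "\<dots> = frechet_derivative (\<lambda>y. lam (Lc d) u (snd d P, y)) (at y) u"
    by (rule fun_cong[OF frechet_derivative_cong_open(1)[OF S yS fr]])
  also have "\<dots> = frechet_derivative (lam (Lc d) u) (at z) (0, u)"
    by (simp add: frechet_derivative_eq[OF d2] P(2))
  finally show "frechet_derivative (lam (Lc d) u) (at z) (0, u) > 0"
    using FT_pos[OF PB yD N.coord_tangent_in[OF d P(1)] u0] by linarith
qed

text \<open>The definition of a Finsler metric only gives F \<ge> 0. By homogeneity the second
  radial derivative of F^2 is 2 F^2, so the fundamental tensor evaluated on \<xi> itself equals F^2,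
  and it is positive.\<close>

lemma F_pos:
  assumes P: "P \<in> points B" and \<xi>: "\<xi> \<in> D P"
  shows "F P \<xi> > 0"
proof -
  let ?f = "\<lambda>\<eta>. (F P \<eta>)\<^sup>2" and ?c = "(F P \<xi>)\<^sup>2"
  have hom: "?f (r *\<^sub>R \<xi>) = r\<^sup>2 * ?c" if "r > 0" for r
    using F_hom[OF P \<xi> that] by (simp add: power_mult_distrib)
  have 1: "pd ?f \<xi> (\<xi> + t *\<^sub>R \<xi>) = 2 * (1 + t) * ?c" if t: "t > -1" for t
  proof -
    have "((\<lambda>r. (1 + t + r)\<^sup>2 * ?c) has_real_derivative 2 * (1 + t) * ?c) (at 0)"
      by (auto intro!: derivative_eq_intros)
    then have "((\<lambda>r. ?f ((\<xi> + t *\<^sub>R \<xi>) + r *\<^sub>R \<xi>)) has_real_derivative 2 * (1 + t) * ?c) (at 0)"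
    proof (rule has_field_derivative_transform_within_open)
      show "open {- (1 + t)<..}" "0 \<in> {- (1 + t)<..}" using t by auto
      fix r assume "r \<in> {- (1 + t)<..}"
      then have "1 + t + r > 0" by auto
      moreover have "(\<xi> + t *\<^sub>R \<xi>) + r *\<^sub>R \<xi> = (1 + t + r) *\<^sub>R \<xi>" by (simp add: scaleR_add_left)
      ultimately show "(1 + t + r)\<^sup>2 * ?c = ?f ((\<xi> + t *\<^sub>R \<xi>) + r *\<^sub>R \<xi>)" by (simp only: hom)
    qed
    then show ?thesis unfolding pd_def by (rule DERIV_imp_deriv)
  qed
  have "((\<lambda>t. 2 * (1 + t) * ?c) has_real_derivative 2 * ?c) (at 0)"
    by (auto intro!: derivative_eq_intros)
  then have "((\<lambda>t. pd ?f \<xi> (\<xi> + t *\<^sub>R \<xi>)) has_real_derivative 2 * ?c) (at 0)"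
  proof (rule has_field_derivative_transform_within_open)
    show "open {- 1 :: real <..}" "(0::real) \<in> {- 1 <..}" by auto
    fix t :: real assume "t \<in> {- 1 <..}"
    then show "2 * (1 + t) * ?c = pd ?f \<xi> (\<xi> + t *\<^sub>R \<xi>)" using 1[of t] by simp
  qed
  then have "pd (pd ?f \<xi>) \<xi> \<xi> = 2 * ?c" unfolding pd_def[of "pd ?f \<xi>"] by (rule DERIV_imp_deriv)
  then have "fundamental_tensor F P \<xi> \<xi> \<xi> = ?c" by (simp add: fundamental_tensor_def)
  then have "?c > 0" using FT_pos[OF P \<xi>] D_sub[OF P \<xi>] by metis
  then show ?thesis using F_ge[OF P \<xi>] by (cases "F P \<xi> = 0") auto
qed

text \<open>Positivity of F puts the domain inside the cone \<beta> > \<alpha>; \<beta> = \<alpha>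
  is excluded as well, since the quotient is then 0 by convention.\<close>

lemma D_pos:
  assumes P: "P \<in> points B" and \<xi>: "\<xi> \<in> D P"
  shows "0 < a P \<xi> \<xi>" "sqrt (a P \<xi> \<xi>) < \<beta> P \<xi>"
proof -
  show "0 < a P \<xi> \<xi>" using a_pos[OF P] D_sub[OF P \<xi>] by blast
  have "0 < (\<beta> P \<xi>)\<^sup>2 / (\<beta> P \<xi> - sqrt (a P \<xi> \<xi>))" using F_pos[OF P \<xi>] F_eq[OF P \<xi>] by simp
  then have "0 < \<beta> P \<xi> - sqrt (a P \<xi> \<xi>)" by (simp add: zero_less_divide_iff)
  then show "sqrt (a P \<xi> \<xi>) < \<beta> P \<xi>" by simp
qed

lemma dact_D_imp:
  "g \<in> carrier G \<Longrightarrow> P \<in> points B \<Longrightarrow> \<xi> \<in> D P \<Longrightarrow> dact g P \<xi> \<in> D (g <# P) \<and> F (g <# P) (dact g P \<xi>) = F P \<xi>"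
  using finv unfolding invariant_finsler_def by blast

text \<open>Invariance gives one direction, the inverse group element the other.\<close>

lemma dact_D:
  assumes g: "g \<in> carrier G" and P: "P \<in> points B" and \<xi>: "\<xi> \<in> tangent_space B P"
  shows "dact g P \<xi> \<in> D (g <# P) \<longleftrightarrow> \<xi> \<in> D P"
proof
  assume "dact g P \<xi> \<in> D (g <# P)"
  then have "dact (inv g) (g <# P) (dact g P \<xi>) \<in> D (inv g <# (g <# P))"
    using dact_D_imp[OF inv_closed[OF g] act_in[OF g P]] by blast
  then show "\<xi> \<in> D P" using g P by (simp add: dact_inverse[OF g P \<xi>] act_act act_one)
qed (use dact_D_imp[OF g P] in blast)

end

text \<open>Orthonormal coordinates \<open>T\<close> on the tangent space at the origin; \<open>w\<close> represents \<open>\<beta>\<close>.\<close>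

locale finsler_frame = finsler_hspace G X A Y B H D F \<beta> a
  for G :: "('g, 'r) monoid_scheme" (structure) and X :: "'g topology"
    and A :: "('g, 'e::euclidean_space) chart set"
    and Y :: "'g set topology" and B :: "('g set, real ^ 'n) chart set" and H :: "'g set"
    and D :: "'g set \<Rightarrow> ('g set, real ^ 'n) tangent set"
    and F \<beta> :: "'g set \<Rightarrow> ('g set, real ^ 'n) tangent \<Rightarrow> real"
    and a :: "'g set \<Rightarrow> ('g set, real ^ 'n) tangent \<Rightarrow> ('g set, real ^ 'n) tangent \<Rightarrow> real" +
  fixes T :: "real ^ 'n \<Rightarrow> ('g set, real ^ 'n) tangent" and w :: "real ^ 'n"
  assumes T: "linear T" "inj T" "range T = tangent_space B H"
    and aT: "\<And>z z'. a H (T z) (T z') = z \<bullet> z'" and \<beta>T: "\<And>z. \<beta> H (T z) = w \<bullet> z"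
begin

definition D0 :: "(real ^ 'n) set" where "D0 = {z. T z \<in> D H}"

lemma T_in: "T z \<in> tangent_space B H" using T(3) by blast

lemma D0_open: "open D0"
proof -
  obtain d where d: "d \<in> B" "H \<in> fst d" using H_in by auto
  have lin: "linear (\<lambda>z. T z d)"
    by (rule linearI) (simp_all add: linear_add[OF T(1)] linear_scale[OF T(1)] scaleR_fun_apply)
  have "D0 = (\<lambda>z. (snd d H, T z d)) -` Wd d"
    by (auto simp: D0_def in_Wd[OF d] N.coord_tangent_eq[OF T_in d])
  moreover have "continuous_on UNIV (\<lambda>z. (snd d H, T z d))"
    using lin by (intro continuous_intros linear_continuous_on) (simp add: linear_conv_bounded_linear)
  ultimately show ?thesis using open_vimage[OF Wd_open[OF d(1)]] by simp
qed

lemma D0_ne: "D0 \<noteq> {}"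
proof -
  obtain \<xi> where \<xi>: "\<xi> \<in> D H" using D_ne[OF H_in] by blast
  then obtain z where "\<xi> = T z" using D_sub[OF H_in \<xi>] T(3) by blast
  then show ?thesis using \<xi> by (auto simp: D0_def)
qed

lemma D0_cone: "z \<in> D0 \<Longrightarrow> r > 0 \<Longrightarrow> r *\<^sub>R z \<in> D0"
  using D_cone[OF H_in] by (simp add: D0_def linear_scale[OF T(1)])

lemma D0_pos: "z \<in> D0 \<Longrightarrow> z \<noteq> 0 \<and> norm z < w \<bullet> z"
  using D_pos[OF H_in, of "T z"] by (auto simp: D0_def aT \<beta>T norm_eq_sqrt_inner)

lemma F_T: "z \<in> D0 \<Longrightarrow> F H (T z) = (w \<bullet> z)\<^sup>2 / (w \<bullet> z - norm z)"
  using F_eq[OF H_in, of "T z"] by (simp add: D0_def aT \<beta>T norm_eq_sqrt_inner)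

lemma D0_N3:
  assumes z: "z \<in> D0"
  shows "N3 (w \<bullet> w) (sf w z) > 0"
proof (rule N3_pos)
  show "z \<noteq> 0" "sf w z > 1" using D0_pos[OF z] sf_gt_one by blast+
  fix u :: "real ^ 'n" assume "u \<noteq> 0"
  then have u: "T u \<noteq> 0" using T(1,2) linear_injective_0 by blast
  have "fundamental_tensor F H (T z) (T u) (T u) = 1/2 * pd (pd (\<lambda>z. (F H (T z))\<^sup>2) u) u z"
    unfolding fundamental_tensor_def pd_linear(2)[OF T(1)] ..
  also have "pd (pd (\<lambda>z. (F H (T z))\<^sup>2) u) u z = hLf w z u u"
    by (rule pd_pd_Lf(2)[OF D0_open z]) (use F_T D0_pos in \<open>auto simp: Lf_def\<close>)
  finally show "hLf w z u u > 0"
    using FT_pos[OF H_in _ T_in u, of "T z"] z by (simp add: D0_def)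
qed

text \<open>Indexed by g and not by the coset: frames for different g over one point differ by the
  isotropy action. Working with g avoids choosing a section of G over G/H.\<close>

definition Tg :: "'g \<Rightarrow> real ^ 'n \<Rightarrow> ('g set, real ^ 'n) tangent" where "Tg g z = dact g H (T z)"

lemma Tg:
  assumes g: "g \<in> carrier G"
  shows "linear (Tg g)" "inj (Tg g)" "range (Tg g) = tangent_space B (g <# H)"
    and "Tg g z \<in> D (g <# H) \<longleftrightarrow> z \<in> D0" and "z \<in> D0 \<Longrightarrow> F (g <# H) (Tg g z) = F H (T z)"
proof -
  have l: "Tg g (r *\<^sub>R u + v) = r *\<^sub>R Tg g u + Tg g v" for r u v
    using dact_linear[OF g H_in T_in T_in] by (simp add: Tg_def linear_add[OF T(1)] linear_scale[OF T(1)])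
  have z0: "Tg g 0 = 0" using l[of 0 0 0] l[of 1 0 0] by simp
  show "linear (Tg g)"
  proof (rule linearI)
    show "Tg g (u + v) = Tg g u + Tg g v" for u v using l[of 1 u v] by simp
    show "Tg g (r *\<^sub>R u) = r *\<^sub>R Tg g u" for r u using l[of r u 0] z0 by simp
  qed
  show "inj (Tg g)"
  proof (rule injI)
    fix u v assume "Tg g u = Tg g v"
    then have "dact (inv g) (g <# H) (dact g H (T u)) = dact (inv g) (g <# H) (dact g H (T v))" by (simp add: Tg_def)
    then have "T u = T v" unfolding dact_inverse[OF g H_in T_in] .
    then show "u = v" using T(2) by (simp add: inj_eq)
  qed
  show "range (Tg g) = tangent_space B (g <# H)"
  proof
    show "range (Tg g) \<subseteq> tangent_space B (g <# H)" using dact_in[OF g H_in T_in] by (auto simp: Tg_def)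
    show "tangent_space B (g <# H) \<subseteq> range (Tg g)"
    proof
      fix \<xi> assume \<xi>: "\<xi> \<in> tangent_space B (g <# H)"
      have gi: "inv g \<in> carrier G" and gH: "g <# H \<in> points B" using g act_in[OF g H_in] by blast+
      have ig: "inv g <# (g <# H) = H" using act_act[OF gi g H_in] act_one[OF H_in] g by simp
      have "dact (inv g) (g <# H) \<xi> \<in> tangent_space B (inv g <# (g <# H))" by (rule dact_in[OF gi gH \<xi>])
      then obtain z where z: "dact (inv g) (g <# H) \<xi> = T z" unfolding ig using T(3) by blast
      have "dact (inv (inv g)) (inv g <# (g <# H)) (dact (inv g) (g <# H) \<xi>) = \<xi>" by (rule dact_inverse[OF gi gH \<xi>])
      then have "Tg g z = \<xi>" unfolding ig z Tg_def inv_inv[OF g] .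
      then show "\<xi> \<in> range (Tg g)" by blast
    qed
  qed
  show "Tg g z \<in> D (g <# H) \<longleftrightarrow> z \<in> D0" unfolding Tg_def D0_def using dact_D[OF g H_in T_in] by simp
  show "z \<in> D0 \<Longrightarrow> F (g <# H) (Tg g z) = F H (T z)" unfolding Tg_def D0_def using dact_D_imp[OF g H_in] by simp
qed

text \<open>Read in any of these frames, F and its domain are the same function and set, so the same
  constant occurs at every point. Only invariance of F and D enters, so this also covers dimension
  one.\<close>

lemma distortion_Tg:
  assumes g: "g \<in> carrier G" and z: "z \<in> D0"
  shows "distortion B D F (g <# H) (Tg g z) = Tf CARD('n) (w \<bullet> w) (sf w z)
    - ln (measure lborel (ball (0::real^'n) 1) / measure lborel {z \<in> D0. (w \<bullet> z)\<^sup>2 / (w \<bullet> z - norm z) < 1})"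
proof (rule distortion_formula)
  show "linear (Tg g)" "inj (Tg g)" "range (Tg g) = tangent_space B (g <# H)" by (rule Tg[OF g])+
  show "Tg g z \<in> D (g <# H) \<longleftrightarrow> z \<in> D0" for z by (rule Tg(4)[OF g])
  show "F (g <# H) (Tg g z) = (w \<bullet> z)\<^sup>2 / (w \<bullet> z - norm z)" if "z \<in> D0" for z
    using Tg(5)[OF g that] F_T[OF that] by simp
  show "r *\<^sub>R z \<in> D0" if "z \<in> D0" "r > 0" for z r using that by (rule D0_cone)
  show "z \<noteq> 0 \<and> norm z < w \<bullet> z" "N3 (w \<bullet> w) (sf w z) > 0" if "z \<in> D0" for z
    using D0_pos[OF that] D0_N3[OF that] by blast+
qed (rule D0_open, rule z)

text \<open>The transported inner product and form yield on the open cone \<open>D0\<close> the same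
  F as those at the origin, so \<open>metric_and_form_unique\<close> identifies them.\<close>

lemma metric_invariant:
  assumes n: "CARD('n) \<ge> 2" and g: "g \<in> carrier G"
  shows "a (g <# H) (Tg g z) (Tg g z') = z \<bullet> z'" and "\<beta> (g <# H) (Tg g z) = w \<bullet> z"
proof -
  have P: "g <# H \<in> points B" by (rule act_in[OF g H_in])
  have in': "Tg g z \<in> tangent_space B (g <# H)" for z using Tg(3)[OF g] by blast
  define a' where "a' = (\<lambda>z z'. a (g <# H) (Tg g z) (Tg g z'))"
  define b' where "b' = (\<lambda>z. \<beta> (g <# H) (Tg g z))"
  note lT = linear_add[OF Tg(1)[OF g]] linear_scale[OF Tg(1)[OF g]] linear_0[OF Tg(1)[OF g]]
  have sym: "a' z z' = a' z' z" for z z' unfolding a'_def by (rule a_sym[OF P in' in'])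
  have l: "a' (r *\<^sub>R u + v) z = r * a' u z + a' v z" for r u v z
    unfolding a'_def lT by (rule a_lin[OF P in' in' in'])
  have l0: "a' 0 z = 0" for z using l[of 1 0 0 z] by simp
  have lin: "linear (\<lambda>u. a' u z)" for z
  proof (rule linearI)
    show "a' (u + v) z = a' u z + a' v z" for u v using l[of 1 u v z] by simp
    show "a' (r *\<^sub>R u) z = r *\<^sub>R a' u z" for r u using l[of r u 0 z] l0 by simp
  qed
  have eq: "a' x = (\<lambda>u. a' u x)" for x by (rule ext) (rule sym)
  have lin2: "linear (a' x)" for x by (subst eq) (rule lin)
  have bil: "bilinear a'" unfolding bilinear_def using lin lin2 by blast
  have apos: "a' z z > 0" if "z \<noteq> 0" for z
  proof -
    have "Tg g z \<noteq> 0" using that Tg(1,2)[OF g] linear_injective_0 by blast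
    then show ?thesis unfolding a'_def by (rule a_pos[OF P in'])
  qed
  have bl: "b' (r *\<^sub>R u + v) = r * b' u + b' v" for r u v
    unfolding b'_def lT by (rule \<beta>_lin[OF P in' in'])
  have b0: "b' 0 = 0" using bl[of 1 0 0] by simp
  have blin: "linear b'"
  proof (rule linearI)
    show "b' (u + v) = b' u + b' v" for u v using bl[of 1 u v] by simp
    show "b' (r *\<^sub>R u) = r *\<^sub>R b' u" for r u using bl[of r u 0] b0 by simp
  qed
  obtain y0 where y0: "y0 \<in> D0" using D0_ne by blast
  have onD: "sqrt (a' z z) < b' z" "(w \<bullet> z)\<^sup>2 / (w \<bullet> z - sqrt (z \<bullet> z)) = (b' z)\<^sup>2 / (b' z - sqrt (a' z z))" if z: "z \<in> D0" for z
  proof -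
    have zD: "Tg g z \<in> D (g <# H)" using Tg(4)[OF g] z by blast
    show "sqrt (a' z z) < b' z" unfolding a'_def b'_def by (rule D_pos(2)[OF P zD])
    show "(w \<bullet> z)\<^sup>2 / (w \<bullet> z - sqrt (z \<bullet> z)) = (b' z)\<^sup>2 / (b' z - sqrt (a' z z))"
      using F_eq[OF P zD] Tg(5)[OF g z] F_T[OF z] by (simp add: a'_def b'_def norm_eq_sqrt_inner)
  qed
  have bi: "bilinear ((\<bullet>) :: real ^ 'n \<Rightarrow> _)"
    by (auto simp: bilinear_def intro!: linearI simp: inner_add_left inner_add_right)
  have lw: "linear (\<lambda>z. w \<bullet> z)" by (auto intro!: linearI simp: inner_add_right)
  have res: "(\<lambda>z. w \<bullet> z) = b'" "(\<bullet>) = a'"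
  proof -
    have dim: "2 \<le> DIM(real ^ 'n)" using n by simp
    have ipos: "0 < x \<bullet> x" if "x \<noteq> 0" for x :: "real ^ 'n" using that by simp
    have p1: "sqrt (y \<bullet> y) < w \<bullet> y" if "y \<in> D0" for y using D0_pos[OF that] by (simp add: norm_eq_sqrt_inner)
    note hyps = dim bi inner_commute ipos bil sym apos lw blin D0_open y0 p1 onD
    show "(\<lambda>z. w \<bullet> z) = b'"
      by (rule metric_and_form_unique(1)[where a="(\<bullet>)" and a'=a' and D=D0]) (fact hyps | erule p1 onD apos ipos)+
    show "(\<bullet>) = a'"
      by (rule metric_and_form_unique(2)[where b="\<lambda>z. w \<bullet> z" and b'=b' and D=D0]) (fact hyps | erule p1 onD apos ipos)+
  qed
  show "a (g <# H) (Tg g z) (Tg g z') = z \<bullet> z'" using fun_cong[OF fun_cong[OF res(2), of z], of z'] by (simp add: a'_def)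
  show "\<beta> (g <# H) (Tg g z) = w \<bullet> z" using fun_cong[OF res(1), of z] by (simp add: b'_def)
qed

end

section \<open>Geodesics of the homogeneous metric\<close>

context finsler_hspace
begin

text \<open>The second order system is solved in the single chart d; \<open>EL_transform\<close>
  carries the equation to every other chart met by the curve, as \<open>geodesic\<close>
  asks.\<close>

lemma geodesic_exists:
  assumes d: "d \<in> B" "P \<in> fst d" and \<xi>: "\<xi> \<in> D P"
  obtains \<gamma> \<epsilon> where "\<epsilon> > 0" "geodesic B D F {-\<epsilon><..<\<epsilon>} \<gamma>" "\<gamma> 0 = P" "velocity B \<gamma> 0 = \<xi>"
proof -
  interpret L: lagrangian "Lc d" "Wd d" by (rule lagrangian[OF d(1)])
  have PB: "P \<in> points B" using d by blast
  have \<xi>T: "\<xi> \<in> tangent_space B P" using D_sub[OF PB \<xi>] by blast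
  have z0: "(snd d P, \<xi> d) \<in> Wd d" using \<xi> by (simp add: in_Wd[OF d] N.coord_tangent_eq[OF \<xi>T d])
  have fs: "smooth_on (Wd d) (\<lambda>z. (snd z, L.accel z))"
    by (rule smooth_on_Pair[OF L.W smooth_on_snd L.accel_smooth])
  obtain \<epsilon> Z where \<epsilon>: "\<epsilon> > 0" and Z0: "Z 0 = (snd d P, \<xi> d)" and Zs: "smooth_on {-\<epsilon><..<\<epsilon>} Z"
    and Z: "\<And>t. \<bar>t\<bar> < \<epsilon> \<Longrightarrow> Z t \<in> Wd d \<and> (Z has_vector_derivative (snd (Z t), L.accel (Z t))) (at t)"
    using ode_exists[OF L.W z0 fs] by blast
  define x where "x t = fst (Z t)" for t
  define y where "y t = snd (Z t)" for t
  define \<gamma> where "\<gamma> t = chart_inv d (x t)" for t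
  have Zxy: "Z t = (x t, y t)" for t by (simp add: x_def y_def)
  have small: "\<bar>t\<bar> < \<epsilon>" if "t \<in> {-\<epsilon><..<\<epsilon>}" for t using that by auto
  have xd: "(x has_vector_derivative y t) (at t)" "(y has_vector_derivative L.accel (x t, y t)) (at t)"
    if t: "\<bar>t\<bar> < \<epsilon>" for t
  proof -
    note D = Z[OF t, THEN conjunct2, unfolded has_vector_derivative_def]
    show "(x has_vector_derivative y t) (at t)"
      using has_derivative_fst[OF D] by (simp add: has_vector_derivative_def x_def[abs_def] y_def)
    show "(y has_vector_derivative L.accel (x t, y t)) (at t)"
      using has_derivative_snd[OF D] by (simp add: has_vector_derivative_def x_def[abs_def] y_def[abs_def])
  qed
  have inW: "(x t, y t) \<in> Wd d" if "\<bar>t\<bar> < \<epsilon>" for t using Z[OF that] by (simp add: Zxy)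
  have \<gamma>: "\<gamma> t \<in> fst d" "snd d (\<gamma> t) = x t" "coord_tangent B d (\<gamma> t) (y t) \<in> D (\<gamma> t)" if "\<bar>t\<bar> < \<epsilon>" for t
  proof -
    have i: "x t \<in> snd d ` fst d" "coord_tangent B d (chart_inv d (x t)) (y t) \<in> D (chart_inv d (x t))"
      using inW[OF that] by (auto simp: Wd_def)
    show "\<gamma> t \<in> fst d" unfolding \<gamma>_def by (rule N.chart_inv_in[OF i(1)])
    show "snd d (\<gamma> t) = x t" unfolding \<gamma>_def by (rule N.chart_inv_right[OF i(1)])
    show "coord_tangent B d (\<gamma> t) (y t) \<in> D (\<gamma> t)" unfolding \<gamma>_def by (rule i(2))
  qed
  have evI: "\<forall>\<^sub>F r in nhds t. \<bar>r\<bar> < \<epsilon>" if "\<bar>t\<bar> < \<epsilon>" for t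
  proof -
    have "\<forall>\<^sub>F r in nhds t. r \<in> {-\<epsilon><..<\<epsilon>}" by (rule eventually_nhds_in_open) (use that in auto)
    then show ?thesis by eventually_elim (rule small)
  qed
  have ev: "\<forall>\<^sub>F r in nhds t. \<gamma> r \<in> fst d" if "\<bar>t\<bar> < \<epsilon>" for t
    using evI[OF that] by eventually_elim (rule \<gamma>(1))
  have D\<gamma>: "((snd d \<circ> \<gamma>) has_vector_derivative y t) (at t)" if t: "\<bar>t\<bar> < \<epsilon>" for t
  proof -
    have "\<forall>\<^sub>F r in nhds t. x r = (snd d \<circ> \<gamma>) r" using evI[OF t] by eventually_elim (simp add: \<gamma>(2))
    then show ?thesis
      using has_derivative_transform_eventually_at[OF xd(1)[OF t, unfolded has_vector_derivative_def]]
      by (simp add: has_vector_derivative_def)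
  qed
  have vel: "velocity B \<gamma> t = coord_tangent B d (\<gamma> t) (y t)" if t: "\<bar>t\<bar> < \<epsilon>" for t
    by (rule N.velocity_coord(2)[OF d(1) \<gamma>(1)[OF t] ev[OF t] D\<gamma>[OF t]])
  have sc: "smooth_curve B {-\<epsilon><..<\<epsilon>} \<gamma>"
  proof (rule N.smooth_curveI)
    show "open {-\<epsilon><..<\<epsilon>}" by simp
    fix t assume t: "t \<in> {-\<epsilon><..<\<epsilon>}"
    have "smooth_on {-\<epsilon><..<\<epsilon>} x"
      unfolding x_def by (rule smooth_on_linear_compose[OF bounded_linear_fst _ Zs]) simp
    then have "smooth_on {-\<epsilon><..<\<epsilon>} (snd d \<circ> \<gamma>)"
      by (rule smooth_on_cong[THEN iffD1, rotated 2]) (use \<gamma>(2)[OF small] in simp_all)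
    moreover have "\<gamma> ` {-\<epsilon><..<\<epsilon>} \<subseteq> fst d" using \<gamma>(1)[OF small] by blast
    ultimately show "\<exists>J c. open J \<and> t \<in> J \<and> c \<in> B \<and> \<gamma> ` J \<subseteq> fst c \<and> smooth_on J (snd c \<circ> \<gamma>)"
      using d(1) t open_greaterThanLessThan by blast
  qed
  have geo: "vector_derivative (\<lambda>r. vector_derivative (snd c \<circ> \<gamma>) (at r)) (at t)
      + 2 *\<^sub>R spray_coeff (\<lambda>u w. (local_expr B F c u w)\<^sup>2) ((snd c \<circ> \<gamma>) t) (vector_derivative (snd c \<circ> \<gamma>) (at t)) = 0"
    if t: "\<bar>t\<bar> < \<epsilon>" and c: "c \<in> B" "\<gamma> t \<in> fst c" for t c
  proof -
    interpret L': lagrangian "Lc c" "Wd c" by (rule lagrangian[OF c(1)])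
    let ?S = "snd d ` (fst d \<inter> fst c)" and ?\<tau> = "transition d c"
    have "snd d (\<gamma> t) \<in> ?S" using \<gamma>(1)[OF t] c(2) by blast
    then have S: "open ?S" "x t \<in> ?S"
      using N.open_overlap[OF d(1) c(1)] by (simp_all add: \<gamma>(2)[OF t])
    have sm: "smooth_on ?S ?\<tau>" by (rule N.transition_smooth[OF d(1) c(1)])
    have ch: "((snd c \<circ> \<gamma>) has_vector_derivative frechet_derivative ?\<tau> (at (x r)) (y r)) (at r)"
      if r: "\<bar>r\<bar> < \<epsilon>" "\<gamma> r \<in> fst c" for r
      using N.curve_chart_change(2)[OF d(1) \<gamma>(1)[OF r(1)] ev[OF r(1)] D\<gamma>[OF r(1)] c(1) r(2)] by (simp add: \<gamma>(2)[OF r(1)])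
    have evc: "\<forall>\<^sub>F r in nhds t. \<gamma> r \<in> fst c"
      by (rule N.curve_chart_change(1)[OF d(1) \<gamma>(1)[OF t] ev[OF t] D\<gamma>[OF t] c])
    define a' where "a' = frechet_derivative ?\<tau> (at (x t)) (L.accel (x t, y t))
        + frechet_derivative (\<lambda>z. frechet_derivative ?\<tau> (at z) (y t)) (at (x t)) (y t)"
    have l1: "linear (frechet_derivative ?\<tau> (at (x t)))"
      by (rule has_derivative_linear[OF smooth_on_has_derivative[OF sm S(2)]])
    have l2: "linear (frechet_derivative (\<lambda>z. frechet_derivative ?\<tau> (at z) (y t)) (at (x t)))"
      by (rule has_derivative_linear[OF smooth_on_has_derivative[OF smooth_on_frechet[OF sm] S(2)]])
    have u: "((\<lambda>r. frechet_derivative ?\<tau> (at (x r)) (y r)) has_vector_derivative a') (at t)"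
      using frechet_derivative_along[OF S sm xd(1)[OF t, unfolded has_vector_derivative_def] xd(2)[OF t, unfolded has_vector_derivative_def]]
      by (simp add: has_vector_derivative_def a'_def linear_scale[OF l1] linear_scale[OF l2] scaleR_add_right)
    have v1: "vector_derivative (snd c \<circ> \<gamma>) (at t) = frechet_derivative ?\<tau> (at (x t)) (y t)"
      by (rule vector_derivative_at[OF ch[OF t c(2)]])
    have "\<forall>\<^sub>F r in nhds t. frechet_derivative ?\<tau> (at (x r)) (y r) = vector_derivative (snd c \<circ> \<gamma>) (at r)"
      using evI[OF t] evc by eventually_elim (rule vector_derivative_at[OF ch, symmetric])
    then have "((\<lambda>r. vector_derivative (snd c \<circ> \<gamma>) (at r)) has_vector_derivative a') (at t)"
      using has_derivative_transform_eventually_at[OF u[unfolded has_vector_derivative_def]]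
      by (simp add: has_vector_derivative_def)
    then have v2: "vector_derivative (\<lambda>r. vector_derivative (snd c \<circ> \<gamma>) (at r)) (at t) = a'"
      by (rule vector_derivative_at)
    have surj: "surj (frechet_derivative ?\<tau> (at (x t)))"
    proof (rule surjI)
      fix v
      show "frechet_derivative ?\<tau> (at (x t)) (dtrans c d (\<gamma> t) v) = v"
        using N.dtrans_comp[OF c(1) d(1) c(1) c(2) \<gamma>(1)[OF t] c(2)] N.dtrans_id[OF c] by (simp add: \<gamma>(2)[OF t])
    qed
    have eqL: "(?\<tau> (fst z), frechet_derivative ?\<tau> (at (fst z)) (snd z)) \<in> Wd c
      \<and> Lc d z = Lc c (?\<tau> (fst z), frechet_derivative ?\<tau> (at (fst z)) (snd z))" if z: "z \<in> Wd d" "fst z \<in> ?S" for z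
    proof -
      obtain q v where q: "q \<in> fst d" "q \<in> fst c" "z = (snd d q, v)" using z(2) by (cases z) auto
      have co: "coord_tangent B c q (dtrans d c q v) = coord_tangent B d q v"
        using N.coord_tangent_eq[OF N.coord_tangent_in[OF d(1) q(1), of v] c(1) q(2)] c(1) q(2)
        by (simp add: coord_tangent_def)
      show ?thesis
        using z(1) by (simp add: q(3) N.transition_apply[OF d(1) q(1)] in_Wd[OF c(1) q(2)] in_Wd[OF d(1) q(1)]
            Lc_eq[OF c(1) q(2)] Lc_eq[OF d(1) q(1)] co)
    qed
    have "EL (Lc c) (?\<tau> (x t), frechet_derivative ?\<tau> (at (x t)) (y t)) a'"
      by (rule EL_transform[OF lagrangian[OF d(1)] lagrangian[OF c(1)] S sm surj _ xd[OF t] inW[OF t] u L.EL_accel[OF inW[OF t]]])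
        (rule eqL)
    moreover have "(?\<tau> (x t), frechet_derivative ?\<tau> (at (x t)) (y t)) \<in> Wd c"
      using eqL[OF inW[OF t]] S(2) by simp
    moreover have "?\<tau> (x t) = (snd c \<circ> \<gamma>) t"
      using N.transition_apply[OF d(1) \<gamma>(1)[OF t], of c] by (simp add: \<gamma>(2)[OF t])
    ultimately have "a' + 2 *\<^sub>R spray_coeff (\<lambda>u w. Lc c (u, w)) ((snd c \<circ> \<gamma>) t) (frechet_derivative ?\<tau> (at (x t)) (y t)) = 0"
      using L'.spray_coeff_eq[of "(snd c \<circ> \<gamma>) t"] by simp
    then show ?thesis unfolding v1 v2 by (simp add: Lc_def)
  qed
  have "geodesic B D F {-\<epsilon><..<\<epsilon>} \<gamma>"
    unfolding geodesic_def Let_def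
  proof (intro conjI ballI impI)
    show "smooth_curve B {-\<epsilon><..<\<epsilon>} \<gamma>" by (rule sc)
    fix t assume t: "t \<in> {-\<epsilon><..<\<epsilon>}"
    show "velocity B \<gamma> t \<in> D (\<gamma> t)" unfolding vel[OF small[OF t]] by (rule \<gamma>(3)[OF small[OF t]])
  qed (use geo small in blast)
  moreover have "x 0 = snd d P" "y 0 = \<xi> d" using Z0 by (simp_all add: x_def y_def)
  then have "\<gamma> 0 = P" "velocity B \<gamma> 0 = \<xi>"
    using vel[of 0] \<epsilon> N.coord_tangent_eq[OF \<xi>T d] d by (simp_all add: \<gamma>_def)
  ultimately show ?thesis using that[OF \<epsilon>] by blast
qed

end

section \<open>The S-curvature\<close>

locale finsler_lift = finsler_frame G X A Y B H D F \<beta> a T w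
  for G :: "('g, 'r) monoid_scheme" (structure) and X :: "'g topology"
    and A :: "('g, 'e::euclidean_space) chart set"
    and Y :: "'g set topology" and B :: "('g set, real ^ 'n) chart set" and H :: "'g set"
    and D :: "'g set \<Rightarrow> ('g set, real ^ 'n) tangent set"
    and F \<beta> :: "'g set \<Rightarrow> ('g set, real ^ 'n) tangent \<Rightarrow> real"
    and a :: "'g set \<Rightarrow> ('g set, real ^ 'n) tangent \<Rightarrow> ('g set, real ^ 'n) tangent \<Rightarrow> real"
    and T :: "real ^ 'n \<Rightarrow> ('g set, real ^ 'n) tangent" and w :: "real ^ 'n" +
  fixes \<kappa> :: "real ^ 'n \<Rightarrow> ('g, 'e) tangent"
  assumes \<kappa>: "linear \<kappa>" "\<And>z. \<kappa> z \<in> \<gg>" "\<And>z. \<iota>0 (\<kappa> z) = T z"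
begin

text \<open>Coordinates of the bracket after projection to the tangent space at the origin. The
  isotropy part is projected away, so this represents the m-component.\<close>

definition brz :: "real ^ 'n \<Rightarrow> real ^ 'n \<Rightarrow> real ^ 'n"
  where "brz u v = inv_into UNIV T (\<iota>0 (lbr (\<kappa> u) (\<kappa> v)))"

lemma T_brz: "T (brz u v) = \<iota>0 (lbr (\<kappa> u) (\<kappa> v))"
  unfolding brz_def by (rule f_inv_into_f) (use \<iota>0_in[OF lie_bracket_in[OF \<kappa>(2) \<kappa>(2)]] T(3) in blast)

lemma brz_anti: "brz u v = - brz v u"
proof -
  have "\<iota>0 (- lbr (\<kappa> v) (\<kappa> u)) = - \<iota>0 (lbr (\<kappa> v) (\<kappa> u))"
  proof -
    have z: "0 \<in> \<gg>" by (rule subspace_0[OF subspace_lie_algebra])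
    have l: "lbr (\<kappa> v) (\<kappa> u) \<in> \<gg>" by (rule lie_bracket_in[OF \<kappa>(2) \<kappa>(2)])
    show ?thesis using \<iota>0_diff[OF z l] \<iota>0_diff[OF z z] by simp
  qed
  then have "T (brz u v) = T (- brz v u)"
    unfolding T_brz linear_neg[OF T(1)] lie_bracket_anti[OF \<kappa>(2)[of u] \<kappa>(2)[of v]] .
  then show ?thesis using T(2) by (simp add: inj_eq)
qed

lemma brz_linear: "brz u (r *\<^sub>R v + v') = r *\<^sub>R brz u v + brz u v'"
proof -
  have "T (brz u (r *\<^sub>R v + v')) = T (r *\<^sub>R brz u v + brz u v')"
    unfolding T_brz linear_add[OF T(1)] linear_scale[OF T(1)] linear_add[OF \<kappa>(1)] linear_scale[OF \<kappa>(1)]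
      lie_bracket_linear[OF \<kappa>(2) \<kappa>(2) \<kappa>(2)]
    by (rule \<iota>0_linear) (rule lie_bracket_in[OF \<kappa>(2) \<kappa>(2)])+
  then show ?thesis using T(2) by (simp add: inj_eq)
qed

lemma brz_self: "brz u u = 0"
proof -
  have "2 *\<^sub>R brz u u = 0" using brz_anti[of u u] by (simp add: scaleR_2)
  then show ?thesis by simp
qed

definition Sval :: "real ^ 'n \<Rightarrow> real"
  where "Sval z = Af CARD('n) (w \<bullet> w) (sf w z) / norm z * (brz w z \<bullet> z)
    + Af CARD('n) (w \<bullet> w) (sf w z) * (1 - 2 / sf w z) * (brz w z \<bullet> w)"

definition tau_const :: real where "tau_const = - ln (measure lborel (ball (0::real^'n) 1)
    / measure lborel {z \<in> D0. (w \<bullet> z)\<^sup>2 / (w \<bullet> z - norm z) < 1})"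

lemma point_cases:
  assumes "Q \<in> points B" "\<xi> \<in> D Q"
  obtains g z where "g \<in> carrier G" "Q = g <# H" "z \<in> D0" "\<xi> = Tg g z"
proof -
  obtain g where g: "g \<in> carrier G" "Q = g <# H" using assms(1) by (auto simp: points_B)
  obtain z where z: "\<xi> = Tg g z" using D_sub[OF assms] Tg(3)[OF g(1)] g(2) by blast
  have "z \<in> D0" using assms(2) Tg(4)[OF g(1)] g(2) z by simp
  with g z show ?thesis using that by blast
qed

text \<open>In this form no group element is mentioned: the distortion becomes a function of point
  and velocity that can be differentiated along a geodesic in a chart of G/H.\<close>

lemma distortion_D:
  assumes "CARD('n) \<ge> 2" "Q \<in> points B" "\<xi> \<in> D Q"
  shows "distortion B D F Q \<xi> = Tf CARD('n) (w \<bullet> w) (\<beta> Q \<xi> / sqrt (a Q \<xi> \<xi>)) + tau_const"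
proof -
  obtain g z where g: "g \<in> carrier G" "Q = g <# H" "z \<in> D0" "\<xi> = Tg g z" using point_cases[OF assms(2,3)] .
  show ?thesis
    unfolding g(2,4) distortion_Tg[OF g(1,3)] metric_invariant[OF assms(1) g(1)]
    by (simp add: sf_def norm_eq_sqrt_inner tau_const_def)
qed

text \<open>On a line Cauchy-Schwarz is an equality, so s equals |w| throughout
  \<open>D0\<close>.\<close>

lemma distortion_one_dim:
  assumes n: "CARD('n) = 1" and "Q \<in> points B" "\<xi> \<in> D Q" "Q' \<in> points B" "\<xi>' \<in> D Q'"
  shows "distortion B D F Q \<xi> = distortion B D F Q' \<xi>'"
proof -
  obtain g z where g: "g \<in> carrier G" "Q = g <# H" "z \<in> D0" "\<xi> = Tg g z" using point_cases[OF assms(2,3)] .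
  obtain g' z' where g': "g' \<in> carrier G" "Q' = g' <# H" "z' \<in> D0" "\<xi>' = Tg g' z'" using point_cases[OF assms(4,5)] .
  have "sf w z = norm w" if z: "z \<in> D0" for z
  proof -
    obtain k :: 'n where k: "UNIV = {k}" using n card_1_singletonE by blast
    have nz: "norm z > 0" "w \<bullet> z > 0" using D0_pos[OF z] norm_ge_zero[of z] by (auto, linarith)
    have e: "u \<bullet> v = u $ k * v $ k" for u v :: "real ^ 'n" by (simp add: inner_vec_def k)
    have "(w \<bullet> z)\<^sup>2 = (w \<bullet> w) * (z \<bullet> z)" by (simp add: e power2_eq_square mult_ac)
    then have "(w \<bullet> z)\<^sup>2 = (norm w * norm z)\<^sup>2" by (simp add: power_mult_distrib power2_norm_eq_inner)
    then have "w \<bullet> z = norm w * norm z" using nz by (simp add: power2_eq_iff_nonneg)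
    then show ?thesis using nz by (simp add: sf_def)
  qed
  then have "sf w z = sf w z'" using g(3) g'(3) by simp
  then show ?thesis unfolding g(2,4) g'(2,4) distortion_Tg[OF g(1,3)] distortion_Tg[OF g'(1,3)] by simp
qed

text \<open>z is a multiple of w, and the bracket of w with itself vanishes.\<close>

lemma Sval_one_dim:
  assumes n: "CARD('n) = 1" and z: "z \<in> D0"
  shows "Sval z = 0"
proof -
  obtain k :: 'n where k: "UNIV = {k}" using n card_1_singletonE by blast
  have "w \<noteq> 0" using D0_pos[OF z] norm_ge_zero[of z] by auto
  then have wk: "w $ k \<noteq> 0" using k by (metis UNIV_I singletonD vec_eq_iff zero_index)
  have "z = (z $ k / w $ k) *\<^sub>R w"
  proof (rule vec_eq_iff[THEN iffD2, rule_format])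
    fix i :: 'n
    have "i = k" using k by blast
    then show "z $ i = ((z $ k / w $ k) *\<^sub>R w) $ i" using wk by simp
  qed
  then have "brz w z = brz w ((z $ k / w $ k) *\<^sub>R w + 0)" by simp
  also have "\<dots> = 0" unfolding brz_linear using brz_linear[of w 1 0 0] by (simp add: brz_self)
  finally show ?thesis by (simp add: Sval_def)
qed

end

section \<open>Derivative of the distortion along geodesics\<close>

text \<open>Euler's relation for the first fibre derivative of F^2, which is homogeneous of degree
  one.\<close>

lemma hLf_euler: "z \<noteq> 0 \<Longrightarrow> hLf w z u z = dLf w z (u :: 'v::real_inner)"
proof -
  assume z: "z \<noteq> 0"
  have "u \<bullet> z = norm z * (pf z \<bullet> u)" "pf z \<bullet> z = norm z" "thf w z \<bullet> z = 0"
    using fiber_atoms(2)[OF z, of u] fiber_atoms(2)[OF z, of "pf z"] fiber_atoms(2)[OF z, of "thf w z"]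
      fiber_atoms(4)[OF z] fiber_atoms(5)[OF z, of w] by (simp_all add: inner_commute)
  then show ?thesis by (simp add: hLf_def dLf_def Let_def algebra_simps)
qed

lemma differentiable_compose_fst:
  assumes "f differentiable (at x0)"
  shows "(\<lambda>p. f (fst p)) differentiable (at (x0, y0))"
proof -
  have "(fst has_derivative fst) (at (x0, y0))" by (auto intro!: derivative_eq_intros)
  then show ?thesis
    using has_derivative_compose[of fst fst "(x0, y0)" UNIV f] assms unfolding differentiable_def by auto
qed

text \<open>Smoothness of a metric is given for fixed vectors only; expanding in coordinate vectors
  yields joint differentiability in point and vector.\<close>

lemma differentiable_quadratic_form:
  fixes f :: "real ^ 'n \<Rightarrow> real ^ 'n \<Rightarrow> real ^ 'n \<Rightarrow> real"
  assumes S: "open S" "x0 \<in> S" and sm: "\<And>u v. smooth_on S (\<lambda>x. f x u v)"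
    and lin: "\<And>x v. x \<in> S \<Longrightarrow> linear (\<lambda>u. f x u v)" "\<And>x u. x \<in> S \<Longrightarrow> linear (f x u)"
  shows "(\<lambda>p. f (fst p) (snd p) (snd p)) differentiable (at (x0, y0))"
proof -
  have ax: "(v :: real ^ 'n) = (\<Sum>i\<in>UNIV. v $ i *\<^sub>R axis i 1)" for v
    using basis_expansion[of v] by (simp add: scalar_mult_eq_scaleR)
  have e: "(\<Sum>i\<in>UNIV. \<Sum>j\<in>UNIV. y $ i * (y $ j * f x (axis i 1) (axis j 1))) = f x y y" if x: "x \<in> S" for x y
  proof -
    have 1: "f x y y = (\<Sum>i\<in>UNIV. y $ i * f x (axis i 1) y)"
      by (subst (1) ax[of y], subst linear_sum[OF lin(1)[OF x]]) (simp only: linear_scale[OF lin(1)[OF x]] real_scaleR_def)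
    have 2: "f x (axis i 1) y = (\<Sum>j\<in>UNIV. y $ j * f x (axis i 1) (axis j 1))" for i
      by (subst ax[of y], subst linear_sum[OF lin(2)[OF x]]) (simp only: linear_scale[OF lin(2)[OF x]] real_scaleR_def)
    show ?thesis by (subst 1, subst 2) (simp add: sum_distrib_left)
  qed
  have c: "(\<lambda>p. f (fst p) u v) differentiable (at (x0, y0))" for u v
    by (rule differentiable_compose_fst[OF smooth_on_imp_differentiable[OF sm S(2)]])
  have d: "(\<lambda>p. snd p $ i) differentiable (at (x0, y0))" for i
    by (rule linear_imp_differentiable) (auto intro!: linearI)
  have "(\<lambda>p. \<Sum>i\<in>UNIV. \<Sum>j\<in>UNIV. snd p $ i * (snd p $ j * f (fst p) (axis i 1) (axis j 1))) differentiable (at (x0, y0))"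
    by (intro differentiable_sum differentiable_mult c d ballI finite_class.finite)
  then obtain f' where f': "((\<lambda>p. \<Sum>i\<in>UNIV. \<Sum>j\<in>UNIV. snd p $ i * (snd p $ j * f (fst p) (axis i 1) (axis j 1))) has_derivative f') (at (x0, y0))"
    unfolding differentiable_def by blast
  have "((\<lambda>p. f (fst p) (snd p) (snd p)) has_derivative f') (at (x0, y0))"
  proof (rule has_derivative_transform_within_open[OF f'])
    show "open (S \<times> (UNIV :: (real ^ 'n) set))" "(x0, y0) \<in> S \<times> UNIV" using S by (auto intro: open_Times)
  qed (use e in auto)
  then show ?thesis unfolding differentiable_def by blast
qed

context finsler_lift
begin

section \<open>The Lagrangian in transported frames\<close>

lemma Tg_coord:
  assumes g: "g \<in> carrier G" and d: "d \<in> B" "g <# H \<in> fst d"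
  shows "coord_tangent B d (g <# H) (Tg g v d) = Tg g v" and "linear (\<lambda>v. Tg g v d)"
proof -
  have "Tg g v \<in> tangent_space B (g <# H)" using Tg(3)[OF g] by blast
  then show "coord_tangent B d (g <# H) (Tg g v d) = Tg g v" by (rule N.coord_tangent_eq[OF _ d])
  show "linear (\<lambda>v. Tg g v d)"
    by (rule linearI) (simp_all add: linear_add[OF Tg(1)[OF g]] linear_scale[OF Tg(1)[OF g]] scaleR_fun_apply)
qed

text \<open>The right sides are the model functions and do not contain g; this constancy is what
  gets differentiated in \<open>frame_L\<close> and \<open>frame_lam\<close>.\<close>

lemma lam_Tg:
  assumes g: "g \<in> carrier G" and d: "d \<in> B" "g <# H \<in> fst d" and z: "z \<in> D0"
  defines "p \<equiv> (snd d (g <# H), Tg g z d)"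
  shows "p \<in> Wd d" "Lc d p = Lf w z" "frechet_derivative (Lc d) (at p) (0, Tg g v d) = dLf w z v"
    and "frechet_derivative (lam (Lc d) (Tg g v d)) (at p) (0, Tg g u d) = hLf w z u v"
proof -
  interpret L: lagrangian "Lc d" "Wd d" by (rule lagrangian[OF d(1)])
  let ?p = "\<lambda>y. (snd d (g <# H), Tg g y d)"
  have W: "?p y \<in> Wd d" if "y \<in> D0" for y
    using that by (simp add: in_Wd[OF d] Tg_coord[OF g d] Tg(4)[OF g])
  have Leq: "Lc d (?p y) = Lf w y" if "y \<in> D0" for y
    using Tg(5)[OF g that] F_T[OF that] by (simp add: Lc_eq[OF d] Tg_coord[OF g d] Lf_def)
  show "p \<in> Wd d" "Lc d p = Lf w z" unfolding p_def using W[OF z] Leq[OF z] by blast+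
  have pd: "(?p has_derivative (\<lambda>v. (0, Tg g v d))) (at y)" for y
    using linear_imp_has_derivative[OF Tg_coord(2)[OF g d]] by (intro has_derivative_Pair has_derivative_const)
  have Ld: "frechet_derivative (Lc d) (at (?p y)) (0, Tg g v d) = dLf w y v" if y: "y \<in> D0" for y v
  proof -
    have 1: "((\<lambda>y. Lc d (?p y)) has_derivative (\<lambda>v. frechet_derivative (Lc d) (at (?p y)) (0, Tg g v d))) (at y)"
      by (rule has_derivative_compose[OF pd smooth_on_has_derivative[OF Lc_smooth[OF d(1)] W[OF y]]])
    have s: "sf w y > 1" "y \<noteq> 0" using D0_pos[OF y] sf_gt_one by blast+
    have 2: "((\<lambda>y. Lc d (?p y)) has_derivative dLf w y) (at y)"
      by (rule has_derivative_transform_within_open[OF Lf_has_derivative D0_open y]) (use s Leq in auto)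
    show ?thesis using fun_cong[OF has_derivative_unique[OF 1 2]] .
  qed
  show "frechet_derivative (Lc d) (at p) (0, Tg g v d) = dLf w z v" unfolding p_def by (rule Ld[OF z])
  have 1: "((\<lambda>y. lam (Lc d) (Tg g v d) (?p y)) has_derivative
      (\<lambda>u. frechet_derivative (lam (Lc d) (Tg g v d)) (at (?p z)) (0, Tg g u d))) (at z)"
    by (rule has_derivative_compose[OF pd smooth_on_has_derivative[OF L.lam_smooth W[OF z]]])
  have s: "sf w z > 1" "z \<noteq> 0" using D0_pos[OF z] sf_gt_one by blast+
  have 2: "((\<lambda>y. lam (Lc d) (Tg g v d) (?p y)) has_derivative (\<lambda>u. hLf w z u v)) (at z)"
    by (rule has_derivative_transform_within_open[OF dLf_has_derivative D0_open z]) (use s Ld in \<open>auto simp: lam_def\<close>)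
  show "frechet_derivative (lam (Lc d) (Tg g v d)) (at p) (0, Tg g u d) = hLf w z u v"
    unfolding p_def using fun_cong[OF has_derivative_unique[OF 1 2]] .
qed

context
  fixes c d
  assumes c: "c \<in> A" "\<one> \<in> fst c" and d: "d \<in> B" "H \<in> fst d"
begin

abbreviation "Td v \<equiv> T v d"
abbreviation "\<Gamma> u v \<equiv> fgamma c d (\<kappa> u) (\<kappa> v)"

lemma frame_at:
  "\<forall>\<^sub>F t in nhds 0. \<exists>g\<in>carrier G. g <# H \<in> fst d \<and> fcurve c d (\<kappa> u) t = snd d (g <# H) \<and>
      (\<forall>v. fmove c d (\<kappa> u) (\<kappa> v) t = Tg g v d)"
  using moving_frame(1)[OF c d \<kappa>(2)[of u] \<kappa>(2)[of u]]
proof eventually_elim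
  case (elim t)
  then obtain g where g: "g \<in> carrier G" "g <# H \<in> fst d" "fcurve c d (\<kappa> u) t = snd d (g <# H)"
    "\<And>w. w \<in> \<gg> \<Longrightarrow> fmove c d (\<kappa> u) w t = dact g H (\<iota>0 w) d" by blast
  have "fmove c d (\<kappa> u) (\<kappa> v) t = Tg g v d" for v
    using g(4)[OF \<kappa>(2)[of v]] by (simp add: Tg_def \<kappa>(3))
  then show ?case using g(1-3) by blast
qed

text \<open>The frame at time 0 is T itself, which brings \<open>lam_Tg\<close> to the
  origin.\<close>

lemma frame_origin: obtains g where "g \<in> carrier G" "g <# H \<in> fst d" "snd d H = snd d (g <# H)" "\<And>v. Td v = Tg g v d"
proof -
  obtain g where g: "g \<in> carrier G" "g <# H \<in> fst d" "fcurve c d (\<kappa> 0) 0 = snd d (g <# H)"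
    "\<And>v. fmove c d (\<kappa> 0) (\<kappa> v) 0 = Tg g v d"
    using eventually_nhds_x_imp_x[OF frame_at[of 0]] by blast
  show ?thesis
  proof (rule that[OF g(1,2)])
    show "snd d H = snd d (g <# H)" using g(3) moving_frame(2)[OF c d \<kappa>(2) \<kappa>(2)] by simp
    show "Td v = Tg g v d" for v
      using g(4)[of v] moving_frame(4)[OF c d \<kappa>(2)[of 0] \<kappa>(2)[of v]] by (simp add: \<kappa>(3))
  qed
qed

lemma lam_T:
  assumes z: "z \<in> D0"
  shows "(snd d H, Td z) \<in> Wd d" "frechet_derivative (Lc d) (at (snd d H, Td z)) (0, Td v) = dLf w z v"
    and "frechet_derivative (lam (Lc d) (Td v)) (at (snd d H, Td z)) (0, Td u) = hLf w z u v"
proof -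
  obtain g where g: "g \<in> carrier G" "g <# H \<in> fst d" "snd d H = snd d (g <# H)" "\<And>v. Td v = Tg g v d"
    using frame_origin by blast
  show "(snd d H, Td z) \<in> Wd d" "frechet_derivative (Lc d) (at (snd d H, Td z)) (0, Td v) = dLf w z v"
    "frechet_derivative (lam (Lc d) (Td v)) (at (snd d H, Td z)) (0, Td u) = hLf w z u v"
    unfolding g(3,4) using lam_Tg[OF g(1) d(1) g(2) z] by blast+
qed

lemma frame_derivative:
  "((\<lambda>t. (fcurve c d (\<kappa> u) t, fmove c d (\<kappa> u) (\<kappa> v) t)) has_derivative (\<lambda>r. r *\<^sub>R (Td u, \<Gamma> u v))) (at 0)"
  using has_derivative_Pair[OF moving_frame(3)[OF c d \<kappa>(2)[of u] \<kappa>(2)[of v], unfolded has_vector_derivative_def]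
      moving_frame(5)[OF c d \<kappa>(2)[of u] \<kappa>(2)[of v], unfolded has_vector_derivative_def]]
  by (simp add: \<kappa>(3))

lemma frame_value: "fcurve c d (\<kappa> u) 0 = snd d H" "fmove c d (\<kappa> u) (\<kappa> v) 0 = Td v"
  using moving_frame(2,4)[OF c d \<kappa>(2)[of u] \<kappa>(2)[of v]] by (simp_all add: \<kappa>(3))

text \<open>F^2 of a transported vector is constant, so its derivative along the frame
  vanishes.\<close>

lemma frame_L:
  assumes z: "z \<in> D0"
  shows "frechet_derivative (Lc d) (at (snd d H, Td z)) (Td u, \<Gamma> u z) = 0"
proof -
  let ?k = "\<lambda>t. (fcurve c d (\<kappa> u) t, fmove c d (\<kappa> u) (\<kappa> z) t)"
  have "((\<lambda>t. Lc d (?k t)) has_derivative (\<lambda>r. frechet_derivative (Lc d) (at (?k 0)) (r *\<^sub>R (Td u, \<Gamma> u z)))) (at 0)"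
  proof (rule has_derivative_compose[OF frame_derivative])
    show "(Lc d has_derivative frechet_derivative (Lc d) (at (?k 0))) (at (?k 0))"
      unfolding frame_value by (rule smooth_on_has_derivative[OF Lc_smooth[OF d(1)] lam_T(1)[OF z]])
  qed
  moreover have "((\<lambda>t. Lc d (?k t)) has_derivative (\<lambda>r. 0)) (at 0)"
  proof (rule has_derivative_transform_eventually_at[OF has_derivative_const])
    show "\<forall>\<^sub>F t in nhds 0. Lf w z = Lc d (?k t)"
      using frame_at[of u]
    proof eventually_elim
      case (elim t)
      then obtain g where "g \<in> carrier G" "g <# H \<in> fst d" "fcurve c d (\<kappa> u) t = snd d (g <# H)"
        "\<And>v. fmove c d (\<kappa> u) (\<kappa> v) t = Tg g v d" by blast
      then show ?case using lam_Tg(2)[OF _ d(1) _ z] by simp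
    qed
  qed
  ultimately have "(\<lambda>r. frechet_derivative (Lc d) (at (?k 0)) (r *\<^sub>R (Td u, \<Gamma> u z))) = (\<lambda>r. 0)"
    by (rule has_derivative_unique)
  from fun_cong[OF this, of 1] show ?thesis by (simp add: frame_value)
qed

text \<open>Likewise for the momentum: both its direction v and the vector z are transported, which
  accounts for the two terms.\<close>

lemma frame_lam:
  assumes z: "z \<in> D0"
  shows "frechet_derivative (Lc d) (at (snd d H, Td z)) (0, \<Gamma> u v)
    + frechet_derivative (lam (Lc d) (Td v)) (at (snd d H, Td z)) (Td u, \<Gamma> u z) = 0"
proof -
  let ?k = "\<lambda>t. (fcurve c d (\<kappa> u) t, fmove c d (\<kappa> u) (\<kappa> z) t)" and ?h = "\<lambda>t. (0, fmove c d (\<kappa> u) (\<kappa> v) t)"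
  have hd: "(?h has_derivative (\<lambda>r. r *\<^sub>R (0, \<Gamma> u v))) (at 0)"
    using has_derivative_Pair[OF has_derivative_const moving_frame(5)[OF c d \<kappa>(2)[of u] \<kappa>(2)[of v], unfolded has_vector_derivative_def]]
    by simp
  have k0: "?k 0 \<in> Wd d" unfolding frame_value by (rule lam_T(1)[OF z])
  have "((\<lambda>t. frechet_derivative (Lc d) (at (?k t)) (?h t)) has_derivative
     (\<lambda>r. frechet_derivative (Lc d) (at (?k 0)) (r *\<^sub>R (0, \<Gamma> u v))
        + frechet_derivative (\<lambda>z. frechet_derivative (Lc d) (at z) (?h 0)) (at (?k 0)) (r *\<^sub>R (Td u, \<Gamma> u z)))) (at 0)"
    by (rule frechet_derivative_along[OF Wd_open[OF d(1)] k0 Lc_smooth[OF d(1)] frame_derivative hd])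
  moreover have "((\<lambda>t. frechet_derivative (Lc d) (at (?k t)) (?h t)) has_derivative (\<lambda>r. 0)) (at 0)"
  proof (rule has_derivative_transform_eventually_at[OF has_derivative_const])
    show "\<forall>\<^sub>F t in nhds 0. dLf w z v = frechet_derivative (Lc d) (at (?k t)) (?h t)"
      using frame_at[of u]
    proof eventually_elim
      case (elim t)
      then obtain g where "g \<in> carrier G" "g <# H \<in> fst d" "fcurve c d (\<kappa> u) t = snd d (g <# H)"
        "\<And>v. fmove c d (\<kappa> u) (\<kappa> v) t = Tg g v d" by blast
      then show ?case using lam_Tg(3)[OF _ d(1) _ z] by simp
    qed
  qed
  ultimately have "(\<lambda>r. frechet_derivative (Lc d) (at (?k 0)) (r *\<^sub>R (0, \<Gamma> u v))
        + frechet_derivative (\<lambda>z. frechet_derivative (Lc d) (at z) (?h 0)) (at (?k 0)) (r *\<^sub>R (Td u, \<Gamma> u z))) = (\<lambda>r. 0)"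
    by (rule has_derivative_unique)
  from fun_cong[OF this, of 1] show ?thesis by (simp add: frame_value lam_def)
qed

text \<open>\<open>\<eta>\<close> is the acceleration of the geodesic relative to the moving frame.\<close>

lemma relative_acceleration:
  assumes z: "z \<in> D0" and EL: "EL (Lc d) (snd d H, Td z) a0"
  obtains \<eta> where "Td \<eta> = a0 - \<Gamma> z z" "\<And>v. hLf w z \<eta> v = dLf w z (brz z v)" "dLf w z \<eta> = 0"
proof -
  interpret L: lagrangian "Lc d" "Wd d" by (rule lagrangian[OF d(1)])
  let ?p = "(snd d H, Td z)"
  have p: "?p \<in> Wd d" by (rule lam_T(1)[OF z])
  obtain \<eta> where "T \<eta> = coord_tangent B d H (a0 - \<Gamma> z z)"
    using N.coord_tangent_in[OF d, of "a0 - \<Gamma> z z"] T(3) by (metis imageE)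
  then have \<eta>: "Td \<eta> = a0 - \<Gamma> z z" by (simp add: N.coord_tangent_apply[OF d])
  have h: "hLf w z \<eta> v = dLf w z (brz z v)" for v
  proof -
    let ?D = "frechet_derivative (Lc d) (at ?p)" and ?M = "frechet_derivative (lam (Lc d) (Td v)) (at ?p)"
    note lD = linear_diff[OF L.L_deriv_linear[OF p]] and aD = linear_add[OF L.L_deriv_linear[OF p]]
    \<comment> \<open>The Euler-Lagrange equation is compared with the two frame identities; what
      remains of the frame terms is \<open>\<Gamma> z v - \<Gamma> v z\<close>, the bracket.\<close>
    have 1: "?M (Td z, a0) = ?D (Td v, 0)" using EL by (simp add: EL_def)
    have 2: "?M (Td z, a0) = ?M (Td z, \<Gamma> z z) + ?M (0, Td \<eta>)"
      using linear_add[OF L.lam_deriv_linear[OF p], of "Td v" "(Td z, \<Gamma> z z)" "(0, Td \<eta>)"] by (simp add: \<eta>)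
    have 3: "?D (0, \<Gamma> z v) + ?M (Td z, \<Gamma> z z) = 0" by (rule frame_lam[OF z])
    have 4: "?D (Td v, 0) + ?D (0, \<Gamma> v z) = 0"
      using frame_L[OF z, of v] aD[of "(Td v, 0)" "(0, \<Gamma> v z)"] by simp
    have "\<Gamma> z v - \<Gamma> v z = Td (brz z v)"
      using moving_frame(6)[OF c d \<kappa>(2)[of z] \<kappa>(2)[of v]] by (simp add: T_brz)
    then have 5: "?D (0, \<Gamma> z v) - ?D (0, \<Gamma> v z) = dLf w z (brz z v)"
      using lD[of "(0, \<Gamma> z v)" "(0, \<Gamma> v z)"] lam_T(2)[OF z, of "brz z v"] by simp
    show ?thesis using 1 2 3 4 5 lam_T(3)[OF z, of v \<eta>] by linarith
  qed
  \<comment> \<open>The case v = z, where the bracket vanishes, combined with Euler's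
    relation.\<close>
  have "dLf w z \<eta> = 0"
    using h[of z] hLf_euler[of z w \<eta>] D0_pos[OF z] by (simp add: brz_self dLf_def)
  with \<eta> h show ?thesis using that by blast
qed

section \<open>Change of s along a geodesic\<close>

definition sloc :: "(real ^ 'n) \<times> (real ^ 'n) \<Rightarrow> real"
  where "sloc p = \<beta> (chart_inv d (fst p)) (coord_tangent B d (chart_inv d (fst p)) (snd p))
    / sqrt (a (chart_inv d (fst p)) (coord_tangent B d (chart_inv d (fst p)) (snd p)) (coord_tangent B d (chart_inv d (fst p)) (snd p)))"

lemma sloc_eq: "P \<in> fst d \<Longrightarrow> \<xi> \<in> tangent_space B P \<Longrightarrow> sloc (snd d P, \<xi> d) = \<beta> P \<xi> / sqrt (a P \<xi> \<xi>)"
  using d(1) by (simp add: sloc_def N.coord_tangent_eq)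

lemma sloc_differentiable:
  assumes z: "z \<noteq> 0"
  shows "sloc differentiable (at (snd d H, Td z))"
proof -
  let ?S = "snd d ` fst d" and ?c = "\<lambda>x. coord_tangent B d (chart_inv d x)"
  have S: "open ?S" "snd d H \<in> ?S" using N.open_overlap[OF d(1) d(1)] d(2) by auto
  have pt: "chart_inv d x \<in> fst d" "chart_inv d x \<in> points B" if "x \<in> ?S" for x
    using N.chart_inv_in[OF that] d(1) by blast+
  have ct: "?c x u \<in> tangent_space B (chart_inv d x)" if "x \<in> ?S" for x u
    by (rule N.coord_tangent_in[OF d(1) pt(1)[OF that]])
  have cl: "linear (?c x)" if "x \<in> ?S" for x
    by (rule N.coord_tangent_linear[OF d(1) pt(1)[OF that]])
  have linI: "linear f" if "\<And>r u v. f (r *\<^sub>R u + v) = r * f u + f v" for f :: "real ^ 'n \<Rightarrow> real"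
  proof (rule linearI)
    have f0: "f 0 = 0" using that[of 1 0 0] by simp
    show "f (u + v) = f u + f v" for u v using that[of 1 u v] by simp
    show "f (r *\<^sub>R u) = r *\<^sub>R f u" for r u using that[of r u 0] f0 by simp
  qed
  have lb: "linear (\<lambda>u. \<beta> (chart_inv d x) (?c x u))" if "x \<in> ?S" for x
    by (rule linI) (simp add: linear_add[OF cl[OF that]] linear_scale[OF cl[OF that]] \<beta>_lin[OF pt(2)[OF that] ct[OF that] ct[OF that]])
  have la: "linear (\<lambda>u. a (chart_inv d x) (?c x u) (?c x v))" if "x \<in> ?S" for x v
    by (rule linI) (simp add: linear_add[OF cl[OF that]] linear_scale[OF cl[OF that]] a_lin[OF pt(2)[OF that] ct[OF that] ct[OF that] ct[OF that]])
  have la': "linear (\<lambda>v. a (chart_inv d x) (?c x u) (?c x v))" if x: "x \<in> ?S" for x u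
    by (subst a_sym[OF pt(2)[OF x] ct[OF x] ct[OF x]]) (rule la[OF x])
  have A: "(\<lambda>p. a (chart_inv d (fst p)) (?c (fst p) (snd p)) (?c (fst p) (snd p))) differentiable (at (snd d H, Td z))"
    by (rule differentiable_quadratic_form[OF S a_smooth[OF d(1)] la la'])
  have ax: "(v :: real ^ 'n) = (\<Sum>i\<in>UNIV. v $ i *\<^sub>R axis i 1)" for v
    using basis_expansion[of v] by (simp add: scalar_mult_eq_scaleR)
  have Bd: "(\<lambda>p. \<beta> (chart_inv d (fst p)) (?c (fst p) (snd p))) differentiable (at (snd d H, Td z))"
  proof -
    have cd: "(\<lambda>p. \<beta> (chart_inv d (fst p)) (?c (fst p) u)) differentiable (at (snd d H, Td z))" for u
      by (rule differentiable_compose_fst[OF smooth_on_imp_differentiable[OF \<beta>_smooth[OF d(1)] S(2)]])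
    have dd: "(\<lambda>p. snd p $ i) differentiable (at (snd d H, Td z))" for i
      by (rule linear_imp_differentiable) (auto intro!: linearI)
    have "(\<lambda>p. \<Sum>i\<in>UNIV. snd p $ i * \<beta> (chart_inv d (fst p)) (?c (fst p) (axis i 1))) differentiable (at (snd d H, Td z))"
      by (intro differentiable_sum differentiable_mult cd dd ballI finite_class.finite)
    then obtain f' where f': "((\<lambda>p. \<Sum>i\<in>UNIV. snd p $ i * \<beta> (chart_inv d (fst p)) (?c (fst p) (axis i 1))) has_derivative f') (at (snd d H, Td z))"
      unfolding differentiable_def by blast
    have e: "(\<Sum>i\<in>UNIV. y $ i * \<beta> (chart_inv d x) (?c x (axis i 1))) = \<beta> (chart_inv d x) (?c x y)" if x: "x \<in> ?S" for x y
      by (subst (2) ax[of y], subst linear_sum[OF lb[OF x]]) (simp only: linear_scale[OF lb[OF x]] real_scaleR_def)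
    have "((\<lambda>p. \<beta> (chart_inv d (fst p)) (?c (fst p) (snd p))) has_derivative f') (at (snd d H, Td z))"
    proof (rule has_derivative_transform_within_open[OF f'])
      show "open (?S \<times> (UNIV :: (real ^ 'n) set))" "(snd d H, Td z) \<in> ?S \<times> UNIV" using S by (auto intro: open_Times)
    qed (use e in auto)
    then show ?thesis unfolding differentiable_def by blast
  qed
  have "a H (T z) (T z) > 0" using z by (simp add: aT)
  then have pos: "a (chart_inv d (snd d H)) (?c (snd d H) (Td z)) (?c (snd d H) (Td z)) > 0"
    using d by (simp add: N.coord_tangent_eq[OF T_in])
  obtain f' where f': "((\<lambda>p. a (chart_inv d (fst p)) (?c (fst p) (snd p)) (?c (fst p) (snd p))) has_derivative f') (at (snd d H, Td z))"
    using A unfolding differentiable_def by blast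
  have "(\<lambda>p. sqrt (a (chart_inv d (fst p)) (?c (fst p) (snd p)) (?c (fst p) (snd p)))) differentiable (at (snd d H, Td z))"
    using has_derivative_real_sqrt[OF _ f'] pos unfolding differentiable_def by auto
  from differentiable_divide[OF Bd this] pos show ?thesis
    unfolding sloc_def[abs_def] by simp
qed

text \<open>s is constant along the transported frame, so only the vertical part \<eta> of the
  acceleration changes it, and on the fibre s is \<open>sf w\<close>.\<close>

lemma sloc_derivative:
  assumes n: "CARD('n) \<ge> 2" and z: "z \<in> D0" and \<eta>: "Td \<eta> = a0 - \<Gamma> z z"
  shows "(sloc has_derivative frechet_derivative sloc (at (snd d H, Td z))) (at (snd d H, Td z))"
    and "frechet_derivative sloc (at (snd d H, Td z)) (Td z, a0) = (thf w z \<bullet> \<eta>) / norm z"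
proof -
  have z0: "z \<noteq> 0" using D0_pos[OF z] by blast
  let ?D = "frechet_derivative sloc (at (snd d H, Td z))"
  show D: "(sloc has_derivative ?D) (at (snd d H, Td z))"
    using sloc_differentiable[OF z0] by (simp add: frechet_derivative_works)
  have lin: "linear ?D" by (rule has_derivative_linear[OF D])
  have val: "sloc (snd d (g <# H), Tg g v d) = sf w v" if g: "g \<in> carrier G" "g <# H \<in> fst d" for g v
  proof -
    have "Tg g v \<in> tangent_space B (g <# H)" using Tg(3)[OF g(1)] by blast
    then show ?thesis by (simp add: sloc_eq g(2) metric_invariant[OF n g(1)] sf_def norm_eq_sqrt_inner)
  qed
  let ?k = "\<lambda>t. (fcurve c d (\<kappa> z) t, fmove c d (\<kappa> z) (\<kappa> z) t)"
  have "((\<lambda>t. sloc (?k t)) has_derivative (\<lambda>r. ?D (r *\<^sub>R (Td z, \<Gamma> z z)))) (at 0)"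
    by (rule has_derivative_compose[OF frame_derivative]) (simp add: frame_value D)
  moreover have "((\<lambda>t. sloc (?k t)) has_derivative (\<lambda>r. 0)) (at 0)"
  proof (rule has_derivative_transform_eventually_at[OF has_derivative_const])
    show "\<forall>\<^sub>F t in nhds 0. sf w z = sloc (?k t)"
      using frame_at[of z]
    proof eventually_elim
      case (elim t)
      then obtain g where "g \<in> carrier G" "g <# H \<in> fst d" "fcurve c d (\<kappa> z) t = snd d (g <# H)"
        "\<And>v. fmove c d (\<kappa> z) (\<kappa> v) t = Tg g v d" by blast
      then show ?case using val by simp
    qed
  qed
  ultimately have "(\<lambda>r. ?D (r *\<^sub>R (Td z, \<Gamma> z z))) = (\<lambda>r. 0)" by (rule has_derivative_unique)
  from fun_cong[OF this, of 1] have 1: "?D (Td z, \<Gamma> z z) = 0" by simp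
  obtain g where g: "g \<in> carrier G" "g <# H \<in> fst d" "snd d H = snd d (g <# H)" "\<And>v. Td v = Tg g v d"
    using frame_origin by blast
  have "((\<lambda>v. (snd d H, Td v)) has_derivative (\<lambda>v. (0, Td v))) (at z)"
    unfolding g(4) using linear_imp_has_derivative[OF Tg_coord(2)[OF g(1) d(1) g(2)]]
    by (intro has_derivative_Pair has_derivative_const)
  from has_derivative_compose[OF this D]
  have "(sf w has_derivative (\<lambda>v. ?D (0, Td v))) (at z)"
    unfolding g(3,4) val[OF g(1,2)] .
  from fun_cong[OF has_derivative_unique[OF this sf_has_derivative[OF z0]], of \<eta>]
  have 2: "?D (0, Td \<eta>) = (thf w z \<bullet> \<eta>) / norm z" .
  show "?D (Td z, a0) = (thf w z \<bullet> \<eta>) / norm z"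
    using linear_add[OF lin, of "(Td z, \<Gamma> z z)" "(0, Td \<eta>)"] 1 2 by (simp add: \<eta>)
qed

end

text \<open>Every geodesic with this initial velocity gives the same derivative, because its initial
  acceleration is fixed by the Euler-Lagrange equation. This is the uniqueness that the definite
  description in \<open>S_curvature\<close> needs.\<close>

lemma S_along:
  assumes z: "z \<in> D0" and \<epsilon>: "\<epsilon> > 0" and geo: "geodesic B D F {-\<epsilon><..<\<epsilon>} \<gamma>"
    and \<gamma>0: "\<gamma> 0 = H" and vel0: "velocity B \<gamma> 0 = T z"
  shows "((\<lambda>t. distortion B D F (\<gamma> t) (velocity B \<gamma> t)) has_real_derivative Sval z) (at 0)"
proof -
  have sc: "smooth_curve B {-\<epsilon><..<\<epsilon>} \<gamma>" and vD: "\<And>t. t \<in> {-\<epsilon><..<\<epsilon>} \<Longrightarrow> velocity B \<gamma> t \<in> D (\<gamma> t)"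
    using geo unfolding geodesic_def by simp_all
  have pts: "\<gamma> t \<in> points B" if "t \<in> {-\<epsilon><..<\<epsilon>}" for t
    using sc that unfolding smooth_curve_def by blast
  have I0: "0 \<in> {-\<epsilon><..<\<epsilon>}" using \<epsilon> by simp
  have evI: "\<forall>\<^sub>F t in nhds 0. t \<in> {-\<epsilon><..<\<epsilon>}" by (rule eventually_nhds_in_open[OF _ I0]) simp
  show ?thesis
  proof (cases "CARD('n) = 1")
    case True
    have "\<forall>\<^sub>F t in nhds 0. distortion B D F (\<gamma> 0) (velocity B \<gamma> 0) = distortion B D F (\<gamma> t) (velocity B \<gamma> t)"
      using evI by eventually_elim (rule distortion_one_dim[OF True pts[OF I0] vD[OF I0] pts vD])
    from has_derivative_transform_eventually_at[OF has_derivative_const this]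
    show ?thesis
      unfolding Sval_one_dim[OF True z] has_field_derivative_def by (rule has_derivative_eq_rhs) (simp add: fun_eq_iff)
  next
    case False
    then have n: "CARD('n) \<ge> 2" using zero_less_card_finite[where 'a='n] by linarith
    obtain d where d: "d \<in> B" "H \<in> fst d" using H_in by auto
    obtain c where c: "c \<in> A" "\<one> \<in> fst c" using chart_at[OF one_closed] by blast
    interpret L: lagrangian "Lc d" "Wd d" by (rule lagrangian[OF d(1)])
    define x where "x = snd d \<circ> \<gamma>"
    define y where "y t = vector_derivative x (at t)" for t
    define J where "J = {t \<in> {-\<epsilon><..<\<epsilon>}. \<gamma> t \<in> fst d}"
    have J: "open J" "smooth_on J x" "0 \<in> J"
      using sc d \<gamma>0 I0 unfolding smooth_curve_def Let_def J_def x_def by auto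
    have xd: "(x has_vector_derivative y t) (at t)" if "t \<in> J" for t
      unfolding y_def using smooth_on_imp_differentiable[OF J(2) that] by (simp add: vector_derivative_works)
    have fy: "frechet_derivative x (at t) 1 = y t" if "t \<in> J" for t
      using frechet_derivative_eq[OF xd[OF that, unfolded has_vector_derivative_def]] by simp
    define a0 where "a0 = vector_derivative y (at 0)"
    have yd: "(y has_vector_derivative a0) (at 0)"
    proof -
      have "((\<lambda>t. frechet_derivative x (at t) 1) has_derivative frechet_derivative (\<lambda>t. frechet_derivative x (at t) 1) (at 0)) (at 0)"
        by (rule smooth_on_has_derivative[OF smooth_on_frechet[OF J(2)] J(3)])
      then have "(y has_derivative frechet_derivative (\<lambda>t. frechet_derivative x (at t) 1) (at 0)) (at 0)"
        by (rule has_derivative_transform_within_open[OF _ J(1,3)]) (rule fy)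
      then have "y differentiable (at 0)" unfolding differentiable_def by blast
      then show ?thesis unfolding a0_def by (simp add: vector_derivative_works)
    qed
    have velt: "velocity B \<gamma> t d = y t" if "t \<in> J" for t
      using that d(1) by (simp add: velocity_def J_def y_def x_def)
    have x0: "x 0 = snd d H" "y 0 = T z d" using velt[OF J(3)] by (simp_all add: x_def \<gamma>0 vel0)
    have "a0 + 2 *\<^sub>R spray_coeff (\<lambda>u w. (local_expr B F d u w)\<^sup>2) (x 0) (y 0) = 0"
      using geo[unfolded geodesic_def Let_def, THEN conjunct2, THEN conjunct2, THEN bspec, OF I0, THEN bspec, OF d(1), THEN mp]
        d(2) \<gamma>0 unfolding a0_def x_def y_def[abs_def] by simp
    then have "EL (Lc d) (snd d H, T z d) a0"
      using L.spray_coeff_eq[OF lam_T(1)[OF c d z]] by (simp add: Lc_def x0)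
    then obtain \<eta> where \<eta>: "T \<eta> d = a0 - fgamma c d (\<kappa> z) (\<kappa> z)"
      "\<And>v. hLf w z \<eta> v = dLf w z (brz z v)" "dLf w z \<eta> = 0"
      using relative_acceleration[OF c d z] by blast
    note sl = sloc_derivative[OF c d n z \<eta>(1)]
    let ?sl = "sloc d"
    have "((\<lambda>t. (x t, y t)) has_derivative (\<lambda>r. r *\<^sub>R (T z d, a0))) (at 0)"
      using has_derivative_Pair[OF xd[OF J(3), unfolded has_vector_derivative_def] yd[unfolded has_vector_derivative_def]]
      by (simp add: x0)
    from has_derivative_compose[OF this, of ?sl] sl(1)
    have "((\<lambda>t. ?sl (x t, y t)) has_derivative (\<lambda>r. frechet_derivative ?sl (at (snd d H, T z d)) (r *\<^sub>R (T z d, a0)))) (at 0)"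
      by (simp add: x0)
    then have sd: "((\<lambda>t. ?sl (x t, y t)) has_real_derivative (thf w z \<bullet> \<eta>) / norm z) (at 0)"
      unfolding has_field_derivative_def
      by (rule has_derivative_eq_rhs)
        (rule ext, simp only: linear_scale[OF has_derivative_linear[OF sl(1)]] sl(2) real_scaleR_def mult.commute)
    have s0: "?sl (x 0, y 0) = sf w z"
      using sloc_eq[OF c d d(2) T_in, of z] by (simp add: x0 aT \<beta>T sf_def norm_eq_sqrt_inner)
    have s1: "sf w z > 1" "z \<noteq> 0" using D0_pos[OF z] sf_gt_one by blast+
    have Td: "(Tf CARD('n) (w \<bullet> w) has_real_derivative - Af CARD('n) (w \<bullet> w) (sf w z) * N3 (w \<bullet> w) (sf w z)
        / ((sf w z)\<^sup>2 * (sf w z - 1))) (at (?sl (x 0, y 0)))"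
      unfolding s0 by (rule Tf_has_derivative[OF s1(1) D0_N3[OF z]])
    have Se: "- Af CARD('n) (w \<bullet> w) (sf w z) * N3 (w \<bullet> w) (sf w z) / ((sf w z)\<^sup>2 * (sf w z - 1)) * ((thf w z \<bullet> \<eta>) / norm z) = Sval z"
      unfolding S_from_acceleration[OF s1(2,1) \<eta>(3) \<eta>(2)[of w]] Sval_def
      by (simp add: brz_anti[of z w])
    have "((\<lambda>t. Tf CARD('n) (w \<bullet> w) (?sl (x t, y t)) + tau_const) has_real_derivative Sval z) (at 0)"
      by (rule DERIV_cong[OF DERIV_add[OF DERIV_chain2[OF Td sd] DERIV_const]]) (simp only: Se add_0_right)
    then have "((\<lambda>t. Tf CARD('n) (w \<bullet> w) (?sl (x t, y t)) + tau_const) has_derivative (*) (Sval z)) (at 0)"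
      unfolding has_field_derivative_def .
    then show ?thesis
      unfolding has_field_derivative_def
    proof (rule has_derivative_transform_within_open[OF _ J(1,3)])
      fix t assume t: "t \<in> J"
      then have tI: "t \<in> {-\<epsilon><..<\<epsilon>}" and td: "\<gamma> t \<in> fst d" by (simp_all add: J_def)
      have "velocity B \<gamma> t \<in> tangent_space B (\<gamma> t)" using D_sub[OF pts[OF tI] vD[OF tI]] by blast
      from sloc_eq[OF c d td this]
      show "Tf CARD('n) (w \<bullet> w) (?sl (x t, y t)) + tau_const = distortion B D F (\<gamma> t) (velocity B \<gamma> t)"
        unfolding distortion_D[OF n pts[OF tI] vD[OF tI]] velt[OF t] by (simp add: x_def)
    qed
  qed
qed

lemma S_curvature_eq:
  assumes z: "z \<in> D0"
  shows "S_curvature B D F H (T z) = Sval z"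
proof -
  obtain d where d: "d \<in> B" "H \<in> fst d" using H_in by auto
  have TD: "T z \<in> D H" using z by (simp add: D0_def)
  obtain \<gamma> \<epsilon> where g: "\<epsilon> > 0" "geodesic B D F {-\<epsilon><..<\<epsilon>} \<gamma>" "\<gamma> 0 = H" "velocity B \<gamma> 0 = T z"
    using geodesic_exists[OF d TD] .
  show ?thesis
    unfolding S_curvature_def
  proof (rule the_equality)
    show "\<exists>\<gamma> \<epsilon>. \<epsilon> > 0 \<and> geodesic B D F {-\<epsilon><..<\<epsilon>} \<gamma> \<and> \<gamma> 0 = H \<and> velocity B \<gamma> 0 = T z \<and>
        ((\<lambda>t. distortion B D F (\<gamma> t) (velocity B \<gamma> t)) has_real_derivative Sval z) (at 0)"
      using g S_along[OF z g] by blast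
    fix r assume "\<exists>\<gamma> \<epsilon>. \<epsilon> > 0 \<and> geodesic B D F {-\<epsilon><..<\<epsilon>} \<gamma> \<and> \<gamma> 0 = H \<and> velocity B \<gamma> 0 = T z \<and>
        ((\<lambda>t. distortion B D F (\<gamma> t) (velocity B \<gamma> t)) has_real_derivative r) (at 0)"
    then obtain \<gamma>' \<epsilon>' where g': "\<epsilon>' > 0" "geodesic B D F {-\<epsilon>'<..<\<epsilon>'} \<gamma>'" "\<gamma>' 0 = H" "velocity B \<gamma>' 0 = T z"
      "((\<lambda>t. distortion B D F (\<gamma>' t) (velocity B \<gamma>' t)) has_real_derivative r) (at 0)" by blast
    show "r = Sval z" by (rule DERIV_unique[OF g'(5) S_along[OF z g'(1-4)]])
  qed
qed

end

section \<open>Second partial derivatives\<close>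

text \<open>Induction through the derivative in direction u, which is the inner product of u and z
  divided by the norm of z: if the norm is C^k away from 0, so is this quotient.\<close>

lemma smooth_on_norm: "smooth_on (- {0}) (norm :: 'v::euclidean_space \<Rightarrow> real)"
  unfolding smooth_on_def
proof
  fix k show "Ck_on k (- {0}) (norm :: 'v \<Rightarrow> real)"
  proof (induction k)
    case 0
    show ?case by (auto intro: continuous_intros)
  next
    case (Suc k)
    have op: "open (- {0 :: 'v})" by auto
    have fr: "frechet_derivative norm (at z) u = (u \<bullet> z) * inverse (norm z)" if "z \<in> - {0}" for z u :: 'v
      using that frechet_derivative_eq[OF has_derivative_norm_at, of z] by (simp add: divide_inverse inner_commute)
    have "Ck_on k (- {0}) (\<lambda>z :: 'v. (u \<bullet> z) * inverse (norm z))" for u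
      by (rule Ck_on_bilinear[OF bounded_bilinear_mult op Ck_on_bounded_linear[OF bounded_linear_inner_right]
            Ck_on_compose[OF op Ck_on_inverse Suc]]) auto
    then have "Ck_on k (- {0}) (\<lambda>z :: 'v. frechet_derivative norm (at z) u)" for u
      using Ck_on_cong[OF op, of "\<lambda>z. frechet_derivative norm (at z) u" "\<lambda>z. (u \<bullet> z) * inverse (norm z)" k] fr by blast
    moreover have "norm differentiable (at z)" if "z \<in> - {0}" for z :: 'v
      using has_derivative_norm_at[of z] that unfolding differentiable_def by auto
    ultimately show ?case by simp
  qed
qed

lemma pd_const: "pd (\<lambda>z :: 'v::real_normed_vector. c) u z = 0"
  by (rule pd_of_has_derivative[OF has_derivative_const])

lemma pd_bounded_linear: "bounded_linear f \<Longrightarrow> pd f u (z :: 'v::real_normed_vector) = f u"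
  by (rule pd_of_has_derivative) (rule bounded_linear_imp_has_derivative)

lemma pd_pd_const: "pd (pd (\<lambda>z :: 'v::real_normed_vector. c) u) v z = 0"
proof -
  have "pd (\<lambda>z :: 'v. c) u = (\<lambda>z. 0)" by (rule ext) (rule pd_const)
  then show ?thesis by (simp only: pd_const)
qed

lemma pd_pd_bounded_linear: "bounded_linear f \<Longrightarrow> pd (pd f u) v (z :: 'v::real_normed_vector) = 0"
proof -
  assume "bounded_linear f"
  then have "pd f u = (\<lambda>z. f u)" by (intro ext) (rule pd_bounded_linear)
  then show ?thesis by (simp only: pd_const)
qed

context
  fixes S :: "'v::euclidean_space set"
  assumes S: "open S"
begin

lemma pd_has_derivative: "smooth_on S f \<Longrightarrow> z \<in> S \<Longrightarrow> (f has_derivative (\<lambda>u. pd f u z)) (at z)"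
  using smooth_on_has_derivative[of S f z] pd_of_has_derivative[of f _ z] by simp

lemma smooth_on_pd: "smooth_on S f \<Longrightarrow> smooth_on S (pd f u)"
  using smooth_on_cong[OF S, of "pd f u" "\<lambda>z. frechet_derivative f (at z) u"] smooth_on_frechet[of S f u]
    pd_of_has_derivative[OF smooth_on_has_derivative] by blast

lemma pd_cong: "(\<And>z. z \<in> S \<Longrightarrow> f z = g z) \<Longrightarrow> z \<in> S \<Longrightarrow> pd f u z = pd g u z"
proof -
  assume e: "\<And>z. z \<in> S \<Longrightarrow> f z = g z" and z: "z \<in> S"
  have "isCont (\<lambda>t. z + t *\<^sub>R u) 0" by (intro continuous_intros)
  then have "\<forall>\<^sub>F t in nhds 0. z + t *\<^sub>R u \<in> S"
    using eventually_nhds_compose_continuous[where f="\<lambda>t. z + t *\<^sub>R u" and x=0 and P="\<lambda>x. x \<in> S"]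
      eventually_nhds_in_open[OF S z] by simp
  then have "\<forall>\<^sub>F t in nhds 0. f (z + t *\<^sub>R u) = g (z + t *\<^sub>R u)" by eventually_elim (rule e)
  then show ?thesis unfolding pd_def by (rule deriv_cong_ev) simp
qed

lemma pd_add:
  assumes "smooth_on S f" "smooth_on S g" "z \<in> S"
  shows "pd (\<lambda>z. f z + g z) u z = pd f u z + pd g u z"
  using pd_of_has_derivative[OF has_derivative_add[OF pd_has_derivative[OF assms(1,3)] pd_has_derivative[OF assms(2,3)]]] .

lemma pd_mult:
  assumes "smooth_on S f" "smooth_on S g" "z \<in> S"
  shows "pd (\<lambda>z. f z * g z) u z = f z * pd g u z + pd f u z * g z"
  using pd_of_has_derivative[OF has_derivative_mult[OF pd_has_derivative[OF assms(1,3)] pd_has_derivative[OF assms(2,3)]]] .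

lemma pd_pd_add:
  assumes "smooth_on S f" "smooth_on S g" "z \<in> S"
  shows "pd (pd (\<lambda>z. f z + g z) u) v z = pd (pd f u) v z + pd (pd g u) v z"
  using pd_cong[OF pd_add[OF assms(1,2)] assms(3)] pd_add[OF smooth_on_pd[OF assms(1)] smooth_on_pd[OF assms(2)] assms(3)]
  by simp

lemma pd_pd_mult:
  assumes f: "smooth_on S f" and g: "smooth_on S g" and z: "z \<in> S"
  shows "pd (pd (\<lambda>z. f z * g z) u) v z
    = f z * pd (pd g u) v z + pd f v z * pd g u z + pd f u z * pd g v z + pd (pd f u) v z * g z"
proof -
  have "pd (pd (\<lambda>z. f z * g z) u) v z = pd (\<lambda>z. f z * pd g u z + pd f u z * g z) v z"
    by (rule pd_cong[OF pd_mult[OF f g] z])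
  also have "\<dots> = pd (\<lambda>z. f z * pd g u z) v z + pd (\<lambda>z. pd f u z * g z) v z"
    by (rule pd_add[OF smooth_on_mult[OF S f smooth_on_pd[OF g]] smooth_on_mult[OF S smooth_on_pd[OF f] g] z])
  finally show ?thesis
    by (simp add: pd_mult[OF f smooth_on_pd[OF g] z] pd_mult[OF smooth_on_pd[OF f] g z])
qed

lemma pd_inverse:
  assumes "smooth_on S f" "\<And>z. z \<in> S \<Longrightarrow> f z \<noteq> (0 :: real)" "z \<in> S"
  shows "pd (\<lambda>z. inverse (f z)) u z = - (pd f u z * (inverse (f z))\<^sup>2)"
  by (rule pd_of_has_derivative, rule has_derivative_eq_rhs, rule Deriv.has_derivative_inverse[OF assms(2)[OF assms(3)] pd_has_derivative[OF assms(1,3)]])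
    (simp add: power2_eq_square mult_ac)

lemma pd_pd_inverse:
  assumes f: "smooth_on S f" and n: "\<And>z. z \<in> S \<Longrightarrow> f z \<noteq> (0 :: real)" and z: "z \<in> S"
  shows "pd (pd (\<lambda>z. inverse (f z)) u) v z
    = 2 * pd f u z * pd f v z * (inverse (f z)) ^ 3 - pd (pd f u) v z * (inverse (f z))\<^sup>2"
proof -
  let ?i = "\<lambda>z. inverse (f z)"
  have i: "smooth_on S ?i" by (rule smooth_on_inverse[OF S f n])
  have "pd (pd ?i u) v z = pd (\<lambda>z. (- 1) * (pd f u z * (?i z * ?i z))) v z"
    by (rule pd_cong[OF _ z]) (use pd_inverse[OF f n] in \<open>simp add: power2_eq_square\<close>)
  also have "\<dots> = - (pd f u z * (?i z * pd ?i v z + pd ?i v z * ?i z) + pd (pd f u) v z * (?i z * ?i z))"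
    unfolding pd_mult[OF smooth_on_const smooth_on_mult[OF S smooth_on_pd[OF f] smooth_on_mult[OF S i i]] z]
      pd_mult[OF smooth_on_pd[OF f] smooth_on_mult[OF S i i] z] pd_mult[OF i i z] pd_const by simp
  finally show ?thesis
    by (simp add: pd_inverse[OF f n z] power2_eq_square power3_eq_cube algebra_simps)
qed

lemma pd_norm:
  assumes "0 \<notin> S" "z \<in> S"
  shows "pd norm u z = (z \<bullet> u) * inverse (norm z)"
    and "pd (pd norm u) v z = (u \<bullet> v) * inverse (norm z) - (z \<bullet> u) * (z \<bullet> v) * (inverse (norm z)) ^ 3"
proof -
  have N: "smooth_on S norm" by (rule smooth_on_subset[OF smooth_on_norm]) (use assms(1) in auto)
  have n: "norm z \<noteq> 0" if "z \<in> S" for z using assms(1) that by auto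
  have 1: "pd norm u z = (u \<bullet> z) * inverse (norm z)" if "z \<in> S" for z u
    using pd_of_has_derivative[OF has_derivative_norm_at, of z u] n[OF that] by (simp add: divide_inverse inner_commute)
  show "pd norm u z = (z \<bullet> u) * inverse (norm z)" using 1[OF assms(2)] by (simp add: inner_commute)
  have "pd (pd norm u) v z = pd (\<lambda>z. (u \<bullet> z) * inverse (norm z)) v z" by (rule pd_cong[OF 1 assms(2)])
  also have "\<dots> = (u \<bullet> z) * pd (\<lambda>z. inverse (norm z)) v z + pd ((\<bullet>) u) v z * inverse (norm z)"
    by (rule pd_mult[OF smooth_on_bounded_linear[OF bounded_linear_inner_right] smooth_on_inverse[OF S N n] assms(2)])
  finally show "pd (pd norm u) v z = (u \<bullet> v) * inverse (norm z) - (z \<bullet> u) * (z \<bullet> v) * (inverse (norm z)) ^ 3"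
    by (simp add: pd_inverse[OF N n assms(2)] 1[OF assms(2)] pd_bounded_linear[OF bounded_linear_inner_right]
        inner_commute power2_eq_square power3_eq_cube algebra_simps)
qed

text \<open>Pure product rule, with a and s arbitrary and f in the place of the bracket by the
  vector dual to \<beta>. The function is a / |z| times a quadratic form plus a (1 - 2 / s) times a
  linear form; the second derivatives of these forms are constant and zero, respectively.\<close>

lemma mean_berwald_expansion:
  fixes a s :: "'v \<Rightarrow> real" and f :: "'v \<Rightarrow> 'v"
  assumes a: "smooth_on S a" and s: "smooth_on S s" and f: "linear f" and snz: "\<forall>z\<in>S. s z \<noteq> 0"
    and S0: "0 \<notin> S" and z: "z \<in> S"
  shows "pd (pd (\<lambda>z. a z / norm z * (f z \<bullet> z) + a z * (1 - 2 / s z) * (f z \<bullet> w)) u) v z =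
      (1 / norm z * pd (pd a u) v z
        - (z \<bullet> v) / norm z ^ 3 * pd a u z - (z \<bullet> u) / norm z ^ 3 * pd a v z
        - a z / norm z ^ 3 * (v \<bullet> u)
        + 3 * a z * (z \<bullet> v) * (z \<bullet> u) / norm z ^ 5) * (f z \<bullet> z)
    + (1 / norm z * pd a u z - a z * (z \<bullet> u) / norm z ^ 3) * (f v \<bullet> z + f z \<bullet> v)
    + (1 / norm z * pd a v z - a z * (z \<bullet> v) / norm z ^ 3) * (f u \<bullet> z + f z \<bullet> u)
    + a z / norm z * (f u \<bullet> v + f v \<bullet> u)
    + ((1 - 2 / s z) * pd (pd a u) v z
        + 2 * pd s v z / (s z)\<^sup>2 * pd a u z
        + 2 * pd s u z / (s z)\<^sup>2 * pd a v z
        - 4 * a z * pd s v z * pd s u z / s z ^ 3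
        + 2 * a z / (s z)\<^sup>2 * pd (pd s u) v z) * (f z \<bullet> w)
    + ((1 - 2 / s z) * pd a u z + 2 * a z * pd s u z / (s z)\<^sup>2) * (f v \<bullet> w)
    + ((1 - 2 / s z) * pd a v z + 2 * a z * pd s v z / (s z)\<^sup>2) * (f u \<bullet> w)"
proof -
  let ?N = "\<lambda>z :: 'v. inverse (norm z)" and ?Q = "\<lambda>z. f z \<bullet> z" and ?K = "\<lambda>z. f z \<bullet> w" and ?M = "\<lambda>z. 1 + (- 2) * inverse (s z)"
  have s0: "s z \<noteq> 0" if "z \<in> S" for z using snz that by blast
  have fb: "bounded_linear f" using f by (simp add: linear_conv_bounded_linear)
  have Kb: "bounded_linear ?K" by (rule bounded_linear_compose[OF bounded_linear_inner_left fb])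
  have N: "smooth_on S norm" by (rule smooth_on_subset[OF smooth_on_norm]) (use S0 in auto)
  have n: "norm z \<noteq> 0" if "z \<in> S" for z using S0 that by auto
  have iN: "smooth_on S ?N" by (rule smooth_on_inverse[OF S N n])
  have Q: "smooth_on S ?Q"
    by (rule smooth_on_bilinear[OF bounded_bilinear_inner S smooth_on_bounded_linear[OF fb] smooth_on_id])
  have K: "smooth_on S ?K" by (rule smooth_on_bounded_linear[OF Kb])
  have iS: "smooth_on S (\<lambda>z. inverse (s z))" by (rule smooth_on_inverse[OF S s s0])
  have cS: "smooth_on S (\<lambda>z. (- 2) * inverse (s z))" by (rule smooth_on_mult[OF S smooth_on_const iS])
  have M: "smooth_on S ?M" by (rule smooth_on_add[OF S smooth_on_const cS])
  have dQ: "pd ?Q u z = f u \<bullet> z + f z \<bullet> u" for u z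
    by (rule pd_of_has_derivative, rule has_derivative_eq_rhs,
        rule has_derivative_inner[OF bounded_linear_imp_has_derivative[OF fb] has_derivative_ident]) (simp add: fun_eq_iff)
  have ddQ: "pd (pd ?Q u) v z = f u \<bullet> v + f v \<bullet> u"
  proof -
    have "bounded_linear (\<lambda>z. f u \<bullet> z + f z \<bullet> u)"
      by (intro bounded_linear_add bounded_linear_inner_right bounded_linear_compose[OF bounded_linear_inner_left fb])
    from pd_bounded_linear[OF this] show ?thesis by (simp add: dQ[abs_def])
  qed
  have dK: "pd ?K u z = f u \<bullet> w" "pd (pd ?K u) v z = 0" for u v z
    by (rule pd_bounded_linear[OF Kb], rule pd_pd_bounded_linear[OF Kb])
  have i1: "pd (\<lambda>z. inverse (s z)) u z = - (pd s u z * (inverse (s z))\<^sup>2)" for u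
    by (rule pd_inverse[OF s _ z]) (rule s0)
  have i2: "pd (pd (\<lambda>z. inverse (s z)) u) v z
      = 2 * pd s u z * pd s v z * (inverse (s z)) ^ 3 - pd (pd s u) v z * (inverse (s z))\<^sup>2" for u v
    by (rule pd_pd_inverse[OF s _ z]) (rule s0)
  have dM: "pd ?M u z = 2 * pd s u z * (inverse (s z))\<^sup>2" for u
    unfolding pd_add[OF smooth_on_const cS z] pd_mult[OF smooth_on_const iS z] pd_const i1 by simp
  have ddM: "pd (pd ?M u) v z = - 4 * pd s u z * pd s v z * inverse (s z) ^ 3 + 2 * pd (pd s u) v z * (inverse (s z))\<^sup>2"
    unfolding pd_pd_add[OF smooth_on_const cS z] pd_pd_mult[OF smooth_on_const iS z] pd_const pd_pd_const i2
    by simp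
  have dN: "pd ?N u z = - ((z \<bullet> u) * ?N z ^ 3)" for u
    by (simp add: pd_inverse[OF N n z] pd_norm(1)[OF S0 z] power2_eq_square power3_eq_cube)
  have ddN: "pd (pd ?N u) v z = 3 * (z \<bullet> u) * (z \<bullet> v) * ?N z ^ 5 - (u \<bullet> v) * ?N z ^ 3"
    by (simp add: pd_pd_inverse[OF N n z] pd_norm[OF S0 z] power_def numeral_eq_Suc algebra_simps)
  note aN = smooth_on_mult[OF S a iN] and aM = smooth_on_mult[OF S a M]
  have "(\<lambda>z. a z / norm z * (f z \<bullet> z) + a z * (1 - 2 / s z) * (f z \<bullet> w)) = (\<lambda>z. (a z * ?N z) * ?Q z + (a z * ?M z) * ?K z)"
    by (simp add: fun_eq_iff divide_inverse)
  then have "pd (pd (\<lambda>z. a z / norm z * (f z \<bullet> z) + a z * (1 - 2 / s z) * (f z \<bullet> w)) u) v z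
      = pd (pd (\<lambda>z. (a z * ?N z) * ?Q z) u) v z + pd (pd (\<lambda>z. (a z * ?M z) * ?K z) u) v z"
    by (simp only: pd_pd_add[OF smooth_on_mult[OF S aN Q] smooth_on_mult[OF S aM K] z])
  also have "\<dots> = (a z * ?N z) * pd (pd ?Q u) v z + pd (\<lambda>z. a z * ?N z) v z * pd ?Q u z + pd (\<lambda>z. a z * ?N z) u z * pd ?Q v z
        + pd (pd (\<lambda>z. a z * ?N z) u) v z * ?Q z
      + ((a z * ?M z) * pd (pd ?K u) v z + pd (\<lambda>z. a z * ?M z) v z * pd ?K u z + pd (\<lambda>z. a z * ?M z) u z * pd ?K v z
        + pd (pd (\<lambda>z. a z * ?M z) u) v z * ?K z)"
    by (simp only: pd_pd_mult[OF aN Q z] pd_pd_mult[OF aM K z])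
  finally show ?thesis
    unfolding pd_mult[OF a iN z] pd_mult[OF a M z] pd_pd_mult[OF a iN z] pd_pd_mult[OF a M z] dQ ddQ dK dM ddM dN ddN
    by (simp add: divide_inverse power_inverse algebra_simps inner_commute)
qed

end

context finsler_lift
begin

section \<open>From orthonormal coordinates to the stated formula\<close>

lemma sf_smooth: "smooth_on D0 (sf w)"
  unfolding sf_def[abs_def]
  by (rule smooth_on_divide[OF D0_open smooth_on_bounded_linear[OF bounded_linear_inner_right] smooth_on_subset[OF smooth_on_norm]])
    (use D0_pos in auto)

lemma Af_smooth: "smooth_on D0 (\<lambda>z. Af m (w \<bullet> w) (sf w z))"
proof -
  have pw: "smooth_on D0 (\<lambda>z. sf w z ^ k)" for k
    by (induction k) (simp_all add: smooth_on_mult[OF D0_open sf_smooth])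
  have c: "smooth_on D0 (\<lambda>z. r * f z)" if "smooth_on D0 f" for r :: real and f
    by (rule smooth_on_mult[OF D0_open smooth_on_const that])
  have N: "smooth_on D0 (\<lambda>z. sf w z ^ 3 - 3 * (sf w z)\<^sup>2 + 2 * (w \<bullet> w))"
    by (intro smooth_on_add smooth_on_diff c pw smooth_on_const D0_open)
  show ?thesis
    unfolding Af_def
  proof (rule smooth_on_divide[OF D0_open])
    show "smooth_on D0 (\<lambda>z. - (real m + 1) * sf w z ^ 5 + (7 * real m + 1) * sf w z ^ 4 - 12 * real m * sf w z ^ 3
             + 2 * (2 - real m) * (w \<bullet> w) * (sf w z)\<^sup>2 + 4 * (2 * real m - 1) * (w \<bullet> w) * sf w z)"
      by (intro smooth_on_add smooth_on_diff c pw sf_smooth D0_open)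
    show "smooth_on D0 (\<lambda>z. 2 * (sf w z ^ 3 - 3 * (sf w z)\<^sup>2 + 2 * (w \<bullet> w))\<^sup>2)"
      unfolding power2_eq_square[of "sf w _ ^ 3 - _ + _"]
      by (rule c[OF smooth_on_mult[OF D0_open N N]])
    show "2 * (sf w z ^ 3 - 3 * (sf w z)\<^sup>2 + 2 * (w \<bullet> w))\<^sup>2 \<noteq> 0" if "z \<in> D0" for z
      using D0_N3[OF that] by (simp add: N3_def)
  qed
qed

lemma w_nz: "w \<noteq> 0"
proof -
  obtain z where "z \<in> D0" using D0_ne by blast
  from D0_pos[OF this] show ?thesis by auto
qed

text \<open>Cauchy-Schwarz, attained at w; this identifies b^2 with
  \<open>w \<bullet> w\<close>.\<close>

lemma length_w: "one_form_length B a \<beta> H = norm w"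
proof -
  have im: "tangent_space B H - {0} = T ` (- {0})"
    by (simp add: Compl_eq_Diff_UNIV image_set_diff[OF T(2)] linear_0[OF T(1)] T(3))
  have "one_form_length B a \<beta> H = (SUP z\<in>- {0}. (w \<bullet> z) / norm z)"
    unfolding one_form_length_def im image_image by (simp add: aT \<beta>T norm_eq_sqrt_inner)
  also have "\<dots> = norm w"
  proof (rule cSup_eq_maximum)
    have "(w \<bullet> w) / norm w = norm w" using w_nz by (simp add: dot_square_norm power2_eq_square)
    then show "norm w \<in> (\<lambda>z. (w \<bullet> z) / norm z) ` (- {0})" using w_nz by (intro image_eqI[of _ _ w]) auto
    show "x \<le> norm w" if x: "x \<in> (\<lambda>z. (w \<bullet> z) / norm z) ` (- {0})" for x
    proof -
      obtain z where z: "z \<noteq> 0" "x = (w \<bullet> z) / norm z" using x by blast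
      have "w \<bullet> z \<le> norm w * norm z" by (rule norm_cauchy_schwarz)
      then show ?thesis using z by (simp add: pos_divide_le_eq)
    qed
  qed
  finally show ?thesis .
qed

text \<open>S is known on \<open>D0\<close> only; since this set is open, the derivatives agree
  there too.\<close>

lemma mean_berwald_eq:
  assumes z: "z \<in> D0"
  shows "mean_berwald B D F H (T z) (T v) (T u) = 1/2 * pd (pd Sval u) v z"
proof -
  have e: "pd (\<lambda>z. S_curvature B D F H (T z)) u z = pd Sval u z" if "z \<in> D0" for z u
    by (rule pd_cong[OF D0_open S_curvature_eq that])
  show ?thesis
    unfolding mean_berwald_def pd_linear(2)[OF T(1)] using pd_cong[OF D0_open e z] by simp
qed

end

lemma hspace_of_homogeneous_space:
  assumes "homogeneous_space G X A H Y B"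
  shows "hspace G X A Y B H"
proof -
  have lg: "lie_group G X A" using assms unfolding homogeneous_space_def by (elim conjE)
  have Y: "smooth_manifold Y B" using assms unfolding homogeneous_space_def by (elim conjE)
  have "group G" using lg unfolding lie_group_def by (elim conjE)
  moreover have "smooth_manifold X A" using lg unfolding lie_group_def by (elim conjE)
  ultimately show ?thesis
    by (intro hspace.intro lie.intro mfd.intro lie_axioms.intro hspace_axioms.intro lg Y assms)
qed

theorem theorem5p1:
  fixes G :: "('g, 'r) monoid_scheme" and X :: "'g topology"
    and \<A> :: "('g, 'e::euclidean_space) chart set"
    and H :: "'g set"
    and Y :: "'g set topology" and \<B> :: "('g set, real^'n) chart set"
    and \<mm> :: "('g, 'e) tangent set"
    and D :: "'g set \<Rightarrow> ('g set, real^'n) tangent set"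
    and F \<beta> :: "'g set \<Rightarrow> ('g set, real^'n) tangent \<Rightarrow> real"
    and a :: "'g set \<Rightarrow> ('g set, real^'n) tangent \<Rightarrow> ('g set, real^'n) tangent \<Rightarrow> real"
    and \<iota> :: "('g, 'e) tangent \<Rightarrow> ('g set, real^'n) tangent"
    and ip :: "('g, 'e) tangent \<Rightarrow> ('g, 'e) tangent \<Rightarrow> real"
    and br :: "('g, 'e) tangent \<Rightarrow> ('g, 'e) tangent \<Rightarrow> ('g, 'e) tangent"
    and v y :: "('g, 'e) tangent" and e :: "nat \<Rightarrow> ('g, 'e) tangent"
    and yc :: "nat \<Rightarrow> real"
    and \<alpha> s A :: "('g, 'e) tangent \<Rightarrow> real" and b :: real and n i j :: nat
  assumes "homogeneous_space G X \<A> H Y \<B>"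
    and "reductive_decomposition G \<A> H \<mm>"
    and "infinite_series_metric \<B> D a \<beta> F"
    and "invariant_finsler G \<B> D F"
    and n: "n = CARD('n)"
    and \<iota>: "\<iota> = origin_tangent G \<A> H \<B>"
    and ip: "ip = (\<lambda>u w. a H (\<iota> u) (\<iota> w))"
    and br: "br = (\<lambda>u w. m_component G \<A> H \<mm> (lie_bracket G \<A> u w))"
    and "v \<in> \<mm>" and "\<And>w. w \<in> \<mm> \<Longrightarrow> ip v w = \<beta> H (\<iota> w)"
    and "\<And>k. k \<in> {1..n} \<Longrightarrow> e k \<in> \<mm>"
    and "\<And>k l. k \<in> {1..n} \<Longrightarrow> l \<in> {1..n} \<Longrightarrow> ip (e k) (e l) = (if k = l then 1 else 0)"
    and "span (e ` {1..n}) = \<mm>"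
    and "v = sqrt (ip v v) *\<^sub>R e n"
    and y: "y = (\<Sum>k=1..n. yc k *\<^sub>R e k)" and "\<iota> y \<in> D H"
    and \<alpha>: "\<alpha> = (\<lambda>w. sqrt (ip w w))"
    and s: "s = (\<lambda>w. \<beta> H (\<iota> w) / \<alpha> w)"
    and b: "b = one_form_length \<B> a \<beta> H"
    and A: "A = (\<lambda>w.
          (- (real n + 1) * s w ^ 5 + (7 * real n + 1) * s w ^ 4 - 12 * real n * s w ^ 3
             + 2 * (2 - real n) * b\<^sup>2 * (s w)\<^sup>2 + 4 * (2 * real n - 1) * b\<^sup>2 * s w)
          / (2 * (s w ^ 3 - 3 * (s w)\<^sup>2 + 2 * b\<^sup>2)\<^sup>2))"
    and "i \<in> {1..n}" and "j \<in> {1..n}"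
  shows "mean_berwald \<B> D F H (\<iota> y) (\<iota> (e i)) (\<iota> (e j)) = 1/2 * (
      (1 / \<alpha> y * pd (pd A (e j)) (e i) y
        - yc i / \<alpha> y ^ 3 * pd A (e j) y - yc j / \<alpha> y ^ 3 * pd A (e i) y
        - A y / \<alpha> y ^ 3 * (if i = j then 1 else 0)
        + 3 * A y * yc i * yc j / \<alpha> y ^ 5) * ip (br v y) y
    + (1 / \<alpha> y * pd A (e j) y - A y * yc j / \<alpha> y ^ 3) * (ip (br v (e i)) y + ip (br v y) (e i))
    + (1 / \<alpha> y * pd A (e i) y - A y * yc i / \<alpha> y ^ 3) * (ip (br v (e j)) y + ip (br v y) (e j))
    + A y / \<alpha> y * (ip (br v (e j)) (e i) + ip (br v (e i)) (e j))
    + ((1 - 2 / s y) * pd (pd A (e j)) (e i) y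
        + 2 * pd s (e i) y / (s y)\<^sup>2 * pd A (e j) y
        + 2 * pd s (e j) y / (s y)\<^sup>2 * pd A (e i) y
        - 4 * A y * pd s (e i) y * pd s (e j) y / s y ^ 3
        + 2 * A y / (s y)\<^sup>2 * pd (pd s (e j)) (e i) y) * ip (br v y) v
    + ((1 - 2 / s y) * pd A (e j) y + 2 * A y * pd s (e j) y / (s y)\<^sup>2) * ip (br v (e i)) v
    + ((1 - 2 / s y) * pd A (e i) y + 2 * A y * pd s (e i) y / (s y)\<^sup>2) * ip (br v (e j)) v)"
proof -
  note red = assms(2) and en = \<open>\<And>k. k \<in> {1..n} \<Longrightarrow> e k \<in> \<mm>\<close>
    and on = \<open>\<And>k l. k \<in> {1..n} \<Longrightarrow> l \<in> {1..n} \<Longrightarrow> ip (e k) (e l) = (if k = l then 1 else 0)\<close>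
  interpret hspace G X \<A> Y \<B> H
    by (rule hspace_of_homogeneous_space[OF assms(1)])
  interpret finsler_hspace G X \<A> Y \<B> H D F \<beta> a
    by unfold_locales (rule assms)+
  note m\<gg> = reductiveD(2)[OF red] and subm = reductiveD(1)[OF red]
  \<comment> \<open>The given basis is indexed by {1..n}, coordinate vectors by a finite type; h and
    its inverse f translate.\<close>
  obtain h where h: "bij_betw h {1..n} (UNIV :: 'n set)"
    using ex_bij_betw_nat_finite_1[OF finite_class.finite[of "UNIV :: 'n set"]] n by auto
  define f where "f = inv_into {1..n} h"
  have f: "bij_betw f UNIV {1..n}" unfolding f_def by (rule bij_betw_inv_into[OF h])
  have fn: "f k \<in> {1..n}" for k using f by (auto simp: bij_betw_def)
  have fh: "f (h k) = k" if "k \<in> {1..n}" for k unfolding f_def by (rule bij_betw_inv_into_left[OF h that])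
  have f_eq: "f k = f l \<longleftrightarrow> k = l" for k l using f by (auto simp: bij_betw_def inj_on_def)
  define \<kappa> where "\<kappa> z = (\<Sum>k\<in>UNIV. z $ k *\<^sub>R e (f k))" for z :: "real ^ 'n"
  have \<kappa>l: "linear \<kappa>"
    by (rule linearI) (simp_all add: \<kappa>_def scaleR_add_left sum.distrib scaleR_sum_right)
  have \<kappa>m: "\<kappa> z \<in> \<mm>" for z
    unfolding \<kappa>_def by (rule subspace_sum[OF subm subspace_scale[OF subm en[OF fn]]])
  have \<kappa>g: "\<kappa> z \<in> \<gg>" for z by (rule m\<gg>[OF \<kappa>m])
  have \<kappa>ax: "\<kappa> (axis k 1) = e (f k)" for k
    by (simp add: \<kappa>_def axis_def if_distrib[of "\<lambda>r. r *\<^sub>R _"] cong: if_cong)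
  have \<kappa>e: "e k = \<kappa> (axis (h k) 1)" if "k \<in> {1..n}" for k by (simp add: \<kappa>ax fh[OF that])
  have \<kappa>r: "\<exists>z. u = \<kappa> z" if u: "u \<in> \<mm>" for u
  proof -
    have "e ` {1..n} \<subseteq> range \<kappa>" using \<kappa>e by blast
    then have "span (e ` {1..n}) \<subseteq> range \<kappa>"
      by (rule span_minimal) (rule linear_subspace_image[OF \<kappa>l subspace_UNIV])
    then show ?thesis using u \<open>span (e ` {1..n}) = \<mm>\<close> by blast
  qed
  have \<iota>eq: "\<iota> u = \<iota>0 u" if "u \<in> \<mm>" for u unfolding \<iota> by (rule origin_tangent_eq[OF m\<gg>[OF that]])
  define T where "T z = \<iota>0 (\<kappa> z)" for z
  have \<iota>\<kappa>: "\<iota> (\<kappa> z) = T z" for z unfolding T_def by (rule \<iota>eq[OF \<kappa>m])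
  have Tin: "T z \<in> tangent_space \<B> H" for z unfolding T_def by (rule \<iota>0_in[OF \<kappa>g])
  have Tl': "T (r *\<^sub>R u + u') = r *\<^sub>R T u + T u'" for r u u'
    unfolding T_def linear_add[OF \<kappa>l] linear_scale[OF \<kappa>l] by (rule \<iota>0_linear[OF \<kappa>g \<kappa>g])
  have T0: "T 0 = 0" using Tl'[of 1 0 0] by simp
  have Tl: "linear T"
  proof (rule linearI)
    show "T (u + u') = T u + T u'" for u u' using Tl'[of 1 u u'] by simp
    show "T (r *\<^sub>R u) = r *\<^sub>R T u" for r u using Tl'[of r u 0] T0 by simp
  qed
  define q where "q z z' = a H (T z) (T z')" for z z'
  have ipq: "ip (\<kappa> z) (\<kappa> z') = q z z'" for z z' by (simp add: ip \<iota>\<kappa> q_def)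
  have q1: "q (r *\<^sub>R u + u') z = r * q u z + q u' z" for r u u' z
    unfolding q_def Tl' by (rule a_lin[OF H_in Tin Tin Tin])
  have qs: "q z z' = q z' z" for z z' unfolding q_def by (rule a_sym[OF H_in Tin Tin])
  have q0: "q 0 z = 0" for z using q1[of 1 0 0 z] by simp
  have ql: "linear (\<lambda>u. q u z)" for z
  proof (rule linearI)
    show "q (u + u') z = q u z + q u' z" for u u' using q1[of 1 u u' z] by simp
    show "q (r *\<^sub>R u) z = r *\<^sub>R q u z" for r u using q1[of r u 0 z] q0 by simp
  qed
  have ax: "(z :: real ^ 'n) = (\<Sum>k\<in>UNIV. z $ k *\<^sub>R axis k 1)" for z
    using basis_expansion[of z] by (simp add: scalar_mult_eq_scaleR)
  have qe: "q z u = (\<Sum>k\<in>UNIV. z $ k * q (axis k 1) u)" for z u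
    by (subst (1) ax[of z], subst linear_sum[OF ql]) (simp only: linear_scale[OF ql] real_scaleR_def)
  have qax: "q (axis k 1) (axis l 1) = (if k = l then 1 else 0)" for k l
    using on[OF fn fn, of k l] ipq[of "axis k 1" "axis l 1"] by (simp add: \<kappa>ax f_eq)
  \<comment> \<open>Orthonormality of the basis means that in these coordinates the inner product at
    the origin is the standard one.\<close>
  have qi: "q z z' = z \<bullet> z'" for z z'
  proof -
    have "q (axis k 1) z' = z' $ k" for k
      unfolding qs[of "axis k 1" z'] by (subst qe) (simp add: qax mult_delta_right)
    then show ?thesis by (subst qe) (simp add: inner_vec_def)
  qed
  have Ti: "inj T"
  proof (rule linear_injective_0[OF Tl, THEN iffD2], intro allI impI)
    fix z assume "T z = 0"
    then have "q z z = q 0 z" by (simp add: q_def T0)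
    then show "z = 0" by (simp add: qi)
  qed
  have Tr: "range T = tangent_space \<B> H"
  proof
    show "range T \<subseteq> tangent_space \<B> H" using Tin by blast
    show "tangent_space \<B> H \<subseteq> range T"
      unfolding \<iota>0_m_surj[OF red, symmetric] using \<kappa>r by (auto simp: T_def)
  qed
  obtain w where w: "v = \<kappa> w" using \<kappa>r[OF \<open>v \<in> \<mm>\<close>] by blast
  have \<beta>w: "\<beta> H (T z) = w \<bullet> z" for z
    using \<open>\<And>w. w \<in> \<mm> \<Longrightarrow> ip v w = \<beta> H (\<iota> w)\<close>[OF \<kappa>m[of z]] by (simp add: w ipq qi \<iota>\<kappa>)
  interpret finsler_frame G X \<A> Y \<B> H D F \<beta> a T w
    by unfold_locales (use Ti Tr qi \<beta>w in \<open>simp_all add: q_def linear_add[OF Tl] linear_scale[OF Tl]\<close>)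
  interpret finsler_lift G X \<A> Y \<B> H D F \<beta> a T w \<kappa>
    by unfold_locales (use \<kappa>g in \<open>simp_all add: T_def linear_add[OF \<kappa>l] linear_scale[OF \<kappa>l]\<close>)
  \<comment> \<open>T is injective because the inner product is definite; hence
    \<open>\<iota>0\<close> is injective on \<mm>, as \<open>m_component\<close> asks.\<close>
  have inj\<iota>: "u = 0" if u: "u \<in> \<mm>" "\<iota>0 u = 0" for u
  proof -
    obtain z where z: "u = \<kappa> z" using \<kappa>r[OF u(1)] by blast
    then have "T z = T 0" using u(2) by (simp add: T_def[of z] T0)
    then have "z = 0" using Ti by (simp add: inj_eq)
    then show ?thesis using linear_0[OF \<kappa>l] by (simp add: z)
  qed
  have brq: "ip (br (\<kappa> u) (\<kappa> u')) (\<kappa> z) = brz u u' \<bullet> z" for u u' z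
  proof -
    let ?l = "lie_bracket G \<A> (\<kappa> u) (\<kappa> u')"
    have l: "?l \<in> \<gg>" by (rule lie_bracket_in[OF \<kappa>g \<kappa>g])
    have m: "m_component G \<A> H \<mm> ?l \<in> \<mm>" "\<iota>0 (m_component G \<A> H \<mm> ?l) = \<iota>0 ?l"
      by (rule m_component[OF red _ l], erule inj\<iota>, assumption)+
    have "\<iota> (br (\<kappa> u) (\<kappa> u')) = T (brz u u')"
      unfolding br \<iota>eq[OF m(1)] m(2) T_brz ..
    then show ?thesis by (simp add: ip \<iota>\<kappa> qi[unfolded q_def])
  qed
  have flin: "linear (brz w)"
  proof (rule linearI)
    have b0: "brz w 0 = 0" using brz_linear[of w 1 0 0] by simp
    show "brz w (u + u') = brz w u + brz w u'" for u u' using brz_linear[of w 1 u u'] by simp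
    show "brz w (r *\<^sub>R u) = r *\<^sub>R brz w u" for r u using brz_linear[of w r u 0] b0 by simp
  qed
  define z where "z = (\<chi> k. yc (f k))"
  have yz: "y = \<kappa> z"
    unfolding y \<kappa>_def z_def using sum.reindex_bij_betw[OF f, of "\<lambda>k. yc k *\<^sub>R e k"] by simp
  have zD: "z \<in> D0" using \<open>\<iota> y \<in> D H\<close> by (simp add: D0_def yz \<iota>\<kappa>)
  have zax: "z \<bullet> axis (h k) 1 = yc k" if "k \<in> {1..n}" for k
    by (simp add: inner_axis z_def fh[OF that])
  have hk: "axis (h i) 1 \<bullet> axis (h j) (1::real) = (if i = j then 1 else 0)"
  proof -
    have "h i = h j \<longleftrightarrow> i = j" using fh[OF \<open>i \<in> {1..n}\<close>] fh[OF \<open>j \<in> {1..n}\<close>] by metis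
    then show ?thesis by (simp add: inner_axis_axis)
  qed
  have \<alpha>z: "\<alpha> (\<kappa> z) = norm z" for z by (simp add: \<alpha> ipq qi norm_eq_sqrt_inner)
  have sz: "s (\<kappa> z) = sf w z" for z by (simp add: s \<alpha>z \<iota>\<kappa> \<beta>w sf_def)
  have b2: "b\<^sup>2 = w \<bullet> w" by (simp add: b length_w power2_norm_eq_inner)
  have Az: "A (\<kappa> z) = Af n (w \<bullet> w) (sf w z)" for z by (simp add: A Af_def sz b2)
  let ?A = "\<lambda>z. Af CARD('n) (w \<bullet> w) (sf w z)"
  have s0: "\<forall>z\<in>D0. sf w z \<noteq> 0"
  proof
    fix z assume "z \<in> D0"
    then show "sf w z \<noteq> 0" using D0_pos[of z] norm_ge_zero[of z] by (auto simp: sf_def)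
  qed
  have o0: "0 \<notin> D0" using D0_pos by blast
  \<comment> \<open>\<open>mean_berwald\<close> differentiates first in its last argument, so u in
    the expansion is the direction of \<open>e j\<close> and v that of \<open>e i\<close>.\<close>
  note E = mean_berwald_expansion[OF D0_open Af_smooth sf_smooth flin s0 o0 zD, of "CARD('n)" w "axis (h j) 1" "axis (h i) 1"]
  have "mean_berwald \<B> D F H (\<iota> y) (\<iota> (e i)) (\<iota> (e j)) = 1/2 * pd (pd Sval (axis (h j) 1)) (axis (h i) 1) z"
    unfolding yz \<kappa>e[OF \<open>i \<in> {1..n}\<close>] \<kappa>e[OF \<open>j \<in> {1..n}\<close>] \<iota>\<kappa> by (rule mean_berwald_eq[OF zD])
  then show ?thesis
    unfolding Sval_def[abs_def] E
    unfolding yz w \<kappa>e[OF \<open>i \<in> {1..n}\<close>] \<kappa>e[OF \<open>j \<in> {1..n}\<close>] brq pd_linear[OF \<kappa>l] \<alpha>z sz Az n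
      zax[OF \<open>i \<in> {1..n}\<close>] zax[OF \<open>j \<in> {1..n}\<close>] hk .
qed

end
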